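(* Let $n\ge 2$ and let $\lambda$ be a partition with at most $n-1$ parts, viewed as a dominant weight of $\mathfrak{sl}_n$. Then $$K_{\lambda,0}(t)=\sum_{b\in B(\lambda)_0}t^{|\boldsymbol{\varepsilon}(b)|},$$ where $K_{\lambda,0}(t)$ is the generalized exponent (zero-weight Lusztig $t$-analogue) of type $A_{n-1}$ attached to $\lambda$, $B(\lambda)_0$ is the set of vertices of weight $0$ in the $\mathfrak{sl}_n$-crystal $B(\lambda)$, and $|\boldsymbol{\varepsilon}(b)|=\sum_{i=1}^{n-1} i\,\varepsilon_i(b)$.
   Context: For a simple complex Lie algebra with Weyl group $W$, length function $\ell$, positive roots $R_+$ and half-sum $\rho$ of positive roots, define the $t$-Kostant partition function $P_t$ by $\prod_{\alpha\in R_+}\frac{1}{1-te^{\alpha}}=\sum_{\beta}P_t(\beta)e^{\beta}$ (with $P_t(\beta)=0$ if $\beta$ is not in the positive root cone). For a dominant weight $\lambda$, the generalized exponent is $K_{\lambda,0}(t)=\sum_{w\in W}(-1)^{\ell(w)}P_t(w(\lambda+\rho)-\rho)$. Here the Lie algebra is $\mathfrak{sl}_n$ (type $A_{n-1}$). A partition $\lambda$ with at most $n-1$ parts corresponds to the dominant weight $\sum_{i=1}^{n-1}a_i\omega_i$ of $\mathfrak{sl}_n$, where $a_i$ is the number of columns of height $i$ of the Young diagram of $\lambda$. $B(\lambda)$ is the Kashiwara crystal graph of the irreducible $\mathfrak{sl}_n$-module of highest weight $\lambda$; $\varepsilon_i(b)$ is the maximal number of times the raising crystal operator $\tilde e_i$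 can be applied to $b$. One sets $\boldsymbol{\varepsilon}(b)=\sum_{i=1}^{n-1}\varepsilon_i(b)\omega_i$, identified with the partition having $\varepsilon_i(b)$ columns of height $i$; $|\cdot|$ denotes the sum of the parts of a partition. *)

theory Defs
  imports
    "HOL-Computational_Algebra.Computational_Algebra"
    "HOL-Combinatorics.Permutations"
    "HOL-Library.FuncSet"
begin

section \<open>Weights, Weyl group and generalized exponents in type A\<close>

text \<open>
  Weights of \<open>sl_n\<close> are written in the coordinates of the sum-zero hyperplane of \<open>\<rat>\<^sup>n\<close>: a weight is
  a function \<open>nat \<Rightarrow> rat\<close> supported on \<open>{1..n}\<close>. The simple roots are \<open>\<epsilon>\<^sub>i - \<epsilon>\<^sub>i\<^sub>+\<^sub>1\<close>, and the Weyl group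
  is the group of permutations of \<open>{1..n}\<close>, acting by permuting coordinates.
\<close>

type_synonym weight = "nat \<Rightarrow> rat"

definition sl_root :: "nat \<Rightarrow> nat \<Rightarrow> weight" where
  "sl_root i j = (\<lambda>k. of_bool (k = i) - of_bool (k = j))"

definition positive_roots :: "nat \<Rightarrow> weight set" where
  "positive_roots n = {sl_root i j |i j. 1 \<le> i \<and> i < j \<and> j \<le> n}"

definition half_sum :: "nat \<Rightarrow> weight" where
  "half_sum n = (\<lambda>k. (\<Sum>\<alpha>\<in>positive_roots n. \<alpha> k) / 2)"

text \<open>The projection of \<open>\<epsilon>\<^sub>1 + \<dots> + \<epsilon>\<^sub>i\<close> to the sum-zero hyperplane.\<close>

definition fundamental_weight :: "nat \<Rightarrow> nat \<Rightarrow> weight" where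
  "fundamental_weight n i =
     (\<lambda>k. if k \<in> {1..n} then of_bool (k \<le> i) - of_nat i / of_nat n else 0)"

definition weyl_group :: "nat \<Rightarrow> (nat \<Rightarrow> nat) set" where
  "weyl_group n = {w. w permutes {1..n}}"

definition weyl_act :: "(nat \<Rightarrow> nat) \<Rightarrow> weight \<Rightarrow> weight" where
  "weyl_act w \<mu> = (\<lambda>k. \<mu> (inv w k))"

definition simple_reflection :: "nat \<Rightarrow> nat \<Rightarrow> nat" where
  "simple_reflection i = transpose i (Suc i)"

definition weyl_length :: "nat \<Rightarrow> (nat \<Rightarrow> nat) \<Rightarrow> nat" where
  "weyl_length n w =
     (LEAST l. \<exists>js. length js = l \<and> set js \<subseteq> {1..<n} \<and>
                    w = foldr (\<circ>) (map simple_reflection js) id)"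

text \<open>
  The coefficient of \<open>e\<^sup>\<beta>\<close> in the product over the positive roots \<open>\<alpha>\<close> of the geometric series
  \<open>\<Sum>k. t\<^sup>k e\<^sup>k\<^sup>\<alpha>\<close>: one term for each choice \<open>m\<close> of an exponent \<open>k = m \<alpha>\<close> in every factor. The index
  set is finite, and it is empty if \<open>\<beta>\<close> is outside the positive root cone.
\<close>

definition kostant_choices :: "nat \<Rightarrow> weight \<Rightarrow> (weight \<Rightarrow> nat) set" where
  "kostant_choices n \<beta> =
     {m \<in> positive_roots n \<rightarrow>\<^sub>E UNIV. (\<lambda>k. \<Sum>\<alpha>\<in>positive_roots n. of_nat (m \<alpha>) * \<alpha> k) = \<beta>}"

definition t_kostant :: "nat \<Rightarrow> weight \<Rightarrow> int poly" where
  "t_kostant n \<beta> = (\<Sum>m\<in>kostant_choices n \<beta>. monom 1 (\<Sum>\<alpha>\<in>positive_roots n. m \<alpha>))"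

definition generalized_exponent :: "nat \<Rightarrow> weight \<Rightarrow> int poly" where
  "generalized_exponent n \<mu> =
     (\<Sum>w\<in>weyl_group n. (-1) ^ weyl_length n w *
        t_kostant n (\<lambda>k. weyl_act w (\<lambda>j. \<mu> j + half_sum n j) k - half_sum n k))"

definition is_partition :: "nat list \<Rightarrow> bool" where
  "is_partition lam \<longleftrightarrow> sorted_wrt (\<ge>) lam \<and> (\<forall>p\<in>set lam. 0 < p)"

text \<open>
  Column \<open>j\<close> (counted from \<open>0\<close>) of the Young diagram meets the rows whose part exceeds \<open>j\<close>.
  \<open>columns_of_height\<close> is only used for heights \<open>i \<ge> 1\<close>.
\<close>

definition columns_of_height :: "nat list \<Rightarrow> nat \<Rightarrow> nat" where
  "columns_of_height lam i = card {j. card {r. r < length lam \<and> j < lam ! r} = i}"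

definition partition_weight :: "nat \<Rightarrow> nat list \<Rightarrow> weight" where
  "partition_weight n lam =
     (\<lambda>k. \<Sum>i=1..n-1. of_nat (columns_of_height lam i) * fundamental_weight n i k)"

section \<open>Representations of the quantum group of type A\<close>

type_synonym qfield = "rat poly fract"

definition qvar :: qfield where
  "qvar = Fract [:0, 1:] 1"

definition qconst :: "rat \<Rightarrow> qfield" where
  "qconst c = Fract [:c:] 1"

text \<open>The subring of rational functions regular at \<open>q = 0\<close>.\<close>

definition regular_at_0 :: "qfield set" where
  "regular_at_0 = {Fract a b |a b. poly b 0 \<noteq> 0}"

definition qint :: "nat \<Rightarrow> qfield" where
  "qint m = (qvar ^ m - inverse qvar ^ m) / (qvar - inverse qvar)"

definition qfact :: "nat \<Rightarrow> qfield" where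
  "qfact m = (\<Prod>k=1..m. qint k)"

definition cartan :: "nat \<Rightarrow> nat \<Rightarrow> int" where
  "cartan i j = (if i = j then 2 else if i = Suc j \<or> j = Suc i then -1 else 0)"

text \<open>
  A vector space over \<open>\<rat>(q)\<close>, carried by the whole type, with the actions of the Chevalley generators
  \<open>e\<^sub>i\<close>, \<open>f\<^sub>i\<close>, \<open>q\<^bsup>h\<^sub>i\<^esup>\<close> and \<open>q\<^bsup>-h\<^sub>i\<^esup>\<close>; only the indices \<open>1 \<le> i < n\<close> matter.
\<close>

record 'v uq_rep =
  smult :: "qfield \<Rightarrow> 'v \<Rightarrow> 'v"
  opE :: "nat \<Rightarrow> 'v \<Rightarrow> 'v"
  opF :: "nat \<Rightarrow> 'v \<Rightarrow> 'v"
  opK :: "nat \<Rightarrow> 'v \<Rightarrow> 'v"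
  opKinv :: "nat \<Rightarrow> 'v \<Rightarrow> 'v"

definition q_serre ::
    "(qfield \<Rightarrow> 'v::ab_group_add \<Rightarrow> 'v) \<Rightarrow> (nat \<Rightarrow> 'v \<Rightarrow> 'v) \<Rightarrow> nat \<Rightarrow> nat \<Rightarrow> bool" where
  "q_serre sc X i j \<longleftrightarrow>
     (cartan i j = 0 \<longrightarrow> (\<forall>v. X i (X j v) = X j (X i v))) \<and>
     (cartan i j = -1 \<longrightarrow>
        (\<forall>v. X i (X i (X j v)) - sc (qvar + inverse qvar) (X i (X j (X i v))) + X j (X i (X i v)) = 0))"

definition uq_sl_rep :: "nat \<Rightarrow> 'v::ab_group_add uq_rep \<Rightarrow> bool" where
  "uq_sl_rep n M \<longleftrightarrow>
     vector_space (smult M) \<and>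
     (\<forall>i\<in>{1..<n}. \<forall>X\<in>{opE M i, opF M i, opK M i, opKinv M i}.
        Vector_Spaces.linear (smult M) (smult M) X) \<and>
     (\<forall>i\<in>{1..<n}. \<forall>v. opK M i (opKinv M i v) = v \<and> opKinv M i (opK M i v) = v) \<and>
     (\<forall>i\<in>{1..<n}. \<forall>j\<in>{1..<n}. \<forall>v.
        opK M i (opK M j v) = opK M j (opK M i v) \<and>
        opK M i (opE M j v) = smult M (qvar powi cartan i j) (opE M j (opK M i v)) \<and>
        opK M i (opF M j v) = smult M (qvar powi (- cartan i j)) (opF M j (opK M i v)) \<and>
        opE M i (opF M j v) - opF M j (opE M i v) =
          (if i = j then smult M (inverse (qvar - inverse qvar)) (opK M i v - opKinv M i v) else 0)) \<and>
     (\<forall>i\<in>{1..<n}. \<forall>j\<in>{1..<n}. q_serre (smult M) (opE M) i j \<and> q_serre (smult M) (opF M) i j)"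

text \<open>
  Here a weight \<open>\<mu>\<close> is given by its values \<open>\<mu> i = \<langle>h\<^sub>i, \<mu>\<rangle>\<close> for \<open>1 \<le> i < n\<close>, i.e. by its coordinates in
  the basis of fundamental weights.
\<close>

definition weight_space :: "nat \<Rightarrow> 'v::ab_group_add uq_rep \<Rightarrow> (nat \<Rightarrow> int) \<Rightarrow> 'v set" where
  "weight_space n M \<mu> = {v. \<forall>i\<in>{1..<n}. opK M i v = smult M (qvar powi \<mu> i) v}"

definition uq_subrep :: "nat \<Rightarrow> 'v::ab_group_add uq_rep \<Rightarrow> 'v set \<Rightarrow> bool" where
  "uq_subrep n M W \<longleftrightarrow>
     module.subspace (smult M) W \<and>
     (\<forall>i\<in>{1..<n}. \<forall>v\<in>W. opE M i v \<in> W \<and> opF M i v \<in> W \<and> opK M i v \<in> W \<and> opKinv M i v \<in> W)"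

text \<open>\<open>M\<close> is the finite-dimensional irreducible module with highest weight \<open>\<Sum>i. a i \<omega>\<^sub>i\<close>.\<close>

definition irreducible_of_highest_weight ::
    "nat \<Rightarrow> 'v::ab_group_add uq_rep \<Rightarrow> (nat \<Rightarrow> nat) \<Rightarrow> bool" where
  "irreducible_of_highest_weight n M a \<longleftrightarrow>
     uq_sl_rep n M \<and>
     (\<exists>S. finite S \<and> module.span (smult M) S = UNIV) \<and>
     (\<forall>W. uq_subrep n M W \<longrightarrow> W = {0} \<or> W = UNIV) \<and>
     (\<exists>v. v \<noteq> 0 \<and> v \<in> weight_space n M (\<lambda>i. int (a i)) \<and> (\<forall>i\<in>{1..<n}. opE M i v = 0))"

section \<open>Crystal bases\<close>

text \<open>The action of \<open>f\<^sub>i\<^sup>k / [k]!\<close>.\<close>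

definition divided_F :: "'v::ab_group_add uq_rep \<Rightarrow> nat \<Rightarrow> nat \<Rightarrow> 'v \<Rightarrow> 'v" where
  "divided_F M i k v = smult M (inverse (qfact k)) ((opF M i ^^ k) v)"

text \<open>
  Kashiwara's operators. A finite-dimensional module with integral weights is the direct sum of the
  spaces \<open>f\<^sub>i\<^bsup>(k)\<^esup> (ker e\<^sub>i \<inter> M\<^sub>\<mu>)\<close> with \<open>0 \<le> k \<le> \<langle>h\<^sub>i, \<mu>\<rangle>\<close>, and in this range \<open>f\<^sub>i\<^bsup>(k)\<^esup>\<close> is injective on
  \<open>ker e\<^sub>i \<inter> M\<^sub>\<mu>\<close>, so the following conditions determine the two linear operators.
\<close>

definition kashiwara_e :: "nat \<Rightarrow> 'v::ab_group_add uq_rep \<Rightarrow> nat \<Rightarrow> 'v \<Rightarrow> 'v" where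
  "kashiwara_e n M i = (THE g. Vector_Spaces.linear (smult M) (smult M) g \<and>
     (\<forall>\<mu> u k. u \<in> weight_space n M \<mu> \<and> opE M i u = 0 \<and> int k \<le> \<mu> i \<longrightarrow>
        g (divided_F M i k u) = (if k = 0 then 0 else divided_F M i (k - 1) u)))"

definition kashiwara_f :: "nat \<Rightarrow> 'v::ab_group_add uq_rep \<Rightarrow> nat \<Rightarrow> 'v \<Rightarrow> 'v" where
  "kashiwara_f n M i = (THE g. Vector_Spaces.linear (smult M) (smult M) g \<and>
     (\<forall>\<mu> u k. u \<in> weight_space n M \<mu> \<and> opE M i u = 0 \<and> int k \<le> \<mu> i \<longrightarrow>
        g (divided_F M i k u) = divided_F M i (k + 1) u))"

text \<open>
  A free lattice \<open>L\<close> with \<open>M = \<rat>(q) \<otimes> L\<close> is the span over \<open>regular_at_0\<close> of a \<open>\<rat>(q)\<close>-basis \<open>S\<close> of \<open>M\<close>.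
\<close>

definition crystal_lattice :: "nat \<Rightarrow> 'v::ab_group_add uq_rep \<Rightarrow> 'v set \<Rightarrow> bool" where
  "crystal_lattice n M L \<longleftrightarrow>
     (\<exists>S. finite S \<and> \<not> module.dependent (smult M) S \<and> module.span (smult M) S = UNIV \<and>
          L = {\<Sum>s\<in>S. smult M (c s) s |c. \<forall>s\<in>S. c s \<in> regular_at_0}) \<and>
     (\<forall>u\<in>L. \<exists>P x. finite P \<and> (\<forall>\<mu>\<in>P. x \<mu> \<in> L \<inter> weight_space n M \<mu>) \<and> u = (\<Sum>\<mu>\<in>P. x \<mu>)) \<and>
     (\<forall>i\<in>{1..<n}. \<forall>u\<in>L. kashiwara_e n M i u \<in> L \<and> kashiwara_f n M i u \<in> L)"

text \<open>
  Elements of \<open>L / qL\<close> are represented by the cosets \<open>u + qL\<close>, so the zero element is \<open>lattice_coset M L 0\<close>.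
\<close>

definition lattice_coset :: "'v::ab_group_add uq_rep \<Rightarrow> 'v set \<Rightarrow> 'v \<Rightarrow> 'v set" where
  "lattice_coset M L u = {u + smult M qvar x |x. x \<in> L}"

definition quotient_basis :: "'v::ab_group_add uq_rep \<Rightarrow> 'v set \<Rightarrow> 'v set set \<Rightarrow> bool" where
  "quotient_basis M L B \<longleftrightarrow>
     finite B \<and> B \<subseteq> lattice_coset M L ` L \<and>
     (\<forall>x\<in>L. \<exists>!c. c \<in> B \<rightarrow>\<^sub>E UNIV \<and>
        lattice_coset M L x = lattice_coset M L (\<Sum>b\<in>B. smult M (qconst (c b)) (SOME u. u \<in> b)))"

text \<open>
  The operators induced on \<open>L / qL\<close>: all members of the union are equal when \<open>L\<close> is a crystal lattice
  and \<open>b\<close> is a coset.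
\<close>

definition crystal_e ::
    "nat \<Rightarrow> 'v::ab_group_add uq_rep \<Rightarrow> 'v set \<Rightarrow> nat \<Rightarrow> 'v set \<Rightarrow> 'v set" where
  "crystal_e n M L i b = (\<Union>u\<in>b. lattice_coset M L (kashiwara_e n M i u))"

definition crystal_f ::
    "nat \<Rightarrow> 'v::ab_group_add uq_rep \<Rightarrow> 'v set \<Rightarrow> nat \<Rightarrow> 'v set \<Rightarrow> 'v set" where
  "crystal_f n M L i b = (\<Union>u\<in>b. lattice_coset M L (kashiwara_f n M i u))"

definition crystal_of_weight ::
    "nat \<Rightarrow> 'v::ab_group_add uq_rep \<Rightarrow> 'v set \<Rightarrow> 'v set set \<Rightarrow> (nat \<Rightarrow> int) \<Rightarrow> 'v set set" where
  "crystal_of_weight n M L B \<mu> = B \<inter> lattice_coset M L ` (L \<inter> weight_space n M \<mu>)"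

text \<open>
  Lower crystal bases at \<open>q = 0\<close>. The set \<open>B\<close>, with the arrows \<open>b \<rightarrow> crystal_f n M L i b \<noteq> 0\<close>, is the
  crystal graph of \<open>M\<close>.
\<close>

definition crystal_base ::
    "nat \<Rightarrow> 'v::ab_group_add uq_rep \<Rightarrow> 'v set \<Rightarrow> 'v set set \<Rightarrow> bool" where
  "crystal_base n M L B \<longleftrightarrow>
     crystal_lattice n M L \<and> quotient_basis M L B \<and>
     B = (\<Union>\<mu>. crystal_of_weight n M L B \<mu>) \<and>
     (\<forall>i\<in>{1..<n}. \<forall>b\<in>B. crystal_e n M L i b \<in> B \<union> {lattice_coset M L 0} \<and>
                         crystal_f n M L i b \<in> B \<union> {lattice_coset M L 0}) \<and>
     (\<forall>i\<in>{1..<n}. \<forall>b\<in>B. \<forall>b'\<in>B. b' = crystal_f n M L i b \<longleftrightarrow> b = crystal_e n M L i b')"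

definition crystal_eps ::
    "nat \<Rightarrow> 'v::ab_group_add uq_rep \<Rightarrow> 'v set \<Rightarrow> nat \<Rightarrow> 'v set \<Rightarrow> nat" where
  "crystal_eps n M L i b = (GREATEST k. (crystal_e n M L i ^^ k) b \<noteq> lattice_coset M L 0)"

end

theory Submission
  imports Defs "HOL-Library.Poly_Mapping" "HOL-Library.Function_Algebras"
begin

text \<open>
  The irreducible module is embedded in a tensor power of the vector representation, its highest weight vector being
  congruent modulo \<open>q\<close> to a Yamanouchi word \<open>y\<close>. Modulo \<open>q\<close> the Kashiwara operators act on words by the signature
  rule, which identifies the crystal with the connected component of \<open>y\<close> in the crystal of words.

  Let \<open>A\<close> be an antisymmetric function of weights and \<open>\<kappa>\<^sub>i - \<kappa>\<^sub>i\<^sub>+\<^sub>1 = \<mu>\<^sub>i + 1\<close>. A sign-reversing reflection of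
  \<open>i\<close>-strings cancels all terms of \<open>\<Sum>b. A (\<kappa> + wt b)\<close> but those with \<open>\<epsilon>\<^sub>i(b) \<le> \<mu>\<^sub>i\<close> for all \<open>i\<close>. For \<open>\<kappa> = \<rho>\<close> only
  \<open>b = y\<close> survives, and by Weyl's denominator formula \<open>K\<^sub>\<lambda>\<^sub>,\<^sub>0(t)\<close> is the pairing of the character with
  \<open>\<Prod>\<alpha>. (1 - e\<^sup>\<alpha>) / (1 - t e\<^sup>\<alpha>)\<close>. By the identities of Macdonald and Cauchy the symmetrization of this product is
  \<open>t\<^bsup>-n(n-1)/2\<^esup> \<Prod>k. (1 - t\<^sup>k)\<close> times \<open>\<Sum>w. sgn w \<Prod>i. 1 / (1 - t x\<^sub>i / x\<^bsub>w i\<^esub>)\<close>. After expansion of the geometric series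
  into exponents \<open>\<kappa>\<close>, the cancellation applies again: for strictly decreasing \<open>\<kappa>\<close> it leaves the \<open>b\<close> of weight zero
  with \<open>\<epsilon>\<^sub>i(b) < \<kappa>\<^sub>i - \<kappa>\<^sub>i\<^sub>+\<^sub>1\<close>, and summing \<open>t\<^bsup>|\<kappa>|\<^esup>\<close> over these \<open>\<kappa>\<close> gives
  \<open>t\<^bsup>n(n-1)/2 + |\<epsilon>(b)|\<^esup> \<Prod>k. 1 / (1 - t\<^sup>k)\<close>.
\<close>

section \<open>Rational functions regular at the origin\<close>

text \<open>The crystal base in the theorem is an arbitrary one. So one must also show that every
  crystal lattice of the module is, up to rescaling the highest weight vector, the one cut out by
  the lattice of words; a further rescaling by a rational constant puts the class of that vector
  into the given basis. The role of complete reducibility is played by a bilinear form on the tensor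
  power for which words are orthonormal: arguments over \<rat>(q) become arguments over \<rat> after
  division by the least power of q that occurs, and there the form is a sum of squares.

  The product \<Prod>(1 - e^\<alpha>) / (1 - t e^\<alpha>) is not symmetric, but the character is,
  so averaging over permutations costs only a factor n!. The same factor arises on the other side,
  since equal entries of \<kappa> give zero and all arrangements of distinct entries contribute
  alike. The identities of Macdonald and Cauchy are identities of rational functions; they reach
  power series in t over formal exponentials through the fraction field.\<close>

lemma Fract_in_regular: "poly b 0 \<noteq> 0 \<Longrightarrow> Fract a b \<in> regular_at_0"
  unfolding regular_at_0_def by blast

lemma regular_cases:
  assumes "x \<in> regular_at_0"
  obtains a b where "x = Fract a b" "poly b 0 \<noteq> 0" "b \<noteq> 0"
proof -
  obtain a b where "x = Fract a b" "poly b 0 \<noteq> 0" using assms unfolding regular_at_0_def by blast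
  moreover from this have "b \<noteq> 0" by auto
  ultimately show ?thesis using that by blast
qed

text \<open>The residue map of the local ring \<open>regular_at_0\<close>; by
  \<open>ev0_Fract\<close> the value does not depend on the fraction chosen. It is meant for regular
  arguments only.\<close>

definition ev0 :: "qfield \<Rightarrow> rat" where
  "ev0 x = (THE r. \<exists>a b. x = Fract a b \<and> poly b 0 \<noteq> 0 \<and> r = poly a 0 / poly b 0)"

lemma ev0_Fract:
  assumes "poly b 0 \<noteq> 0"
  shows "ev0 (Fract a b) = poly a 0 / poly b 0"
  unfolding ev0_def
proof (rule the_equality)
  fix r assume "\<exists>a' b'. Fract a b = Fract a' b' \<and> poly b' 0 \<noteq> 0 \<and> r = poly a' 0 / poly b' 0"
  then obtain a' b' where h: "Fract a b = Fract a' b'" "poly b' 0 \<noteq> 0" "r = poly a' 0 / poly b' 0"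
    by blast
  have "b \<noteq> 0" "b' \<noteq> 0" using assms h by auto
  then have "a * b' = a' * b" using h(1) by (simp add: eq_fract)
  then have "poly a 0 * poly b' 0 = poly a' 0 * poly b 0" by (metis poly_mult)
  then show "r = poly a 0 / poly b 0" unfolding h(3) using h(2) assms by (simp add: frac_eq_eq)
qed (use assms in blast)

lemma regular_add [simp]: "x \<in> regular_at_0 \<Longrightarrow> y \<in> regular_at_0 \<Longrightarrow> x + y \<in> regular_at_0"
  by (elim regular_cases) (auto simp: intro!: Fract_in_regular)

lemma ev0_add [simp]: "x \<in> regular_at_0 \<Longrightarrow> y \<in> regular_at_0 \<Longrightarrow> ev0 (x + y) = ev0 x + ev0 y"
  by (elim regular_cases) (auto simp: ev0_Fract field_simps)

lemma regular_mult [simp]: "x \<in> regular_at_0 \<Longrightarrow> y \<in> regular_at_0 \<Longrightarrow> x * y \<in> regular_at_0"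
  by (elim regular_cases) (auto simp: intro!: Fract_in_regular)

lemma ev0_mult [simp]: "x \<in> regular_at_0 \<Longrightarrow> y \<in> regular_at_0 \<Longrightarrow> ev0 (x * y) = ev0 x * ev0 y"
  by (elim regular_cases) (auto simp: ev0_Fract)

lemma regular_uminus [simp]: "x \<in> regular_at_0 \<Longrightarrow> - x \<in> regular_at_0"
  by (elim regular_cases) (auto simp: intro!: Fract_in_regular)

lemma ev0_uminus [simp]: "x \<in> regular_at_0 \<Longrightarrow> ev0 (- x) = - ev0 x"
  by (elim regular_cases) (auto simp: ev0_Fract)

lemma regular_diff [simp]: "x \<in> regular_at_0 \<Longrightarrow> y \<in> regular_at_0 \<Longrightarrow> x - y \<in> regular_at_0"
  using regular_add[of x "- y"] by simp

lemma ev0_diff [simp]: "x \<in> regular_at_0 \<Longrightarrow> y \<in> regular_at_0 \<Longrightarrow> ev0 (x - y) = ev0 x - ev0 y"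
  using ev0_add[of x "- y"] by simp

lemma regular_0 [simp]: "0 \<in> regular_at_0"
  using Fract_in_regular[of 1 0] by (simp add: fract_collapse)

lemma ev0_0 [simp]: "ev0 0 = 0"
  using ev0_Fract[of 1 0] by (simp add: fract_collapse)

lemma regular_1 [simp]: "1 \<in> regular_at_0"
  using Fract_in_regular[of 1 1] by (simp add: fract_collapse)

lemma ev0_1 [simp]: "ev0 1 = 1"
  using ev0_Fract[of 1 1] by (simp add: fract_collapse)

lemma regular_sum [simp]: "(\<And>i. i \<in> S \<Longrightarrow> f i \<in> regular_at_0) \<Longrightarrow> sum f S \<in> regular_at_0"
  by (induction S rule: infinite_finite_induct) auto

lemma ev0_sum: "(\<And>i. i \<in> S \<Longrightarrow> f i \<in> regular_at_0) \<Longrightarrow> ev0 (sum f S) = (\<Sum>i\<in>S. ev0 (f i))"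
  by (induction S rule: infinite_finite_induct) auto

lemma regular_power [simp]: "x \<in> regular_at_0 \<Longrightarrow> x ^ k \<in> regular_at_0"
  by (induction k) auto

lemma ev0_power [simp]: "x \<in> regular_at_0 \<Longrightarrow> ev0 (x ^ k) = ev0 x ^ k"
  by (induction k) auto

lemma regular_qvar [simp]: "qvar \<in> regular_at_0"
  unfolding qvar_def by (rule Fract_in_regular) simp

lemma ev0_qvar [simp]: "ev0 qvar = 0"
  unfolding qvar_def by (subst ev0_Fract) auto

lemma qvar_nonzero [simp]: "qvar \<noteq> 0"
  unfolding qvar_def by (simp add: Zero_fract_def eq_fract)

lemma regular_qconst [simp]: "qconst c \<in> regular_at_0"
  unfolding qconst_def by (rule Fract_in_regular) simp

lemma ev0_qconst [simp]: "ev0 (qconst c) = c"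
  unfolding qconst_def by (subst ev0_Fract) auto

lemma regular_inverse:
  assumes "x \<in> regular_at_0" "ev0 x \<noteq> 0"
  shows "inverse x \<in> regular_at_0" "ev0 (inverse x) = inverse (ev0 x)"
proof -
  obtain a b where x: "x = Fract a b" "poly b 0 \<noteq> 0" using assms(1) by (elim regular_cases)
  have "poly a 0 \<noteq> 0" using assms(2) x by (auto simp: ev0_Fract)
  then show "inverse x \<in> regular_at_0" "ev0 (inverse x) = inverse (ev0 x)"
    using x by (auto simp: ev0_Fract intro!: Fract_in_regular)
qed

lemma regular_divide:
  assumes "y \<in> regular_at_0" "x \<in> regular_at_0" "ev0 x \<noteq> 0"
  shows "y / x \<in> regular_at_0" "ev0 (y / x) = ev0 y / ev0 x"
  using assms regular_inverse[of x] by (auto simp: divide_inverse)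

lemma ev0_eq_0_D:
  assumes "x \<in> regular_at_0" "ev0 x = 0"
  obtains y where "y \<in> regular_at_0" "x = qvar * y"
proof -
  obtain a b where x: "x = Fract a b" "poly b 0 \<noteq> 0" "b \<noteq> 0" using assms(1) by (elim regular_cases)
  then have "poly a 0 = 0" using assms(2) by (auto simp: ev0_Fract)
  then obtain a' where a: "a = [:0, 1:] * a'" by (auto simp: poly_eq_0_iff_dvd)
  have "x = qvar * Fract a' b" using x a unfolding qvar_def by simp
  then show ?thesis using that Fract_in_regular[OF x(2)] by blast
qed

text \<open>Powers of the variable are split off from numerator and denominator:
  \<open>regular_at_0\<close> is a discrete valuation ring with uniformizer \<open>qvar\<close>, so
  a nonzero element is a power of \<open>qvar\<close> times a unit.\<close>

lemma q_valuation:
  assumes "x \<noteq> 0"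
  obtains k u where "x = qvar powi k * u" "u \<in> regular_at_0" "ev0 u \<noteq> 0"
proof -
  have *: "\<exists>m u. Fract a 1 = qvar ^ m * u \<and> u \<in> regular_at_0 \<and> ev0 u \<noteq> 0" if a0: "a \<noteq> 0" for a :: "rat poly"
  proof -
    obtain a' where "a = [:- 0, 1:] ^ order 0 a * a'" "\<not> [:- 0, 1:] dvd a'"
      using order_decomp[where a = 0, OF a0] by blast
    then have a: "a = [:0, 1:] ^ order 0 a * a'" "\<not> [:0, 1:] dvd a'" by simp_all
    have "poly a' 0 \<noteq> 0" using a(2) by (auto simp: poly_eq_0_iff_dvd)
    then have u: "Fract a' 1 \<in> regular_at_0" "ev0 (Fract a' 1) \<noteq> 0"
      using Fract_in_regular[of 1 a'] ev0_Fract[of 1 a'] by auto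
    have "Fract ([:0, 1:] ^ k * a') 1 = qvar ^ k * Fract a' 1" for k
    proof (induction k)
      case (Suc k)
      have "Fract ([:0, 1:] ^ Suc k * a') 1 = qvar * Fract ([:0, 1:] ^ k * a') 1"
        unfolding qvar_def by (simp add: mult.assoc)
      then show ?case using Suc by (simp add: mult.assoc)
    qed simp
    from this[of "order 0 a"] have "Fract a 1 = qvar ^ order 0 a * Fract a' 1" using a(1) by simp
    then show ?thesis using u by blast
  qed
  obtain a b where x: "x = Fract a b" "b \<noteq> 0" by (cases x) auto
  have "a \<noteq> 0" using assms x by (auto simp: fract_collapse)
  obtain m u where 1: "Fract a 1 = qvar ^ m * u" "u \<in> regular_at_0" "ev0 u \<noteq> 0" using *[OF \<open>a \<noteq> 0\<close>] by blast
  obtain l v where 2: "Fract b 1 = qvar ^ l * v" "v \<in> regular_at_0" "ev0 v \<noteq> 0" using *[OF \<open>b \<noteq> 0\<close>] by blast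
  have "x = Fract a 1 / Fract b 1" using x by simp
  also have "\<dots> = qvar powi (int m - int l) * (u / v)"
    unfolding 1 2 by (simp add: power_int_diff)
  finally show ?thesis using that[of "int m - int l" "u / v"] regular_divide[OF 1(2) 2(2,3)] 1 2 by auto
qed

lemma regular_powi: "k \<ge> 0 \<Longrightarrow> qvar powi k \<in> regular_at_0"
  by (simp add: power_int_def)

text \<open>Dividing by q to the least valuation among the entries makes a nonzero family primitive.
  Vanishing over \<rat>(q) can then be tested on residues.\<close>

lemma q_scaling:
  assumes "finite S" "\<exists>i\<in>S. x i \<noteq> 0"
  obtains k :: int where "\<And>i. i \<in> S \<Longrightarrow> qvar powi k * x i \<in> regular_at_0" "\<exists>i\<in>S. ev0 (qvar powi k * x i) \<noteq> 0"
proof -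
  let ?T = "{i\<in>S. x i \<noteq> 0}"
  have "\<forall>i\<in>?T. \<exists>k u. x i = qvar powi k * u \<and> u \<in> regular_at_0 \<and> ev0 u \<noteq> 0"
  proof
    fix i assume "i \<in> ?T"
    then have "x i \<noteq> 0" by simp
    from q_valuation[OF this] show "\<exists>k u. x i = qvar powi k * u \<and> u \<in> regular_at_0 \<and> ev0 u \<noteq> 0" by blast
  qed
  then obtain v u where vu: "\<And>i. i \<in> ?T \<Longrightarrow> x i = qvar powi v i * u i \<and> u i \<in> regular_at_0 \<and> ev0 (u i) \<noteq> 0"
    by metis
  have fin: "finite (v ` ?T)" "v ` ?T \<noteq> {}" using assms by auto
  define k where "k = Min (v ` ?T)"
  have kin: "k \<in> v ` ?T" using Min_in[OF fin] k_def by simp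
  have kle: "k \<le> v i" if "i \<in> ?T" for i using Min_le fin that k_def by auto
  have eq: "qvar powi (-k) * x i = qvar powi (v i - k) * u i" if "i \<in> ?T" for i
  proof -
    have "x i = qvar powi v i * u i" using vu[OF that] by blast
    moreover have "qvar powi (v i - k) = qvar powi (-k) * qvar powi v i"
      using power_int_add[of qvar "-k" "v i"] by simp
    ultimately show ?thesis by (simp only: mult.assoc)
  qed
  have 1: "qvar powi (-k) * x i \<in> regular_at_0" if "i \<in> S" for i
  proof (cases "x i = 0")
    case False
    then have "i \<in> ?T" using that by simp
    then have "k \<le> v i" "u i \<in> regular_at_0" using kle vu by blast+
    then show ?thesis unfolding eq[OF \<open>i \<in> ?T\<close>] by (intro regular_mult regular_powi) simp_all
  qed simp
  obtain i where i: "i \<in> ?T" "v i = k" using kin by auto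
  have "ev0 (qvar powi (-k) * x i) \<noteq> 0" unfolding eq[OF i(1)] i(2) using vu[OF i(1)] by simp
  then show ?thesis using that[of "-k"] 1 i by blast
qed

subsection \<open>Quantum integers\<close>

text \<open>A rescaled q-integer, q^(m-1) [m]: a polynomial in q with value 1 at q = 0 for m > 0,
  hence a unit of \<open>regular_at_0\<close>.\<close>

definition qU :: "nat \<Rightarrow> qfield" where
  "qU m = (\<Sum>j<m. qvar ^ (2 * j))"

lemma qU_Suc: "qU (Suc m) = qU m + qvar ^ (2 * m)"
  by (simp add: qU_def)

lemma regular_qU [simp]: "qU m \<in> regular_at_0"
  unfolding qU_def by simp

lemma ev0_qU [simp]: "ev0 (qU m) = of_bool (m > 0)"
proof (induction m)
  case (Suc m)
  then show ?case by (cases m) (auto simp: qU_Suc)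
qed (simp add: qU_def)

lemma qU_nonzero [simp]: "m > 0 \<Longrightarrow> qU m \<noteq> 0"
  using ev0_qU[of m] by (metis ev0_0 of_bool_eq(2) zero_neq_one)

lemma qvar_square_neq_1: "qvar - inverse qvar \<noteq> 0"
proof
  assume "qvar - inverse qvar = 0"
  then have "qvar * qvar = 1" by (simp add: field_simps)
  then have "ev0 (qvar * qvar) = 1" by simp
  then show False by simp
qed

lemma qint_0 [simp]: "qint 0 = 0"
  by (simp add: qint_def)

lemma qint_Suc: "qint (Suc m) = qvar * qint m + inverse qvar ^ m"
proof -
  have "qvar ^ Suc m - inverse qvar ^ Suc m = qvar * (qvar ^ m - inverse qvar ^ m) + inverse qvar ^ m * (qvar - inverse qvar)"
    by (simp add: algebra_simps)
  then show ?thesis unfolding qint_def using qvar_square_neq_1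
    by (metis add_divide_distrib nonzero_mult_div_cancel_right times_divide_eq_right)
qed

lemma qint_Suc': "qint (Suc m) = inverse qvar * qint m + qvar ^ m"
proof -
  have "qvar ^ Suc m - inverse qvar ^ Suc m = inverse qvar * (qvar ^ m - inverse qvar ^ m) + qvar ^ m * (qvar - inverse qvar)"
    by (simp add: algebra_simps)
  then show ?thesis unfolding qint_def using qvar_square_neq_1
    by (metis add_divide_distrib nonzero_mult_div_cancel_right times_divide_eq_right)
qed

lemma qint_1 [simp]: "qint (Suc 0) = 1"
  by (simp add: qint_Suc)

lemma qint_qU: "qint (Suc m) = qU (Suc m) * inverse qvar ^ m"
proof (induction m)
  case 0 then show ?case by (simp add: qU_def)
next
  case (Suc m)
  have "qint (Suc (Suc m)) = inverse qvar * qint (Suc m) + qvar ^ Suc m" by (rule qint_Suc')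
  also have "\<dots> = (qU (Suc m) + qvar ^ (2 * Suc m)) * inverse qvar ^ Suc m"
  proof -
    have "qvar ^ (2 * Suc m) * inverse qvar ^ Suc m = qvar ^ Suc m * (qvar ^ Suc m * inverse (qvar ^ Suc m))"
      unfolding mult_2 power_add power_inverse by (simp only: mult.assoc)
    also have "\<dots> = qvar ^ Suc m" by (simp only: right_inverse[OF power_not_zero[OF qvar_nonzero]] mult_1_right)
    finally show ?thesis unfolding Suc by (simp only: distrib_right) (simp add: mult_ac)
  qed
  finally show ?case by (simp add: qU_Suc)
qed

lemma qint_nonzero [simp]: "m > 0 \<Longrightarrow> qint m \<noteq> 0"
  by (cases m) (auto simp: qint_qU)

lemma qfact_Suc: "qfact (Suc m) = qint (Suc m) * qfact m"
  by (simp add: qfact_def)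

lemma qfact_0 [simp]: "qfact 0 = 1"
  by (simp add: qfact_def)

lemma qfact_nonzero [simp]: "qfact m \<noteq> 0"
  by (induction m) (auto simp: qfact_Suc)

lemma qint_add: "qint (a + b) = qvar ^ a * qint b + inverse qvar ^ b * qint a"
proof -
  have "qvar ^ (a + b) - inverse qvar ^ (a + b) =
    qvar ^ a * (qvar ^ b - inverse qvar ^ b) + inverse qvar ^ b * (qvar ^ a - inverse qvar ^ a)"
    by (simp add: algebra_simps power_add)
  then show ?thesis unfolding qint_def
    by (metis add_divide_distrib times_divide_eq_right)
qed

declare plus_fun_apply [simp del] zero_fun_apply [simp del] minus_apply [simp del] uminus_apply [simp del]

section \<open>The crystal of words\<close>

text \<open>The signature rule, evaluated from the right end of the word: a letter i + 1 cancels one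
  still free letter i to its right. \<open>wphi\<close> counts the free letters i and
  \<open>weps\<close> the free letters i + 1. In the reduced word all free i precede the free i + 1,
  so \<open>wft\<close> changes the last free i and \<open>wet\<close> the first free i + 1.\<close>

primrec wphi :: "nat \<Rightarrow> nat list \<Rightarrow> nat" where
  "wphi i [] = 0"
| "wphi i (a # w) = (if a = i then Suc (wphi i w) else if a = Suc i then wphi i w - 1 else wphi i w)"

primrec weps :: "nat \<Rightarrow> nat list \<Rightarrow> nat" where
  "weps i [] = 0"
| "weps i (a # w) = (if a = Suc i \<and> wphi i w = 0 then Suc (weps i w) else weps i w)"

primrec wft :: "nat \<Rightarrow> nat list \<Rightarrow> nat list" where
  "wft i [] = []"
| "wft i (a # w) = (if a = i \<and> wphi i w = 0 then Suc i # w else a # wft i w)"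

primrec wet :: "nat \<Rightarrow> nat list \<Rightarrow> nat list" where
  "wet i [] = []"
| "wet i (a # w) = (if a = Suc i \<and> wphi i w = 0 then i # w else a # wet i w)"

definition wtw :: "nat \<Rightarrow> nat list \<Rightarrow> int" where
  "wtw i w = int (count_list w i) - int (count_list w (Suc i))"

definition words :: "nat \<Rightarrow> nat \<Rightarrow> nat list set" where
  "words n N = {w. length w = N \<and> set w \<subseteq> {1..n}}"

lemma finite_words [simp]: "finite (words n N)"
  using finite_lists_length_eq[of "{1..n}" N] unfolding words_def by (auto elim: finite_subset[rotated])

lemma words_0 [simp]: "words n 0 = {[]}"
  by (auto simp: words_def)

lemma Cons_in_words [simp]: "a # w \<in> words n (Suc N) \<longleftrightarrow> a \<in> {1..n} \<and> w \<in> words n N"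
  by (auto simp: words_def)

lemma words_Suc_cases:
  assumes "w \<in> words n (Suc N)"
  obtains a v where "w = a # v" "a \<in> {1..n}" "v \<in> words n N"
  using assms by (cases w) (auto simp: words_def)

lemma wphi_weps: "int (wphi i w) - int (weps i w) = wtw i w"
  by (induction w) (auto simp: wtw_def of_nat_diff)

lemma length_wf [simp]: "length (wft i w) = length w"
  by (induction w) auto

lemma length_we [simp]: "length (wet i w) = length w"
  by (induction w) auto

lemma wf_props:
  "wphi i w > 0 \<Longrightarrow> wphi i (wft i w) = wphi i w - 1 \<and> weps i (wft i w) = Suc (weps i w) \<and> wet i (wft i w) = w"
proof (induction w)
  case (Cons a w)
  consider "a = i" "wphi i w = 0" | "a = i" "wphi i w > 0" | "a = Suc i" "wphi i w > 1"
    | "a \<noteq> i" "a \<noteq> Suc i" "wphi i w > 0"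
    using Cons.prems by (auto split: if_splits)
  then show ?case using Cons.IH by cases auto
qed simp

lemma we_props:
  "weps i w > 0 \<Longrightarrow> wphi i (wet i w) = Suc (wphi i w) \<and> weps i (wet i w) = weps i w - 1 \<and> wft i (wet i w) = w"
proof (induction w)
  case (Cons a w)
  consider "a = Suc i" "wphi i w = 0" | "a = i" "weps i w > 0" | "a = Suc i" "wphi i w > 0" "weps i w > 0"
    | "a \<noteq> i" "a \<noteq> Suc i" "weps i w > 0"
    using Cons.prems by (auto split: if_splits)
  then show ?case using Cons.IH by cases auto
qed simp

lemma wphi_wf [simp]: "wphi i w > 0 \<Longrightarrow> wphi i (wft i w) = wphi i w - 1"
  and weps_wf [simp]: "wphi i w > 0 \<Longrightarrow> weps i (wft i w) = Suc (weps i w)"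
  and we_wf [simp]: "wphi i w > 0 \<Longrightarrow> wet i (wft i w) = w"
  using wf_props by blast+

lemma wphi_we [simp]: "weps i w > 0 \<Longrightarrow> wphi i (wet i w) = Suc (wphi i w)"
  and weps_we [simp]: "weps i w > 0 \<Longrightarrow> weps i (wet i w) = weps i w - 1"
  and wf_we [simp]: "weps i w > 0 \<Longrightarrow> wft i (wet i w) = w"
  using we_props by blast+

lemma count_wf:
  "wphi i w > 0 \<Longrightarrow> int (count_list (wft i w) k) = int (count_list w k) - of_bool (k = i) + of_bool (k = Suc i)"
proof (induction w)
  case (Cons a w)
  consider "a = i" "wphi i w = 0" | "a = i" "wphi i w > 0" | "a = Suc i" "wphi i w > 1"
    | "a \<noteq> i" "a \<noteq> Suc i" "wphi i w > 0"
    using Cons.prems by (auto split: if_splits)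
  then show ?case using Cons.IH by cases auto
qed simp

lemma count_we:
  assumes "weps i w > 0"
  shows "int (count_list (wet i w) k) = int (count_list w k) + of_bool (k = i) - of_bool (k = Suc i)"
proof -
  have "wphi i (wet i w) > 0" using assms by simp
  from count_wf[OF this, of k] show ?thesis using assms by simp
qed

lemma wf_in_words: "w \<in> words n N \<Longrightarrow> 1 \<le> i \<Longrightarrow> i < n \<Longrightarrow> wft i w \<in> words n N"
proof (induction w arbitrary: N)
  case (Cons a w)
  then show ?case by (cases N) (auto simp: words_def)
qed simp

lemma we_in_words: "w \<in> words n N \<Longrightarrow> 1 \<le> i \<Longrightarrow> i < n \<Longrightarrow> wet i w \<in> words n N"
proof (induction w arbitrary: N)
  case (Cons a w)
  then show ?case by (cases N) (auto simp: words_def)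
qed simp

section \<open>Tensor powers of the vector representation\<close>

text \<open>
  A vector of \<open>V\<^bsup>\<otimes>N\<^esup>\<close> is given by its coordinates on words; the letter \<open>a\<close> of \<open>a # w\<close> is the
  \<^emph>\<open>last\<close> tensor factor. The coproduct is \<open>\<Delta> f = f \<otimes> 1 + K \<otimes> f\<close>, \<open>\<Delta> e = e \<otimes> K\<^bsup>-1\<^esup> + 1 \<otimes> e\<close>.
\<close>

type_synonym wvec = "nat list \<Rightarrow> qfield"

definition sc :: "qfield \<Rightarrow> wvec \<Rightarrow> wvec" where
  "sc c x = (\<lambda>w. c * x w)"

lemma sc_apply: "sc c x w = c * x w"
  by (simp add: sc_def)

lemma fun_diff_apply: "(f - g) x = f x - (g x :: 'b::ab_group_add)"
  by (simp add: fun_diff_def)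

lemma fun_uminus_apply: "(- f) x = - (f x :: 'b::ab_group_add)"
  by (simp add: fun_Compl_def)

lemmas fun_apply = plus_fun_apply zero_fun_apply sc_apply fun_diff_apply fun_uminus_apply

lemma sc_simps [simp]: "sc c 0 = 0" "sc 0 x = 0" "sc 1 x = x" "sc c (sc d x) = sc (c * d) x"
  by (auto simp: fun_eq_iff fun_apply)

lemma sc_add: "sc c (x + y) = sc c x + sc c y" "sc (c + d) x = sc c x + sc d x"
  by (auto simp: fun_eq_iff algebra_simps fun_apply)

lemma sum_fun_apply: "(\<Sum>i\<in>S. f i) x = (\<Sum>i\<in>S. f i x :: 'b::comm_monoid_add)"
  by (induction S rule: infinite_finite_induct) (auto simp: fun_apply)

primrec fop :: "nat \<Rightarrow> nat list \<Rightarrow> wvec \<Rightarrow> qfield" where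
  "fop i [] x = 0"
| "fop i (a # w) x = fop i w (\<lambda>v. x (a # v)) + (if a = Suc i then qvar powi wtw i w * x (i # w) else 0)"

primrec eop :: "nat \<Rightarrow> nat list \<Rightarrow> wvec \<Rightarrow> qfield" where
  "eop i [] x = 0"
| "eop i (a # w) x = qvar powi (- wtw i [a]) * eop i w (\<lambda>v. x (a # v)) + (if a = i then x (Suc i # w) else 0)"

definition WF :: "nat \<Rightarrow> wvec \<Rightarrow> wvec" where "WF i x = (\<lambda>w. fop i w x)"
definition WE :: "nat \<Rightarrow> wvec \<Rightarrow> wvec" where "WE i x = (\<lambda>w. eop i w x)"
definition WK :: "nat \<Rightarrow> wvec \<Rightarrow> wvec" where "WK i x = (\<lambda>w. qvar powi wtw i w * x w)"
definition WKi :: "nat \<Rightarrow> wvec \<Rightarrow> wvec" where "WKi i x = (\<lambda>w. qvar powi (- wtw i w) * x w)"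

lemma WF_Cons: "WF i x (a # w) = WF i (\<lambda>v. x (a # v)) w + (if a = Suc i then WK i (\<lambda>v. x (i # v)) w else 0)"
  by (simp add: WF_def WK_def)

lemma WE_Cons: "WE i x (a # w) = qvar powi (- wtw i [a]) * WE i (\<lambda>v. x (a # v)) w + (if a = i then x (Suc i # w) else 0)"
  by (simp add: WE_def)

lemma WF_Nil [simp]: "WF i x [] = 0" and WE_Nil [simp]: "WE i x [] = 0"
  by (simp_all add: WF_def WE_def)

lemma wtw_Cons: "wtw i (a # w) = wtw i [a] + wtw i w"
  by (simp add: wtw_def)

lemma wtw_single: "wtw i [a] = of_bool (a = i) - of_bool (a = Suc i)"
  by (auto simp: wtw_def)

lemma powi_add: "qvar powi (a + b) = qvar powi a * qvar powi b"
  by (simp add: power_int_add)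

lemma fop_linear: "fop i w (\<lambda>v. c * x v + y v) = c * fop i w x + fop i w y"
  by (induction w arbitrary: x y) (auto simp: algebra_simps)

lemma eop_linear: "eop i w (\<lambda>v. c * x v + y v) = c * eop i w x + eop i w y"
  by (induction w arbitrary: x y) (auto simp: algebra_simps)

lemma WF_0 [simp]: "WF i 0 = 0" and WE_0 [simp]: "WE i 0 = 0"
  and WK_0 [simp]: "WK i 0 = 0" and WKi_0 [simp]: "WKi i 0 = 0"
  using fop_linear[of i _ "-1" 0 0] eop_linear[of i _ "-1" 0 0]
  by (auto simp: fun_eq_iff WF_def WE_def WK_def WKi_def zero_fun_def fun_apply)

lemma WF_add [simp]: "WF i (x + y) = WF i x + WF i y" and WE_add [simp]: "WE i (x + y) = WE i x + WE i y"
  using fop_linear[of i _ 1 x y] eop_linear[of i _ 1 x y]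
  by (auto simp: fun_eq_iff WF_def WE_def plus_fun_def)

lemma WF_sc [simp]: "WF i (sc c x) = sc c (WF i x)" and WE_sc [simp]: "WE i (sc c x) = sc c (WE i x)"
  using fop_linear[of i _ c x 0] eop_linear[of i _ c x 0] WF_0[of i] WE_0[of i]
  by (auto simp: fun_eq_iff WF_def WE_def sc_def zero_fun_def)

lemma WK_add [simp]: "WK i (x + y) = WK i x + WK i y" and WK_sc [simp]: "WK i (sc c x) = sc c (WK i x)"
  and WKi_add [simp]: "WKi i (x + y) = WKi i x + WKi i y" and WKi_sc [simp]: "WKi i (sc c x) = sc c (WKi i x)"
  by (auto simp: fun_eq_iff WK_def WKi_def algebra_simps fun_apply)

lemma minus_sc: "x - y = x + sc (-1) (y :: wvec)"
  by (auto simp: fun_eq_iff fun_apply)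

lemma WF_diff [simp]: "WF i (x - y) = WF i x - WF i y" and WE_diff [simp]: "WE i (x - y) = WE i x - WE i y"
  by (simp_all add: minus_sc)

lemma WF_sum: "WF i (\<Sum>w\<in>S. g w) = (\<Sum>w\<in>S. WF i (g w))"
  by (induction S rule: infinite_finite_induct) simp_all

lemma WE_sum: "WE i (\<Sum>w\<in>S. g w) = (\<Sum>w\<in>S. WE i (g w))"
  by (induction S rule: infinite_finite_induct) simp_all

lemma WK_sum: "WK i (\<Sum>w\<in>S. g w) = (\<Sum>w\<in>S. WK i (g w))"
  by (induction S rule: infinite_finite_induct) simp_all

lemma sc_sum: "sc c (\<Sum>w\<in>S. g w) = (\<Sum>w\<in>S. sc c (g w))"
  by (induction S rule: infinite_finite_induct) (simp_all add: sc_add)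

text \<open>The vector x tensored with the basis vector of the letter a as last factor.
  \<open>WF_ten\<close> and \<open>WE_ten\<close> are the coproduct formulas in this form.\<close>

definition ten :: "nat \<Rightarrow> wvec \<Rightarrow> wvec" where
  "ten a x = (\<lambda>w. case w of [] \<Rightarrow> 0 | b # v \<Rightarrow> if b = a then x v else 0)"

lemma ten_simps [simp]: "ten a x [] = 0" "ten a x (b # v) = (if b = a then x v else 0)"
  by (auto simp: ten_def)

lemma zero_slice [simp]: "(\<lambda>_. 0) = (0 :: wvec)"
  by (auto simp: fun_eq_iff fun_apply)

lemma wvec_eqI: "x [] = y [] \<Longrightarrow> (\<And>b v. x (b # v) = y (b # v)) \<Longrightarrow> x = (y :: wvec)"
  by (rule ext) (metis neq_Nil_conv)

lemma WF_ten: "WF i (ten a x) = ten a (WF i x) + (if a = i then ten (Suc i) (WK i x) else 0)"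
  by (rule wvec_eqI) (auto simp: WF_Cons fun_apply)

lemma WE_ten: "WE i (ten a x) = sc (qvar powi (- wtw i [a])) (ten a (WE i x)) + (if a = Suc i then ten i x else 0)"
  by (rule wvec_eqI) (auto simp: WE_Cons fun_apply)

subsection \<open>Bases adapted to the i-th subalgebra\<close>

text \<open>
  The vectors \<open>f\<^sub>i\<^bsup>(k)\<^esup> u\<close> of the string decomposition of \<open>V\<^bsup>\<otimes>N\<^esup>\<close>, obtained by splitting \<open>V(m) \<otimes> V(1)\<close>
  for each \<open>i\<close>-string: one vector for each word, congruent to this word modulo \<open>q\<close>.
\<close>

function XV :: "nat \<Rightarrow> nat list \<Rightarrow> wvec" where
  "XV i [] = (\<lambda>w. of_bool (w = []))"
| "XV i (a # w) =
    (if a = i then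
       ten i (XV i w) + (if weps i w > 0 then sc (qvar ^ Suc (wphi i w)) (ten (Suc i) (XV i (wet i w))) else 0)
     else if a = Suc i \<and> wphi i w > 0 then
       sc (inverse qvar ^ weps i w * qint (wphi i w) / qint (weps i w + wphi i w)) (ten (Suc i) (XV i w)) -
       sc (qvar * qint (Suc (weps i w)) / qint (weps i w + wphi i w)) (ten i (XV i (wft i w)))
     else ten a (XV i w))"
  by pat_completeness auto
termination by (relation "measure (length \<circ> snd)") auto

declare XV.simps(2) [simp del]

lemma XV_support: "XV i w v \<noteq> 0 \<Longrightarrow> count_list v k = count_list w k"
proof (induction i w arbitrary: v rule: XV.induct)
  case (1 i)
  then show ?case by (auto split: if_splits)
next
  case (2 i a w)
  show ?case
  proof (cases v)
    case Nil
    then show ?thesis using "2.prems" by (auto simp: XV.simps(2) fun_apply split: if_splits)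
  next
    case v: (Cons b u)
    consider (a) "a = i" | (b) "a = Suc i" "wphi i w > 0" | (c) "a \<noteq> i" "a = Suc i \<longrightarrow> wphi i w = 0" by auto
    then show ?thesis
    proof cases
      case a
      then have "b = i \<and> XV i w u \<noteq> 0 \<or> b = Suc i \<and> weps i w > 0 \<and> XV i (wet i w) u \<noteq> 0"
        using "2.prems" v by (auto simp: XV.simps(2) fun_apply split: if_splits)
      then show ?thesis
      proof (elim disjE conjE)
        assume h: "b = Suc i" "weps i w > 0" "XV i (wet i w) u \<noteq> 0"
        have "count_list u k = count_list (wet i w) k" using "2.IH"(2)[OF a h(2) h(3)] .
        then have "int (count_list u k) = int (count_list w k) + of_bool (k = i) - of_bool (k = Suc i)"
          using count_we[OF h(2)] by simp
        then show ?thesis using v h a by (auto split: if_splits)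
      qed (use "2.IH"(1)[OF a] v a in auto)
    next
      case b
      then have "b = Suc i \<and> XV i w u \<noteq> 0 \<or> b = i \<and> XV i (wft i w) u \<noteq> 0"
        using "2.prems" v by (auto simp: XV.simps(2) fun_apply split: if_splits)
      then show ?thesis
      proof (elim disjE conjE)
        assume h: "b = i" "XV i (wft i w) u \<noteq> 0"
        have "count_list u k = count_list (wft i w) k" using "2.IH"(4) b h(2) by auto
        then have "int (count_list u k) = int (count_list w k) - of_bool (k = i) + of_bool (k = Suc i)"
          using count_wf[OF b(2)] by simp
        then show ?thesis using v h b by (auto split: if_splits)
      qed (use "2.IH"(3) v b in auto)
    next
      case c
      then have "b = a \<and> XV i w u \<noteq> 0" using "2.prems" v by (auto simp: XV.simps(2) fun_apply split: if_splits)
      then show ?thesis using "2.IH"(5) c v by auto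
    qed
  qed
qed

lemma WK_XV: "WK i (XV i w) = sc (qvar powi wtw i w) (XV i w)"
proof
  fix v
  show "WK i (XV i w) v = sc (qvar powi wtw i w) (XV i w) v"
  proof (cases "XV i w v = 0")
    case False
    then have "wtw i v = wtw i w" using XV_support unfolding wtw_def by simp
    then show ?thesis by (simp add: WK_def fun_apply)
  qed (simp add: WK_def fun_apply)
qed

lemma qpow_wtw: "qvar powi wtw i w = qvar ^ wphi i w * inverse qvar ^ weps i w"
  unfolding wphi_weps[symmetric] by (simp add: power_int_diff field_simps)

lemma ten_linear: "ten a (sc c x) = sc c (ten a x)" "ten a 0 = 0" "ten a (x + y) = ten a x + ten a y"
  "ten a (x - y) = ten a x - ten a y"
  by (auto intro!: wvec_eqI simp: fun_apply)

text \<open>Induction on the length, since \<open>XV i (a # w)\<close> involves the altered tails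
  \<open>wet i w\<close> and \<open>wft i w\<close>, as long as w. After the coproduct is inserted,
  each case compares coefficients in one of the two components of V(m) \<otimes> V(1), which comes
  down to a recurrence of q-integers.\<close>

lemma WF_XV: "WF i (XV i w) = (if wphi i w > 0 then sc (qint (Suc (weps i w))) (XV i (wft i w)) else 0)"
proof (induction w rule: length_induct)
  case (1 w0)
  show ?case
  proof (cases w0)
    case Nil
    have "WF i (XV i []) = 0" by (auto intro!: wvec_eqI simp: WF_Cons fun_apply)
    then show ?thesis using Nil by simp
  next
    case w0: (Cons a w)
    have IH: "WF i (XV i v) = (if wphi i v > 0 then sc (qint (Suc (weps i v))) (XV i (wft i v)) else 0)"
      if "length v = length w" for v using 1 w0 that by simp
    let ?e = "weps i w" and ?p = "wphi i w"
    note I = IH[OF refl] IH[of "wet i w"] IH[of "wft i w"]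
    have q1: "qint (Suc ?e) = qvar * qint ?e + inverse qvar ^ ?e" by (rule qint_Suc)
    have q0: "qvar ^ ?p = qvar * qvar ^ (?p - 1)" if "?p > 0" using that by (cases ?p) auto
    note U = XV.simps(2) WF_ten WK_XV qpow_wtw ten_linear
    consider (a) "a = i" "?p > 0" "?e > 0" | (a') "a = i" "?p > 0" "?e = 0" | (a0) "a = i" "?p = 0" "?e > 0"
      | (a0') "a = i" "?p = 0" "?e = 0" | (b) "a = Suc i" "?p > 1" | (b1) "a = Suc i" "?p = 1"
      | (b0) "a = Suc i" "?p = 0" | (c) "a \<noteq> i" "a \<noteq> Suc i" by linarith
    then show ?thesis
    proof cases
      case a
      then have "WF i (XV i w0) = ten i (sc (qint (Suc ?e)) (XV i (wft i w))) + sc (qvar ^ ?p * inverse qvar ^ ?e) (ten (Suc i) (XV i w))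
          + sc (qvar ^ Suc ?p * qint ?e) (ten (Suc i) (XV i w))"
        using w0 I by (simp add: U add_ac)
      moreover have "XV i (wft i w0) = ten i (XV i (wft i w)) + sc (qvar ^ ?p) (ten (Suc i) (XV i w))"
        using a w0 by (simp add: U q0)
      ultimately show ?thesis using a w0
        by (auto intro!: wvec_eqI simp: fun_apply algebra_simps q1)
    next
      case a'
      then show ?thesis using w0 I by (auto simp: U q0 add_ac sc_add)
    next
      case a0
      then have "WF i (XV i w0) = sc (inverse qvar ^ ?e) (ten (Suc i) (XV i w)) + sc (qvar * qint ?e) (ten (Suc i) (XV i w))"
        using w0 I by (simp add: U add_ac)
      moreover have "XV i (wft i w0) = ten (Suc i) (XV i w)" using a0 w0 by (simp add: U)
      ultimately show ?thesis using a0 w0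
        by (auto intro!: wvec_eqI simp: fun_apply algebra_simps q1)
    next
      case a0'
      then show ?thesis using w0 I by (simp add: U)
    next
      case b
      have "?p = Suc (Suc (?p - 2))" using b(2) by simp
      then obtain p where p: "?p = Suc (Suc p)" by blast
      let ?m = "qint (?e + ?p)"
      have m: "?m \<noteq> 0" using b by simp
      \<comment> \<open>In the component V(m-1), f produces
        \<open>ten (Suc i) (XV i (wft i w))\<close> with coefficient \<open>A - C\<close>, while
        \<open>D\<close> is its coefficient in the expected vector. What has to be seen is that
        \<open>A - C\<close> is [\<epsilon>+1] times \<open>D\<close>.\<close>
      define A B C D where "A = inverse qvar ^ ?e * qint ?p / ?m * qint (Suc ?e)"
        and "B = qvar * qint (Suc (Suc ?e)) / ?m"
        and "C = qvar * qint (Suc ?e) / ?m * (qvar ^ (?p - 1) * inverse qvar ^ Suc ?e)"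
        and "D = inverse qvar ^ Suc ?e * qint (?p - 1) / ?m"
      have 1: "WF i (XV i w0) = sc A (ten (Suc i) (XV i (wft i w)))
         - sc (qint (Suc ?e) * B) (ten i (XV i (wft i (wft i w))))
         - sc C (ten (Suc i) (XV i (wft i w)))"
        using b w0 I unfolding A_def B_def C_def by (simp add: U sc_add diff_diff_eq minus_sc mult_ac)
      have 2: "XV i (wft i w0) = sc D (ten (Suc i) (XV i (wft i w)))
         - sc B (ten i (XV i (wft i (wft i w))))"
        using b w0 unfolding B_def D_def by (simp add: U p)
      have "inverse qvar ^ ?e * qint ?p - qvar * (qvar ^ (?p - 1) * inverse qvar ^ Suc ?e) = inverse qvar ^ Suc ?e * qint (?p - 1)"
        unfolding p qint_Suc'[of "Suc p"] by (simp add: field_simps)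
      moreover have "A - C = qint (Suc ?e) / ?m * (inverse qvar ^ ?e * qint ?p - qvar * (qvar ^ (?p - 1) * inverse qvar ^ Suc ?e))"
        unfolding A_def C_def by (simp add: divide_inverse algebra_simps)
      ultimately have "A - C = qint (Suc ?e) * D" unfolding D_def by (simp add: mult_ac)
      then have "A = C + qint (Suc ?e) * D" by (simp add: algebra_simps)
      then have "sc A y - sc (qint (Suc ?e) * B) z - sc C y = sc (qint (Suc ?e)) (sc D y - sc B z)" for y z
        by (simp add: fun_eq_iff fun_apply algebra_simps)
      then have "WF i (XV i w0) = sc (qint (Suc ?e)) (XV i (wft i w0))"
        unfolding 1 2 .
      then show ?thesis using b w0 by simp
    next
      case b1
      then have "WF i (XV i w0) = sc (inverse qvar ^ ?e) (ten (Suc i) (XV i (wft i w)))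
         - sc (qvar * inverse qvar ^ Suc ?e) (ten (Suc i) (XV i (wft i w)))"
        using w0 I by (simp add: U)
      moreover have "qvar * inverse qvar ^ Suc ?e = inverse qvar ^ ?e" by simp
      ultimately show ?thesis using b1 w0 by (simp del: power_Suc)
    next
      case b0
      then show ?thesis using w0 I by (simp add: U)
    next
      case c
      then show ?thesis using w0 I by (auto simp: U)
    qed
  qed
qed

lemma WE_XV: "WE i (XV i w) = (if weps i w > 0 then sc (qint (Suc (wphi i w))) (XV i (wet i w)) else 0)"
proof (induction w rule: length_induct)
  case (1 w0)
  show ?case
  proof (cases w0)
    case Nil
    have "WE i (XV i []) = 0" by (auto intro!: wvec_eqI simp: WE_Cons fun_apply)
    then show ?thesis using Nil by simp
  next
    case w0: (Cons a w)
    have IH: "WE i (XV i v) = (if weps i v > 0 then sc (qint (Suc (wphi i v))) (XV i (wet i v)) else 0)"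
      if "length v = length w" for v using 1 w0 that by simp
    let ?e = "weps i w" and ?p = "wphi i w"
    note I = IH[OF refl] IH[of "wet i w"] IH[of "wft i w"]
    have q1: "qint (Suc (Suc ?p)) = inverse qvar * qint (Suc ?p) + qvar ^ Suc ?p" by (rule qint_Suc')
    note U = XV.simps(2) WE_ten WK_XV qpow_wtw ten_linear wtw_single
    consider (a) "a = i" "?e > 0" | (a') "a = i" "?e = 0"
      | (b) "a = Suc i" "?p > 0" "?e > 0" | (b') "a = Suc i" "?p > 0" "?e = 0" | (b1) "a = Suc i" "?p = 0" "?e > 0"
      | (b0) "a = Suc i" "?p = 0" "?e = 0" | (c) "a \<noteq> i" "a \<noteq> Suc i" by linarith
    then show ?thesis
    proof cases
      case a
      then have 1: "WE i (XV i w0) = sc (inverse qvar * qint (Suc ?p)) (ten i (XV i (wet i w))) + sc (qvar ^ Suc ?p) (ten i (XV i (wet i w)))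
         + (if ?e > 1 then sc (qvar ^ Suc ?p * qvar * qint (Suc (Suc ?p))) (ten (Suc i) (XV i (wet i (wet i w)))) else 0)"
        using w0 I by (auto simp: U power_int_minus sc_add mult_ac add_ac)
      have 2: "XV i (wet i w0) = ten i (XV i (wet i w)) + (if ?e > 1 then sc (qvar ^ Suc ?p * qvar) (ten (Suc i) (XV i (wet i (wet i w)))) else 0)"
        using a w0 by (auto simp: U mult_ac)
      have "WE i (XV i w0) = sc (qint (Suc (Suc ?p))) (XV i (wet i w0))"
        unfolding 1 2 by (intro wvec_eqI) (auto simp: fun_apply algebra_simps q1)
      then show ?thesis using a w0 by simp
    next
      case a'
      then show ?thesis using w0 I by (auto simp: U)
    next
      case b
      let ?m = "qint (?e + ?p)"
      have m: "?m \<noteq> 0" using b by simp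
      obtain p e where pe: "?p = Suc p" "?e = Suc e" using b by (metis Suc_pred)
      define A B C D where "A = inverse qvar ^ ?e * qint ?p / ?m * (qvar * qint (Suc ?p))"
        and "B = qvar * qint ?e / ?m"
        and "C = inverse qvar ^ ?e * qint ?p / ?m - qint (Suc ?e) / ?m * qint ?p"
        and "D = inverse qvar ^ (?e - 1) * qint (Suc ?p) / ?m"
      have 1: "WE i (XV i w0) = sc A (ten (Suc i) (XV i (wet i w))) + sc C (ten i (XV i w))"
        using b w0 I unfolding A_def C_def
        by (intro wvec_eqI) (auto simp: U power_int_minus fun_apply algebra_simps)
      have 2: "XV i (wet i w0) = sc D (ten (Suc i) (XV i (wet i w))) - sc B (ten i (XV i w))"
        using b w0 unfolding B_def D_def by (auto simp: U pe)
      have A: "A = qint ?p * D" unfolding A_def D_def pe using m by (simp add: field_simps)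
      have "inverse qvar ^ ?e = qint (Suc ?e) - qvar * qint ?e" by (simp add: qint_Suc)
      moreover have "C = qint ?p / ?m * (inverse qvar ^ ?e - qint (Suc ?e))"
        unfolding C_def by (simp add: divide_inverse algebra_simps)
      ultimately have C: "C = - qint ?p * B" unfolding B_def by (simp add: mult_ac)
      have "WE i (XV i w0) = sc (qint ?p) (XV i (wet i w0))"
        unfolding 1 2 A C by (intro wvec_eqI) (auto simp: fun_apply algebra_simps)
      then show ?thesis using b w0 by simp
    next
      case b'
      have m: "qint ?p \<noteq> 0" using b' by simp
      show ?thesis using b' w0 I m by (auto simp: U power_int_minus)
    next
      case b1
      then show ?thesis using w0 I by (auto simp: U power_int_minus add_ac)
    next
      case b0
      then show ?thesis using w0 I by (auto simp: U)
    next
      case c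
      then show ?thesis using w0 I by (auto simp: U)
    qed
  qed
qed

definition red :: "wvec \<Rightarrow> nat list \<Rightarrow> rat" where
  "red x = (\<lambda>w. ev0 (x w))"

text \<open>Clears the negative powers of q from the coefficients in \<open>XV\<close>: the first
  becomes a quotient with value 1 at q = 0, the second carries the factor q^p with p > 0. This is
  why only one word is left modulo q.\<close>

lemma XV_coeff_U:
  assumes "p > 0"
  shows "inverse qvar ^ e * qint p / qint (e + p) = qU p / qU (e + p)"
    and "qvar * qint (Suc e) / qint (e + p) = qvar ^ p * (qU (Suc e) / qU (e + p))"
proof -
  obtain p' where p: "p = Suc p'" using assms by (cases p) auto
  have nz: "qU (Suc (e + p')) \<noteq> 0" by simp
  have 1: "qint (e + p) = qU (Suc (e + p')) * inverse qvar ^ (e + p')" using qint_qU[of "e + p'"] p by simp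
  show "inverse qvar ^ e * qint p / qint (e + p) = qU p / qU (e + p)"
    unfolding 1 unfolding p qint_qU using nz by (simp add: field_simps power_add)
  show "qvar * qint (Suc e) / qint (e + p) = qvar ^ p * (qU (Suc e) / qU (e + p))"
    unfolding 1 unfolding p qint_qU using nz by (simp add: field_simps power_add)
qed

lemma XV_mod_q: "XV i w v \<in> regular_at_0 \<and> ev0 (XV i w v) = of_bool (v = w)"
proof (induction w arbitrary: v rule: length_induct)
  case (1 w0)
  show ?case
  proof (cases w0)
    case Nil
    then show ?thesis by simp
  next
    case w0: (Cons a w)
    have IH: "XV i u v \<in> regular_at_0 \<and> ev0 (XV i u v) = of_bool (v = u)" if "length u = length w" for u v
      using 1 w0 that by simp
    let ?e = "weps i w" and ?p = "wphi i w"
    have I: "XV i w v \<in> regular_at_0" "ev0 (XV i w v) = of_bool (v = w)"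
      "XV i (wft i w) v \<in> regular_at_0" "ev0 (XV i (wft i w) v) = of_bool (v = wft i w)"
      "XV i (wet i w) v \<in> regular_at_0" "ev0 (XV i (wet i w) v) = of_bool (v = wet i w)" for v
      using IH by simp_all
    have u: "qU ?p / qU (?e + ?p) \<in> regular_at_0" "ev0 (qU ?p / qU (?e + ?p)) = 1"
        "qU (Suc ?e) / qU (?e + ?p) \<in> regular_at_0" if "?p > 0"
      using that regular_divide[of "qU ?p" "qU (?e + ?p)"] regular_divide[of "qU (Suc ?e)" "qU (?e + ?p)"] by simp_all
    have z: "(0::nat) ^ ?p = 0" if "?p > 0" using that by simp
    consider (a) "a = i" | (b) "a = Suc i" "?p > 0" | (c) "a \<noteq> i" "a = Suc i \<longrightarrow> ?p = 0" by auto
    then show ?thesis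
    proof cases
      case a
      then show ?thesis using w0 I by (cases v) (auto simp: XV.simps(2) fun_apply)
    next
      case b
      have e: "ev0 (qvar ^ ?p * (qU (Suc ?e) / qU (?e + ?p)) * y) = 0" "qvar ^ ?p * (qU (Suc ?e) / qU (?e + ?p)) * y \<in> regular_at_0"
        if "y \<in> regular_at_0" for y
        using u(3)[OF b(2)] that b(2) by (simp_all del: times_divide_eq_left times_divide_eq_right)
      have e': "ev0 (qU ?p / qU (?e + ?p) * y) = ev0 y" "qU ?p / qU (?e + ?p) * y \<in> regular_at_0"
        if "y \<in> regular_at_0" for y
        using u[OF b(2)] that by (simp_all del: times_divide_eq_left times_divide_eq_right)
      show ?thesis using b w0 I e[OF I(3)] e'[OF I(1)]
        by (cases v) (auto simp: XV.simps(2) fun_apply XV_coeff_U simp del: times_divide_eq_left times_divide_eq_right)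
    next
      case c
      then show ?thesis using w0 I by (cases v) (auto simp: XV.simps(2) fun_apply)
    qed
  qed
qed

subsection \<open>Families congruent to the identity\<close>

text \<open>Gaussian elimination. A diagonal entry has residue 1, so it is a unit; clearing with it
  changes the other entries only by elements vanishing at q = 0, and the remaining block is again
  congruent to the identity. The second conclusion tracks regularity through the same
  elimination.\<close>

lemma unimodular_expand:
  assumes "finite I"
    and "\<And>v w. v \<in> I \<Longrightarrow> w \<in> I \<Longrightarrow> X w v \<in> regular_at_0 \<and> ev0 (X w v) = of_bool (v = w)"
  shows "\<exists>c. (\<forall>v\<in>I. x v = (\<Sum>w\<in>I. c w * X w v)) \<and> ((\<forall>v\<in>I. x v \<in> regular_at_0) \<longrightarrow> (\<forall>w\<in>I. c w \<in> regular_at_0))"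
  using assms
proof (induction I arbitrary: X x rule: finite_induct)
  case (insert a J)
  have a: "X a a \<in> regular_at_0" "ev0 (X a a) = 1" using insert.prems by auto
  then have nz: "X a a \<noteq> 0" by auto
  have inv: "inverse (X a a) \<in> regular_at_0" using regular_inverse(1)[of "X a a"] a by simp
  define X' where "X' w v = X w v - X w a * inverse (X a a) * X a v" for w v
  define x' where "x' v = x v - x a * inverse (X a a) * X a v" for v
  have "X' w v \<in> regular_at_0 \<and> ev0 (X' w v) = of_bool (v = w)" if "v \<in> J" "w \<in> J" for v w
  proof -
    have "v \<noteq> a" "w \<noteq> a" using that insert.hyps by auto
    moreover have "X w a \<in> regular_at_0" "ev0 (X w a) = of_bool (a = w)" "X a v \<in> regular_at_0"
      "X w v \<in> regular_at_0" "ev0 (X w v) = of_bool (v = w)"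
      using insert.prems that by blast+
    ultimately show ?thesis unfolding X'_def using inv by simp
  qed
  then obtain c where c: "\<forall>v\<in>J. x' v = (\<Sum>w\<in>J. c w * X' w v)"
    "(\<forall>v\<in>J. x' v \<in> regular_at_0) \<longrightarrow> (\<forall>w\<in>J. c w \<in> regular_at_0)"
    using insert.IH[of X' x'] by blast
  have c': "x' v = (\<Sum>w\<in>J. c w * X' w v)" if "v \<in> insert a J" for v
  proof (cases "v = a")
    case True
    have "x' a = 0" "\<And>w. X' w a = 0" using nz by (simp_all add: x'_def X'_def)
    then show ?thesis using True by simp
  qed (use that c in auto)
  define d where "d w = (if w = a then x a * inverse (X a a) - (\<Sum>u\<in>J. c u * X u a * inverse (X a a)) else c w)" for w
  have "x v = (\<Sum>w\<in>insert a J. d w * X w v)" if "v \<in> insert a J" for v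
  proof -
    have "(\<Sum>w\<in>J. d w * X w v) = (\<Sum>w\<in>J. c w * X w v)" using insert.hyps by (intro sum.cong) (auto simp: d_def)
    moreover have "x v = x a * inverse (X a a) * X a v + (\<Sum>w\<in>J. c w * X' w v)" using c'[OF that] by (simp add: x'_def)
    moreover have "(\<Sum>w\<in>J. c w * X' w v) = (\<Sum>w\<in>J. c w * X w v) - (\<Sum>u\<in>J. c u * X u a * inverse (X a a)) * X a v"
      unfolding X'_def sum_distrib_right by (simp add: right_diff_distrib sum_subtractf mult_ac)
    ultimately show ?thesis using insert.hyps by (simp add: d_def algebra_simps)
  qed
  moreover have "\<forall>w\<in>insert a J. d w \<in> regular_at_0" if x: "\<forall>v\<in>insert a J. x v \<in> regular_at_0"
  proof -
    have "x' v \<in> regular_at_0" if "v \<in> J" for v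
      unfolding x'_def using x that inv insert.prems by (intro regular_diff regular_mult) auto
    then have "c w \<in> regular_at_0" if "w \<in> J" for w using c(2) that by blast
    then show ?thesis unfolding d_def using x inv insert.prems by (auto intro!: regular_diff regular_mult regular_sum)
  qed
  ultimately show ?case by blast
qed simp

text \<open>A nontrivial relation, scaled to be primitive, would at q = 0 become a relation with the
  identity matrix and a nonzero coefficient.\<close>

lemma unimodular_independent:
  assumes "finite I"
    and "\<And>v w. v \<in> I \<Longrightarrow> w \<in> I \<Longrightarrow> X w v \<in> regular_at_0 \<and> ev0 (X w v) = of_bool (v = w)"
    and "\<And>v. v \<in> I \<Longrightarrow> (\<Sum>w\<in>I. c w * X w v) = 0" and "u \<in> I"
  shows "c u = 0"
proof (rule ccontr)
  assume "c u \<noteq> 0"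
  with assms(4) have "\<exists>i\<in>I. c i \<noteq> 0" by blast
  from q_scaling[OF assms(1) this] obtain k where
    k: "\<And>i. i \<in> I \<Longrightarrow> qvar powi k * c i \<in> regular_at_0" "\<exists>i\<in>I. ev0 (qvar powi k * c i) \<noteq> 0" by blast
  then obtain v where v: "v \<in> I" "ev0 (qvar powi k * c v) \<noteq> 0" by blast
  have "0 = ev0 (qvar powi k * (\<Sum>w\<in>I. c w * X w v))" using assms(3)[OF v(1)] by simp
  also have "\<dots> = ev0 (\<Sum>w\<in>I. (qvar powi k * c w) * X w v)" by (simp add: sum_distrib_left mult.assoc)
  also have "\<dots> = (\<Sum>w\<in>I. ev0 (qvar powi k * c w) * of_bool (v = w))"
    by (subst ev0_sum) (use k(1) assms(2) v in \<open>auto intro!: sum.cong\<close>)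
  also have "\<dots> = ev0 (qvar powi k * c v)" using v(1) assms(1) by (simp add: of_bool_def if_distrib if_distribR sum.delta cong: if_cong)
  finally show False using v by simp
qed

section \<open>Kashiwara operators on tensor powers\<close>

definition Wsp :: "nat \<Rightarrow> nat \<Rightarrow> wvec set" where
  "Wsp n N = {x. \<forall>w. x w \<noteq> 0 \<longrightarrow> w \<in> words n N}"

definition Lat :: "nat \<Rightarrow> nat \<Rightarrow> wvec set" where
  "Lat n N = {x \<in> Wsp n N. \<forall>w. x w \<in> regular_at_0}"

lemma WspD: "x \<in> Wsp n N \<Longrightarrow> x w \<noteq> 0 \<Longrightarrow> w \<in> words n N"
  by (auto simp: Wsp_def)

lemma Wsp_outside: "x \<in> Wsp n N \<Longrightarrow> w \<notin> words n N \<Longrightarrow> x w = 0"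
  by (auto simp: Wsp_def)

lemma Wsp_0 [simp]: "0 \<in> Wsp n N"
  by (simp add: Wsp_def fun_apply)

lemma Wsp_add [simp]: "x \<in> Wsp n N \<Longrightarrow> y \<in> Wsp n N \<Longrightarrow> x + y \<in> Wsp n N"
  by (auto simp: Wsp_def fun_apply) (metis add.right_neutral)

lemma Wsp_sc [simp]: "x \<in> Wsp n N \<Longrightarrow> sc c x \<in> Wsp n N"
  by (auto simp: Wsp_def fun_apply)

lemma Wsp_sum: "(\<And>i. i \<in> S \<Longrightarrow> f i \<in> Wsp n N) \<Longrightarrow> sum f S \<in> Wsp n N"
  by (induction S rule: infinite_finite_induct) auto

lemma Lat_Wsp: "x \<in> Lat n N \<Longrightarrow> x \<in> Wsp n N"
  by (simp add: Lat_def)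

lemma Lat_add [simp]: "x \<in> Lat n N \<Longrightarrow> y \<in> Lat n N \<Longrightarrow> x + y \<in> Lat n N"
  by (auto simp: Lat_def fun_apply)

lemma Lat_0 [simp]: "0 \<in> Lat n N"
  by (auto simp: Lat_def fun_apply)

lemma Lat_sc [simp]: "x \<in> Lat n N \<Longrightarrow> c \<in> regular_at_0 \<Longrightarrow> sc c x \<in> Lat n N"
  by (auto simp: Lat_def fun_apply)

lemma Lat_diff [simp]: "x \<in> Lat n N \<Longrightarrow> y \<in> Lat n N \<Longrightarrow> x - y \<in> Lat n N"
  by (simp add: minus_sc)

lemma Lat_sum: "(\<And>i. i \<in> S \<Longrightarrow> f i \<in> Lat n N) \<Longrightarrow> sum f S \<in> Lat n N"
  by (induction S rule: infinite_finite_induct) auto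

lemma red_simps: "x \<in> Lat n N \<Longrightarrow> y \<in> Lat n N \<Longrightarrow> red (x + y) w = red x w + red y w"
  "x \<in> Lat n N \<Longrightarrow> y \<in> Lat n N \<Longrightarrow> red (x - y) w = red x w - red y w"
  "x \<in> Lat n N \<Longrightarrow> c \<in> regular_at_0 \<Longrightarrow> red (sc c x) w = ev0 c * red x w"
  by (auto simp: Lat_def red_def fun_apply)

lemma red_outside: "x \<in> Lat n N \<Longrightarrow> w \<notin> words n N \<Longrightarrow> red x w = 0"
  using Wsp_outside[OF Lat_Wsp, of x n N w] by (simp add: red_def)

lemma red_sum: "(\<And>i. i \<in> S \<Longrightarrow> f i \<in> Lat n N) \<Longrightarrow> red (sum f S) w = (\<Sum>i\<in>S. red (f i) w)"
proof (induction S rule: infinite_finite_induct)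
  case (insert j F)
  have "red (f j + sum f F) w = red (f j) w + red (sum f F) w"
    by (rule red_simps(1)[where n = n and N = N]) (use insert.prems in \<open>auto intro: Lat_sum\<close>)
  then show ?case using insert by simp
qed (auto simp: red_def fun_apply)

lemma mset_eq_if_counts:
  assumes "\<And>k. count_list v k = count_list w k"
  shows "mset v = mset w"
  using assms by (intro multiset_eqI) (simp add: count_mset)

lemma words_mset: "mset v = mset w \<Longrightarrow> v \<in> words n N \<longleftrightarrow> w \<in> words n N"
  unfolding words_def by (metis (no_types, lifting) mem_Collect_eq set_mset_mset size_mset)

lemma XV_Lat: 
  assumes "w \<in> words n N"
  shows "XV i w \<in> Lat n N"
proof -
  have "v \<in> words n N" if "XV i w v \<noteq> 0" for v
    using words_mset[OF mset_eq_if_counts[OF XV_support[OF that]]] assms by simp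
  then show ?thesis by (auto simp: Lat_def Wsp_def XV_mod_q)
qed

lemma XV_expansion:
  assumes "x \<in> Wsp n N"
  shows "\<exists>c. (\<forall>w. c w \<noteq> 0 \<longrightarrow> w \<in> words n N) \<and> x = (\<Sum>w\<in>words n N. sc (c w) (XV i w)) \<and>
     (x \<in> Lat n N \<longrightarrow> (\<forall>w. c w \<in> regular_at_0))"
proof -
  obtain c where c: "\<forall>v\<in>words n N. x v = (\<Sum>w\<in>words n N. c w * XV i w v)"
    "(\<forall>v\<in>words n N. x v \<in> regular_at_0) \<longrightarrow> (\<forall>w\<in>words n N. c w \<in> regular_at_0)"
    using unimodular_expand[OF finite_words, of n N "XV i" x] XV_mod_q by blast
  define d where "d w = (if w \<in> words n N then c w else 0)" for w
  have "x v = (\<Sum>w\<in>words n N. sc (d w) (XV i w)) v" for v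
  proof (cases "v \<in> words n N")
    case True
    then show ?thesis using c(1) by (simp add: sum_fun_apply fun_apply d_def)
  next
    case False
    then have "XV i w v = 0" if "w \<in> words n N" for w
      using XV_Lat[OF that] Lat_Wsp Wsp_outside by blast
    then show ?thesis using False assms by (simp add: sum_fun_apply fun_apply Wsp_outside)
  qed
  then show ?thesis using c(2) by (intro exI[of _ d]) (auto simp: d_def Lat_def)
qed

lemma XV_expansion_unique:
  assumes "\<And>w. c w \<noteq> 0 \<Longrightarrow> w \<in> words n N" "\<And>w. d w \<noteq> 0 \<Longrightarrow> w \<in> words n N"
    and "(\<Sum>w\<in>words n N. sc (c w) (XV i w)) = (\<Sum>w\<in>words n N. sc (d w) (XV i w))"
  shows "c = d"
proof
  fix u
  show "c u = d u"
  proof (cases "u \<in> words n N")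
    case True
    have "(\<Sum>w\<in>words n N. (c w - d w) * XV i w v) = 0" for v
      using fun_cong[OF assms(3), of v] by (simp add: sum_fun_apply fun_apply left_diff_distrib sum_subtractf)
    then have "c u - d u = 0" using unimodular_independent[OF finite_words, of n N "XV i" "\<lambda>w. c w - d w" u] XV_mod_q True by blast
    then show ?thesis by simp
  next
    case False
    then show ?thesis using assms by metis
  qed
qed

section \<open>Coordinates in the basis adapted to i\<close>

definition coord :: "nat \<Rightarrow> nat \<Rightarrow> nat \<Rightarrow> wvec \<Rightarrow> nat list \<Rightarrow> qfield" where
  "coord n N i x = (THE c. (\<forall>w. c w \<noteq> 0 \<longrightarrow> w \<in> words n N) \<and> x = (\<Sum>w\<in>words n N. sc (c w) (XV i w)))"

lemma coord_eqI:
  assumes "\<And>w. c w \<noteq> 0 \<Longrightarrow> w \<in> words n N" "x = (\<Sum>w\<in>words n N. sc (c w) (XV i w))"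
  shows "coord n N i x = c"
  unfolding coord_def by (rule the_equality) (use assms XV_expansion_unique in blast)+

lemma coord_props:
  assumes "x \<in> Wsp n N"
  shows coord_support: "coord n N i x w \<noteq> 0 \<Longrightarrow> w \<in> words n N"
    and coord_sum: "(\<Sum>w\<in>words n N. sc (coord n N i x w) (XV i w)) = x"
proof -
  obtain c where c: "\<forall>w. c w \<noteq> 0 \<longrightarrow> w \<in> words n N" "x = (\<Sum>w\<in>words n N. sc (c w) (XV i w))"
    using XV_expansion[OF assms] by blast
  then have "coord n N i x = c" by (intro coord_eqI) auto
  then show "coord n N i x w \<noteq> 0 \<Longrightarrow> w \<in> words n N" "(\<Sum>w\<in>words n N. sc (coord n N i x w) (XV i w)) = x"
    using c by auto
qed

text \<open>Since \<open>XV i w\<close> is congruent to w modulo q, the coordinates in every adapted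
  basis have the same residues as the word coordinates. In this way the signature rule, exact on
  \<open>XV i\<close>, becomes a statement about residues that holds for all i at once.\<close>

lemma coord_Lat:
  assumes "x \<in> Lat n N"
  shows "coord n N i x w \<in> regular_at_0" "ev0 (coord n N i x w) = red x w"
proof -
  have x: "x \<in> Wsp n N" using assms Lat_Wsp by blast
  obtain c where c: "\<forall>w. c w \<noteq> 0 \<longrightarrow> w \<in> words n N" "x = (\<Sum>w\<in>words n N. sc (c w) (XV i w))" "\<forall>w. c w \<in> regular_at_0"
    using XV_expansion[OF x] assms by blast
  have cc: "coord n N i x = c" using c by (intro coord_eqI) auto
  show "coord n N i x w \<in> regular_at_0" using cc c by simp
  have "red x w = (\<Sum>v\<in>words n N. ev0 (c v) * of_bool (w = v))"
    unfolding c(2) by (subst red_sum[where n = n and N = N])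
      (use c(3) XV_Lat XV_mod_q in \<open>auto simp: red_def fun_apply intro!: sum.cong\<close>)
  also have "\<dots> = ev0 (c w)"
  proof (cases "w \<in> words n N")
    case False
    then have "c w = 0" using c(1) by blast
    then show ?thesis using False by (auto intro!: sum.neutral)
  qed (auto simp: of_bool_def if_distrib if_distribR sum.delta cong: if_cong)
  finally show "ev0 (coord n N i x w) = red x w" using cc by simp
qed

lemma coord_0 [simp]: "coord n N i 0 w = 0"
proof -
  have "coord n N i 0 = 0" by (rule coord_eqI) (auto simp: fun_apply)
  then show ?thesis by (simp add: fun_apply)
qed

lemma coord_add: "x \<in> Wsp n N \<Longrightarrow> y \<in> Wsp n N \<Longrightarrow> coord n N i (x + y) w = coord n N i x w + coord n N i y w"
proof -
  assume a: "x \<in> Wsp n N" "y \<in> Wsp n N"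
  have "coord n N i (x + y) = (\<lambda>w. coord n N i x w + coord n N i y w)"
  proof (rule coord_eqI)
    show "x + y = (\<Sum>w\<in>words n N. sc (coord n N i x w + coord n N i y w) (XV i w))"
      using coord_sum[OF a(1), of i] coord_sum[OF a(2), of i] by (simp add: sc_add sum.distrib)
  qed (use a coord_support in \<open>metis add.right_neutral\<close>)
  then show ?thesis by simp
qed

lemma coord_sc: "x \<in> Wsp n N \<Longrightarrow> coord n N i (sc a x) w = a * coord n N i x w"
proof -
  assume a: "x \<in> Wsp n N"
  have "coord n N i (sc a x) = (\<lambda>w. a * coord n N i x w)"
  proof (rule coord_eqI)
    have "sc a x = sc a (\<Sum>w\<in>words n N. sc (coord n N i x w) (XV i w))" using coord_sum[OF a, of i] by simp
    then show "sc a x = (\<Sum>w\<in>words n N. sc (a * coord n N i x w) (XV i w))" by (simp add: sc_sum)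
  qed (use a coord_support in auto)
  then show ?thesis by simp
qed

lemma coord_diff: "x \<in> Wsp n N \<Longrightarrow> y \<in> Wsp n N \<Longrightarrow> coord n N i (x - y) w = coord n N i x w - coord n N i y w"
  by (simp add: minus_sc coord_add coord_sc)

lemma coord_inject: "x \<in> Wsp n N \<Longrightarrow> y \<in> Wsp n N \<Longrightarrow> coord n N i x = coord n N i y \<Longrightarrow> x = y"
  by (metis coord_sum)

text \<open>The linear map sending \<open>XV i w\<close> to \<open>XV i (wft i w)\<close>, or to 0
  if \<open>wphi i w\<close> is 0. It is written by its coefficients at the target word, whose only
  possible source is \<open>wet i w\<close>.\<close>

definition KF :: "nat \<Rightarrow> nat \<Rightarrow> nat \<Rightarrow> wvec \<Rightarrow> wvec" where
  "KF n N i x = (\<Sum>w\<in>words n N. sc (if weps i w > 0 then coord n N i x (wet i w) else 0) (XV i w))"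

definition KE :: "nat \<Rightarrow> nat \<Rightarrow> nat \<Rightarrow> wvec \<Rightarrow> wvec" where
  "KE n N i x = (\<Sum>w\<in>words n N. sc (if wphi i w > 0 then coord n N i x (wft i w) else 0) (XV i w))"

locale rank =
  fixes n i :: nat
  assumes i: "1 \<le> i" "i < n"
begin

lemma sum_wft: "(\<Sum>w\<in>words n N. if wphi i w > 0 then g w (wft i w) else (0::'a::comm_monoid_add)) =
    (\<Sum>v\<in>words n N. if weps i v > 0 then g (wet i v) v else 0)"
proof -
  have "(\<Sum>w\<in>{w\<in>words n N. wphi i w > 0}. g w (wft i w)) = (\<Sum>v\<in>{v\<in>words n N. weps i v > 0}. g (wet i v) v)"
    by (rule sum.reindex_bij_witness[where i = "wet i" and j = "wft i"]) (use i wf_in_words we_in_words in auto)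
  then show ?thesis by (simp add: sum.inter_filter)
qed

lemma we_words: "weps i w > 0 \<Longrightarrow> wet i w \<in> words n N \<Longrightarrow> w \<in> words n N"
  using wf_in_words[of "wet i w" n N i] i by simp

lemma wf_words: "wphi i w > 0 \<Longrightarrow> wft i w \<in> words n N \<Longrightarrow> w \<in> words n N"
  using we_in_words[of "wft i w" n N i] i by simp

lemma coord_KF:
  assumes "x \<in> Wsp n N"
  shows "coord n N i (KF n N i x) w = (if weps i w > 0 then coord n N i x (wet i w) else 0)"
proof -
  have "coord n N i (KF n N i x) = (\<lambda>w. if weps i w > 0 then coord n N i x (wet i w) else 0)"
    by (rule coord_eqI) (use assms coord_support we_words in \<open>auto simp: KF_def split: if_splits\<close>)
  then show ?thesis by simp
qed

lemma coord_KE: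
  assumes "x \<in> Wsp n N"
  shows "coord n N i (KE n N i x) w = (if wphi i w > 0 then coord n N i x (wft i w) else 0)"
proof -
  have "coord n N i (KE n N i x) = (\<lambda>w. if wphi i w > 0 then coord n N i x (wft i w) else 0)"
    by (rule coord_eqI) (use assms coord_support wf_words in \<open>auto simp: KE_def split: if_splits\<close>)
  then show ?thesis by simp
qed

lemma KF_Wsp [simp]: "KF n N i x \<in> Wsp n N" and KE_Wsp [simp]: "KE n N i x \<in> Wsp n N"
  unfolding KF_def KE_def using XV_Lat Lat_Wsp by (auto intro!: Wsp_sum)

lemma KF_Lat: "x \<in> Lat n N \<Longrightarrow> KF n N i x \<in> Lat n N"
  and KE_Lat: "x \<in> Lat n N \<Longrightarrow> KE n N i x \<in> Lat n N"
  unfolding KF_def KE_def using XV_Lat coord_Lat(1) by (auto intro!: Lat_sum Lat_sc)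

lemma red_KF:
  assumes "x \<in> Lat n N"
  shows "red (KF n N i x) w = (if weps i w > 0 then red x (wet i w) else 0)"
proof -
  have "red (KF n N i x) w = ev0 (coord n N i (KF n N i x) w)" using coord_Lat(2)[OF KF_Lat[OF assms]] by simp
  then show ?thesis using coord_KF[OF Lat_Wsp[OF assms], of w] coord_Lat(2)[OF assms] by simp
qed

lemma red_KE:
  assumes "x \<in> Lat n N"
  shows "red (KE n N i x) w = (if wphi i w > 0 then red x (wft i w) else 0)"
proof -
  have "red (KE n N i x) w = ev0 (coord n N i (KE n N i x) w)" using coord_Lat(2)[OF KE_Lat[OF assms]] by simp
  then show ?thesis using coord_KE[OF Lat_Wsp[OF assms], of w] coord_Lat(2)[OF assms] by simp
qed

lemma WF_expand:
  assumes "x \<in> Wsp n N"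
  shows "WF i x = (\<Sum>v\<in>words n N. sc (if weps i v > 0 then qint (weps i v) * coord n N i x (wet i v) else 0) (XV i v))"
proof -
  have "WF i x = (\<Sum>w\<in>words n N. sc (coord n N i x w) (WF i (XV i w)))"
    using coord_sum[OF assms, of i] by (metis (no_types, lifting) WF_sc WF_sum sum.cong)
  also have "\<dots> = (\<Sum>w\<in>words n N. if wphi i w > 0 then sc (coord n N i x w * qint (Suc (weps i w))) (XV i (wft i w)) else 0)"
    by (intro sum.cong) (auto simp: WF_XV)
  also have "\<dots> = (\<Sum>v\<in>words n N. if weps i v > 0 then sc (coord n N i x (wet i v) * qint (Suc (weps i (wet i v)))) (XV i v) else 0)"
    by (rule sum_wft)
  also have "\<dots> = (\<Sum>v\<in>words n N. sc (if weps i v > 0 then qint (weps i v) * coord n N i x (wet i v) else 0) (XV i v))"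
    by (intro sum.cong) (auto simp: mult.commute)
  finally show ?thesis .
qed

lemma WE_expand:
  assumes "x \<in> Wsp n N"
  shows "WE i x = (\<Sum>v\<in>words n N. sc (if wphi i v > 0 then qint (wphi i v) * coord n N i x (wft i v) else 0) (XV i v))"
proof -
  have "WE i x = (\<Sum>w\<in>words n N. sc (coord n N i x w) (WE i (XV i w)))"
    using coord_sum[OF assms, of i] by (metis (no_types, lifting) WE_sc WE_sum sum.cong)
  also have "\<dots> = (\<Sum>w\<in>words n N. if weps i w > 0 then sc (coord n N i x w * qint (Suc (wphi i w))) (XV i (wet i w)) else 0)"
    by (intro sum.cong) (auto simp: WE_XV)
  also have "\<dots> = (\<Sum>w\<in>words n N. if weps i w > 0 then sc (coord n N i x (wft i (wet i w)) * qint (Suc (wphi i w))) (XV i (wet i w)) else 0)"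
    by (intro sum.cong) auto
  also have "\<dots> = (\<Sum>w\<in>words n N. if weps i w > 0 then sc (coord n N i x (wft i (wet i w)) * qint (wphi i (wet i w))) (XV i (wet i w)) else 0)"
    by (intro sum.cong) auto
  also have "\<dots> = (\<Sum>v\<in>words n N. if wphi i v > 0 then sc (coord n N i x (wft i v) * qint (wphi i v)) (XV i v) else 0)"
    using sum_wft[where N = N and g = "\<lambda>v w. sc (coord n N i x (wft i v) * qint (wphi i v)) (XV i v)"] by simp
  also have "\<dots> = (\<Sum>v\<in>words n N. sc (if wphi i v > 0 then qint (wphi i v) * coord n N i x (wft i v) else 0) (XV i v))"
    by (intro sum.cong) (auto simp: mult.commute)
  finally show ?thesis .
qed

lemma coord_WF:
  assumes "x \<in> Wsp n N"
  shows "coord n N i (WF i x) v = (if weps i v > 0 then qint (weps i v) * coord n N i x (wet i v) else 0)"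
proof -
  have "coord n N i (WF i x) = (\<lambda>v. if weps i v > 0 then qint (weps i v) * coord n N i x (wet i v) else 0)"
    by (rule coord_eqI[OF _ WF_expand[OF assms]]) (use assms coord_support we_words in \<open>auto split: if_splits\<close>)
  then show ?thesis by simp
qed

lemma coord_WE:
  assumes "x \<in> Wsp n N"
  shows "coord n N i (WE i x) v = (if wphi i v > 0 then qint (wphi i v) * coord n N i x (wft i v) else 0)"
proof -
  have "coord n N i (WE i x) = (\<lambda>v. if wphi i v > 0 then qint (wphi i v) * coord n N i x (wft i v) else 0)"
    by (rule coord_eqI[OF _ WE_expand[OF assms]]) (use assms coord_support wf_words in \<open>auto split: if_splits\<close>)
  then show ?thesis by simp
qed

lemma WF_Wsp [simp]: "x \<in> Wsp n N \<Longrightarrow> WF i x \<in> Wsp n N"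
  by (subst WF_expand) (auto intro!: Wsp_sum Wsp_sc Lat_Wsp[OF XV_Lat])

lemma WE_Wsp [simp]: "x \<in> Wsp n N \<Longrightarrow> WE i x \<in> Wsp n N"
  by (subst WE_expand) (auto intro!: Wsp_sum Wsp_sc Lat_Wsp[OF XV_Lat])

lemma coord_WE_0:
  assumes "x \<in> Wsp n N" "WE i x = 0" "coord n N i x w \<noteq> 0"
  shows "weps i w = 0"
proof (rule ccontr)
  assume "weps i w \<noteq> 0"
  then have e: "weps i w > 0" by simp
  have "coord n N i (WE i x) (wet i w) = 0" using assms(2) by simp
  then show False using coord_WE[OF assms(1), of "wet i w"] e assms(3) by simp
qed

definition DF :: "nat \<Rightarrow> wvec \<Rightarrow> wvec" where
  "DF k x = sc (inverse (qfact k)) ((WF i ^^ k) x)"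

lemma WF_pow_Wsp: "x \<in> Wsp n N \<Longrightarrow> (WF i ^^ k) x \<in> Wsp n N"
  by (induction k) auto

lemma WE_pow_Wsp: "x \<in> Wsp n N \<Longrightarrow> (WE i ^^ k) x \<in> Wsp n N"
  by (induction k) auto

lemma DF_Wsp [simp]: "x \<in> Wsp n N \<Longrightarrow> DF k x \<in> Wsp n N"
  by (simp add: DF_def WF_pow_Wsp)

text \<open>A vector killed by e_i has nonzero coordinates only at words with \<open>weps\<close> 0
  (\<open>coord_WE_0\<close>), and k steps of f_i carry each of these to the word with
  \<open>weps\<close> k on its string; the factors [1], ..., [k] picked up on the way cancel against
  \<open>qfact k\<close>.\<close>

lemma coord_DF:
  assumes "x \<in> Wsp n N" "WE i x = 0"
  shows "coord n N i (DF k x) v = (if weps i v = k then coord n N i x ((wet i ^^ k) v) else 0)"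
proof -
  have "coord n N i ((WF i ^^ k) x) v = (if weps i v = k then qfact k * coord n N i x ((wet i ^^ k) v) else 0)"
  proof (induction k arbitrary: v)
    case 0
    then show ?case using coord_WE_0[OF assms, of v] by (cases "coord n N i x v = 0") auto
  next
    case (Suc k)
    show ?case
    proof (cases "weps i v > 0")
      case True
      then show ?thesis using Suc[of "wet i v"] coord_WF[OF WF_pow_Wsp[OF assms(1)], of k v]
        by (auto simp: qfact_Suc funpow_swap1)
    next
      case False
      then show ?thesis using coord_WF[OF WF_pow_Wsp[OF assms(1)], of k v] by simp
    qed
  qed
  then show ?thesis unfolding DF_def by (simp add: coord_sc WF_pow_Wsp assms)
qed

lemma KF_DF:
  assumes "x \<in> Wsp n N" "WE i x = 0"
  shows "KF n N i (DF k x) = DF (Suc k) x"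
proof (rule coord_inject)
  show "coord n N i (KF n N i (DF k x)) = coord n N i (DF (Suc k) x)"
    using assms by (auto simp: fun_eq_iff coord_KF coord_DF funpow_swap1)
qed (use assms in auto)

lemma KE_DF_0:
  assumes "x \<in> Wsp n N" "WE i x = 0"
  shows "KE n N i (DF 0 x) = 0"
proof (rule coord_inject)
  show "coord n N i (KE n N i (DF 0 x)) = coord n N i 0"
    using assms by (auto simp: fun_eq_iff coord_KE coord_DF)
qed (use assms in auto)

text \<open>The bound on the weights says that \<open>DF (Suc k)\<close> does not run past the end
  of any string occurring in x. Past the end it would have lost a component that
  \<open>DF k x\<close> may still have.\<close>

lemma KE_DF:
  assumes "x \<in> Wsp n N" "WE i x = 0" "\<And>w. coord n N i x w \<noteq> 0 \<Longrightarrow> int k < wtw i w"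
  shows "KE n N i (DF (Suc k) x) = DF k x"
proof (rule coord_inject)
  show "coord n N i (KE n N i (DF (Suc k) x)) = coord n N i (DF k x)"
  proof
    fix v
    have pow: "wphi i ((wet i ^^ j) v) = wphi i v + j \<and> weps i ((wet i ^^ j) v) = weps i v - j" if "j \<le> weps i v" for j
      using that by (induction j) auto
    have "coord n N i x ((wet i ^^ k) v) = 0" if "wphi i v = 0" "weps i v = k"
    proof (rule ccontr)
      assume "coord n N i x ((wet i ^^ k) v) \<noteq> 0"
      then have "int k < wtw i ((wet i ^^ k) v)" by (rule assms(3))
      then show False using pow[of k] that wphi_weps[of i "(wet i ^^ k) v"] by simp
    qed
    then show "coord n N i (KE n N i (DF (Suc k) x)) v = coord n N i (DF k x) v"
      using assms by (auto simp: coord_KE coord_DF funpow_swap1)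
  qed
qed (use assms in auto)

end

section \<open>Relations and the invariant form\<close>

text \<open>The component of x at last letter a, a vector on shorter words. With
  \<open>sl_WF\<close>, \<open>sl_WE\<close>, \<open>sl_WK\<close> and \<open>sl_WKi\<close>
  induction on words becomes a matter of identities between slices, where the coproduct is
  visible.\<close>

definition sl :: "nat \<Rightarrow> wvec \<Rightarrow> wvec" where
  "sl a x = (\<lambda>w. x (a # w))"

lemma sl_linear [simp]: "sl a (x + y) = sl a x + sl a y" "sl a (sc c x) = sc c (sl a x)" "sl a 0 = 0"
  "sl a (x - y) = sl a x - sl a y"
  by (auto simp: sl_def fun_eq_iff fun_apply)

lemma sl_WF: "sl a (WF i x) = WF i (sl a x) + (if a = Suc i then WK i (sl i x) else 0)"
  by (auto simp: sl_def WF_Cons fun_eq_iff fun_apply)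

lemma sl_WE: "sl a (WE i x) = sc (qvar powi (- wtw i [a])) (WE i (sl a x)) + (if a = i then sl (Suc i) x else 0)"
  by (auto simp: sl_def WE_Cons fun_eq_iff fun_apply)

lemma sl_WK: "sl a (WK i x) = sc (qvar powi wtw i [a]) (WK i (sl a x))"
proof
  fix w
  show "sl a (WK i x) w = sc (qvar powi wtw i [a]) (WK i (sl a x)) w"
    using wtw_Cons[of i a w] by (simp add: sl_def WK_def fun_apply powi_add)
qed

lemma sl_WKi: "sl a (WKi i x) = sc (qvar powi (- wtw i [a])) (WKi i (sl a x))"
proof
  fix w
  show "sl a (WKi i x) w = sc (qvar powi (- wtw i [a])) (WKi i (sl a x)) w"
    using wtw_Cons[of i a w] powi_add[of "- wtw i [a]" "- wtw i w"] by (simp add: sl_def WKi_def fun_apply)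
qed

lemma WK_at_Nil: "WK i x [] = x []" "WKi i x [] = x []"
  by (simp_all add: WK_def WKi_def wtw_def)

lemma WF_if: "WF i (if b then x else y) = (if b then WF i x else WF i y)"
  and WE_if: "WE i (if b then x else y) = (if b then WE i x else WE i y)"
  and WK_if: "WK i (if b then x else y) = (if b then WK i x else WK i y)"
  and sc_if: "sc c (if b then x else y) = (if b then sc c x else sc c y)"
  by auto

lemma wtw_cartan: "wtw i [Suc j] - wtw i [j] = - cartan i j"
  by (auto simp: wtw_single cartan_def)

lemma WK_WF_pt: "WK i (WF j x) w = qvar powi (- cartan i j) * WF j (WK i x) w"
proof (induction w arbitrary: x)
  case (Cons a w)
  have 1: "WK i (WF j x) (a # w) = (sl a (WK i (WF j x))) w" by (simp add: sl_def)
  also have "\<dots> = qvar powi wtw i [a] * (WK i (WF j (sl a x)) w + (if a = Suc j then WK i (WK j (sl j x)) w else 0))"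
    by (simp add: sl_WK sl_WF WK_if fun_apply)
  also have "\<dots> = qvar powi wtw i [a] * (qvar powi (- cartan i j) * WF j (WK i (sl a x)) w + (if a = Suc j then WK i (WK j (sl j x)) w else 0))"
    unfolding Cons ..
  finally have L: "WK i (WF j x) (a # w) = qvar powi wtw i [a] * (qvar powi (- cartan i j) * WF j (WK i (sl a x)) w + (if a = Suc j then WK i (WK j (sl j x)) w else 0))" .
  have "WF j (WK i x) (a # w) = sl a (WF j (WK i x)) w" by (simp add: sl_def)
  also have "\<dots> = qvar powi wtw i [a] * WF j (WK i (sl a x)) w + (if a = Suc j then qvar powi wtw i [j] * WK j (WK i (sl j x)) w else 0)"
    by (simp add: sl_WK sl_WF fun_apply)
  finally have R: "WF j (WK i x) (a # w) = qvar powi wtw i [a] * WF j (WK i (sl a x)) w + (if a = Suc j then qvar powi wtw i [j] * WK j (WK i (sl j x)) w else 0)" .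
  have c: "qvar powi wtw i [Suc j] = qvar powi (- cartan i j) * qvar powi wtw i [j]"
  proof -
    have "wtw i [Suc j] = - cartan i j + wtw i [j]" using wtw_cartan[of i j] by simp
    then show ?thesis by (simp only: powi_add)
  qed
  have "WK i (WK j (sl j x)) w = WK j (WK i (sl j x)) w" by (simp add: WK_def)
  then show ?case unfolding L R by (auto simp: c algebra_simps)
qed (simp add: WK_def)

lemma WK_WF: "WK i (WF j x) = sc (qvar powi (- cartan i j)) (WF j (WK i x))"
  by (rule ext) (simp add: WK_WF_pt fun_apply)

lemma WK_WKi [simp]: "WK i (WKi i x) = x" "WKi i (WK i x) = x"
  by (auto simp: WK_def WKi_def fun_eq_iff power_int_minus)

lemma WKi_eqI: "WK i x = y \<Longrightarrow> WKi i y = x"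
  by auto

lemma WKi_WF: "WKi i (WF j x) = sc (qvar powi (cartan i j)) (WF j (WKi i x))"
proof (rule WKi_eqI)
  show "WK i (sc (qvar powi cartan i j) (WF j (WKi i x))) = WF j x"
    by (simp add: WK_WF power_int_minus)
qed

lemma WF_commute:
  assumes "cartan i j = 0"
  shows "WF i (WF j x) = WF j (WF i x)"
proof
  fix w
  have c: "cartan j i = 0" "i \<noteq> Suc j" "j \<noteq> Suc i" "i \<noteq> j" using assms by (auto simp: cartan_def split: if_splits)
  have k: "WK i (WF j x) = WF j (WK i x)" "WK j (WF i x) = WF i (WK j x)" for x
    using WK_WF[of i j x] WK_WF[of j i x] assms c by simp_all
  show "WF i (WF j x) w = WF j (WF i x) w"
  proof (induction w arbitrary: x)
    case (Cons a w)
    have "sl a (WF i (WF j x)) w = sl a (WF j (WF i x)) w"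
      unfolding sl_WF using c Cons by (auto simp: fun_apply k)
    then show ?case by (simp add: sl_def)
  qed simp
qed

text \<open>By the coproduct, the terms in which e and f act on different tensor factors have to
  cancel (\<open>kx\<close> balances the powers of q coming from K and K^-1), and the bracket on the
  last factor completes the bracket on the others to that of the whole.\<close>

lemma WE_WF_pt: "WE i (WF j x) w = WF j (WE i x) w +
   (if i = j then inverse (qvar - inverse qvar) * (WK i x w - WKi i x w) else 0)"
proof (induction w arbitrary: x)
  case (Cons a w)
  let ?D = "inverse (qvar - inverse qvar)"
  have D: "qvar * ?D - inverse qvar * ?D = 1"
    using qvar_square_neq_1 by (simp add: left_diff_distrib[symmetric])
  have kx: "qvar powi (- wtw i [Suc j]) * WE i (WK j y) w = qvar powi (- wtw i [j]) * WK j (WE i y) w" for y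
  proof -
    have "WK j (WE i y) w = qvar powi cartan i j * WE i (WK j y) w" for y w
    proof (induction w arbitrary: y)
      case (Cons b w)
      have L: "WK j (WE i y) (b # w) = qvar powi wtw j [b] * (qvar powi (- wtw i [b]) * WK j (WE i (sl b y)) w + (if b = i then WK j (sl (Suc i) y) w else 0))"
      proof -
        have "WK j (WE i y) (b # w) = sl b (WK j (WE i y)) w" by (simp add: sl_def)
        then show ?thesis by (simp add: sl_WK sl_WE WK_if fun_apply)
      qed
      have R: "WE i (WK j y) (b # w) = qvar powi (- wtw i [b]) * (qvar powi wtw j [b] * WE i (WK j (sl b y)) w) + (if b = i then qvar powi wtw j [Suc i] * WK j (sl (Suc i) y) w else 0)"
      proof -
        have "WE i (WK j y) (b # w) = sl b (WE i (WK j y)) w" by (simp add: sl_def)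
        then show ?thesis by (simp add: sl_WK sl_WE WK_if fun_apply)
      qed
      have c: "qvar powi wtw j [i] = qvar powi cartan i j * qvar powi wtw j [Suc i]"
      proof -
        have "cartan j i = cartan i j" by (auto simp: cartan_def)
        then have "wtw j [i] = cartan i j + wtw j [Suc i]" using wtw_cartan[of j i] by simp
        then show ?thesis by (simp only: powi_add)
      qed
      show ?case unfolding L R Cons by (auto simp: c algebra_simps)
    qed (simp add: WK_def)
    moreover have "qvar powi (- wtw i [Suc j]) = qvar powi (- wtw i [j]) * qvar powi cartan i j"
    proof -
      have "- wtw i [Suc j] = - wtw i [j] + cartan i j" using wtw_cartan[of i j] by simp
      then show ?thesis by (simp only: powi_add)
    qed
    ultimately show ?thesis by simp
  qed
  have L: "WE i (WF j x) (a # w) = qvar powi (- wtw i [a]) * (WE i (WF j (sl a x)) w + (if a = Suc j then WE i (WK j (sl j x)) w else 0))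
     + (if a = i then WF j (sl (Suc i) x) w + (if i = j then WK i (sl i x) w else 0) else 0)"
  proof -
    have "WE i (WF j x) (a # w) = sl a (WE i (WF j x)) w" by (simp add: sl_def)
    then show ?thesis by (simp add: sl_WF sl_WE WE_if fun_apply)
  qed
  have R: "WF j (WE i x) (a # w) = qvar powi (- wtw i [a]) * WF j (WE i (sl a x)) w + (if a = i then WF j (sl (Suc i) x) w else 0)
     + (if a = Suc j then qvar powi (- wtw i [j]) * WK j (WE i (sl j x)) w + (if j = i then WK j (sl (Suc i) x) w else 0) else 0)"
  proof -
    have "WF j (WE i x) (a # w) = sl a (WF j (WE i x)) w" by (simp add: sl_def)
    then show ?thesis by (simp add: sl_WF sl_WE WF_if WK_if fun_apply)
  qed
  have K: "WK i x (a # w) = qvar powi wtw i [a] * WK i (sl a x) w" "WKi i x (a # w) = qvar powi (- wtw i [a]) * WKi i (sl a x) w"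
    using fun_cong[OF sl_WK, of a i x w] fun_cong[OF sl_WKi, of a i x w] by (simp_all add: sl_def fun_apply)
  have e: "WE i (WK j (sl j x)) w * qvar powi (- wtw i [Suc j]) = qvar powi (- wtw i [j]) * WK j (WE i (sl j x)) w"
    using kx[of "sl j x"] by (simp add: mult.commute)
  show ?case
  proof (cases "i = j")
    case False
    then show ?thesis unfolding L R Cons K using e by (auto simp: algebra_simps)
  next
    case ij: True
    consider "a = i" | "a = Suc i" | "a \<noteq> i" "a \<noteq> Suc i" by blast
    then show ?thesis
    proof cases
      case 1
      have "qvar powi (- wtw i [a]) = inverse qvar" "qvar powi (wtw i [a]) = qvar" using 1 by (simp_all add: wtw_single power_int_minus)
      moreover have "WK i (sl i x) w = (qvar * ?D - inverse qvar * ?D) * WK i (sl i x) w" unfolding D by simp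
      ultimately show ?thesis unfolding L R Cons K using ij 1 by (simp add: algebra_simps)
    next
      case 2
      have "qvar powi (- wtw i [a]) = qvar" "qvar powi (wtw i [a]) = inverse qvar" using 2 by (simp_all add: wtw_single power_int_minus)
      moreover have "WK i (sl a x) w = (qvar * ?D - inverse qvar * ?D) * WK i (sl a x) w" unfolding D by simp
      ultimately show ?thesis unfolding L R Cons K using ij 2 e by (simp add: algebra_simps)
    next
      case 3
      then show ?thesis unfolding L R Cons K using ij by (simp add: wtw_single algebra_simps)
    qed
  qed
qed (simp add: WK_at_Nil)

lemma WE_WF: "WE i (WF j x) = WF j (WE i x) + (if i = j then sc (inverse (qvar - inverse qvar)) (WK i x - WKi i x) else 0)"
  by (rule ext) (simp add: WE_WF_pt fun_apply)

definition wt :: "wvec \<Rightarrow> nat \<Rightarrow> int \<Rightarrow> bool" where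
  "wt x i m \<longleftrightarrow> WK i x = sc (qvar powi m) x"

lemma wt_WKi: "wt x i m \<Longrightarrow> WKi i x = sc (qvar powi (- m)) x"
  unfolding wt_def by (metis WK_WKi(2) WKi_sc mult.commute power_int_minus qvar_nonzero power_int_eq_0_iff right_inverse sc_simps(3,4))

lemma WE_WF_wt:
  assumes "wt x i (int m)"
  shows "WE i (WF i x) = WF i (WE i x) + sc (qint m) x"
proof -
  have "sc (inverse (qvar - inverse qvar)) (WK i x - WKi i x) = sc (qint m) x"
    using assms wt_WKi[OF assms] unfolding wt_def
    by (simp add: fun_eq_iff fun_apply qint_def power_int_minus algebra_simps power_inverse divide_inverse)
  then show ?thesis by (simp add: WE_WF)
qed

lemma wt_WF: "wt x i m \<Longrightarrow> wt (WF j x) i (m - cartan i j)"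
  unfolding wt_def WK_WF by (simp add: mult.commute power_int_diff power_int_minus divide_inverse)

lemma wt_simps: "wt x i m \<Longrightarrow> wt (sc c x) i m" "wt x i m \<Longrightarrow> wt y i m \<Longrightarrow> wt (x + y) i m"
  "wt x i m \<Longrightarrow> wt y i m \<Longrightarrow> wt (x - y) i m" "wt 0 i m"
  unfolding wt_def by (simp_all add: mult.commute sc_add minus_sc)

lemma wt_support: "(\<And>w. x w \<noteq> 0 \<Longrightarrow> wtw i w = m) \<Longrightarrow> wt x i m"
  unfolding wt_def by (rule ext) (metis (no_types, lifting) WK_def mult_not_zero sc_def)

text \<open>q is not a root of unity: a relation 1 = q^d with d > 0 fails at q = 0.\<close>

lemma powi_inj: 
  assumes "qvar powi a = qvar powi b"
  shows "a = b"
proof -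
  have *: "\<not> a < b" if "qvar powi a = qvar powi b" for a b
  proof
    assume "a < b"
    then obtain d where d: "b = a + int (Suc d)" by (metis add_diff_cancel_left' diff_add_cancel zero_less_imp_eq_int zless_iff_Suc_zadd)
    have "qvar powi a * 1 = qvar powi a * qvar ^ Suc d" using that d powi_add[of a "int (Suc d)"] by (simp only: power_int_of_nat mult_1_right)
    then have "1 = qvar ^ Suc d" using mult_left_cancel[of "qvar powi a"] by simp
    then have "ev0 1 = ev0 (qvar ^ Suc d)" by simp
    then show False by simp
  qed
  from *[OF assms] *[OF assms[symmetric]] show ?thesis by simp
qed

lemma wt_supportD: "wt x i m \<Longrightarrow> x w \<noteq> 0 \<Longrightarrow> wtw i w = m"
  unfolding wt_def WK_def sc_def by (metis mult_cancel_right powi_inj)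

section \<open>The contravariant form on the tensor power\<close>

definition bil :: "nat \<Rightarrow> nat \<Rightarrow> wvec \<Rightarrow> wvec \<Rightarrow> qfield" where
  "bil n N x y = (\<Sum>w\<in>words n N. x w * y w)"

lemma bil_Suc: "bil n (Suc N) x y = (\<Sum>a\<in>{1..n}. bil n N (sl a x) (sl a y))"
proof -
  have 1: "words n (Suc N) = (\<lambda>(a, w). a # w) ` ({1..n} \<times> words n N)"
    by (auto simp: image_iff elim!: words_Suc_cases)
  have "bil n (Suc N) x y = (\<Sum>p\<in>{1..n} \<times> words n N. x (fst p # snd p) * y (fst p # snd p))"
    unfolding bil_def 1 by (subst sum.reindex) (auto simp: inj_on_def case_prod_beta)
  also have "\<dots> = (\<Sum>a\<in>{1..n}. \<Sum>w\<in>words n N. x (a # w) * y (a # w))"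
    by (subst sum.cartesian_product) (simp add: case_prod_beta)
  finally show ?thesis by (simp add: bil_def sl_def)
qed

lemma bil_linear: "bil n N (x + x') y = bil n N x y + bil n N x' y" "bil n N x (y + y') = bil n N x y + bil n N x y'"
  "bil n N (sc c x) y = c * bil n N x y" "bil n N x (sc c y) = c * bil n N x y" "bil n N 0 y = 0" "bil n N x 0 = 0"
  unfolding bil_def by (auto simp: fun_apply algebra_simps sum.distrib sum_distrib_left)

lemma bil_WK: "bil n N (WK i x) y = bil n N x (WK i y)"
  unfolding bil_def WK_def by (simp add: algebra_simps)

text \<open>The coproduct of e K is e K \<otimes> 1 + K \<otimes> e K, the same shape as that of f,
  and on a single letter q e K is the transpose of f. So the adjointness passes from the vector
  representation to all tensor powers.\<close>

lemma bil_WF: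
  assumes "1 \<le> i" "i < n"
  shows "bil n N (WF i x) y = bil n N x (sc qvar (WE i (WK i y)))"
proof (induction N arbitrary: x y)
  case 0
  then show ?case by (simp add: bil_def fun_apply)
next
  case (Suc N)
  have 1: "sl a (sc qvar (WE i (WK i y))) = sc qvar (WE i (WK i (sl a y))) + (if a = i then WK i (sl (Suc i) y) else 0)" for a
    by (auto simp: sl_WE sl_WK wtw_single power_int_minus fun_eq_iff fun_apply distrib_left mult.assoc[symmetric])
  have "bil n (Suc N) (WF i x) y = (\<Sum>a\<in>{1..n}. bil n N (WF i (sl a x)) (sl a y)) + (\<Sum>a\<in>{1..n}. if a = Suc i then bil n N (WK i (sl i x)) (sl a y) else 0)"
    unfolding bil_Suc sl_WF bil_linear sum.distrib by (intro arg_cong2[where f = "(+)"] sum.cong refl) (auto simp: bil_linear)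
  also have "\<dots> = (\<Sum>a\<in>{1..n}. bil n N (WF i (sl a x)) (sl a y)) + bil n N (WK i (sl i x)) (sl (Suc i) y)"
    using assms by (simp add: sum.delta)
  finally have L: "bil n (Suc N) (WF i x) y = (\<Sum>a\<in>{1..n}. bil n N (WF i (sl a x)) (sl a y)) + bil n N (WK i (sl i x)) (sl (Suc i) y)" .
  have "bil n (Suc N) x (sc qvar (WE i (WK i y))) = (\<Sum>a\<in>{1..n}. bil n N (sl a x) (sc qvar (WE i (WK i (sl a y))))) + (\<Sum>a\<in>{1..n}. if a = i then bil n N (sl a x) (WK i (sl (Suc i) y)) else 0)"
    unfolding bil_Suc 1 bil_linear(2) sum.distrib by (intro arg_cong2[where f = "(+)"] sum.cong refl) (auto simp: bil_linear)
  also have "\<dots> = (\<Sum>a\<in>{1..n}. bil n N (sl a x) (sc qvar (WE i (WK i (sl a y))))) + bil n N (sl i x) (WK i (sl (Suc i) y))"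
    using assms by (simp add: sum.delta)
  finally show ?case unfolding L using Suc bil_WK by simp
qed

text \<open>For a primitive multiple of x the form has as residue a sum of rational squares that are
  not all zero. An anisotropic form with f_i adjoint to e_i does what complete reducibility would
  do.\<close>

lemma bil_pos:
  assumes "x \<in> Wsp n N" "bil n N x x = 0"
  shows "x = 0"
proof (rule ccontr)
  assume "x \<noteq> 0"
  then obtain w where w: "x w \<noteq> 0" by (auto simp: fun_eq_iff fun_apply)
  then have "\<exists>i\<in>words n N. x i \<noteq> 0" using assms(1) WspD by blast
  from q_scaling[OF finite_words this] obtain k where k: "\<And>i. i \<in> words n N \<Longrightarrow> qvar powi k * x i \<in> regular_at_0" 
    "\<exists>i\<in>words n N. ev0 (qvar powi k * x i) \<noteq> 0" by blast
  have "0 = ev0 (qvar powi k * qvar powi k * bil n N x x)" using assms(2) by simp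
  also have "qvar powi k * qvar powi k * bil n N x x = (\<Sum>w\<in>words n N. (qvar powi k * x w) * (qvar powi k * x w))"
    unfolding bil_def sum_distrib_left by (simp add: mult_ac)
  also have "ev0 \<dots> = (\<Sum>w\<in>words n N. ev0 (qvar powi k * x w) * ev0 (qvar powi k * x w))"
    by (subst ev0_sum) (use k(1) in auto)
  also have "\<dots> > 0"
  proof -
    obtain v where "v \<in> words n N" "ev0 (qvar powi k * x v) \<noteq> 0" using k(2) by blast
    then show ?thesis by (intro sum_pos2[of _ v]) (auto simp: zero_less_mult_iff linorder_neq_iff)
  qed
  finally show False by simp
qed

section \<open>Highest weight vectors\<close>

subsection \<open>Lowering operators\<close>

text \<open>
  Applied to a highest weight vector \<open>w\<close> with \<open>\<langle>h\<^sub>i, wt w\<rangle> = \<mu> i\<close>, the operator \<open>lower \<mu> a d\<close> has weight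
  \<open>\<epsilon>\<^sub>a - \<epsilon>\<^sub>j\<close> with \<open>j = a - d\<close>, its image is killed by \<open>e\<^sub>i\<close> for \<open>i \<noteq> j\<close>, and \<open>e\<^sub>j\<close> sends it to a multiple of the image of
  \<open>lower \<mu> a (d - 1)\<close>. So a suitable combination of the vectors \<open>lower \<mu> a d w \<otimes> v\<^sub>j\<close> is a highest weight
  vector with leading term \<open>w \<otimes> v\<^sub>a\<close>.
\<close>

primrec shift :: "(nat \<Rightarrow> nat) \<Rightarrow> nat \<Rightarrow> nat \<Rightarrow> nat" where
  "shift \<mu> a 0 = 0"
| "shift \<mu> a (Suc d) = \<mu> (a - Suc d) + shift \<mu> a d + 1"

text \<open>\<open>shift\<close> is the pairing of wt + \<rho> with the coroot of \<epsilon>_(a-d) -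
  \<epsilon>_a, and \<open>lcoef\<close> is the q-integer one below it. The value -1 at d = 0 makes
  \<open>lower \<mu> a 1\<close> equal to f_(a-1), as the other term there has coefficient [0] =
  0.\<close>

definition lcoef :: "(nat \<Rightarrow> nat) \<Rightarrow> nat \<Rightarrow> nat \<Rightarrow> qfield" where
  "lcoef \<mu> a d = (if d = 0 then -1 else qint (shift \<mu> a d - 1))"

primrec lower :: "(nat \<Rightarrow> nat) \<Rightarrow> nat \<Rightarrow> nat \<Rightarrow> wvec \<Rightarrow> wvec" where
  "lower \<mu> a 0 x = x"
| "lower \<mu> a (Suc d) x = sc (qint (shift \<mu> a d)) (WF (a - Suc d) (lower \<mu> a d x)) -
     sc (lcoef \<mu> a d) (lower \<mu> a d (WF (a - Suc d) x))"

lemma lower_linear [simp]: "lower \<mu> a d 0 = 0" "lower \<mu> a d (sc c x) = sc c (lower \<mu> a d x)"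
  "lower \<mu> a d (x + y) = lower \<mu> a d x + lower \<mu> a d y"
  by (induction d arbitrary: x y) (simp_all add: minus_sc sc_add add_ac mult_ac)

lemma WE_WF_neq: "i \<noteq> j \<Longrightarrow> WE i (WF j x) = WF j (WE i x)"
  by (simp add: WE_WF)

lemma lower_WE: "d < a \<Longrightarrow> i < a - d \<or> i \<ge> a \<Longrightarrow> WE i (lower \<mu> a d x) = lower \<mu> a d (WE i x)"
proof (induction d arbitrary: x)
  case (Suc d)
  then have "i \<noteq> a - Suc d" "i < a - d \<or> i \<ge> a" "d < a" by auto
  then show ?case using Suc.IH by (simp add: WE_WF_neq)
qed simp

lemma lower_WF: "d < a \<Longrightarrow> Suc i < a - d \<Longrightarrow> WF i (lower \<mu> a d x) = lower \<mu> a d (WF i x)"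
proof (induction d arbitrary: x)
  case (Suc d)
  then have "cartan i (a - Suc d) = 0" by (auto simp: cartan_def)
  then show ?case using Suc by (simp add: WF_commute[of i "a - Suc d"])
qed simp

lemma lower_wt_sum: "wt x i m \<Longrightarrow> wt (lower \<mu> a d x) i (m - (\<Sum>k<d. cartan i (a - Suc k)))"
proof (induction d arbitrary: x m)
  case (Suc d)
  let ?S = "\<Sum>k<d. cartan i (a - Suc k)"
  have "wt (WF (a - Suc d) (lower \<mu> a d x)) i (m - ?S - cartan i (a - Suc d))"
    by (rule wt_WF[OF Suc.IH[OF Suc.prems]])
  moreover have "wt (lower \<mu> a d (WF (a - Suc d) x)) i (m - cartan i (a - Suc d) - ?S)"
    by (rule Suc.IH[OF wt_WF[OF Suc.prems]])
  ultimately show ?case by (auto intro!: wt_simps simp: algebra_simps)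
qed simp

lemma lower_wt:
  assumes "d < a" "wt x i m" "Suc i = a - d" "d > 0"
  shows "wt (lower \<mu> a d x) i (m + 1)"
proof -
  have "(\<Sum>k<d. cartan i (a - Suc k)) = (\<Sum>k<d. if k = d - 1 then -1 else 0)"
    using assms by (intro sum.cong) (auto simp: cartan_def)
  also have "\<dots> = -1" using assms(4) by (simp add: sum.delta)
  finally show ?thesis using lower_wt_sum[OF assms(2), of \<mu> a d] by simp
qed

text \<open>The quantum dimensions in the splitting of V(r) \<otimes> V(m) into V(r+m) and V(r-1)
  \<otimes> V(m-1).\<close>

lemma qint_identity: "qint (Suc r) * qint (Suc m) - qint r * qint m = qint (Suc (r + m))"
proof -
  have "qint (Suc r) * qint (Suc m) = (qvar * qint r + inverse qvar ^ r) * (inverse qvar * qint m + qvar ^ m)"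
    by (simp only: qint_Suc[of r] qint_Suc'[of m])
  also have "\<dots> = qint r * qint m + qvar ^ Suc m * qint r + inverse qvar ^ r * (inverse qvar * qint m + qvar ^ m)"
    by (simp add: algebra_simps)
  also have "\<dots> = qint r * qint m + qint (Suc m + r)" unfolding qint_add[of "Suc m" r] qint_Suc'[of m] by simp
  finally show ?thesis by (simp add: add.commute)
qed

text \<open>Both claims need each other and are proved in one induction. When f_j with j = a - d - 1
  is added, e_j gives the two terms the coefficients [r+1][m+1] and [r][m], combined by
  \<open>qint_identity\<close>; e_(a-d) gives them equal coefficients, so they cancel. The weight at
  a - d is a free parameter m because the induction is applied to x and to f_j x, whose weights
  differ there.\<close>

lemma lower_main:
  assumes "d < a" "\<And>i. a - d \<le> i \<Longrightarrow> i < a \<Longrightarrow> WE i x = 0"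
    and "\<And>i. a - d < i \<Longrightarrow> i < a \<Longrightarrow> wt x i (int (\<mu> i))"
  shows "d > 0 \<Longrightarrow> wt x (a - d) (int m) \<Longrightarrow>
      WE (a - d) (lower \<mu> a d x) = sc (qint (shift \<mu> a (d - 1) + m)) (lower \<mu> a (d - 1) x)"
    and "a - d < i \<Longrightarrow> i < a \<Longrightarrow> WE i (lower \<mu> a d x) = 0"
proof -
  have "(d > 0 \<longrightarrow> (\<forall>m. wt x (a - d) (int m) \<longrightarrow>
      WE (a - d) (lower \<mu> a d x) = sc (qint (shift \<mu> a (d - 1) + m)) (lower \<mu> a (d - 1) x))) \<and>
     (\<forall>i. a - d < i \<and> i < a \<longrightarrow> WE i (lower \<mu> a d x) = 0)"
    using assms
  proof (induction d arbitrary: x)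
    case (Suc d)
    let ?j = "a - Suc d"
    have j1: "a - d = Suc ?j" using Suc.prems(1) by simp
    have E: "WE ?j x = 0" using Suc.prems by simp
    have jd: "d < a" "?j < a - d" using Suc.prems(1) by auto
    have alpha: "WE ?j (lower \<mu> a (Suc d) x) = sc (qint (shift \<mu> a d + m)) (lower \<mu> a d x)" if m: "wt x ?j (int m)" for m
    proof (cases d)
      case 0
      then show ?thesis using WE_WF_wt[OF m] E by (simp add: lcoef_def minus_sc)
    next
      case d: (Suc e)
      then obtain r where r: "shift \<mu> a d = Suc r" by simp
      have "wt (lower \<mu> a d x) ?j (int m + 1)"
        by (rule lower_wt[OF _ m]) (use Suc.prems(1) d in auto)
      then have "wt (lower \<mu> a d x) ?j (int (Suc m))" by (simp only: of_nat_Suc add.commute)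
      then have 1: "WE ?j (WF ?j (lower \<mu> a d x)) = sc (qint (Suc m)) (lower \<mu> a d x)"
        using WE_WF_wt[of _ ?j "Suc m"] lower_WE[of d a ?j \<mu> x] jd E by simp
      have 2: "WE ?j (lower \<mu> a d (WF ?j x)) = sc (qint m) (lower \<mu> a d x)"
        using WE_WF_wt[OF m] lower_WE[of d a ?j \<mu> "WF ?j x"] jd E by simp
      have "WE ?j (lower \<mu> a (Suc d) x) = sc (qint (Suc r) * qint (Suc m) - qint r * qint m) (lower \<mu> a d x)"
      proof -
        have lc: "lcoef \<mu> a d = qint r" using r d unfolding lcoef_def by (simp del: shift.simps)
        show ?thesis unfolding lower.simps WE_diff WE_sc 1 2 r lc
          by (simp add: fun_eq_iff fun_apply algebra_simps)
      qed
      then show ?thesis unfolding qint_identity using r by simp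
    qed
    have beta: "WE i (lower \<mu> a (Suc d) x) = 0" if i: "?j < i" "i < a" for i
    proof -
      have dpos: "d > 0" using i by auto
      have Ex: "WE k x = 0" "WE k (WF ?j x) = 0" if "a - d \<le> k" "k < a" for k
        using Suc.prems(2)[of k] that j1 by (simp_all add: WE_WF_neq)
      have Wx: "wt x k (int (\<mu> k))" if "a - d \<le> k" "k < a" for k
        using Suc.prems(3)[of k] that j1 by simp
      have Wf: "wt (WF ?j x) k (int (\<mu> k))" if "a - d < k" "k < a" for k
      proof -
        have "cartan k ?j = 0" using that j1 by (auto simp: cartan_def)
        then show ?thesis using wt_WF[OF Wx, of k ?j] that by simp
      qed
      have Wf1: "wt (WF ?j x) (a - d) (int (Suc (\<mu> (a - d))))"
      proof -
        have "cartan (a - d) ?j = -1" using j1 by (auto simp: cartan_def)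
        then show ?thesis using wt_WF[OF Wx, of "a - d" ?j] dpos Suc.prems(1) by (simp add: add.commute)
      qed
      have da: "d < a" using Suc.prems(1) by simp
      note IHx = Suc.IH[OF da, of x] and IHf = Suc.IH[OF da, of "WF ?j x"]
      have X: "(d > 0 \<longrightarrow> (\<forall>m. wt x (a - d) (int m) \<longrightarrow>
          WE (a - d) (lower \<mu> a d x) = sc (qint (shift \<mu> a (d - 1) + m)) (lower \<mu> a (d - 1) x))) \<and>
         (\<forall>i. a - d < i \<and> i < a \<longrightarrow> WE i (lower \<mu> a d x) = 0)"
        by (rule IHx) (use Ex Wx in auto)
      have F: "(d > 0 \<longrightarrow> (\<forall>m. wt (WF ?j x) (a - d) (int m) \<longrightarrow>
          WE (a - d) (lower \<mu> a d (WF ?j x)) = sc (qint (shift \<mu> a (d - 1) + m)) (lower \<mu> a (d - 1) (WF ?j x)))) \<and>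
         (\<forall>i. a - d < i \<and> i < a \<longrightarrow> WE i (lower \<mu> a d (WF ?j x)) = 0)"
        by (rule IHf) (use Ex Wf in auto)
      show ?thesis
      proof (cases "i = a - d")
        case False
        then have "a - d < i" using i j1 by simp
        then have "WE i (lower \<mu> a d x) = 0" "WE i (lower \<mu> a d (WF ?j x)) = 0" using X F i by auto
        then show ?thesis using i by (simp add: WE_WF_neq)
      next
        case True
        obtain e where e: "d = Suc e" using dpos by (cases d) auto
        have s: "shift \<mu> a d = Suc (shift \<mu> a e + \<mu> (a - d))" using e by simp
        have 1: "WE i (lower \<mu> a d x) = sc (qint (shift \<mu> a e + \<mu> (a - d))) (lower \<mu> a e x)"
          using X True Wx[of "a - d"] e Suc.prems(1) by simp
        have 2: "WE i (lower \<mu> a d (WF ?j x)) = sc (qint (Suc (shift \<mu> a e + \<mu> (a - d)))) (lower \<mu> a e (WF ?j x))"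
          using F True Wf1 e by (metis Suc_eq_plus1 add_Suc_right diff_Suc_1 zero_less_Suc)
        have 3: "WF ?j (lower \<mu> a e x) = lower \<mu> a e (WF ?j x)"
          by (rule lower_WF) (use e Suc.prems(1) in auto)
        have "i \<noteq> ?j" using i by simp
        then have 4: "WE i (WF ?j (lower \<mu> a d x)) = WF ?j (WE i (lower \<mu> a d x))" by (rule WE_WF_neq)
        have lc: "lcoef \<mu> a d = qint (shift \<mu> a e + \<mu> (a - d))" using s dpos by (simp add: lcoef_def)
        show ?thesis unfolding lower.simps WE_diff WE_sc 4 1 2 s lc WF_sc 3 by (simp add: mult.commute)
      qed
    qed
    show ?case using alpha beta by auto
  qed auto
  then show "d > 0 \<Longrightarrow> wt x (a - d) (int m) \<Longrightarrow>
      WE (a - d) (lower \<mu> a d x) = sc (qint (shift \<mu> a (d - 1) + m)) (lower \<mu> a (d - 1) x)"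
    "a - d < i \<Longrightarrow> i < a \<Longrightarrow> WE i (lower \<mu> a d x) = 0" by blast+
qed

subsection \<open>Submodules generated by highest weight vectors\<close>

text \<open>The submodule generated by h when h is a highest weight vector. Only closure under the
  f_i is built in, so inductions over it need to follow the lowering operators alone.\<close>

inductive_set Sub :: "nat \<Rightarrow> wvec \<Rightarrow> wvec set" for n h where
  Sub_base: "h \<in> Sub n h"
| Sub_add: "x \<in> Sub n h \<Longrightarrow> y \<in> Sub n h \<Longrightarrow> x + y \<in> Sub n h"
| Sub_sc: "x \<in> Sub n h \<Longrightarrow> sc c x \<in> Sub n h"
| Sub_WF: "x \<in> Sub n h \<Longrightarrow> 1 \<le> i \<Longrightarrow> i < n \<Longrightarrow> WF i x \<in> Sub n h"

lemma Sub_diff: "x \<in> Sub n h \<Longrightarrow> y \<in> Sub n h \<Longrightarrow> x - y \<in> Sub n h"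
  unfolding minus_sc by (intro Sub_add Sub_sc)

lemma lower_Sub: "x \<in> Sub n h \<Longrightarrow> d < a \<Longrightarrow> a \<le> n \<Longrightarrow> lower \<mu> a d x \<in> Sub n h"
proof (induction d arbitrary: x)
  case (Suc d)
  have "1 \<le> a - Suc d" "a - Suc d < n" using Suc.prems by auto
  moreover from this have "WF (a - Suc d) x \<in> Sub n h" using Suc.prems by (intro Sub_WF)
  moreover have "d < a" using Suc.prems by simp
  ultimately show ?case unfolding lower.simps using Suc.IH Suc.prems by (intro Sub_diff Sub_sc Sub_WF) blast+
qed simp

lemma WF_mset:
  "WF i x w \<noteq> 0 \<Longrightarrow> \<exists>v. x v \<noteq> 0 \<and> add_mset i (mset w) = add_mset (Suc i) (mset v)"
proof (induction w arbitrary: x)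
  case (Cons a w)
  show ?case
  proof (cases "WF i (sl a x) w = 0")
    case False
    from Cons.IH[OF this] obtain v where v: "x (a # v) \<noteq> 0" "add_mset i (mset w) = add_mset (Suc i) (mset v)"
      by (auto simp: sl_def)
    then show ?thesis by (intro exI[of _ "a # v"]) (simp add: add_mset_commute)
  next
    case True
    then have "a = Suc i" "x (i # w) \<noteq> 0"
      using Cons.prems by (auto simp: WF_Cons sl_def WK_def split: if_splits)
    then show ?thesis by (intro exI[of _ "i # w"]) (simp add: add_mset_commute)
  qed
qed simp

lemma WF_sum_list:
  assumes "WF i x w \<noteq> 0"
  obtains v where "x v \<noteq> 0" "sum_list w = Suc (sum_list v)"
proof -
  obtain v where v: "x v \<noteq> 0" "add_mset i (mset w) = add_mset (Suc i) (mset v)" using WF_mset[OF assms] by blast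
  have "sum_mset (add_mset i (mset w)) = sum_mset (add_mset (Suc i) (mset v))" using v by simp
  then have "sum_list w = Suc (sum_list v)" by (simp add: sum_mset_sum_list)
  then show ?thesis using v that by blast
qed

lemma lower_mset:
  "d < a \<Longrightarrow> lower \<mu> a d x w \<noteq> 0 \<Longrightarrow> \<exists>v. x v \<noteq> 0 \<and> add_mset (a - d) (mset w) = add_mset a (mset v)"
proof (induction d arbitrary: x w)
  case (Suc d)
  let ?j = "a - Suc d"
  have j: "a - d = Suc ?j" using Suc.prems by simp
  consider "WF ?j (lower \<mu> a d x) w \<noteq> 0" | "lower \<mu> a d (WF ?j x) w \<noteq> 0"
    using Suc.prems(2) unfolding lower.simps fun_apply by force
  then show ?case
  proof cases
    case 1
    from WF_mset[OF this] obtain v where v: "lower \<mu> a d x v \<noteq> 0" "add_mset ?j (mset w) = add_mset (Suc ?j) (mset v)" by blast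
    from Suc.IH[OF _ v(1)] Suc.prems obtain u where "x u \<noteq> 0" "add_mset (a - d) (mset v) = add_mset a (mset u)" by auto
    then show ?thesis using v j by auto
  next
    case 2
    from Suc.IH[OF _ 2] Suc.prems obtain v where v: "WF ?j x v \<noteq> 0" "add_mset (a - d) (mset w) = add_mset a (mset v)" by auto
    from WF_mset[OF v(1)] obtain u where u: "x u \<noteq> 0" "add_mset ?j (mset v) = add_mset (Suc ?j) (mset u)" by blast
    have "add_mset (Suc ?j) (add_mset ?j (mset w)) = add_mset ?j (add_mset a (mset v))"
      using v j by (simp add: add_mset_commute)
    also have "\<dots> = add_mset a (add_mset (Suc ?j) (mset u))" using u by (simp add: add_mset_commute)
    also have "\<dots> = add_mset (Suc ?j) (add_mset a (mset u))" by (simp add: add_mset_commute)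
    finally show ?thesis using u by auto
  qed
qed auto

definition yam :: "nat \<Rightarrow> nat list \<Rightarrow> bool" where
  "yam n w \<longleftrightarrow> (\<forall>i. 1 \<le> i \<and> i < n \<longrightarrow> weps i w = 0)"

lemma yam_Cons: "yam n (a # w) \<Longrightarrow> yam n w"
  unfolding yam_def by (auto split: if_splits)

lemma yam_wphi: "yam n w \<Longrightarrow> 1 \<le> i \<Longrightarrow> i < n \<Longrightarrow> int (wphi i w) = wtw i w"
  using wphi_weps[of i w] by (simp add: yam_def)

definition hwvec :: "nat \<Rightarrow> nat \<Rightarrow> nat list \<Rightarrow> wvec \<Rightarrow> bool" where
  "hwvec n N y h \<longleftrightarrow> h \<in> Lat n N \<and> (\<forall>w. h w \<noteq> 0 \<longrightarrow> mset w = mset y) \<and>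
     (\<forall>i. 1 \<le> i \<and> i < n \<longrightarrow> WE i h = 0) \<and> (\<forall>w. red h w = of_bool (w = y))"

text \<open>The residue of x is read in each adapted basis in turn: at a word with nonzero residue
  the coordinate is nonzero for every i, and e_i x = 0 leaves only words with \<epsilon>_i =
  0.\<close>

lemma hw_red_yam:
  assumes "x \<in> Lat n N" "\<And>i. 1 \<le> i \<Longrightarrow> i < n \<Longrightarrow> WE i x = 0" "red x w \<noteq> 0"
  shows "yam n w"
  unfolding yam_def
proof (intro allI impI)
  fix i assume i: "1 \<le> i \<and> i < n"
  interpret rank n i by unfold_locales (use i in auto)
  have "coord n N i x w \<noteq> 0" using coord_Lat(2)[OF assms(1), of i w] assms(3) by auto
  then show "weps i w = 0" using coord_WE_0[OF Lat_Wsp[OF assms(1)]] assms(2) i by blast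
qed

lemma mset_wtw: "mset v = mset w \<Longrightarrow> wtw i v = wtw i w"
  unfolding wtw_def by (metis count_mset)

text \<open>By \<open>bil_WF\<close> an f_i on the left becomes e_i applied to a multiple of k,
  which is zero.\<close>

lemma hw_orthogonal:
  assumes "\<And>i. 1 \<le> i \<Longrightarrow> i < n \<Longrightarrow> WE i k = 0" "\<And>i. 1 \<le> i \<Longrightarrow> i < n \<Longrightarrow> \<exists>m. wt k i m"
    and "bil n N h k = 0" "x \<in> Sub n h"
  shows "bil n N x k = 0"
  using assms(4)
proof induction
  case (Sub_WF x i)
  obtain m where "WK i k = sc (qvar powi m) k" using assms(2)[of i] Sub_WF unfolding wt_def by blast
  then have "WE i (WK i k) = 0" using assms(1)[of i] Sub_WF by simp
  then show ?case using bil_WF[of i n N x k] Sub_WF by (simp add: bil_linear)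
qed (simp_all add: bil_linear assms(3))

text \<open>Each f_i raises the letter sum by one, so in the submodule only the multiples of h
  contribute at the letter sum of y. \<open>sum_list\<close> serves as a height on words from here
  on.\<close>

lemma Sub_leading:
  assumes "\<And>w. h w \<noteq> 0 \<Longrightarrow> mset w = mset y" "x \<in> Sub n h"
  obtains c z where "x = sc c h + z" "\<And>w. z w \<noteq> 0 \<Longrightarrow> sum_list w > sum_list y"
proof -
  have "\<exists>c z. x = sc c h + z \<and> (\<forall>w. z w \<noteq> 0 \<longrightarrow> sum_list w > sum_list y)"
    using assms(2)
  proof induction
    case Sub_base
    then show ?case by (intro exI[of _ 1] exI[of _ 0]) (simp add: fun_apply)
  next
    case (Sub_add x x')
    then obtain c z c' z' where "x = sc c h + z" "\<forall>w. z w \<noteq> 0 \<longrightarrow> sum_list w > sum_list y"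
      "x' = sc c' h + z'" "\<forall>w. z' w \<noteq> 0 \<longrightarrow> sum_list w > sum_list y" by blast
    then show ?case
      by (intro exI[of _ "c + c'"] exI[of _ "z + z'"]) (auto simp: sc_add fun_apply add_ac, metis add.left_neutral)
  next
    case (Sub_sc x d)
    then obtain c z where "x = sc c h + z" "\<forall>w. z w \<noteq> 0 \<longrightarrow> sum_list w > sum_list y" by blast
    then show ?case
      by (intro exI[of _ "d * c"] exI[of _ "sc d z"]) (auto simp: sc_add fun_apply)
  next
    case (Sub_WF x i)
    then obtain c z where x: "x = sc c h + z" "\<forall>w. z w \<noteq> 0 \<longrightarrow> sum_list w > sum_list y" by blast
    have "sum_list w > sum_list y" if w: "WF i x w \<noteq> 0" for w
    proof -
      obtain v where v: "x v \<noteq> 0" "sum_list w = Suc (sum_list v)" using WF_sum_list[OF w] by blast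
      have "h v \<noteq> 0 \<or> z v \<noteq> 0" using v(1) x(1) by (auto simp: fun_apply)
      then have "sum_list v \<ge> sum_list y" using x(2) assms(1)[of v]
        by (metis less_imp_le order_refl sum_mset_sum_list)
      then show ?thesis using v by simp
    qed
    then show ?case by (intro exI[of _ 0] exI[of _ "WF i x"]) auto
  qed
  then show ?thesis using that by blast
qed

text \<open>On words with the content of y, x is a multiple of \<open>h y\<close>, whose residue is
  y alone. For a word w of another content, the highest weight vectors lifting the Yamanouchi words
  of that content are combined with the residues of x as coefficients. The result k is orthogonal to
  \<open>h y\<close>, hence to x; but at q = 0 the pairing of x and k is a sum of squares of
  residues of x, among them that at w.\<close>

lemma Sub_red_yam:
  assumes h: "\<And>y. y \<in> words n N \<Longrightarrow> yam n y \<Longrightarrow> hwvec n N y (h y)"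
    and y: "y \<in> words n N" "yam n y"
    and x: "x \<in> Sub n (h y)" "x \<in> Lat n N" "\<And>w. red x w \<noteq> 0 \<Longrightarrow> yam n w"
    and w: "red x w \<noteq> 0"
  shows "w = y"
proof -
  have wN: "w \<in> words n N" using w red_outside x(2) by blast
  have hy: "h y \<in> Lat n N" "\<And>w. h y w \<noteq> 0 \<Longrightarrow> mset w = mset y" "\<And>w. red (h y) w = of_bool (w = y)"
    using h[OF y] unfolding hwvec_def by blast+
  show ?thesis
  proof (cases "mset w = mset y")
    case True
    obtain c z where cz: "x = sc c (h y) + z" "\<And>w. z w \<noteq> 0 \<Longrightarrow> sum_list w > sum_list y"
      using Sub_leading[OF hy(2) x(1)] by blast
    have z: "z v = 0" if "mset v = mset y" for v
      using cz(2)[of v] that by (metis less_irrefl sum_mset_sum_list)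
    have r: "x v = c * h y v" if "mset v = mset y" for v using z[OF that] cz(1) by (simp add: fun_apply)
    have reg: "h y v \<in> regular_at_0" "x v \<in> regular_at_0" for v using hy(1) x(2) by (auto simp: Lat_def)
    have "ev0 (h y y) = 1" using hy(3)[of y] by (simp add: red_def)
    then have "h y y \<noteq> 0" "inverse (h y y) \<in> regular_at_0" using regular_inverse(1)[OF reg(1), of y] by auto
    moreover have "c = x y * inverse (h y y)" using r[of y] \<open>h y y \<noteq> 0\<close> by simp
    ultimately have "c \<in> regular_at_0" using reg by simp
    then have "red x w = ev0 c * red (h y) w" using r[OF True] reg by (simp add: red_def)
    then show ?thesis using w hy(3) by auto
  next
    case False
    let ?Y = "{v \<in> words n N. yam n v \<and> mset v = mset w}"
    define k where "k = (\<Sum>v\<in>?Y. sc (qconst (red x v)) (h v))"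
    have hY: "h v \<in> Lat n N" "\<And>u. h v u \<noteq> 0 \<Longrightarrow> mset u = mset v" "\<And>u. red (h v) u = of_bool (u = v)"
      "\<And>i. 1 \<le> i \<Longrightarrow> i < n \<Longrightarrow> WE i (h v) = 0" if "v \<in> ?Y" for v
      using h[of v] that unfolding hwvec_def by blast+
    have kL: "k \<in> Lat n N" unfolding k_def using hY(1) by (auto intro!: Lat_sum Lat_sc)
    have ks: "mset u = mset w" if "k u \<noteq> 0" for u
    proof -
      have "\<exists>v\<in>?Y. sc (qconst (red x v)) (h v) u \<noteq> 0"
        using that unfolding k_def sum_fun_apply by (meson sum.not_neutral_contains_not_neutral)
      then obtain v where v: "v \<in> ?Y" "h v u \<noteq> 0" by (auto simp: fun_apply)
      then show ?thesis using hY(2)[OF v] by simp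
    qed
    have kr: "red k u = (if u \<in> ?Y then red x u else 0)" for u
    proof -
      have "red k u = (\<Sum>v\<in>?Y. red x v * of_bool (u = v))"
        unfolding k_def by (subst red_sum[where n = n and N = N]) (use hY(1,3) in \<open>auto simp: red_simps(3)[where n = n and N = N] intro!: sum.cong Lat_sc\<close>)
      also have "\<dots> = (\<Sum>v\<in>?Y. if u = v then red x v else 0)" by (intro sum.cong) auto
      also have "\<dots> = (if u \<in> ?Y then red x u else 0)" by (subst sum.delta') auto
      finally show ?thesis .
    qed
    have kE: "WE i k = 0" if "1 \<le> i" "i < n" for i
      unfolding k_def using hY(4) that by (auto simp: WE_sum intro!: sum.neutral)
    have kW: "wt k i (wtw i w)" for i
      by (rule wt_support) (use ks mset_wtw in blast)
    have "bil n N (h y) k = 0" unfolding bil_def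
      using hy(2) ks False by (intro sum.neutral) (metis mult_zero_left mult_zero_right)
    then have "bil n N x k = 0" using hw_orthogonal[of n k N "h y" x] kE kW x(1) by blast
    then have "0 = ev0 (bil n N x k)" by simp
    also have "\<dots> = (\<Sum>u\<in>words n N. red x u * red k u)"
      unfolding bil_def red_def by (subst ev0_sum) (use x(2) kL in \<open>auto simp: Lat_def\<close>)
    also have "\<dots> > 0"
    proof (rule sum_pos2[of _ w])
      show "0 < red x w * red k w" using w wN x(3)[OF w] by (auto simp: kr zero_less_mult_iff linorder_neq_iff)
    qed (use wN in \<open>auto simp: kr zero_le_mult_iff\<close>)
    finally show ?thesis by simp
  qed
qed

subsection \<open>Existence of highest weight vectors\<close>

text \<open>\<open>H\<close> is the highest weight vector with leading term \<open>h y\<close>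
  \<otimes> v_a. Its residue is not computed from the coefficients: it is scaled to a primitive
  \<open>X\<close>, each slice of \<open>X\<close> lies in the submodule generated by
  \<open>h y\<close> and has Yamanouchi residues, so by \<open>Sub_red_yam\<close> only words
  \<open>b # y\<close> survive, and their content leaves \<open>a # y\<close>.\<close>

lemma hwvec_step:
  assumes h: "\<And>y. y \<in> words n N \<Longrightarrow> yam n y \<Longrightarrow> hwvec n N y (h y)"
    and y: "a # y \<in> words n (Suc N)" "yam n (a # y)"
  shows "\<exists>k. hwvec n (Suc N) (a # y) k"
proof -
  have yN: "y \<in> words n N" "yam n y" "1 \<le> a" "a \<le> n" using y yam_Cons by auto
  define g where "g = h y"
  have g: "g \<in> Lat n N" "\<And>w. g w \<noteq> 0 \<Longrightarrow> mset w = mset y" "\<And>w. red g w = of_bool (w = y)"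
    "\<And>i. 1 \<le> i \<Longrightarrow> i < n \<Longrightarrow> WE i g = 0"
    using h[OF yN(1,2)] unfolding hwvec_def g_def by blast+
  define \<mu> where "\<mu> i = wphi i y" for i
  have gw: "wt g i (int (\<mu> i))" if "1 \<le> i" "i < n" for i
    unfolding \<mu>_def yam_wphi[OF yN(2) that] by (rule wt_support) (use g(2) mset_wtw in blast)
  \<comment> \<open>As \<open>a # y\<close> is Yamanouchi, its first letter a is cancelled by a free
    a - 1 in y. This keeps the q-integers in the denominators of \<open>cf\<close> nonzero.\<close>
  have mu: "\<mu> (a - 1) > 0" if "a > 1"
  proof (rule ccontr)
    assume "\<not> \<mu> (a - 1) > 0"
    moreover have "1 \<le> a - 1 \<and> a - 1 < n" using yN(4) that by auto
    then have "weps (a - 1) (a # y) = 0" using y(2) unfolding yam_def by blast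
    ultimately show False using that by (simp add: \<mu>_def)
  qed
  \<comment> \<open>The factors are forced by the highest weight condition: e_i takes the summand
    with last letter i + 1 to \<open>G (d - 1)\<close> \<otimes> v_i with d = a - i, and q^-1 times
    e_i \<open>G d\<close> has to cancel this.\<close>
  define cf where "cf d = (\<Prod>k<d. - qvar / qint (shift \<mu> a k + \<mu> (a - Suc k)))" for d
  define G where "G d = sc (cf d) (lower \<mu> a d g)" for d
  define H where "H = (\<Sum>d<a. ten (a - d) (G d))"
  have shift_pos: "shift \<mu> a k + \<mu> (a - Suc k) > 0" if "Suc k < a" for k
    using mu that by (cases k) auto
  have GE: "WE i (G d) = (if i = a - d \<and> d > 0 then sc (- qvar) (G (d - 1)) else 0)" if "1 \<le> i" "i < n" "d < a" for i d
  proof (cases "i < a - d \<or> i \<ge> a")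
    case True
    then show ?thesis using lower_WE[OF that(3) True, of \<mu> g] g(4) that by (auto simp: G_def)
  next
    case False
    have A: "d < a" "\<And>i. a - d \<le> i \<Longrightarrow> i < a \<Longrightarrow> WE i g = 0" "\<And>i. a - d < i \<Longrightarrow> i < a \<Longrightarrow> wt g i (int (\<mu> i))"
      using that yN g(4) gw by auto
    show ?thesis
    proof (cases "i = a - d")
      case i: True
      then obtain e where e: "d = Suc e" using False by (cases d) auto
      have s: "qint (shift \<mu> a e + \<mu> (a - Suc e)) \<noteq> 0" using shift_pos[of e] e that by simp
      have "WE i (lower \<mu> a d g) = sc (qint (shift \<mu> a (d - 1) + \<mu> (a - d))) (lower \<mu> a (d - 1) g)"
        unfolding i by (rule lower_main(1)[OF A]) (use e gw that i in auto)
      moreover have "cf d = cf e * (- qvar / qint (shift \<mu> a e + \<mu> (a - Suc e)))" by (simp add: cf_def e mult.commute)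
      ultimately show ?thesis using i e s by (simp add: G_def mult_ac)
    next
      case ni: False
      have "WE i (lower \<mu> a d g) = 0" by (rule lower_main(2)[OF A]) (use ni False in auto)
      then show ?thesis using ni by (simp add: G_def)
    qed
  qed
  have HE: "WE i H = 0" if i: "1 \<le> i" "i < n" for i
  proof -
    have "WE i H = (\<Sum>d<a. sc (qvar powi (- wtw i [a - d])) (ten (a - d) (WE i (G d))) + (if a - d = Suc i then ten i (G d) else 0))"
      unfolding H_def by (simp add: WE_sum WE_ten)
    also have "\<dots> = (\<Sum>d<a. (if d = a - i \<and> i < a then sc (inverse qvar) (ten i (sc (- qvar) (G (d - 1)))) else 0)) + (\<Sum>d<a. if d = a - Suc i \<and> i < a then ten i (G d) else 0)"
      unfolding sum.distrib
    proof (intro arg_cong2[where f = "(+)"] sum.cong refl)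
      fix d assume d: "d \<in> {..<a}"
      show "sc (qvar powi (- wtw i [a - d])) (ten (a - d) (WE i (G d))) = (if d = a - i \<and> i < a then sc (inverse qvar) (ten i (sc (- qvar) (G (d - 1)))) else 0)"
      proof (cases "d = a - i \<and> i < a")
        case True
        then have "i = a - d" "d > 0" by auto
        then show ?thesis using True GE[OF i, of d] d by (simp add: wtw_single power_int_minus)
      next
        case False
        then have "WE i (G d) = 0" using GE[OF i, of d] d by auto
        then show ?thesis unfolding if_not_P[OF False] by (simp add: ten_linear)
      qed
      show "(if a - d = Suc i then ten i (G d) else 0) = (if d = a - Suc i \<and> i < a then ten i (G d) else 0)"
        using d by auto
    qed
    also have "\<dots> = 0"
    proof (cases "i < a")
      case True
      have "(\<Sum>d<a. (if d = a - i \<and> i < a then sc (inverse qvar) (ten i (sc (- qvar) (G (d - 1)))) else 0)) = sc (inverse qvar) (ten i (sc (- qvar) (G (a - i - 1))))"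
        using True i by (simp add: sum.delta)
      moreover have "(\<Sum>d<a. if d = a - Suc i \<and> i < a then ten i (G d) else 0) = ten i (G (a - Suc i))"
        using True i by (simp add: sum.delta)
      ultimately show ?thesis by (simp add: ten_linear fun_eq_iff fun_apply)
    qed simp
    finally show ?thesis .
  qed
  have gN: "g \<in> Wsp n N" using g(1) Lat_Wsp by blast
  have Hsl: "sl b H = (if 1 \<le> b \<and> b \<le> a then G (a - b) else 0)" for b
  proof -
    have "sl b H = (\<Sum>d<a. if d = a - b \<and> 1 \<le> b \<and> b \<le> a then G d else 0)"
      unfolding H_def sl_def
      by (rule ext) (auto simp: sum_fun_apply fun_apply intro!: sum.cong)
    then show ?thesis by (auto simp: sum.delta)
  qed
  have Hms: "mset w = mset (a # y)" if w: "H w \<noteq> 0" for w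
  proof (cases w)
    case Nil
    then show ?thesis using w by (simp add: H_def sum_fun_apply)
  next
    case (Cons b u)
    then have "sl b H u \<noteq> 0" using w by (simp add: sl_def)
    then have b: "1 \<le> b" "b \<le> a" "lower \<mu> a (a - b) g u \<noteq> 0" by (auto simp: Hsl G_def fun_apply split: if_splits)
    from lower_mset[OF _ b(3)] b obtain v where "g v \<noteq> 0" "add_mset b (mset u) = add_mset a (mset v)" by auto
    then show ?thesis using g(2) Cons by simp
  qed
  have HW: "H \<in> Wsp n (Suc N)"
    using Hms words_mset[of _ "a # y" n "Suc N"] y(1) by (auto simp: Wsp_def)
  have "H (a # y) \<noteq> 0"
  proof -
    have "H (a # y) = sl a H y" by (simp add: sl_def)
    also have "\<dots> = g y" using yN by (simp add: Hsl G_def cf_def)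
    also have "\<dots> \<noteq> 0" using g(3)[of y] by (auto simp: red_def)
    finally show ?thesis .
  qed
  then have "\<exists>w\<in>words n (Suc N). H w \<noteq> 0" using y(1) by blast
  from q_scaling[OF finite_words this] obtain k :: int where
    k: "\<And>w. w \<in> words n (Suc N) \<Longrightarrow> qvar powi k * H w \<in> regular_at_0" "\<exists>w\<in>words n (Suc N). ev0 (qvar powi k * H w) \<noteq> 0" by blast
  define X where "X = sc (qvar powi k) H"
  have XL: "X \<in> Lat n (Suc N)" using HW k(1) Wsp_outside[OF HW] by (auto simp: Lat_def X_def fun_apply) (metis mult_zero_right regular_0)
  have XE: "WE i X = 0" if "1 \<le> i" "i < n" for i using HE that by (simp add: X_def)
  have Xm: "mset w = mset (a # y)" if "X w \<noteq> 0" for w using that Hms by (auto simp: X_def fun_apply)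
  have only: "w = a # y" if w: "red X w \<noteq> 0" for w
  proof (cases w)
    case Nil
    then show ?thesis using w Xm[of w] by (auto simp: red_def) (metis ev0_0 w red_def list.size(3) nat.distinct(1) length_Cons size_mset)
  next
    case (Cons b u)
    have Xw: "X w \<noteq> 0" using w by (auto simp: red_def)
    have "u = y"
    proof (rule Sub_red_yam[OF h yN(1,2), of "sl b X" u])
      have "sl b X = sc (qvar powi k) (if 1 \<le> b \<and> b \<le> a then G (a - b) else 0)" by (simp add: X_def Hsl)
      moreover have "G (a - b) \<in> Sub n (h y)" if "1 \<le> b" "b \<le> a" unfolding G_def g_def
        by (rule Sub_sc, rule lower_Sub) (use that yN in \<open>auto intro: Sub_base\<close>)
      moreover have "sc 0 (h y) \<in> Sub n (h y)" by (intro Sub_sc Sub_base)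
      then have "0 \<in> Sub n (h y)" by simp
      ultimately show "sl b X \<in> Sub n (h y)" by (auto intro!: Sub_sc)

      have "v \<in> words n N" if "X (b # v) \<noteq> 0" for v
        using WspD[OF Lat_Wsp[OF XL] that] by simp
      then show "sl b X \<in> Lat n N" using XL by (auto simp: Lat_def Wsp_def sl_def)
      show "yam n v" if "red (sl b X) v \<noteq> 0" for v
        using hw_red_yam[OF XL XE, of "b # v"] that yam_Cons by (auto simp: red_def sl_def)
      show "red (sl b X) u \<noteq> 0" using w Cons by (simp add: red_def sl_def)
    qed
    then show ?thesis using Xm[OF Xw] Cons by simp
  qed
  obtain w where "w \<in> words n (Suc N)" "ev0 (qvar powi k * H w) \<noteq> 0" using k(2) by blast
  then have r: "red X (a # y) \<noteq> 0" using only[of w] by (auto simp: red_def X_def fun_apply)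
  have "hwvec n (Suc N) (a # y) (sc (qconst (1 / red X (a # y))) X)"
    unfolding hwvec_def
  proof (intro conjI allI impI)
    show "red (sc (qconst (1 / red X (a # y))) X) w = of_bool (w = a # y)" for w
    proof (cases "w = a # y")
      case True
      then show ?thesis unfolding red_simps(3)[OF XL regular_qconst] using r by simp
    next
      case False
      then have "red X w = 0" using only by blast
      then show ?thesis unfolding red_simps(3)[OF XL regular_qconst] using False by simp
    qed
    show "mset w = mset (a # y)" if "sc (qconst (1 / red X (a # y))) X w \<noteq> 0" for w
      using Xm[of w] that by (auto simp: fun_apply)
  qed (use XL XE in auto)
  then show ?thesis by blast
qed

lemma hwvec_exists: "y \<in> words n N \<Longrightarrow> yam n y \<Longrightarrow> \<exists>h. hwvec n N y h"
proof (induction N arbitrary: y)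
  case 0
  have "hwvec n 0 [] (\<lambda>w. of_bool (w = []))"
    by (auto simp: hwvec_def Lat_def Wsp_def red_def intro!: wvec_eqI simp: WE_Cons fun_apply)
  then show ?case using 0 by auto
next
  case (Suc N)
  then have "\<exists>h. \<forall>y\<in>words n N. yam n y \<longrightarrow> hwvec n N y (h y)" by metis
  then obtain h where h: "\<And>y. y \<in> words n N \<Longrightarrow> yam n y \<Longrightarrow> hwvec n N y (h y)" by blast
  obtain a v where "y = a # v" using Suc.prems(1) by (auto elim: words_Suc_cases)
  then show ?case using hwvec_step[OF h] Suc.prems by blast
qed

section \<open>Embedding an irreducible module in a tensor power\<close>

text \<open>The graph of the intended homomorphism from M to the tensor power, generated by the pair
  (v, h). As a relation it can be studied before it is known to be single-valued
  (\<open>X_0_zero\<close>) and defined everywhere (\<open>X_ex\<close>).\<close>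

inductive mgraph :: "nat \<Rightarrow> 'v::ab_group_add uq_rep \<Rightarrow> 'v \<Rightarrow> wvec \<Rightarrow> 'v \<Rightarrow> wvec \<Rightarrow> bool"
  for n M v h where
  mg_base: "mgraph n M v h v h"
| mg_add: "mgraph n M v h x z \<Longrightarrow> mgraph n M v h x' z' \<Longrightarrow> mgraph n M v h (x + x') (z + z')"
| mg_sc: "mgraph n M v h x z \<Longrightarrow> mgraph n M v h (smult M c x) (sc c z)"
| mg_F: "mgraph n M v h x z \<Longrightarrow> 1 \<le> i \<Longrightarrow> i < n \<Longrightarrow> mgraph n M v h (opF M i x) (WF i z)"

text \<open>Pairing with the sum of all positive coroots, whose coefficients in the simple coroots
  are i (n - i); every simple root has height 2.\<close>

definition height :: "nat \<Rightarrow> (nat \<Rightarrow> int) \<Rightarrow> int" where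
  "height n \<mu> = (\<Sum>i\<in>{1..<n}. int i * (int n - int i) * \<mu> i)"

lemma height_cartan:
  assumes "1 \<le> j" "j < n"
  shows "height n (\<lambda>i. \<mu> i - cartan i j) = height n \<mu> - 2"
proof -
  let ?g = "\<lambda>i. int i * (int n - int i)"
  have "(\<Sum>i\<in>{1..<n}. ?g i * cartan i j) =
    (\<Sum>i\<in>{1..<n}. (if i = j then 2 * ?g i else 0)) - (\<Sum>i\<in>{1..<n}. (if i = Suc j then ?g i else 0)) - (\<Sum>i\<in>{1..<n}. (if i = j - 1 then ?g i else 0))"
    unfolding sum_subtractf[symmetric] using assms by (intro sum.cong) (auto simp: cartan_def)
  also have "\<dots> = 2 * ?g j - ?g (Suc j) - ?g (j - 1)"
    using assms by (auto simp: sum.delta not_less) (cases "Suc j = n"; cases "j = 1"; auto)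
  also have "\<dots> = 2" using assms by (simp add: of_nat_diff algebra_simps)
  finally show ?thesis unfolding height_def by (simp add: right_diff_distrib sum_subtractf)
qed

locale irrep =
  fixes n N :: nat and M :: "'v::ab_group_add uq_rep" and lam :: "nat \<Rightarrow> nat" and y :: "nat list" and v :: 'v and h :: wvec
  assumes irr: "irreducible_of_highest_weight n M lam"
    and v: "v \<noteq> 0" "v \<in> weight_space n M (\<lambda>i. int (lam i))" "\<forall>i\<in>{1..<n}. opE M i v = 0"
    and y: "y \<in> words n N" "yam n y" "\<forall>i\<in>{1..<n}. wtw i y = int (lam i)"
    and h: "hwvec n N y h"
begin

lemma rep: "uq_sl_rep n M"
  using irr by (simp add: irreducible_of_highest_weight_def)

sublocale vs: vector_space "smult M"
  using rep by (simp add: uq_sl_rep_def)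

lemma ops_linear:
  assumes "1 \<le> i" "i < n"
  shows "opE M i (x + x') = opE M i x + opE M i x'" "opE M i (smult M c x) = smult M c (opE M i x)"
    "opF M i (x + x') = opF M i x + opF M i x'" "opF M i (smult M c x) = smult M c (opF M i x)"
    "opK M i (x + x') = opK M i x + opK M i x'" "opK M i (smult M c x) = smult M c (opK M i x)"
    "opKinv M i (x + x') = opKinv M i x + opKinv M i x'" "opKinv M i (smult M c x) = smult M c (opKinv M i x)"
proof -
  have "i \<in> {1..<n}" using assms by simp
  then have "\<forall>X\<in>{opE M i, opF M i, opK M i, opKinv M i}. Vector_Spaces.linear (smult M) (smult M) X"
    using rep unfolding uq_sl_rep_def by blast
  then have "Vector_Spaces.linear (smult M) (smult M) (opE M i)" "Vector_Spaces.linear (smult M) (smult M) (opF M i)"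
    "Vector_Spaces.linear (smult M) (smult M) (opK M i)" "Vector_Spaces.linear (smult M) (smult M) (opKinv M i)" by blast+
  then show "opE M i (x + x') = opE M i x + opE M i x'" "opE M i (smult M c x) = smult M c (opE M i x)"
    "opF M i (x + x') = opF M i x + opF M i x'" "opF M i (smult M c x) = smult M c (opF M i x)"
    "opK M i (x + x') = opK M i x + opK M i x'" "opK M i (smult M c x) = smult M c (opK M i x)"
    "opKinv M i (x + x') = opKinv M i x + opKinv M i x'" "opKinv M i (smult M c x) = smult M c (opKinv M i x)"
    unfolding Vector_Spaces.linear_iff by blast+
qed

lemma ops_zero:
  assumes "1 \<le> i" "i < n"
  shows "opE M i 0 = 0" "opF M i 0 = 0" "opK M i 0 = 0"
  using ops_linear(2,4,6)[OF assms, of 0 0] by simp_all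

lemma K_inv: "1 \<le> i \<Longrightarrow> i < n \<Longrightarrow> opK M i (opKinv M i x) = x" "1 \<le> i \<Longrightarrow> i < n \<Longrightarrow> opKinv M i (opK M i x) = x"
  using rep by (auto simp: uq_sl_rep_def)

lemma rels:
  assumes "1 \<le> i" "i < n" "1 \<le> j" "j < n"
  shows "opK M i (opK M j x) = opK M j (opK M i x)"
    "opK M i (opE M j x) = smult M (qvar powi cartan i j) (opE M j (opK M i x))"
    "opK M i (opF M j x) = smult M (qvar powi (- cartan i j)) (opF M j (opK M i x))"
    "opE M i (opF M j x) = opF M j (opE M i x) +
      (if i = j then smult M (inverse (qvar - inverse qvar)) (opK M i x - opKinv M i x) else 0)"
proof -
  have ij: "i \<in> {1..<n}" "j \<in> {1..<n}" using assms by auto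
  have A: "\<forall>v. opK M i (opK M j v) = opK M j (opK M i v) \<and>
        opK M i (opE M j v) = smult M (qvar powi cartan i j) (opE M j (opK M i v)) \<and>
        opK M i (opF M j v) = smult M (qvar powi (- cartan i j)) (opF M j (opK M i v)) \<and>
        opE M i (opF M j v) - opF M j (opE M i v) =
          (if i = j then smult M (inverse (qvar - inverse qvar)) (opK M i v - opKinv M i v) else 0)"
    using rep ij unfolding uq_sl_rep_def by blast
  then show "opK M i (opK M j x) = opK M j (opK M i x)"
    "opK M i (opE M j x) = smult M (qvar powi cartan i j) (opE M j (opK M i x))"
    "opK M i (opF M j x) = smult M (qvar powi (- cartan i j)) (opF M j (opK M i x))" by blast+
  have "opE M i (opF M j x) - opF M j (opE M i x) =
          (if i = j then smult M (inverse (qvar - inverse qvar)) (opK M i x - opKinv M i x) else 0)" using A by blast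
  then show "opE M i (opF M j x) = opF M j (opE M i x) +
      (if i = j then smult M (inverse (qvar - inverse qvar)) (opK M i x - opKinv M i x) else 0)"
    by (simp add: algebra_simps)
qed

lemma hL: "h \<in> Lat n N" "h \<in> Wsp n N" and hms: "h w \<noteq> 0 \<Longrightarrow> mset w = mset y"
  and hE: "1 \<le> i \<Longrightarrow> i < n \<Longrightarrow> WE i h = 0" and hred: "red h w = of_bool (w = y)"
  using h Lat_Wsp unfolding hwvec_def by blast+

lemma h_wt: "1 \<le> i \<Longrightarrow> i < n \<Longrightarrow> wt h i (int (lam i))"
  using y(3) by (intro wt_support) (metis atLeastLessThan_iff hms mset_wtw)

lemma h_nonzero: "h \<noteq> 0"
  using hred[of y] by (auto simp: red_def fun_apply)

section \<open>Weight spaces of the module\<close>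

lemma weight_spaceI: "(\<And>i. 1 \<le> i \<Longrightarrow> i < n \<Longrightarrow> opK M i x = smult M (qvar powi \<mu> i) x) \<Longrightarrow> x \<in> weight_space n M \<mu>"
  by (simp add: weight_space_def)

lemma weight_spaceD: "x \<in> weight_space n M \<mu> \<Longrightarrow> 1 \<le> i \<Longrightarrow> i < n \<Longrightarrow> opK M i x = smult M (qvar powi \<mu> i) x"
  by (simp add: weight_space_def)

lemma weight_space_linear:
  "x \<in> weight_space n M \<mu> \<Longrightarrow> x' \<in> weight_space n M \<mu> \<Longrightarrow> x + x' \<in> weight_space n M \<mu>"
  "x \<in> weight_space n M \<mu> \<Longrightarrow> smult M c x \<in> weight_space n M \<mu>"
  "0 \<in> weight_space n M \<mu>"
  by (auto simp: weight_space_def ops_linear ops_zero vs.scale_right_distrib vs.scale_left_commute)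

lemma weight_space_F:
  "x \<in> weight_space n M \<mu> \<Longrightarrow> 1 \<le> j \<Longrightarrow> j < n \<Longrightarrow> opF M j x \<in> weight_space n M (\<lambda>i. \<mu> i - cartan i j)"
  by (intro weight_spaceI) (simp add: rels weight_spaceD ops_linear power_int_diff power_int_minus divide_inverse mult.commute)

lemma weight_space_E:
  "x \<in> weight_space n M \<mu> \<Longrightarrow> 1 \<le> j \<Longrightarrow> j < n \<Longrightarrow> opE M j x \<in> weight_space n M (\<lambda>i. \<mu> i + cartan i j)"
  by (intro weight_spaceI) (simp add: rels weight_spaceD ops_linear power_int_add mult.commute)

lemma Kinv_weight: "x \<in> weight_space n M \<mu> \<Longrightarrow> 1 \<le> i \<Longrightarrow> i < n \<Longrightarrow> opKinv M i x = smult M (qvar powi (- \<mu> i)) x"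
proof -
  assume a: "x \<in> weight_space n M \<mu>" "1 \<le> i" "i < n"
  have "opK M i (smult M (qvar powi (- \<mu> i)) x) = x"
    using a by (simp add: ops_linear weight_spaceD power_int_minus)
  then show ?thesis using K_inv(2)[OF a(2,3)] by metis
qed

text \<open>At an index i where \<nu> and \<mu> differ, K_i - q^(\<nu> i) kills the summand of \<nu>
  and rescales the others, that of \<mu> by a nonzero factor. Such an index exists in {1..<n}
  because all weights in P vanish elsewhere; without this, distinct functions could name the same
  weight space.\<close>

lemma weight_independent:
  assumes "finite P" "\<And>\<mu>. \<mu> \<in> P \<Longrightarrow> f \<mu> \<in> weight_space n M \<mu>"
    and "\<And>\<mu> i. \<mu> \<in> P \<Longrightarrow> i \<notin> {1..<n} \<Longrightarrow> \<mu> i = 0" and "sum f P = 0" "\<mu> \<in> P"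
  shows "f \<mu> = 0"
  using assms
proof (induction "card P" arbitrary: P f \<mu> rule: less_induct)
  case less
  show ?case
  proof (cases "\<exists>\<nu>\<in>P. \<nu> \<noteq> \<mu>")
    case False
    then have "P = {\<mu>}" using less.prems by blast
    then show ?thesis using less.prems by simp
  next
    case True
    then obtain \<nu> where nu: "\<nu> \<in> P" "\<nu> \<noteq> \<mu>" by blast
    then obtain i where "\<nu> i \<noteq> \<mu> i" by blast
    then have i: "\<nu> i \<noteq> \<mu> i" "1 \<le> i" "i < n" using less.prems(3)[OF nu(1), of i] less.prems(3)[OF less.prems(5), of i] by (metis atLeastLessThan_iff)+
    define g where "g \<kappa> = smult M (qvar powi \<kappa> i - qvar powi \<nu> i) (f \<kappa>)" for \<kappa>
    have Ksum: "opK M i (sum f Q) = (\<Sum>\<kappa>\<in>Q. opK M i (f \<kappa>))" for Q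
      by (induction Q rule: infinite_finite_induct) (auto simp: ops_linear[OF i(2,3)] ops_zero[OF i(2,3)])
    have "sum g P = (\<Sum>\<kappa>\<in>P. opK M i (f \<kappa>)) - smult M (qvar powi \<nu> i) (sum f P)"
      unfolding g_def vs.scale_left_diff_distrib vs.scale_sum_right sum_subtractf
      by (intro arg_cong2[where f = "(-)"] sum.cong refl) (simp add: weight_spaceD[OF less.prems(2) i(2,3)])
    also have "\<dots> = 0" using Ksum[of P] less.prems(4) by (simp add: ops_zero[OF i(2,3)])
    finally have 1: "sum g (P - {\<nu>}) = 0"
      using less.prems(1) nu(1) by (simp add: sum.remove g_def)
    have "g \<mu> = 0"
    proof (rule less.hyps[of "P - {\<nu>}"])
      show "card (P - {\<nu>}) < card P" using less.prems(1) nu(1) by (intro psubset_card_mono) auto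
    qed (use less.prems nu 1 in \<open>auto simp: g_def intro!: weight_space_linear\<close>)
    then show ?thesis unfolding g_def using i(1) powi_inj by fastforce
  qed
qed

text \<open>The part of M below the highest weight. By \<open>v_not_Low\<close> the coefficient of v
  modulo this part is well determined.\<close>

inductive_set Low :: "'v set" where
  Low_0: "0 \<in> Low"
| Low_add: "x \<in> Low \<Longrightarrow> x' \<in> Low \<Longrightarrow> x + x' \<in> Low"
| Low_wt: "x \<in> weight_space n M \<mu> \<Longrightarrow> height n \<mu> < height n (\<lambda>i. int (lam i)) \<Longrightarrow> x \<in> Low"

lemma Low_smult: "x \<in> Low \<Longrightarrow> smult M c x \<in> Low"
proof (induction rule: Low.induct)
  case (Low_add x x')
  then show ?case by (simp add: vs.scale_right_distrib Low.Low_add)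
next
  case (Low_wt x \<mu>)
  then show ?case using weight_space_linear(2) Low.Low_wt by blast
qed (simp add: Low_0)

lemma Low_F: "x \<in> Low \<Longrightarrow> 1 \<le> i \<Longrightarrow> i < n \<Longrightarrow> opF M i x \<in> Low"
proof (induction rule: Low.induct)
  case (Low_add x x')
  then show ?case by (simp add: ops_linear Low.Low_add)
next
  case (Low_wt x \<mu>)
  then show ?case using weight_space_F[of x \<mu> i] height_cartan[of i n \<mu>] Low.Low_wt[of "opF M i x" "\<lambda>j. \<mu> j - cartan j i"] by simp
qed (simp add: Low_0 ops_zero)

lemma Low_decomp:
  assumes "x \<in> Low"
  shows "\<exists>P f. finite P \<and> (\<forall>\<mu>\<in>P. (\<forall>i. i \<notin> {1..<n} \<longrightarrow> \<mu> i = 0) \<and> height n \<mu> < height n (\<lambda>i. int (lam i)) \<and>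
     f \<mu> \<in> weight_space n M \<mu>) \<and> x = sum f P"
  using assms
proof (induction rule: Low.induct)
  case Low_0
  then show ?case by (intro exI[of _ "{}"]) auto
next
  case (Low_add x x')
  then obtain P f P' f' where P: "finite P" "\<forall>\<mu>\<in>P. (\<forall>i. i \<notin> {1..<n} \<longrightarrow> \<mu> i = 0) \<and> height n \<mu> < height n (\<lambda>i. int (lam i)) \<and>
     f \<mu> \<in> weight_space n M \<mu>" "x = sum f P" 
    and P': "finite P'" "\<forall>\<mu>\<in>P'. (\<forall>i. i \<notin> {1..<n} \<longrightarrow> \<mu> i = 0) \<and> height n \<mu> < height n (\<lambda>i. int (lam i)) \<and>
     f' \<mu> \<in> weight_space n M \<mu>" "x' = sum f' P'" by blast
  define g where "g \<mu> = (if \<mu> \<in> P then f \<mu> else 0) + (if \<mu> \<in> P' then f' \<mu> else 0)" for \<mu>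
  have "sum g (P \<union> P') = (\<Sum>\<mu>\<in>P \<union> P'. if \<mu> \<in> P then f \<mu> else 0) + (\<Sum>\<mu>\<in>P \<union> P'. if \<mu> \<in> P' then f' \<mu> else 0)"
    unfolding g_def by (rule sum.distrib)
  also have "(\<Sum>\<mu>\<in>P \<union> P'. if \<mu> \<in> P then f \<mu> else 0) = sum f P"
    using P(1) P'(1) by (intro sum.mono_neutral_cong_right) auto
  also have "(\<Sum>\<mu>\<in>P \<union> P'. if \<mu> \<in> P' then f' \<mu> else 0) = sum f' P'"
    using P(1) P'(1) by (intro sum.mono_neutral_cong_right) auto
  finally have "x + x' = sum g (P \<union> P')" using P P' by simp
  moreover have "g \<mu> \<in> weight_space n M \<mu>" if "\<mu> \<in> P \<union> P'" for \<mu>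
    unfolding g_def using P(2) P'(2) by (intro weight_space_linear(1)) (auto intro: weight_space_linear(3))
  ultimately show ?case using P P' by (intro exI[of _ "P \<union> P'"] exI[of _ g]) auto
next
  case (Low_wt x \<mu>)
  let ?m = "\<lambda>i. if i \<in> {1..<n} then \<mu> i else 0"
  have "x \<in> weight_space n M ?m" using Low_wt by (simp add: weight_space_def)
  moreover have "height n ?m = height n \<mu>" by (simp add: height_def)
  ultimately show ?case using Low_wt by (intro exI[of _ "{?m}"] exI[of _ "\<lambda>_. x"]) auto
qed

lemma v_not_Low: "v \<notin> Low"
proof
  assume "v \<in> Low"
  from Low_decomp[OF this] obtain P f where P: "finite P" "\<And>\<mu> i. \<mu> \<in> P \<Longrightarrow> i \<notin> {1..<n} \<Longrightarrow> \<mu> i = 0"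
    "\<And>\<mu>. \<mu> \<in> P \<Longrightarrow> height n \<mu> < height n (\<lambda>i. int (lam i))" "\<And>\<mu>. \<mu> \<in> P \<Longrightarrow> f \<mu> \<in> weight_space n M \<mu>" "v = sum f P" by blast
  let ?l = "\<lambda>i. if i \<in> {1..<n} then int (lam i) else 0"
  have hl: "height n ?l = height n (\<lambda>i. int (lam i))" by (simp add: height_def)
  have l: "?l \<notin> P" using P(3)[of ?l] unfolding hl by auto
  have "x \<in> weight_space n M (\<lambda>i. int (lam i)) \<Longrightarrow> x \<in> weight_space n M ?l" for x by (simp add: weight_space_def)
  from this[OF weight_space_linear(2)[OF v(2)]] have vl: "smult M (-1) v \<in> weight_space n M ?l" .
  define g where "g = f(?l := smult M (-1) v)"
  have gP: "sum g P = sum f P" unfolding g_def using l by (intro sum.cong) auto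
  have "g ?l = 0"
  proof (rule weight_independent[of "insert ?l P" g])
    have "sum g (insert ?l P) = g ?l + sum g P" by (rule sum.insert[OF P(1) l])
    then show "sum g (insert ?l P) = 0" using P(5) gP by (simp add: g_def)
    show "g \<mu> \<in> weight_space n M \<mu>" if "\<mu> \<in> insert ?l P" for \<mu>
    proof (cases "\<mu> = ?l")
      case True
      then show ?thesis using vl by (simp only: g_def fun_upd_same)
    next
      case False
      then have "\<mu> \<in> P" using that by blast
      have "g \<mu> = f \<mu>" unfolding g_def fun_upd_apply by (rule if_not_P[OF False])
      then show ?thesis using P(4) \<open>\<mu> \<in> P\<close> by simp
    qed
    show "\<mu> i = 0" if "\<mu> \<in> insert ?l P" "i \<notin> {1..<n}" for \<mu> i
      using that P(2) by auto
  qed (use P in auto)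
  then show False using v(1) by (simp add: g_def)
qed

section \<open>The graph is that of an injective homomorphism\<close>

abbreviation X where "X \<equiv> mgraph n M v h"

lemma X_Sub: "X x z \<Longrightarrow> z \<in> Sub n h"
  by (induction rule: mgraph.induct) (auto intro: Sub.intros)

lemma Sub_Wsp: "z \<in> Sub n h \<Longrightarrow> z \<in> Wsp n N"
proof (induction rule: Sub.induct)
  case (Sub_WF x i)
  then interpret rank n i by unfold_locales
  show ?case using Sub_WF by simp
qed (use hL in auto)

lemma X_0: "X 0 0"
  using mg_sc[OF mg_base, of n M v h 0] by simp

lemma X_K: "X x z \<Longrightarrow> 1 \<le> i \<Longrightarrow> i < n \<Longrightarrow> X (opK M i x) (WK i z)"
proof (induction rule: mgraph.induct)
  case mg_base
  then show ?case using h_wt[of i] weight_spaceD[OF v(2), of i] mgraph.mg_sc[OF mgraph.mg_base] by (simp add: wt_def)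
next
  case (mg_F x z j)
  then show ?case by (simp add: rels WK_WF mgraph.mg_sc mgraph.mg_F)
qed (auto simp: ops_linear intro: mgraph.intros)

lemma Kinv_F:
  assumes "1 \<le> i" "i < n" "1 \<le> j" "j < n"
  shows "opKinv M i (opF M j x) = smult M (qvar powi cartan i j) (opF M j (opKinv M i x))"
proof -
  have "opK M i (smult M (qvar powi cartan i j) (opF M j (opKinv M i x))) = opF M j x"
    using assms by (simp add: rels ops_linear K_inv power_int_minus)
  then show ?thesis using K_inv(2)[OF assms(1,2)] by metis
qed

lemma X_Kinv: "X x z \<Longrightarrow> 1 \<le> i \<Longrightarrow> i < n \<Longrightarrow> X (opKinv M i x) (WKi i z)"
proof (induction rule: mgraph.induct)
  case mg_base
  then show ?case using wt_WKi[OF h_wt[of i]] Kinv_weight[OF v(2), of i] mgraph.mg_sc[OF mgraph.mg_base] by simp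
next
  case (mg_F x z j)
  then show ?case by (simp add: Kinv_F WKi_WF mgraph.mg_sc mgraph.mg_F)
qed (auto simp: ops_linear intro: mgraph.intros)

lemma X_diff: "X x z \<Longrightarrow> X x' z' \<Longrightarrow> X (x - x') (z - z')"
  using mg_add[of n M v h x z "smult M (-1) x'" "sc (-1) z'"] mg_sc[of n M v h x' z' "-1"] by (simp add: minus_sc)

lemma X_E: "X x z \<Longrightarrow> 1 \<le> i \<Longrightarrow> i < n \<Longrightarrow> X (opE M i x) (WE i z)"
proof (induction rule: mgraph.induct)
  case mg_base
  then show ?case using v(3) hE X_0 by simp
next
  case (mg_F x z j)
  have "X (smult M (inverse (qvar - inverse qvar)) (opK M i x - opKinv M i x)) (sc (inverse (qvar - inverse qvar)) (WK i z - WKi i z))"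
    by (intro mgraph.mg_sc X_diff X_K X_Kinv mg_F)
  then have "X (if i = j then smult M (inverse (qvar - inverse qvar)) (opK M i x - opKinv M i x) else 0) (if i = j then sc (inverse (qvar - inverse qvar)) (WK i z - WKi i z) else 0)"
    by (cases "i = j") (simp_all add: X_0)
  moreover have "X (opF M j (opE M i x)) (WF j (WE i z))" using mg_F by (intro mgraph.mg_F) auto
  ultimately show ?case using mg_F by (simp only: rels WE_WF mgraph.mg_add)
qed (auto simp: ops_linear intro: mgraph.intros)

text \<open>The same scalar c occurs in both components: the f_i never lead back to the highest
  weight in M, nor to the letter sum of y in the tensor power.\<close>

lemma X_leading:
  assumes "X x z"
  shows "\<exists>c l zz. x = smult M c v + l \<and> l \<in> Low \<and> z = sc c h + zz \<and> (\<forall>w. zz w \<noteq> 0 \<longrightarrow> sum_list w > sum_list y)"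
  using assms
proof (induction rule: mgraph.induct)
  case mg_base
  show ?case using Low_0 by (intro exI[of _ 1] exI[of _ 0]) (simp add: fun_apply)
next
  case (mg_add x z x' z')
  then obtain c l zz c' l' zz' where "x = smult M c v + l" "l \<in> Low" "z = sc c h + zz" "\<forall>w. zz w \<noteq> 0 \<longrightarrow> sum_list w > sum_list y"
    "x' = smult M c' v + l'" "l' \<in> Low" "z' = sc c' h + zz'" "\<forall>w. zz' w \<noteq> 0 \<longrightarrow> sum_list w > sum_list y" by blast
  then show ?case using Low_add
    by (intro exI[of _ "c + c'"] exI[of _ "l + l'"] exI[of _ "zz + zz'"])
      (auto simp: sc_add fun_apply add_ac vs.scale_left_distrib, metis add.left_neutral)
next
  case (mg_sc x z d)
  then obtain c l zz where "x = smult M c v + l" "l \<in> Low" "z = sc c h + zz" "\<forall>w. zz w \<noteq> 0 \<longrightarrow> sum_list w > sum_list y" by blast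
  then show ?case using Low_smult
    by (intro exI[of _ "d * c"] exI[of _ "smult M d l"] exI[of _ "sc d zz"]) (auto simp: sc_add fun_apply vs.scale_right_distrib)
next
  case (mg_F x z i)
  then obtain c l zz where x: "x = smult M c v + l" "l \<in> Low" "z = sc c h + zz" "\<forall>w. zz w \<noteq> 0 \<longrightarrow> sum_list w > sum_list y" by blast
  have "height n (\<lambda>j. int (lam j) - cartan j i) < height n (\<lambda>i. int (lam i))"
    using height_cartan[of i n "\<lambda>j. int (lam j)"] mg_F by simp
  then have "opF M i v \<in> Low" using Low_wt[OF weight_space_F[OF v(2)]] mg_F by simp
  then have 1: "opF M i x \<in> Low" unfolding x using x(2) mg_F by (simp add: ops_linear Low_add Low_smult Low_F)
  have "sum_list w > sum_list y" if w: "WF i z w \<noteq> 0" for w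
  proof -
    obtain u where u: "z u \<noteq> 0" "sum_list w = Suc (sum_list u)" using WF_sum_list[OF w] by blast
    have "h u \<noteq> 0 \<or> zz u \<noteq> 0" using u(1) x(3) by (auto simp: fun_apply)
    then have "sum_list u \<ge> sum_list y" using x(4) hms[of u]
      by (metis less_imp_le order_refl sum_mset_sum_list)
    then show ?thesis using u by simp
  qed
  then show ?case using 1 by (intro exI[of _ 0] exI[of _ "opF M i x"] exI[of _ "WF i z"]) auto
qed

lemma X_0_orth:
  assumes "X 0 z"
  shows "bil n N h z = 0"
proof -
  obtain c l zz where x: "0 = smult M c v + l" "l \<in> Low" "z = sc c h + zz" "\<forall>w. zz w \<noteq> 0 \<longrightarrow> sum_list w > sum_list y"
    using X_leading[OF assms] by blast
  have "c = 0"
  proof (rule ccontr)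
    assume c: "c \<noteq> 0"
    have "smult M c v = smult M (-1) l" using x(1) by (simp add: eq_neg_iff_add_eq_0)
    then have "v = smult M (inverse c) (smult M (-1) l)" using c by (metis left_inverse vs.scale_one vs.scale_scale)
    then show False using v_not_Low Low_smult x(2) by metis
  qed
  then have "h w * z w = 0" for w using x(3,4) hms[of w] by (auto simp: fun_apply) (metis less_irrefl sum_mset_sum_list)
  then show ?thesis unfolding bil_def by (simp add: sum.neutral)
qed

text \<open>The vectors related to 0 are stable under e_i and K_i and orthogonal to h by
  \<open>X_0_orth\<close>. By adjointness they are then orthogonal to everything generated from h,
  in particular each to itself, and the form is anisotropic.\<close>

lemma X_0_zero:
  assumes "X 0 z"
  shows "z = 0"
proof -
  have *: "X x z' \<Longrightarrow> (\<And>z. X 0 z \<Longrightarrow> bil n N z' z = 0)" for x z'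
  proof (induction rule: mgraph.induct)
    case mg_base
    then show ?case by (rule X_0_orth)
  next
    case (mg_F x z' i z)
    have "X 0 (sc qvar (WE i (WK i z)))"
      using mg_sc[OF X_E[OF X_K[OF mg_F.prems mg_F.hyps(2,3)] mg_F.hyps(2,3)], of qvar] mg_F.hyps by (simp add: ops_zero)
    from mg_F.IH[OF this] show ?case by (simp add: bil_WF[OF mg_F.hyps(2,3)])
  qed (simp_all add: bil_linear)
  have "bil n N z z = 0" using *[OF assms assms] .
  then show ?thesis using bil_pos Sub_Wsp X_Sub assms by blast
qed

text \<open>The domain of the graph is a submodule containing v, hence all of M by
  irreducibility.\<close>

lemma X_ex: "\<exists>z. X x z"
proof -
  have "uq_subrep n M {x. \<exists>z. X x z}"
  proof -
    have "\<exists>z. X 0 z" "\<And>x x'. \<exists>z. X x z \<Longrightarrow> \<exists>z. X x' z \<Longrightarrow> \<exists>z. X (x + x') z" "\<And>c x. \<exists>z. X x z \<Longrightarrow> \<exists>z. X (smult M c x) z"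
      "\<And>i x. i \<in> {1..<n} \<Longrightarrow> \<exists>z. X x z \<Longrightarrow> \<exists>z. X (opE M i x) z" "\<And>i x. i \<in> {1..<n} \<Longrightarrow> \<exists>z. X x z \<Longrightarrow> \<exists>z. X (opF M i x) z"
      "\<And>i x. i \<in> {1..<n} \<Longrightarrow> \<exists>z. X x z \<Longrightarrow> \<exists>z. X (opK M i x) z" "\<And>i x. i \<in> {1..<n} \<Longrightarrow> \<exists>z. X x z \<Longrightarrow> \<exists>z. X (opKinv M i x) z"
      using X_0 mg_add mg_sc mg_F X_E X_K X_Kinv by (metis atLeastLessThan_iff)+
    then show ?thesis unfolding uq_subrep_def vs.subspace_def by (simp only: mem_Collect_eq) blast
  qed
  then have "{x. \<exists>z. X x z} = {0} \<or> {x. \<exists>z. X x z} = UNIV"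
    using irr unfolding irreducible_of_highest_weight_def by blast
  then show ?thesis using mg_base[of n M v h] v(1) by blast
qed

lemma X_unique: "X x z \<Longrightarrow> X x z' \<Longrightarrow> z = z'"
  using X_diff[of x z x z'] X_0_zero[of "z - z'"] by simp

definition iota :: "'v \<Rightarrow> wvec" where "iota x = (THE z. X x z)"

lemma X_iota: "X x (iota x)"
  unfolding iota_def using X_ex[of x] X_unique by (metis theI)

lemma iota_eqI: "X x z \<Longrightarrow> iota x = z"
  using X_iota X_unique by blast

lemma iota_add: "iota (x + x') = iota x + iota x'" and iota_smult: "iota (smult M c x) = sc c (iota x)"
  and iota_diff: "iota (x - x') = iota x - iota x'" and iota_0: "iota 0 = 0" and iota_v: "iota v = h"
  by (intro iota_eqI mg_add mg_sc X_iota X_diff X_0 mg_base)+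

lemma iota_ops:
  assumes "1 \<le> i" "i < n"
  shows "iota (opE M i x) = WE i (iota x)" "iota (opF M i x) = WF i (iota x)" "iota (opK M i x) = WK i (iota x)"
  by (rule iota_eqI, rule X_E[OF X_iota assms], rule iota_eqI, rule mg_F[OF X_iota assms],
      rule iota_eqI, rule X_K[OF X_iota assms])

lemma iota_Sub: "iota x \<in> Sub n h" and iota_Wsp: "iota x \<in> Wsp n N"
  using X_Sub[OF X_iota] Sub_Wsp by auto

text \<open>The kernel is a submodule that does not contain v.\<close>

lemma iota_eq_0: 
  assumes "iota x = 0"
  shows "x = 0"
proof -
  have "uq_subrep n M {x. X x 0}"
    unfolding uq_subrep_def vs.subspace_def
    using X_0 mg_add[where z = 0 and z' = 0] mg_sc[where z = 0] mg_F[where z = 0] X_E[where z = 0] X_K[where z = 0] X_Kinv[where z = 0] by auto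
  then have "{x. X x 0} = {0} \<or> {x. X x 0} = UNIV"
    using irr unfolding irreducible_of_highest_weight_def by blast
  moreover have "\<not> X v 0" using iota_eqI[of v 0] iota_v h_nonzero by auto
  ultimately have "{x. X x 0} = {0}" by blast
  then show ?thesis using X_iota[of x] assms by auto
qed

lemma iota_inj: "iota x = iota x' \<Longrightarrow> x = x'"
  using iota_eq_0[of "x - x'"] by (simp add: iota_diff)

end

subsection \<open>Kashiwara operators on the module\<close>

lemma coord_WK:
  assumes "x \<in> Wsp n N"
  shows "coord n N i (WK i x) w = qvar powi wtw i w * coord n N i x w"
proof -
  have "coord n N i (WK i x) = (\<lambda>w. qvar powi wtw i w * coord n N i x w)"
  proof (rule coord_eqI)
    have "WK i x = WK i (\<Sum>w\<in>words n N. sc (coord n N i x w) (XV i w))" using coord_sum[OF assms] by simp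
    then show "WK i x = (\<Sum>w\<in>words n N. sc (qvar powi wtw i w * coord n N i x w) (XV i w))"
      by (simp add: WK_sum WK_XV mult.commute)
  qed (use coord_support[OF assms] in auto)
  then show ?thesis by simp
qed

lemma coord_wt:
  assumes "x \<in> Wsp n N" "wt x i m" "coord n N i x w \<noteq> 0"
  shows "wtw i w = m"
  using coord_WK[OF assms(1), of i w] assms coord_sc[OF assms(1)] powi_inj unfolding wt_def by auto

context rank
begin

lemma wet_pow: "k \<le> weps i w \<Longrightarrow> wphi i ((wet i ^^ k) w) = wphi i w + k \<and> weps i ((wet i ^^ k) w) = weps i w - k \<and> (wft i ^^ k) ((wet i ^^ k) w) = w"
proof (induction k)
  case (Suc k)
  let ?u = "(wet i ^^ k) w"
  have "weps i ?u > 0" using Suc by simp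
  have "(wft i ^^ Suc k) ((wet i ^^ Suc k) w) = (wft i ^^ k) (wft i (wet i ?u))"
    by (metis comp_apply funpow.simps(2) funpow_Suc_right)
  also have "\<dots> = w" using Suc \<open>weps i ?u > 0\<close> by simp
  finally show ?case using Suc \<open>weps i ?u > 0\<close> by simp
qed simp

lemma wft_pow: "k \<le> wphi i w \<Longrightarrow> weps i ((wft i ^^ k) w) = weps i w + k \<and> wphi i ((wft i ^^ k) w) = wphi i w - k"
  by (induction k) auto

lemma coord_WE_pow:
  assumes "x \<in> Wsp n N"
  shows "coord n N i ((WE i ^^ d) x) w =
    (if d \<le> wphi i w then (\<Prod>j<d. qint (wphi i w - j)) * coord n N i x ((wft i ^^ d) w) else 0)"
  using assms
proof (induction d arbitrary: x)
  case (Suc d)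
  have "coord n N i ((WE i ^^ Suc d) x) w = coord n N i ((WE i ^^ d) (WE i x)) w" by (simp add: funpow_swap1)
  also have "\<dots> = (if d \<le> wphi i w then (\<Prod>j<d. qint (wphi i w - j)) * coord n N i (WE i x) ((wft i ^^ d) w) else 0)"
    by (rule Suc.IH) (use Suc.prems in simp)
  also have "\<dots> = (if Suc d \<le> wphi i w then (\<Prod>j<Suc d. qint (wphi i w - j)) * coord n N i x ((wft i ^^ Suc d) w) else 0)"
    using wft_pow[of d w] coord_WE[OF Suc.prems, of "(wft i ^^ d) w"] by (auto simp: mult_ac)
  finally show ?case .
qed simp

lemma WF_pow_0 [simp]: "(WF i ^^ k) 0 = 0"
  by (induction k) auto

text \<open>Peels off the part with \<epsilon>_i = d: e_i^d sees only these words, and as the weight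
  fixes \<phi>_i on them, a single scalar s makes f_i^(d) restore their coordinates. If there are
  none, s is 0. The inequality on m + d yields d \<le> m + 2 d, the bound that the definition of
  Kashiwara's operators puts on k, since e_i^d x has weight m + 2 d.\<close>

lemma string_step:
  assumes x: "x \<in> Wsp n N" "wt x i m" and d: "\<And>w. coord n N i x w \<noteq> 0 \<Longrightarrow> weps i w \<le> d"
  shows "\<exists>s. WE i (sc s ((WE i ^^ d) x)) = 0 \<and> (s \<noteq> 0 \<longrightarrow> 0 \<le> m + int d) \<and>
    (\<forall>w. coord n N i (x - DF d (sc s ((WE i ^^ d) x))) w \<noteq> 0 \<longrightarrow> weps i w < d)"
proof (cases "\<exists>w. coord n N i x w \<noteq> 0 \<and> weps i w = d")
  case False
  then have "weps i w < d" if "coord n N i x w \<noteq> 0" for w using d[OF that] that le_neq_implies_less by blast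
  then show ?thesis by (intro exI[of _ 0]) (simp add: DF_def)
next
  case True
  then obtain w0 where w0: "coord n N i x w0 \<noteq> 0" "weps i w0 = d" by blast
  have wtm: "wtw i w = m" if "coord n N i x w \<noteq> 0" for w by (rule coord_wt[OF x that])
  define p where "p = wphi i w0"
  have p: "int p = m + int d" using wphi_weps[of i w0] wtm[OF w0(1)] w0(2) by (simp add: p_def)
  have phi: "wphi i w = p" if "coord n N i x w \<noteq> 0" "weps i w = d" for w
    using wphi_weps[of i w] wtm[OF that(1)] that(2) p by simp
  define t where "t = (\<Prod>j<d. qint (p + d - j))"
  have t: "t \<noteq> 0" unfolding t_def by simp
  let ?u = "sc (inverse t) ((WE i ^^ d) x)"
  have u: "?u \<in> Wsp n N" using WE_pow_Wsp[OF x(1)] by simp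
  have E0: "WE i ?u = 0"
  proof (rule coord_inject)
    show "coord n N i (WE i ?u) = coord n N i 0"
    proof
      fix w
      have "coord n N i ((WE i ^^ Suc d) x) w = 0"
      proof (cases "Suc d \<le> wphi i w")
        case True
        then have "coord n N i x ((wft i ^^ Suc d) w) = 0"
          using wft_pow[OF True] d[of "(wft i ^^ Suc d) w"] by linarith
        then show ?thesis using coord_WE_pow[OF x(1), of "Suc d" w] by simp
      next
        case False
        then show ?thesis using coord_WE_pow[OF x(1), of "Suc d" w] by (simp only: if_False)
      qed
      then show "coord n N i (WE i ?u) w = coord n N i 0 w" by (simp add: coord_sc WE_pow_Wsp x)
    qed
  qed (use WE_Wsp[OF u] in auto)
  have "coord n N i (DF d ?u) w = (if weps i w = d then coord n N i x w else 0)" for w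
  proof (cases "weps i w = d \<and> coord n N i x w \<noteq> 0")
    case True
    then have "wphi i w = p" using phi by blast
    then have "coord n N i ((WE i ^^ d) x) ((wet i ^^ d) w) = t * coord n N i x w"
      using coord_WE_pow[OF x(1), of d "(wet i ^^ d) w"] wet_pow[of d w] True by (simp add: t_def)
    then show ?thesis using True t coord_DF[OF u E0, of d w] by (simp add: coord_sc WE_pow_Wsp x)
  next
    case False
    then have "weps i w = d \<Longrightarrow> coord n N i ((WE i ^^ d) x) ((wet i ^^ d) w) = 0"
      using coord_WE_pow[OF x(1), of d "(wet i ^^ d) w"] wet_pow[of d w] by auto
    then show ?thesis using False coord_DF[OF u E0, of d w] by (auto simp: coord_sc WE_pow_Wsp x)
  qed
  then have "weps i w < d" if "coord n N i (x - DF d ?u) w \<noteq> 0" for w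
    using that d[of w] by (auto simp: coord_diff x u split: if_splits)
  then show ?thesis using E0 p by (intro exI[of _ "inverse t"]) auto
qed

end

context irrep
begin

lemma iota_DF:
  assumes "1 \<le> i" "i < n"
  shows "iota (divided_F M i k x) = rank.DF i k (iota x)"
proof -
  interpret rank n i by unfold_locales (use assms in auto)
  have "iota ((opF M i ^^ k) x) = (WF i ^^ k) (iota x)" by (induction k) (auto simp: iota_ops[OF assms])
  then show ?thesis by (simp add: divided_F_def DF_def iota_smult)
qed

lemma iota_wt: "x \<in> weight_space n M \<mu> \<Longrightarrow> 1 \<le> i \<Longrightarrow> i < n \<Longrightarrow> wt (iota x) i (\<mu> i)"
  unfolding wt_def by (metis iota_ops(3) iota_smult weight_spaceD)

text \<open>Sums of the vectors at which the conditions in \<open>kashiwara_e\<close> and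
  \<open>kashiwara_f\<close> prescribe the value. That they exhaust M (\<open>strings_UNIV\<close>)
  gives the uniqueness required by the definite descriptions.\<close>

inductive_set strings :: "nat \<Rightarrow> 'v set" for i where
  strings_0: "0 \<in> strings i"
| strings_add: "x \<in> strings i \<Longrightarrow> x' \<in> strings i \<Longrightarrow> x + x' \<in> strings i"
| strings_DF: "u \<in> weight_space n M \<mu> \<Longrightarrow> opE M i u = 0 \<Longrightarrow> int k \<le> \<mu> i \<Longrightarrow> divided_F M i k u \<in> strings i"

lemma weight_strings:
  assumes i: "1 \<le> i" "i < n" and x: "x \<in> weight_space n M \<mu>"
    and d: "\<And>w. coord n N i (iota x) w \<noteq> 0 \<Longrightarrow> weps i w < d"
  shows "x \<in> strings i"
  using x d
proof (induction d arbitrary: x)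
  case 0
  then have "coord n N i (iota x) = coord n N i 0" by (auto simp: fun_eq_iff)
  then have "iota x = 0" using coord_inject[OF iota_Wsp] Wsp_0 by blast
  then show ?case using iota_eq_0 strings_0 by blast
next
  case (Suc d)
  interpret rank n i by unfold_locales (use i in auto)
  have d': "\<And>w. coord n N i (iota x) w \<noteq> 0 \<Longrightarrow> weps i w \<le> d" using Suc.prems(2) less_Suc_eq_le by blast
  obtain s where s: "WE i (sc s ((WE i ^^ d) (iota x))) = 0" "s \<noteq> 0 \<longrightarrow> 0 \<le> \<mu> i + int d"
    "\<forall>w. coord n N i (iota x - DF d (sc s ((WE i ^^ d) (iota x)))) w \<noteq> 0 \<longrightarrow> weps i w < d"
    using string_step[OF iota_Wsp iota_wt[OF Suc.prems(1) i] d'] by blast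
  define u where "u = smult M s ((opE M i ^^ d) x)"
  have pw: "iota ((opE M i ^^ k) x) = (WE i ^^ k) (iota x)" for k by (induction k) (auto simp: iota_ops[OF i])
  have iu: "iota u = sc s ((WE i ^^ d) (iota x))" by (simp add: u_def iota_smult pw)
  have Eu: "opE M i u = 0" using s(1) iu iota_eq_0 by (metis iota_ops(1) i)
  have pE: "(opE M i ^^ k) x \<in> weight_space n M (\<lambda>j. \<mu> j + int k * cartan j i)" for k
  proof (induction k)
    case 0
    then show ?case using Suc.prems by simp
  next
    case (Suc k)
    then show ?case using weight_space_E[OF Suc i] by (simp add: algebra_simps)
  qed
  have uw: "u \<in> weight_space n M (\<lambda>j. \<mu> j + int d * cartan j i)" unfolding u_def by (rule weight_space_linear(2)[OF pE])
  have pF: "(opF M i ^^ k) u \<in> weight_space n M (\<lambda>j. \<mu> j + int d * cartan j i - int k * cartan j i)" for k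
  proof (induction k)
    case 0
    then show ?case using uw by simp
  next
    case (Suc k)
    then show ?case using weight_space_F[OF Suc i] by (simp add: algebra_simps)
  qed
  have Dw: "divided_F M i d u \<in> weight_space n M \<mu>"
    unfolding divided_F_def using weight_space_linear(2)[OF pF[of d]] by simp
  have mem: "divided_F M i d u \<in> strings i"
  proof (cases "s = 0")
    case True
    then have "iota (divided_F M i d u) = 0" unfolding iota_DF[OF i] iu by (simp add: DF_def)
    then have "divided_F M i d u = 0" by (rule iota_eq_0)
    then show ?thesis using strings_0 by simp
  next
    case False
    then have "int d \<le> \<mu> i + int d * cartan i i" using s(2) by (simp add: cartan_def)
    then show ?thesis by (rule strings_DF[OF uw Eu])
  qed
  have "x - divided_F M i d u \<in> strings i"
  proof (rule Suc.IH)
    show "x - divided_F M i d u \<in> weight_space n M \<mu>"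
      using weight_space_linear(1)[OF Suc.prems(1) weight_space_linear(2)[OF Dw, of "-1"]] by simp
    show "weps i w < d" if "coord n N i (iota (x - divided_F M i d u)) w \<noteq> 0" for w
      using that s(3) by (simp add: iota_diff iota_DF[OF i] iu)
  qed
  from strings_add[OF this mem] show ?case by simp
qed

inductive_set wsum :: "'v set" where
  wsum_wt: "x \<in> weight_space n M \<mu> \<Longrightarrow> x \<in> wsum"
| wsum_add: "x \<in> wsum \<Longrightarrow> x' \<in> wsum \<Longrightarrow> x + x' \<in> wsum"

text \<open>By \<open>X_iota\<close> every element of M arises from v by the f_i and linear
  operations, all of which preserve sums of weight vectors.\<close>

lemma wsum_UNIV: "x \<in> wsum"
proof -
  have "x \<in> wsum" if "X x z" for x z
    using that
  proof (induction rule: mgraph.induct)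
    case mg_base
    then show ?case using wsum_wt[OF v(2)] .
  next
    case (mg_add x z x' z')
    then show ?case by (intro wsum_add)
  next
    case (mg_sc x z c)
    have "x \<in> wsum \<Longrightarrow> smult M c x \<in> wsum" for x
    proof (induction rule: wsum.induct)
      case (wsum_wt x \<mu>)
      then show ?case using wsum.wsum_wt[OF weight_space_linear(2)] by blast
    qed (simp add: vs.scale_right_distrib wsum_add)
    then show ?case using mg_sc by blast
  next
    case (mg_F x z i)
    have "x \<in> wsum \<Longrightarrow> opF M i x \<in> wsum" for x
    proof (induction rule: wsum.induct)
      case (wsum_wt x \<mu>)
      then show ?case using wsum.wsum_wt[OF weight_space_F] mg_F by blast
    next
      case (wsum_add x x')
      then show ?case unfolding ops_linear(3)[OF mg_F.hyps(2,3)] by (intro wsum.wsum_add)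
    qed
    then show ?case using mg_F by blast
  qed
  then show ?thesis using X_iota by blast
qed

lemma strings_UNIV:
  assumes i: "1 \<le> i" "i < n"
  shows "x \<in> strings i"
  using wsum_UNIV[of x]
proof (induction rule: wsum.induct)
  case (wsum_wt x \<mu>)
  have "weps i w < Suc (Max (weps i ` words n N))" if "coord n N i (iota x) w \<noteq> 0" for w
    using coord_support[OF iota_Wsp that] by (simp add: less_Suc_eq_le)
  then show ?case by (rule weight_strings[OF i wsum_wt])
qed (rule strings_add)

lemma linear_by_iota:
  assumes "\<And>x. iota (g x) = G (iota x)"
    and "\<And>x x'. x \<in> Wsp n N \<Longrightarrow> x' \<in> Wsp n N \<Longrightarrow> G (x + x') = G x + G x'" "\<And>c x. x \<in> Wsp n N \<Longrightarrow> G (sc c x) = sc c (G x)"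
  shows "Vector_Spaces.linear (smult M) (smult M) g"
  unfolding Vector_Spaces.linear_iff
  using assms iota_Wsp by (auto intro!: vs.vector_space_axioms iota_inj simp: iota_add iota_smult)

lemma KF_linear: "x \<in> Wsp n N \<Longrightarrow> x' \<in> Wsp n N \<Longrightarrow> KF n N i (x + x') = KF n N i x + KF n N i x'"
  "x \<in> Wsp n N \<Longrightarrow> KF n N i (sc c x) = sc c (KF n N i x)"
  unfolding KF_def sc_sum sum.distrib[symmetric] by (auto simp: coord_add coord_sc sc_add intro!: sum.cong)

lemma KE_linear: "x \<in> Wsp n N \<Longrightarrow> x' \<in> Wsp n N \<Longrightarrow> KE n N i (x + x') = KE n N i x + KE n N i x'"
  "x \<in> Wsp n N \<Longrightarrow> KE n N i (sc c x) = sc c (KE n N i x)"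
  unfolding KE_def sc_sum sum.distrib[symmetric] by (auto simp: coord_add coord_sc sc_add intro!: sum.cong)

lemma KF_0: "KF n N i 0 = 0" and KE_0: "KE n N i 0 = 0"
  using KF_linear(2)[of 0 i 0] KE_linear(2)[of 0 i 0] by simp_all

lemma linear_D:
  assumes "Vector_Spaces.linear (smult M) (smult M) g"
  shows "g (x + x') = g x + g x'" "g 0 = 0"
proof -
  show "g (x + x') = g x + g x'" using assms unfolding Vector_Spaces.linear_iff by blast
  have "g (smult M 0 0) = smult M 0 (g 0)" using assms unfolding Vector_Spaces.linear_iff by blast
  then show "g 0 = 0" by simp
qed

text \<open>The definite description needs a solution inside M. The image of \<open>iota\<close> is
  stable under \<open>KF\<close>, since this holds on the string vectors and these span; so
  \<open>KF\<close> restricts to an operator on M. Any other solution agrees with it on the string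
  vectors.\<close>

lemma iota_kashiwara_f:
  assumes i: "1 \<le> i" "i < n"
  shows "iota (kashiwara_f n M i x) = KF n N i (iota x)"
proof -
  interpret rank n i by unfold_locales (use i in auto)
  have key: "KF n N i (iota (divided_F M i k u)) = iota (divided_F M i (k + 1) u)" if "opE M i u = 0" for u k
    using KF_DF[OF iota_Wsp[of u], of k] that iota_ops(1)[OF i, of u] by (simp add: iota_DF[OF i] iota_0)
  have "\<exists>g. iota g = KF n N i (iota x)" for x
    using strings_UNIV[OF i, of x]
  proof (induction rule: strings.induct)
    case strings_0
    then show ?case using iota_0 by (auto simp: KF_0 intro!: exI[of _ 0])
  next
    case (strings_add x x')
    then show ?case by (metis KF_linear(1) iota_Wsp iota_add)
  next
    case (strings_DF u \<mu> k)
    then show ?case using key by metis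
  qed
  then obtain g where g: "\<And>x. iota (g x) = KF n N i (iota x)" by metis
  let ?P = "\<lambda>g. Vector_Spaces.linear (smult M) (smult M) g \<and>
     (\<forall>\<mu> u k. u \<in> weight_space n M \<mu> \<and> opE M i u = 0 \<and> int k \<le> \<mu> i \<longrightarrow>
        g (divided_F M i k u) = divided_F M i (k + 1) u)"
  have Pg: "?P g"
    using linear_by_iota[OF g KF_linear] g key by (metis iota_inj)
  have uniq: "g' = g" if "?P g'" for g'
  proof
    fix x
    have l: "Vector_Spaces.linear (smult M) (smult M) g" "Vector_Spaces.linear (smult M) (smult M) g'"
      using Pg that by blast+
    show "g' x = g x" using strings_UNIV[OF i, of x]
    proof (induction rule: strings.induct)
      case strings_0
      show ?case using linear_D(2) l by metis
    next
      case (strings_add x x')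
      then show ?case using linear_D(1) l by metis
    next
      case (strings_DF u \<mu> k)
      then show ?case using Pg that by metis
    qed
  qed
  have "kashiwara_f n M i = g" unfolding kashiwara_f_def by (rule the_equality[where P = ?P, OF Pg uniq])
  then show ?thesis using g by simp
qed

lemma iota_kashiwara_e:
  assumes i: "1 \<le> i" "i < n"
  shows "iota (kashiwara_e n M i x) = KE n N i (iota x)"
proof -
  interpret rank n i by unfold_locales (use i in auto)
  have key: "KE n N i (iota (divided_F M i k u)) = iota (if k = 0 then 0 else divided_F M i (k - 1) u)"
    if u: "u \<in> weight_space n M \<mu>" "opE M i u = 0" "int k \<le> \<mu> i" for u k \<mu>
  proof -
    have E: "WE i (iota u) = 0" using u(2) iota_ops(1)[OF i, of u] by (simp add: iota_0)
    show ?thesis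
    proof (cases k)
      case 0
      then show ?thesis using KE_DF_0[OF iota_Wsp E] by (simp add: iota_DF[OF i] iota_0)
    next
      case (Suc j)
      have "int j < wtw i w" if "coord n N i (iota u) w \<noteq> 0" for w
        using coord_wt[OF iota_Wsp iota_wt[OF u(1) i] that] u(3) Suc by simp
      then show ?thesis using KE_DF[OF iota_Wsp E, of j] Suc by (simp add: iota_DF[OF i])
    qed
  qed
  have "\<exists>g. iota g = KE n N i (iota x)" for x
    using strings_UNIV[OF i, of x]
  proof (induction rule: strings.induct)
    case strings_0
    then show ?case using iota_0 by (auto simp: KE_0 intro!: exI[of _ 0])
  next
    case (strings_add x x')
    then show ?case by (metis KE_linear(1) iota_Wsp iota_add)
  next
    case (strings_DF u \<mu> k)
    then show ?case using key by metis
  qed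
  then obtain g where g: "\<And>x. iota (g x) = KE n N i (iota x)" by metis
  let ?P = "\<lambda>g. Vector_Spaces.linear (smult M) (smult M) g \<and>
     (\<forall>\<mu> u k. u \<in> weight_space n M \<mu> \<and> opE M i u = 0 \<and> int k \<le> \<mu> i \<longrightarrow>
        g (divided_F M i k u) = (if k = 0 then 0 else divided_F M i (k - 1) u))"
  have "g (divided_F M i k u) = (if k = 0 then 0 else divided_F M i (k - 1) u)"
    if "u \<in> weight_space n M \<mu>" "opE M i u = 0" "int k \<le> \<mu> i" for u k \<mu>
    using key[OF that] g[of "divided_F M i k u"] by (intro iota_inj) simp
  then have Pg: "?P g" using linear_by_iota[OF g KE_linear] by blast
  have uniq: "g' = g" if "?P g'" for g'
  proof
    fix x
    have l: "Vector_Spaces.linear (smult M) (smult M) g" "Vector_Spaces.linear (smult M) (smult M) g'"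
      using Pg that by blast+
    show "g' x = g x" using strings_UNIV[OF i, of x]
    proof (induction rule: strings.induct)
      case strings_0
      show ?case using linear_D(2) l by metis
    next
      case (strings_add x x')
      then show ?case using linear_D(1) l by metis
    next
      case (strings_DF u \<mu> k)
      then show ?case using Pg that by metis
    qed
  qed
  have "kashiwara_e n M i = g" unfolding kashiwara_e_def by (rule the_equality[where P = ?P, OF Pg uniq])
  then show ?thesis using g by simp
qed

end

section \<open>Crystal bases of irreducible modules\<close>

inductive_set wcomp :: "nat \<Rightarrow> nat list \<Rightarrow> nat list set" for n y where
  comp_base: "y \<in> wcomp n y"
| comp_f: "b \<in> wcomp n y \<Longrightarrow> 1 \<le> i \<Longrightarrow> i < n \<Longrightarrow> wphi i b > 0 \<Longrightarrow> wft i b \<in> wcomp n y"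
| comp_e: "b \<in> wcomp n y \<Longrightarrow> 1 \<le> i \<Longrightarrow> i < n \<Longrightarrow> weps i b > 0 \<Longrightarrow> wet i b \<in> wcomp n y"

lemma comp_words: "y \<in> words n N \<Longrightarrow> b \<in> wcomp n y \<Longrightarrow> b \<in> words n N"
  by (rotate_tac, induction rule: wcomp.induct) (auto intro: wf_in_words we_in_words)

lemma finite_comp: "y \<in> words n N \<Longrightarrow> finite (wcomp n y)"
  using comp_words finite_subset[OF _ finite_words] by blast

lemma comp_f_iff: "1 \<le> i \<Longrightarrow> i < n \<Longrightarrow> wphi i b > 0 \<Longrightarrow> wft i b \<in> wcomp n y \<longleftrightarrow> b \<in> wcomp n y"
  using comp_f[of b n y i] comp_e[of "wft i b" n y i] by auto

lemma mset_wft: "wphi i w > 0 \<Longrightarrow> add_mset i (mset (wft i w)) = add_mset (Suc i) (mset w)"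
proof (induction w)
  case (Cons a w)
  consider "a = i" "wphi i w = 0" | "a = i" "wphi i w > 0" | "a = Suc i" "wphi i w > 1"
    | "a \<noteq> i" "a \<noteq> Suc i" "wphi i w > 0"
    using Cons.prems by (auto split: if_splits)
  then show ?case using Cons.IH by cases (auto simp: add_mset_commute)
qed simp

lemma sum_list_wft:
  assumes "wphi i w > 0"
  shows "sum_list (wft i w) = Suc (sum_list w)"
proof -
  have "sum_mset (add_mset i (mset (wft i w))) = sum_mset (add_mset (Suc i) (mset w))" using mset_wft[OF assms] by simp
  then show ?thesis by (simp add: sum_mset_sum_list)
qed

lemma wtw_wft: "wphi i w > 0 \<Longrightarrow> wtw j (wft i w) = wtw j w - cartan j i"
  unfolding wtw_def count_wf by (auto simp: cartan_def)

lemma wtw_wet: "weps i w > 0 \<Longrightarrow> wtw j (wet i w) = wtw j w + cartan j i"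
  using wtw_wft[of i "wet i w" j] by simp

text \<open>Equal weights make the multiplicities of all letters differ by one constant, and the
  common length N forces this constant to be zero.\<close>

lemma words_content:
  assumes "w \<in> words n N" "y \<in> words n N" "\<And>j. 1 \<le> j \<Longrightarrow> j < n \<Longrightarrow> wtw j w = wtw j y"
  shows "mset w = mset y"
proof (cases "n = 0")
  case True
  then show ?thesis using assms by (auto simp: words_def)
next
  case False
  define \<delta> where "\<delta> k = int (count_list w k) - int (count_list y k)" for k
  have step: "\<delta> (Suc j) = \<delta> j" if "1 \<le> j" "j < n" for j
    using assms(3)[OF that] by (simp add: \<delta>_def wtw_def)
  have \<delta>_const: "1 \<le> k \<Longrightarrow> k \<le> n \<Longrightarrow> \<delta> k = \<delta> 1" for k
  proof (induction k)
    case (Suc k)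
    then show ?case using step[of k] by (cases "k = 0") auto
  qed simp
  have len: "(\<Sum>k\<in>{1..n}. count_list u k) = N" if "u \<in> words n N" for u
    using that sum_count_set[of u "{1..n}"] by (simp add: words_def)
  have "(\<Sum>k\<in>{1..n}. \<delta> k) = int (\<Sum>k\<in>{1..n}. count_list w k) - int (\<Sum>k\<in>{1..n}. count_list y k)"
    by (simp add: \<delta>_def sum_subtractf)
  also have "\<dots> = 0" unfolding len[OF assms(1)] len[OF assms(2)] by (rule diff_self)
  also have "(\<Sum>k\<in>{1..n}. \<delta> k) = (\<Sum>k\<in>{1..n}. \<delta> 1)" by (rule sum.cong[OF refl], rule \<delta>_const) auto
  finally have "int n * \<delta> 1 = 0" by simp
  then have "\<delta> 1 = 0" using False by simp
  then have "count_list w k = count_list y k" for k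
  proof (cases "k \<in> {1..n}")
    case True
    then have "\<delta> k = 0" using \<delta>_const[of k] \<open>\<delta> 1 = 0\<close> by simp
    then show ?thesis by (simp add: \<delta>_def)
  next
    case False
    then have "k \<notin> set w" "k \<notin> set y" using assms by (auto simp: words_def)
    then show ?thesis by (simp add: count_list_0_iff)
  qed
  then show ?thesis by (rule mset_eq_if_counts)
qed

text \<open>Each \<open>XV i v\<close> is supported on words with the content of v. If x had no word
  of the content of w, dropping all coordinates of that content would give a second expansion of
  x.\<close>

lemma coord_mset:
  assumes x: "x \<in> Wsp n N" and w: "coord n N i x w \<noteq> 0"
  shows "\<exists>u. x u \<noteq> 0 \<and> mset u = mset w"
proof (rule ccontr)
  assume "\<nexists>u. x u \<noteq> 0 \<and> mset u = mset w"
  then have no: "x u = 0" if "mset u = mset w" for u using that by blast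
  define c where "c v = (if mset v = mset w then 0 else coord n N i x v)" for v
  have "x u = (\<Sum>v\<in>words n N. sc (c v) (XV i v)) u" for u
  proof -
    have S: "XV i v u = 0" if "mset u \<noteq> mset v" for v
      using XV_support[of i v u] mset_eq_if_counts[of u v] that by blast
    show ?thesis
    proof (cases "mset u = mset w")
      case True
      have "(\<Sum>v\<in>words n N. sc (c v) (XV i v)) u = 0" unfolding sum_fun_apply
        using True S by (intro sum.neutral) (auto simp: c_def fun_apply)
      then show ?thesis using no True by simp
    next
      case False
      have "(\<Sum>v\<in>words n N. sc (c v) (XV i v)) u = (\<Sum>v\<in>words n N. sc (coord n N i x v) (XV i v)) u"
        unfolding sum_fun_apply using False S by (intro sum.cong) (auto simp: c_def fun_apply)
      then show ?thesis using coord_sum[OF x] by simp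
    qed
  qed
  then have sum: "x = (\<Sum>v\<in>words n N. sc (c v) (XV i v))" by (rule ext)
  have "v \<in> words n N" if "c v \<noteq> 0" for v
  proof -
    have "c v = coord n N i x v" using that unfolding c_def by (metis (full_types))
    then show ?thesis using that coord_support[OF x, of i v] by metis
  qed
  from coord_eqI[OF this sum] have "coord n N i x w = c w" by simp
  moreover have "c w = 0" unfolding c_def by simp
  ultimately show False using w by simp
qed

lemma wt_if_coords:
  assumes x: "x \<in> Wsp n N" and "\<And>w. coord n N i x w \<noteq> 0 \<Longrightarrow> wtw j w = m"
  shows "wt x j m"
proof (rule wt_support)
  fix u assume "x u \<noteq> 0"
  then have "(\<Sum>w\<in>words n N. sc (coord n N i x w) (XV i w)) u \<noteq> 0" using coord_sum[OF x] by simp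
  then obtain w where "coord n N i x w * XV i w u \<noteq> 0"
    unfolding sum_fun_apply by (metis (no_types, lifting) sc_apply sum.not_neutral_contains_not_neutral)
  then have c: "coord n N i x w \<noteq> 0" "XV i w u \<noteq> 0" by auto
  have "wtw j u = wtw j w" by (rule mset_wtw, rule mset_eq_if_counts, rule XV_support[OF c(2)])
  then show "wtw j u = m" using assms(2)[OF c(1)] by simp
qed

lemma coord_wtj: "x \<in> Wsp n N \<Longrightarrow> wt x j m \<Longrightarrow> coord n N i x w \<noteq> 0 \<Longrightarrow> wtw j w = m"
proof -
  assume a: "x \<in> Wsp n N" "wt x j m" "coord n N i x w \<noteq> 0"
  obtain u where u: "x u \<noteq> 0" "mset u = mset w" using coord_mset[OF a(1,3)] by blast
  show "wtw j w = m" using wt_supportD[OF a(2) u(1)] mset_wtw[OF u(2)] by simp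
qed

lemma (in rank) KF_wt:
  assumes "x \<in> Wsp n N" "wt x j m"
  shows "wt (KF n N i x) j (m - cartan j i)"
proof (rule wt_if_coords[OF KF_Wsp])
  fix w assume "coord n N i (KF n N i x) w \<noteq> 0"
  then have "weps i w > 0" "coord n N i x (wet i w) \<noteq> 0" using assms by (auto simp: coord_KF split: if_splits)
  then show "wtw j w = m - cartan j i" using coord_wtj[OF assms, of i "wet i w"] wtw_wet[of i w j] by simp
qed

lemma (in rank) KE_wt:
  assumes "x \<in> Wsp n N" "wt x j m"
  shows "wt (KE n N i x) j (m + cartan j i)"
proof (rule wt_if_coords[OF KE_Wsp])
  fix w assume "coord n N i (KE n N i x) w \<noteq> 0"
  then have "wphi i w > 0" "coord n N i x (wft i w) \<noteq> 0" using assms by (auto simp: coord_KE split: if_splits)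
  then show "wtw j w = m + cartan j i" using coord_wtj[OF assms, of i "wft i w"] wtw_wft[of i w j] by simp
qed

lemma (in rank) KE_sum_list:
  assumes "x \<in> Wsp n N" "KE n N i x u \<noteq> 0"
  shows "\<exists>w. x w \<noteq> 0 \<and> sum_list w = Suc (sum_list u)"
proof -
  have "(\<Sum>w\<in>words n N. sc (coord n N i (KE n N i x) w) (XV i w)) u \<noteq> 0" using assms coord_sum[OF KE_Wsp] by simp
  then obtain w where "coord n N i (KE n N i x) w * XV i w u \<noteq> 0"
    unfolding sum_fun_apply by (metis (no_types, lifting) sc_apply sum.not_neutral_contains_not_neutral)
  then have w: "wphi i w > 0" "coord n N i x (wft i w) \<noteq> 0" "XV i w u \<noteq> 0" using assms by (auto simp: coord_KE split: if_splits)
  obtain t where "x t \<noteq> 0" "mset t = mset (wft i w)" using coord_mset[OF assms(1) w(2)] by blast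
  moreover have "mset u = mset w" using mset_eq_if_counts[OF XV_support[OF w(3)]] .
  ultimately show ?thesis using sum_list_wft[OF w(1)] by (metis sum_mset_sum_list)
qed

context irrep
begin

abbreviation "ke i \<equiv> kashiwara_e n M i"
abbreviation "kf i \<equiv> kashiwara_f n M i"

lemma iota_red_yam:
  assumes "iota x \<in> Lat n N" "\<And>w. red (iota x) w \<noteq> 0 \<Longrightarrow> yam n w" "red (iota x) w \<noteq> 0"
  shows "w = y"
proof -
  \<comment> \<open>\<open>Sub_red_yam\<close> asks for a highest weight vector at every Yamanouchi
    word; \<open>H\<close> completes h to such a family.\<close>
  define H where "H y' = (if y' = y then h else (SOME k. hwvec n N y' k))" for y'
  have H: "hwvec n N y' (H y')" if "y' \<in> words n N" "yam n y'" for y'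
    unfolding H_def using h someI_ex[OF hwvec_exists[OF that]] by simp
  show ?thesis
    by (rule Sub_red_yam[OF H y(1,2) _ assms(1,2,3)]) (use iota_Sub in \<open>simp_all add: H_def\<close>)
qed

lemma weight_space_iota: "(\<And>j. 1 \<le> j \<Longrightarrow> j < n \<Longrightarrow> wt (iota x) j (\<mu> j)) \<Longrightarrow> x \<in> weight_space n M \<mu>"
  by (intro weight_spaceI iota_inj) (simp add: iota_ops iota_smult wt_def)

text \<open>Lifts of crystal elements along paths of Kashiwara operators starting at v. It is a
  relation because two paths to b may give different vectors; by \<open>gen_props\<close> they agree
  modulo q.\<close>

inductive gen :: "nat list \<Rightarrow> 'v \<Rightarrow> bool" where
  gen_base: "gen y v"
| gen_f: "gen b x \<Longrightarrow> 1 \<le> i \<Longrightarrow> i < n \<Longrightarrow> wphi i b > 0 \<Longrightarrow> gen (wft i b) (kf i x)"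
| gen_e: "gen b x \<Longrightarrow> 1 \<le> i \<Longrightarrow> i < n \<Longrightarrow> weps i b > 0 \<Longrightarrow> gen (wet i b) (ke i x)"

lemma gen_ex: "b \<in> wcomp n y \<Longrightarrow> \<exists>x. gen b x"
  by (induction rule: wcomp.induct) (use gen.intros in blast)+

lemma gen_props: 
  "gen b x \<Longrightarrow> b \<in> wcomp n y \<and> iota x \<in> Lat n N \<and> (\<forall>w. red (iota x) w = of_bool (w = b)) \<and> x \<in> weight_space n M (\<lambda>j. wtw j b)"
proof (induction rule: gen.induct)
  case gen_base
  have "v \<in> weight_space n M (\<lambda>j. wtw j y)" using v(2) y(3) by (simp add: weight_space_def)
  then show ?case using hL hred by (simp add: iota_v comp_base)
next
  case (gen_f b x i)
  interpret rank n i by unfold_locales (use gen_f in auto)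
  have L: "iota x \<in> Lat n N" using gen_f by blast
  have r: "red (iota (kf i x)) w = of_bool (w = wft i b)" for w
  proof -
    have "weps i w > 0 \<Longrightarrow> wet i w = b \<longleftrightarrow> w = wft i b" using gen_f(4) by auto
    moreover have "weps i (wft i b) > 0" using gen_f(4) by simp
    ultimately show ?thesis using gen_f by (auto simp: iota_kashiwara_f red_KF[OF L])
  qed
  moreover have "kf i x \<in> weight_space n M (\<lambda>j. wtw j (wft i b))"
  proof (rule weight_space_iota)
    fix j assume j: "1 \<le> j" "j < n"
    have "wt (iota x) j (wtw j b)" using iota_wt[OF _ j] gen_f by blast
    then show "wt (iota (kf i x)) j (wtw j (wft i b))"
      unfolding iota_kashiwara_f[OF gen_f(2,3)] wtw_wft[OF gen_f(4)] by (rule KF_wt[OF iota_Wsp])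
  qed
  moreover have "iota (kf i x) \<in> Lat n N" using gen_f by (simp add: iota_kashiwara_f KF_Lat)
  ultimately show ?case using gen_f comp_f by blast
next
  case (gen_e b x i)
  interpret rank n i by unfold_locales (use gen_e in auto)
  have L: "iota x \<in> Lat n N" using gen_e by blast
  have r: "red (iota (ke i x)) w = of_bool (w = wet i b)" for w
  proof -
    have "wphi i w > 0 \<Longrightarrow> wft i w = b \<longleftrightarrow> w = wet i b" using gen_e(4) by auto
    moreover have "wphi i (wet i b) > 0" using gen_e(4) by simp
    ultimately show ?thesis using gen_e by (auto simp: iota_kashiwara_e red_KE[OF L])
  qed
  moreover have "ke i x \<in> weight_space n M (\<lambda>j. wtw j (wet i b))"
  proof (rule weight_space_iota)
    fix j assume j: "1 \<le> j" "j < n"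
    have "wt (iota x) j (wtw j b)" using iota_wt[OF _ j] gen_e by blast
    then show "wt (iota (ke i x)) j (wtw j (wet i b))"
      unfolding iota_kashiwara_e[OF gen_e(2,3)] wtw_wet[OF gen_e(4)] by (rule KE_wt[OF iota_Wsp])
  qed
  moreover have "iota (ke i x) \<in> Lat n N" using gen_e by (simp add: iota_kashiwara_e KE_Lat)
  ultimately show ?case using gen_e comp_e by blast
qed

definition g :: "nat list \<Rightarrow> 'v" where "g b = (SOME x. gen b x)"

lemma gen_g: "b \<in> wcomp n y \<Longrightarrow> gen b (g b)"
  unfolding g_def using gen_ex by (rule someI_ex)

lemma g_props:
  assumes "b \<in> wcomp n y"
  shows "iota (g b) \<in> Lat n N" "red (iota (g b)) w = of_bool (w = b)" "g b \<in> weight_space n M (\<lambda>j. wtw j b)"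
  using gen_props[OF gen_g[OF assms]] by auto

text \<open>A combinatorial fact drawn from the module: a Yamanouchi word of the component is the
  residue of a lift in M, and \<open>iota_red_yam\<close> admits only y.\<close>

lemma comp_yam: "b \<in> wcomp n y \<Longrightarrow> yam n b \<Longrightarrow> b = y"
  using iota_red_yam[of "g b" b] g_props[of b] by (auto split: if_splits)

text \<open>Induction on a bound for the letter sums, which the e_i lower. Raising preserves the
  vanishing on the component, so by induction the residue has no word with some \<epsilon>_i > 0.
  What is left is Yamanouchi, hence y, and y lies in the component.\<close>

lemma red_vanishes:
  assumes "iota x \<in> Lat n N" "\<And>w. w \<in> wcomp n y \<Longrightarrow> red (iota x) w = 0"
  shows "red (iota x) w = 0"
proof -
  have "(\<And>w. red (iota x) w \<noteq> 0 \<Longrightarrow> sum_list w < k) \<Longrightarrow> red (iota x) w = 0" for k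
    using assms
  proof (induction k arbitrary: x w)
    case (Suc k)
    have E: "red (iota x) u = 0" if i: "1 \<le> i" "i < n" and u: "weps i u > 0" for i u
    proof -
      interpret rank n i by unfold_locales (use i in auto)
      have r: "red (iota (ke i x)) t = (if wphi i t > 0 then red (iota x) (wft i t) else 0)" for t
        using red_KE[OF Suc.prems(2)] i by (simp add: iota_kashiwara_e)
      have "red (iota (ke i x)) (wet i u) = 0"
      proof (rule Suc.IH)
        show "iota (ke i x) \<in> Lat n N" using KE_Lat[OF Suc.prems(2)] i by (simp add: iota_kashiwara_e)
        show "sum_list t < k" if "red (iota (ke i x)) t \<noteq> 0" for t
          using that Suc.prems(1)[of "wft i t"] sum_list_wft[of i t] by (auto simp: r split: if_splits)
        show "red (iota (ke i x)) t = 0" if "t \<in> wcomp n y" for t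
          using that Suc.prems(3)[of "wft i t"] comp_f_iff[OF i] by (auto simp: r)
      qed
      then show ?thesis using u by (simp add: r)
    qed
    show ?case
    proof (rule ccontr)
      assume w: "red (iota x) w \<noteq> 0"
      have "yam n t" if "red (iota x) t \<noteq> 0" for t
        unfolding yam_def using E that by (metis gr0I)
      then have "w = y" using iota_red_yam[OF Suc.prems(2) _ w] by blast
      then show False using w Suc.prems(3) comp_base by blast
    qed
  qed blast
  from this[of "Suc (sum_list w + Max (sum_list ` words n N))"] show ?thesis
    using red_outside[OF assms(1)] by (metis (no_types, lifting) Max_ge finite_imageI finite_words image_eqI le_imp_less_Suc trans_le_add2)
qed

text \<open>The lifts are completed to a unimodular family by unit vectors at the words outside the
  component. The remainder \<open>x'\<close> has no coordinates at words of the component; if it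
  were nonzero, a primitive multiple would have a nonzero residue vanishing there, against
  \<open>red_vanishes\<close>.\<close>

lemma g_expand:
  shows "\<exists>c. x = (\<Sum>b\<in>wcomp n y. smult M (c b) (g b)) \<and>
    (iota x \<in> Lat n N \<longrightarrow> (\<forall>b\<in>wcomp n y. c b \<in> regular_at_0))"
proof -
  define Z where "Z w = (if w \<in> wcomp n y then iota (g w) else (\<lambda>u. of_bool (u = w)))" for w
  have Z: "Z w u \<in> regular_at_0 \<and> ev0 (Z w u) = of_bool (u = w)" for u w
    using g_props(1,2)[of w] by (auto simp: Z_def Lat_def red_def)
  have sub: "wcomp n y \<subseteq> words n N" using comp_words y(1) by blast
  obtain c where c: "\<forall>u\<in>words n N. iota x u = (\<Sum>w\<in>words n N. c w * Z w u)"
    "(\<forall>u\<in>words n N. iota x u \<in> regular_at_0) \<longrightarrow> (\<forall>w\<in>words n N. c w \<in> regular_at_0)"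
    using unimodular_expand[OF finite_words, of n N Z "iota x"] Z by blast
  define x' where "x' = x - (\<Sum>b\<in>wcomp n y. smult M (c b) (g b))"
  have isum: "iota (\<Sum>b\<in>F. smult M (c b) (g b)) u = (\<Sum>b\<in>F. c b * iota (g b) u)" for F u
    by (induction F rule: infinite_finite_induct) (auto simp: iota_0 iota_add iota_smult fun_apply)
  have x'0: "iota x' u = 0" if "u \<in> wcomp n y" for u
  proof -
    have "iota x u = (\<Sum>w\<in>wcomp n y. c w * Z w u)"
      using c(1) sub that by (subst sum.mono_neutral_left[where T = "words n N"]) (auto simp: Z_def)
    also have "\<dots> = (\<Sum>w\<in>wcomp n y. c w * iota (g w) u)" by (intro sum.cong) (auto simp: Z_def)
    finally show ?thesis by (simp add: x'_def iota_diff isum fun_apply)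
  qed
  have "x' = 0"
  proof (rule ccontr)
    assume "x' \<noteq> 0"
    then have "iota x' \<noteq> 0" using iota_eq_0 by blast
    then have "\<exists>w\<in>words n N. iota x' w \<noteq> 0" using Wsp_outside[OF iota_Wsp[of x']] by (auto simp: fun_eq_iff fun_apply)
    from q_scaling[OF finite_words this] obtain k :: int where
      k: "\<And>w. w \<in> words n N \<Longrightarrow> qvar powi k * iota x' w \<in> regular_at_0" "\<exists>w\<in>words n N. ev0 (qvar powi k * iota x' w) \<noteq> 0" by blast
    let ?z = "smult M (qvar powi k) x'"
    have iz: "iota ?z w = qvar powi k * iota x' w" for w by (simp add: iota_smult fun_apply)
    have "iota ?z w \<in> regular_at_0" for w
      using k(1) Wsp_outside[OF iota_Wsp[of x'], of w] unfolding iz by (cases "w \<in> words n N") auto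
    then have L: "iota ?z \<in> Lat n N" using iota_Wsp by (simp add: Lat_def)
    have "red (iota ?z) w = 0" for w
      by (rule red_vanishes[OF L]) (simp add: red_def iz x'0)
    then show False using k(2) by (simp add: red_def iz)
  qed
  then have "x = (\<Sum>b\<in>wcomp n y. smult M (c b) (g b))" by (simp add: x'_def)
  moreover have "iota x \<in> Lat n N \<longrightarrow> (\<forall>b\<in>wcomp n y. c b \<in> regular_at_0)" using c(2) sub by (auto simp: Lat_def)
  ultimately show ?thesis by blast
qed

end

section \<open>Comparison with an arbitrary crystal lattice\<close>

context irrep
begin

text \<open>The coordinates of v in a basis of the lattice are cleared of their common power of q.
  This removes the freedom of scaling in a crystal lattice.\<close>

lemma primitive_multiple:
  assumes "crystal_lattice n M L"
  shows "\<exists>c. c \<noteq> 0 \<and> smult M c v \<in> L \<and> (\<forall>d. smult M d (smult M c v) \<in> L \<longrightarrow> d \<in> regular_at_0)"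
proof -
  obtain S where S: "finite S" "\<not> module.dependent (smult M) S" "module.span (smult M) S = UNIV"
    "L = {\<Sum>s\<in>S. smult M (c s) s |c. \<forall>s\<in>S. c s \<in> regular_at_0}"
    using assms unfolding crystal_lattice_def by blast
  have "v \<in> module.span (smult M) S" using S(3) by simp
  then obtain c where c: "v = (\<Sum>s\<in>S. smult M (c s) s)" unfolding vs.span_finite[OF S(1)] by auto
  then have "\<exists>s\<in>S. c s \<noteq> 0" using v(1) by (metis (no_types, lifting) sum.neutral vs.scale_zero_left)
  from q_scaling[OF S(1) this] obtain k :: int where
    k: "\<And>s. s \<in> S \<Longrightarrow> qvar powi k * c s \<in> regular_at_0" "\<exists>s\<in>S. ev0 (qvar powi k * c s) \<noteq> 0" by blast
  have kv: "smult M (qvar powi k) v = (\<Sum>s\<in>S. smult M (qvar powi k * c s) s)"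
    unfolding c by (simp add: vs.scale_sum_right)
  have "d \<in> regular_at_0" if d: "smult M d (smult M (qvar powi k) v) \<in> L" for d
  proof -
    obtain e where e: "smult M d (smult M (qvar powi k) v) = (\<Sum>s\<in>S. smult M (e s) s)" "\<forall>s\<in>S. e s \<in> regular_at_0"
      using d unfolding S(4) by blast
    have "(\<Sum>s\<in>S. smult M (d * (qvar powi k * c s) - e s) s) = 0"
      using e(1) unfolding kv by (simp add: vs.scale_sum_right vs.scale_left_diff_distrib sum_subtractf)
    from vs.independentD[OF S(2,1) order_refl this] have ds: "d * (qvar powi k * c s) = e s" if "s \<in> S" for s
      using that by simp
    obtain s where s: "s \<in> S" "ev0 (qvar powi k * c s) \<noteq> 0" using k(2) by blast
    then have "qvar powi k * c s \<noteq> 0" by auto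
    then have "d = e s * inverse (qvar powi k * c s)" using ds[OF s(1)] by (metis divide_inverse nonzero_mult_div_cancel_right)
    then show ?thesis using e(2) s regular_inverse(1)[OF k(1)[OF s(1)] s(2)] by simp
  qed
  moreover have "smult M (qvar powi k) v \<in> L" unfolding S(4) kv using k(1) by auto
  ultimately show ?thesis by (intro exI[of _ "qvar powi k"]) simp
qed

end

text \<open>A crystal base whose lattice meets the line of v in exactly the regular multiples of v.
  Every crystal base is of this kind once v is replaced by a suitable multiple.\<close>

locale crystal_irrep = irrep +
  fixes L B
  assumes cb: "crystal_base n M L B" and vL: "v \<in> L" and vprim: "\<And>c. smult M c v \<in> L \<Longrightarrow> c \<in> regular_at_0"
begin

lemma cl: "crystal_lattice n M L"
  using cb by (simp add: crystal_base_def)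

lemma L_closed:
  shows "x \<in> L \<Longrightarrow> x' \<in> L \<Longrightarrow> x + x' \<in> L" "x \<in> L \<Longrightarrow> c \<in> regular_at_0 \<Longrightarrow> smult M c x \<in> L"
proof -
  obtain S where S: "L = {\<Sum>s\<in>S. smult M (c s) s |c. \<forall>s\<in>S. c s \<in> regular_at_0}"
    using cl unfolding crystal_lattice_def by blast
  show "x + x' \<in> L" if xx: "x \<in> L" "x' \<in> L"
  proof -
    obtain c c' where "x = (\<Sum>s\<in>S. smult M (c s) s)" "\<forall>s\<in>S. c s \<in> regular_at_0"
      "x' = (\<Sum>s\<in>S. smult M (c' s) s)" "\<forall>s\<in>S. c' s \<in> regular_at_0" using xx unfolding S by blast
    then have "x + x' = (\<Sum>s\<in>S. smult M (c s + c' s) s)" "\<forall>s\<in>S. c s + c' s \<in> regular_at_0"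
      by (simp_all add: vs.scale_left_distrib sum.distrib)
    then show ?thesis unfolding S by (intro CollectI exI[of _ "\<lambda>s. c s + c' s"]) simp
  qed
  show "smult M c x \<in> L" if xc: "x \<in> L" "c \<in> regular_at_0"
  proof -
    obtain d where "x = (\<Sum>s\<in>S. smult M (d s) s)" "\<forall>s\<in>S. d s \<in> regular_at_0" using xc unfolding S by blast
    then have "smult M c x = (\<Sum>s\<in>S. smult M (c * d s) s)" "\<forall>s\<in>S. c * d s \<in> regular_at_0"
      using xc by (simp_all add: vs.scale_sum_right)
    then show ?thesis unfolding S by (intro CollectI exI[of _ "\<lambda>s. c * d s"]) simp
  qed
qed

lemma L_sum: "(\<And>i. i \<in> F \<Longrightarrow> f i \<in> L) \<Longrightarrow> sum f F \<in> L"
  using L_closed(2)[OF vL regular_0] by (induction F rule: infinite_finite_induct) (auto intro: L_closed)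

lemma L_stable: "1 \<le> i \<Longrightarrow> i < n \<Longrightarrow> x \<in> L \<Longrightarrow> ke i x \<in> L" "1 \<le> i \<Longrightarrow> i < n \<Longrightarrow> x \<in> L \<Longrightarrow> kf i x \<in> L"
  using cl unfolding crystal_lattice_def by auto

lemma gen_L: "gen b x \<Longrightarrow> x \<in> L"
  by (induction rule: gen.induct) (auto intro: vL L_stable)

lemma Lat_in_L:
  assumes "iota x \<in> Lat n N"
  shows "x \<in> L"
proof -
  obtain c where "x = (\<Sum>b\<in>wcomp n y. smult M (c b) (g b))" "\<forall>b\<in>wcomp n y. c b \<in> regular_at_0"
    using g_expand[of x] assms by blast
  then show ?thesis using gen_L[OF gen_g] by (auto intro!: L_sum L_closed)
qed

text \<open>The heart of the uniqueness of crystal lattices, by induction on a bound for letter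
  sums. If x were outside, a primitive multiple z = q^k x would have k > 0. The Kashiwara operators
  take x into the lattice of words by induction, so they kill the residue of z, which is then a
  multiple of y. Hence x has the highest weight and is a multiple of v, to which
  \<open>vprim\<close> applies.\<close>

lemma weight_L_in_Lat:
  assumes "x \<in> L" "x \<in> weight_space n M \<mu>"
  shows "iota x \<in> Lat n N"
proof -
  have "(\<And>w. iota x w \<noteq> 0 \<Longrightarrow> sum_list w < k) \<Longrightarrow> iota x \<in> Lat n N" for k
    using assms
  proof (induction k arbitrary: x \<mu>)
    case 0
    then have "iota x = 0" by (auto simp: fun_eq_iff fun_apply)
    then show ?case by simp
  next
    case (Suc k)
    show ?case
    proof (rule ccontr)
      assume notin: "iota x \<notin> Lat n N"
      then have "iota x \<noteq> 0" by auto
      then have "\<exists>w\<in>words n N. iota x w \<noteq> 0" using Wsp_outside[OF iota_Wsp[of x]] by (auto simp: fun_eq_iff fun_apply)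
      from q_scaling[OF finite_words this] obtain k0 :: int where
        k0: "\<And>w. w \<in> words n N \<Longrightarrow> qvar powi k0 * iota x w \<in> regular_at_0" "\<exists>w\<in>words n N. ev0 (qvar powi k0 * iota x w) \<noteq> 0" by blast
      define z where "z = smult M (qvar powi k0) x"
      have iz: "iota z = sc (qvar powi k0) (iota x)" by (simp add: z_def iota_smult)
      have "iota z w \<in> regular_at_0" for w
        using k0(1) Wsp_outside[OF iota_Wsp[of x], of w] unfolding iz by (cases "w \<in> words n N") (auto simp: fun_apply)
      then have zL: "iota z \<in> Lat n N" using iota_Wsp by (simp add: Lat_def)
      have kpos: "k0 > 0"
      proof (rule ccontr)
        assume "\<not> k0 > 0"
        then have "qvar powi (- k0) \<in> regular_at_0" by (intro regular_powi) simp
        from Lat_sc[OF zL this] have "iota x \<in> Lat n N" by (simp add: iz power_int_minus)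
        then show False using notin by simp
      qed
      have E: "red (iota z) u = 0" if i: "1 \<le> i" "i < n" and u: "weps i u > 0" for i u
      proof -
        interpret rank n i by unfold_locales (use i in auto)
        have "iota (ke i x) \<in> Lat n N"
        proof (rule Suc.IH)
          show "ke i x \<in> L" by (rule L_stable(1)[OF i Suc.prems(2)])
          show "ke i x \<in> weight_space n M (\<lambda>j. \<mu> j + cartan j i)"
          proof (rule weight_space_iota)
            fix j assume "1 \<le> j" "j < n"
            then show "wt (iota (ke i x)) j (\<mu> j + cartan j i)"
              unfolding iota_kashiwara_e[OF i] by (intro KE_wt[OF iota_Wsp] iota_wt[OF Suc.prems(3)])
          qed
          show "sum_list w < k" if "iota (ke i x) w \<noteq> 0" for w
            using KE_sum_list[OF iota_Wsp, of x w] that Suc.prems(1) unfolding iota_kashiwara_e[OF i] by fastforce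
        qed
        then have "KE n N i (iota x) \<in> Lat n N" by (simp add: iota_kashiwara_e[OF i])
        moreover have "qvar powi k0 \<in> regular_at_0" "ev0 (qvar powi k0) = 0"
          using kpos by (auto simp: power_int_def)
        ultimately have "red (KE n N i (iota z)) w = 0" for w
          unfolding iz KE_linear(2)[OF iota_Wsp] by (simp add: red_simps(3))
        from this[of "wet i u"] show ?thesis using u red_KE[OF zL, of "wet i u"] by simp
      qed
      have ym: "yam n t" if "red (iota z) t \<noteq> 0" for t
        unfolding yam_def using E that by (metis gr0I)
      obtain w where w: "red (iota z) w \<noteq> 0" using k0(2) by (auto simp: red_def iz fun_apply)
      have wy: "w = y" by (rule iota_red_yam[OF zL ym w])
      have xy: "iota x y \<noteq> 0" using w wy by (auto simp: red_def iz fun_apply)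
      have mu: "\<mu> j = wtw j y" if "1 \<le> j" "j < n" for j
        using wt_supportD[OF iota_wt[OF Suc.prems(3) that] xy] by simp
      obtain c l zz where X: "x = smult M c v + l" "iota x = sc c h + zz" "\<forall>w. zz w \<noteq> 0 \<longrightarrow> sum_list w > sum_list y"
        using X_leading[OF X_iota[of x]] by blast
      have "zz w = 0" for w
      proof (rule ccontr)
        assume zw: "zz w \<noteq> 0"
        then have s: "sum_list w > sum_list y" using X(3) by blast
        then have "h w = 0" using hms[of w] by (metis less_irrefl sum_mset_sum_list)
        then have xw: "iota x w \<noteq> 0" using zw X(2) by (simp add: fun_apply)
        have "mset w = mset y"
          by (rule words_content[OF WspD[OF iota_Wsp xw] y(1)]) (use wt_supportD[OF iota_wt[OF Suc.prems(3)] xw] mu in auto)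
        then show False using s by (metis less_irrefl sum_mset_sum_list)
      qed
      then have "iota x = sc c h" using X(2) by (auto simp: fun_eq_iff fun_apply)
      then have "x = smult M c v" by (intro iota_inj) (simp add: iota_smult iota_v)
      then have "c \<in> regular_at_0" using vprim Suc.prems(2) by simp
      then have "iota x \<in> Lat n N" using hL \<open>iota x = sc c h\<close> by simp
      then show False using notin by simp
    qed
  qed
  from this[of "Suc (Max (sum_list ` words n N))"] show ?thesis
    using WspD[OF iota_Wsp[of x]] by (simp add: less_Suc_eq_le)
qed

lemma L_iff: "x \<in> L \<longleftrightarrow> iota x \<in> Lat n N"
proof
  assume "x \<in> L"
  have "\<forall>u\<in>L. \<exists>P x. finite P \<and> (\<forall>\<mu>\<in>P. x \<mu> \<in> L \<inter> weight_space n M \<mu>) \<and> u = (\<Sum>\<mu>\<in>P. x \<mu>)"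
    using cl unfolding crystal_lattice_def by (elim conjE)
  from bspec[OF this \<open>x \<in> L\<close>] obtain P f where P: "finite P" "\<forall>\<mu>\<in>P. f \<mu> \<in> L \<inter> weight_space n M \<mu>" "x = sum f P"
    by (elim exE conjE)
  have isum: "iota (sum f Q) = (\<Sum>\<mu>\<in>Q. iota (f \<mu>))" for Q
    by (induction Q rule: infinite_finite_induct) (simp_all add: iota_0 iota_add)
  show "iota x \<in> Lat n N" unfolding P(3) isum
    by (rule Lat_sum) (use P(2) weight_L_in_Lat in blast)
qed (rule Lat_in_L)

abbreviation "rd x \<equiv> red (iota x)"
abbreviation "cst x \<equiv> lattice_coset M L x"

lemma rd_simps: "x \<in> L \<Longrightarrow> x' \<in> L \<Longrightarrow> rd (x + x') w = rd x w + rd x' w"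
  "x \<in> L \<Longrightarrow> x' \<in> L \<Longrightarrow> rd (x - x') w = rd x w - rd x' w"
  "x \<in> L \<Longrightarrow> c \<in> regular_at_0 \<Longrightarrow> rd (smult M c x) w = ev0 c * rd x w"
  by (simp_all add: L_iff iota_add iota_diff iota_smult red_simps)

lemma rd_0: "rd 0 w = 0"
  by (simp add: iota_0 red_def fun_apply)

lemma L_0: "0 \<in> L"
  by (simp add: L_iff iota_0)

lemma rd_sum: "(\<And>i. i \<in> F \<Longrightarrow> f i \<in> L) \<Longrightarrow> rd (sum f F) w = (\<Sum>i\<in>F. rd (f i) w)"
  by (induction F rule: infinite_finite_induct) (auto simp: rd_simps rd_0 L_sum)

lemma L_diff: "x \<in> L \<Longrightarrow> x' \<in> L \<Longrightarrow> x - x' \<in> L"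
  by (simp add: L_iff iota_diff)

lemma cosI: "u \<in> cst u"
  unfolding lattice_coset_def using L_0 by (auto intro!: exI[of _ 0])

lemma cos_mem: "u' \<in> cst u \<Longrightarrow> u \<in> L \<Longrightarrow> u' \<in> L \<and> (\<forall>w. rd u' w = rd u w)"
  unfolding lattice_coset_def by (auto simp: rd_simps L_closed)

lemma rd_0_D:
  assumes "x \<in> L" "\<And>w. rd x w = 0"
  shows "\<exists>x'\<in>L. x = smult M qvar x'"
proof -
  let ?x' = "smult M (inverse qvar) x"
  have "iota ?x' w \<in> regular_at_0" for w
  proof -
    have "iota x w \<in> regular_at_0" "ev0 (iota x w) = 0" using assms by (auto simp: L_iff Lat_def red_def)
    then obtain r where "r \<in> regular_at_0" "iota x w = qvar * r" by (rule ev0_eq_0_D)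
    then show ?thesis by (simp add: iota_smult fun_apply mult.assoc[symmetric])
  qed
  then have "?x' \<in> L" using iota_Wsp by (simp add: L_iff Lat_def)
  moreover have "x = smult M qvar ?x'" by simp
  ultimately show ?thesis by blast
qed

lemma cos_eq_iff:
  assumes "u \<in> L" "u' \<in> L"
  shows "cst u = cst u' \<longleftrightarrow> (\<forall>w. rd u w = rd u' w)"
proof
  assume "cst u = cst u'"
  then have "u \<in> cst u'" using cosI by blast
  then show "\<forall>w. rd u w = rd u' w" using cos_mem assms by blast
next
  assume r: "\<forall>w. rd u w = rd u' w"
  have sub: "cst u \<subseteq> cst u'" if "u \<in> L" "u' \<in> L" "\<forall>w. rd u w = rd u' w" for u u'
  proof
    fix t assume "t \<in> cst u"
    then obtain x where x: "x \<in> L" "t = u + smult M qvar x" unfolding lattice_coset_def by blast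
    have "rd (u - u') w = 0" for w using that by (simp add: rd_simps)
    from rd_0_D[OF L_diff[OF that(1,2)] this] obtain x' where x': "x' \<in> L" "u - u' = smult M qvar x'" by blast
    have "t = u' + smult M qvar (x' + x)" using x x' by (simp add: vs.scale_right_distrib algebra_simps)
    then show "t \<in> cst u'" unfolding lattice_coset_def using L_closed(1)[OF x'(1) x(1)] by blast
  qed
  show "cst u = cst u'" using sub[of u u'] sub[of u' u] assms r by auto
qed

lemma crystal_e_cos:
  assumes i: "1 \<le> i" "i < n" and u: "u \<in> L"
  shows "crystal_e n M L i (cst u) = cst (ke i u)"
proof -
  interpret rank n i by unfold_locales (use i in auto)
  have "cst (ke i u') = cst (ke i u)" if "u' \<in> cst u" for u'
  proof -
    have u': "u' \<in> L" "\<And>w. rd u' w = rd u w" using cos_mem[OF that u] by auto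
    have "rd (ke i u') w = rd (ke i u) w" for w
      using red_KE[of "iota u'" N w] red_KE[of "iota u" N w] u u' unfolding iota_kashiwara_e[OF i] L_iff by presburger
    then show ?thesis using cos_eq_iff[OF L_stable(1)[OF i u'(1)] L_stable(1)[OF i u]] by blast
  qed
  then have "crystal_e n M L i (cst u) = (\<Union>u'\<in>cst u. cst (ke i u))"
    unfolding crystal_e_def by (rule SUP_cong[OF refl])
  also have "\<dots> = cst (ke i u)" using cosI[of u] by auto
  finally show ?thesis .
qed

lemma crystal_f_cos:
  assumes i: "1 \<le> i" "i < n" and u: "u \<in> L"
  shows "crystal_f n M L i (cst u) = cst (kf i u)"
proof -
  interpret rank n i by unfold_locales (use i in auto)
  have "cst (kf i u') = cst (kf i u)" if "u' \<in> cst u" for u'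
  proof -
    have u': "u' \<in> L" "\<And>w. rd u' w = rd u w" using cos_mem[OF that u] by auto
    have "rd (kf i u') w = rd (kf i u) w" for w
      using red_KF[of "iota u'" N w] red_KF[of "iota u" N w] u u' unfolding iota_kashiwara_f[OF i] L_iff by presburger
    then show ?thesis using cos_eq_iff[OF L_stable(2)[OF i u'(1)] L_stable(2)[OF i u]] by blast
  qed
  then have "crystal_f n M L i (cst u) = (\<Union>u'\<in>cst u. cst (kf i u))"
    unfolding crystal_f_def by (rule SUP_cong[OF refl])
  also have "\<dots> = cst (kf i u)" using cosI[of u] by auto
  finally show ?thesis .
qed

lemma B_cos: "b \<in> B \<Longrightarrow> \<exists>u\<in>L. b = cst u" and finite_B: "finite B"
  using cb unfolding crystal_base_def quotient_basis_def by auto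

lemma B_stable: "1 \<le> i \<Longrightarrow> i < n \<Longrightarrow> b \<in> B \<Longrightarrow> crystal_e n M L i b \<in> B \<union> {cst 0}"
  "1 \<le> i \<Longrightarrow> i < n \<Longrightarrow> b \<in> B \<Longrightarrow> crystal_f n M L i b \<in> B \<union> {cst 0}"
  using cb unfolding crystal_base_def by auto

text \<open>The residue vector of a class in L / qL; by \<open>cos_mem\<close> the choice of the
  representative does not matter.\<close>

definition rho :: "'a set \<Rightarrow> nat list \<Rightarrow> rat" where "rho b = rd (SOME u. u \<in> b)"

lemma rho_cos: "u \<in> L \<Longrightarrow> rho (cst u) w = rd u w"
  unfolding rho_def using someI[of "\<lambda>t. t \<in> cst u" u] cosI cos_mem by blast

lemma some_L: "b \<in> B \<Longrightarrow> (SOME u. u \<in> b) \<in> L"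
  using B_cos[of b] someI[of "\<lambda>t. t \<in> b"] cosI cos_mem by blast

lemma B_basis:
  assumes "x \<in> L"
  shows "\<exists>!c. c \<in> B \<rightarrow>\<^sub>E UNIV \<and> (\<forall>w. rd x w = (\<Sum>b\<in>B. c b * rho b w))"
proof -
  have eq: "(cst x = cst (\<Sum>b\<in>B. smult M (qconst (c b)) (SOME u. u \<in> b))) \<longleftrightarrow> (\<forall>w. rd x w = (\<Sum>b\<in>B. c b * rho b w))" for c
  proof -
    have L: "smult M (qconst (c b)) (SOME u. u \<in> b) \<in> L" if "b \<in> B" for b using some_L[OF that] L_closed(2) by simp
    have "rd (\<Sum>b\<in>B. smult M (qconst (c b)) (SOME u. u \<in> b)) w = (\<Sum>b\<in>B. c b * rho b w)" for w
      by (subst rd_sum) (use L some_L in \<open>auto simp: rd_simps rho_def intro!: sum.cong\<close>)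
    then show ?thesis using cos_eq_iff[OF assms L_sum[of B, OF L]] by simp
  qed
  have "\<forall>x\<in>L. \<exists>!c. c \<in> B \<rightarrow>\<^sub>E UNIV \<and> cst x = cst (\<Sum>b\<in>B. smult M (qconst (c b)) (SOME u. u \<in> b))"
    using cb unfolding crystal_base_def quotient_basis_def by (elim conjE)
  from bspec[OF this assms] show ?thesis unfolding eq .
qed

text \<open>A class with zero residue could carry any coefficient in an expansion of 0.\<close>

lemma rho_nonzero:
  assumes "b \<in> B"
  shows "\<exists>w. rho b w \<noteq> 0"
proof (rule ccontr)
  assume "\<nexists>w. rho b w \<noteq> 0"
  then have r: "rho b w = 0" for w by blast
  have "\<exists>!c. c \<in> B \<rightarrow>\<^sub>E UNIV \<and> (\<forall>w. rd 0 w = (\<Sum>b\<in>B. c b * rho b w))" by (rule B_basis[OF L_0])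
  moreover have "(\<lambda>b'\<in>B. 0) \<in> B \<rightarrow>\<^sub>E UNIV \<and> (\<forall>w. rd 0 w = (\<Sum>b'\<in>B. (\<lambda>b'\<in>B. 0) b' * rho b' w))"
    by (auto simp: rd_0 intro!: sum.neutral[symmetric])
  moreover have "(\<lambda>b'\<in>B. if b' = b then 1 else 0) \<in> B \<rightarrow>\<^sub>E UNIV \<and> (\<forall>w. rd 0 w = (\<Sum>b'\<in>B. (\<lambda>b'\<in>B. if b' = b then 1 else 0) b' * rho b' w))"
    by (auto simp: rd_0 r intro!: sum.neutral)
  ultimately have "(\<lambda>b'\<in>B. 0::rat) = (\<lambda>b'\<in>B. if b' = b then 1 else 0)" by blast
  from fun_cong[OF this, of b] show False using assms by simp
qed

lemma B_memI: "1 \<le> i \<Longrightarrow> i < n \<Longrightarrow> u \<in> L \<Longrightarrow> cst u \<in> B \<Longrightarrow> rd (ke i u) w \<noteq> 0 \<Longrightarrow> cst (ke i u) \<in> B"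
  "1 \<le> i \<Longrightarrow> i < n \<Longrightarrow> u \<in> L \<Longrightarrow> cst u \<in> B \<Longrightarrow> rd (kf i u) w \<noteq> 0 \<Longrightarrow> cst (kf i u) \<in> B"
  using B_stable(1)[of i "cst u"] B_stable(2)[of i "cst u"] crystal_e_cos[of i u] crystal_f_cos[of i u]
    cos_eq_iff[OF L_stable(1) L_0, of i u] cos_eq_iff[OF L_stable(2) L_0, of i u] rd_0 by auto

text \<open>From any element of B, raising stays in B as long as the result is nonzero, and it
  lowers the letter sums. The process ends at a class killed by all raising operators, whose residue
  is a multiple of y.\<close>

lemma highest_in_B: "\<exists>c. c \<noteq> 0 \<and> cst (smult M (qconst c) v) \<in> B"
proof -
  have "B \<noteq> {}"
  proof
    assume "B = {}"
    then have "rd v w = 0" for w using B_basis[OF vL] by auto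
    then show False using hred[of y] by (simp add: iota_v)
  qed
  then obtain b where "b \<in> B" by blast
  then obtain u where u: "u \<in> L" "cst u \<in> B" using B_cos by blast
  have "(\<And>w. rd u w \<noteq> 0 \<Longrightarrow> sum_list w < k) \<Longrightarrow> ?thesis" for k
    using u
  proof (induction k arbitrary: u)
    case 0
    then show ?case using rho_nonzero[of "cst u"] rho_cos[of u] by auto
  next
    case (Suc k)
    show ?case
    proof (cases "\<exists>i t. 1 \<le> i \<and> i < n \<and> weps i t > 0 \<and> rd u t \<noteq> 0")
      case True
      then obtain i t where i: "1 \<le> i" "i < n" and t: "weps i t > 0" "rd u t \<noteq> 0" by blast
      interpret rank n i by unfold_locales (use i in auto)
      have r: "rd (ke i u) s = (if wphi i s > 0 then rd u (wft i s) else 0)" for s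
        using red_KE[of "iota u" N s] Suc.prems(2) by (simp add: iota_kashiwara_e[OF i] L_iff)
      show ?thesis
      proof (rule Suc.IH)
        show "ke i u \<in> L" by (rule L_stable(1)[OF i Suc.prems(2)])
        have "rd (ke i u) (wet i t) \<noteq> 0" using t by (simp add: r)
        then show "cst (ke i u) \<in> B" by (rule B_memI(1)[OF i Suc.prems(2,3)])
        show "sum_list s < k" if "rd (ke i u) s \<noteq> 0" for s
          using that Suc.prems(1)[of "wft i s"] sum_list_wft[of i s] by (auto simp: r split: if_splits)
      qed
    next
      case False
      then have ym: "yam n t" if "rd u t \<noteq> 0" for t using that unfolding yam_def by (metis gr0I)
      have uL: "iota u \<in> Lat n N" using Suc.prems(2) by (simp add: L_iff)
      have only: "t = y" if "rd u t \<noteq> 0" for t by (rule iota_red_yam[OF uL ym that])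
      obtain s where "rd u s \<noteq> 0" using rho_nonzero[OF Suc.prems(3)] rho_cos[OF Suc.prems(2)] by auto
      then have nz: "rd u y \<noteq> 0" using only by blast
      have "rd u t = rd (smult M (qconst (rd u y)) v) t" for t
        using only[of t] hred[of t] by (cases "t = y") (auto simp: rd_simps(3)[OF vL regular_qconst] iota_v)
      then have "cst u = cst (smult M (qconst (rd u y)) v)"
        using cos_eq_iff[OF Suc.prems(2) L_closed(2)[OF vL regular_qconst]] by blast
      then show ?thesis using Suc.prems(3) nz by auto
    qed
  qed
  from this[of "Suc (Max (sum_list ` words n N))"] show ?thesis
    using red_outside[of "iota u" n N] u by (metis L_iff Max_ge finite_imageI finite_words image_eqI le_imp_less_Suc)
qed

end

section \<open>The bijection between the component and the crystal\<close>

locale crystal_irrep_B = crystal_irrep +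
  assumes vB: "lattice_coset M L v \<in> B"
begin

definition beta :: "nat list \<Rightarrow> 'a set" where "beta b = cst (g b)"

lemma gen_B: "gen b x \<Longrightarrow> x \<in> L \<and> cst x \<in> B"
proof (induction rule: gen.induct)
  case gen_base
  then show ?case using vL vB by blast
next
  case (gen_f b x i)
  have "rd (kf i x) (wft i b) \<noteq> 0" using gen_props[OF gen.gen_f[OF gen_f(1-4)]] by simp
  then show ?case using B_memI(2)[of i x] L_stable(2)[of i x] gen_f by blast
next
  case (gen_e b x i)
  have "rd (ke i x) (wet i b) \<noteq> 0" using gen_props[OF gen.gen_e[OF gen_e(1-4)]] by simp
  then show ?case using B_memI(1)[of i x] L_stable(1)[of i x] gen_e by blast
qed

lemma g_L: "b \<in> wcomp n y \<Longrightarrow> g b \<in> L" and beta_B: "b \<in> wcomp n y \<Longrightarrow> beta b \<in> B"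
  using gen_B[OF gen_g] by (auto simp: beta_def)

lemma beta_eqI: "b \<in> wcomp n y \<Longrightarrow> u \<in> L \<Longrightarrow> (\<And>w. rd u w = of_bool (w = b)) \<Longrightarrow> beta b = cst u"
  unfolding beta_def by (subst cos_eq_iff) (simp_all add: g_L g_props)

lemma rho_beta: "b \<in> wcomp n y \<Longrightarrow> rho (beta b) w = of_bool (w = b)"
  by (simp add: beta_def rho_cos g_L g_props)

lemma beta_inj: "inj_on beta (wcomp n y)"
proof (rule inj_onI)
  fix b b' assume "b \<in> wcomp n y" "b' \<in> wcomp n y" "beta b = beta b'"
  then have "(of_bool (b = b) :: rat) = of_bool (b = b')" by (metis rho_beta)
  then show "b = b'" by (auto split: if_splits)
qed

text \<open>The lifts expand every class over the image of \<open>beta\<close>, so an element of B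
  outside the image would have two expansions: itself and one over the image.\<close>

lemma beta_surj: "beta ` wcomp n y = B"
proof
  show "beta ` wcomp n y \<subseteq> B" using beta_B by blast
  show "B \<subseteq> beta ` wcomp n y"
  proof
    fix b assume b: "b \<in> B"
    obtain u where u: "u \<in> L" "b = cst u" using B_cos[OF b] by blast
    show "b \<in> beta ` wcomp n y"
    proof (rule ccontr)
      assume nb: "b \<notin> beta ` wcomp n y"
      obtain d where d: "u = (\<Sum>a\<in>wcomp n y. smult M (d a) (g a))" "\<forall>a\<in>wcomp n y. d a \<in> regular_at_0"
        using g_expand[of u] u(1) by (auto simp: L_iff)
      have rdu: "rd u w = (\<Sum>a\<in>wcomp n y. ev0 (d a) * rho (beta a) w)" for w
        unfolding d(1) by (subst rd_sum) (use d(2) g_L in \<open>auto simp: rd_simps rho_beta g_props L_closed intro!: sum.cong\<close>)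
      let ?c1 = "\<lambda>b'\<in>B. if b' = b then 1 else (0::rat)"
      let ?c2 = "\<lambda>b'\<in>B. if b' \<in> beta ` wcomp n y then ev0 (d (inv_into (wcomp n y) beta b')) else 0"
      have 1: "?c1 \<in> B \<rightarrow>\<^sub>E UNIV \<and> (\<forall>w. rd u w = (\<Sum>b'\<in>B. ?c1 b' * rho b' w))"
      proof -
        have "(\<Sum>b'\<in>B. ?c1 b' * rho b' w) = (\<Sum>b'\<in>B. if b' = b then rho b w else 0)" for w
          by (intro sum.cong) auto
        then show ?thesis using finite_B b u by (auto simp: sum.delta rho_cos)
      qed
      have 2: "?c2 \<in> B \<rightarrow>\<^sub>E UNIV \<and> (\<forall>w. rd u w = (\<Sum>b'\<in>B. ?c2 b' * rho b' w))"
      proof -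
        have "(\<Sum>b'\<in>B. ?c2 b' * rho b' w) = (\<Sum>b'\<in>beta ` wcomp n y. ev0 (d (inv_into (wcomp n y) beta b')) * rho b' w)" for w
          by (rule sum.mono_neutral_cong_right) (use finite_B beta_B in auto)
        also have "\<dots> w = (\<Sum>a\<in>wcomp n y. ev0 (d a) * rho (beta a) w)" for w
          by (subst sum.reindex[OF beta_inj]) (auto simp: inv_into_f_f[OF beta_inj] intro!: sum.cong)
        finally show ?thesis using rdu by simp
      qed
      have "?c1 = ?c2" using B_basis[OF u(1)] 1 2 by blast
      from fun_cong[OF this, of b] show False using b nb by simp
    qed
  qed
qed

lemma beta_bij: "bij_betw beta (wcomp n y) B"
  using beta_inj beta_surj by (simp add: bij_betw_def)

lemma beta_weight:
  assumes b: "b \<in> wcomp n y"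
  shows "beta b \<in> crystal_of_weight n M L B (\<lambda>_. 0) \<longleftrightarrow> (\<forall>i. 1 \<le> i \<longrightarrow> i < n \<longrightarrow> wtw i b = 0)"
proof
  assume "beta b \<in> crystal_of_weight n M L B (\<lambda>_. 0)"
  then obtain u where u: "u \<in> L" "u \<in> weight_space n M (\<lambda>_. 0)" "beta b = cst u" unfolding crystal_of_weight_def by blast
  have "rd u b = rho (beta b) b" using u rho_cos by simp
  then have "iota u b \<noteq> 0" using rho_beta[OF b, of b] by (auto simp: red_def)
  then show "\<forall>i. 1 \<le> i \<longrightarrow> i < n \<longrightarrow> wtw i b = 0" using wt_supportD[OF iota_wt[OF u(2)]] by blast
next
  assume "\<forall>i. 1 \<le> i \<longrightarrow> i < n \<longrightarrow> wtw i b = 0"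
  then have "g b \<in> weight_space n M (\<lambda>_. 0)" using g_props(3)[OF b] by (simp add: weight_space_def)
  then show "beta b \<in> crystal_of_weight n M L B (\<lambda>_. 0)"
    unfolding crystal_of_weight_def using beta_B[OF b] g_L[OF b] by (auto simp: beta_def)
qed

text \<open>A class that has become zero stays zero, so the exponents over which
  \<open>GREATEST\<close> ranges are exactly those up to \<open>weps i b\<close>.\<close>

lemma beta_eps:
  assumes i: "1 \<le> i" "i < n" and b: "b \<in> wcomp n y"
  shows "crystal_eps n M L i (beta b) = weps i b"
proof -
  interpret rank n i by unfold_locales (use i in auto)
  have step: "crystal_e n M L i (beta b) = (if weps i b > 0 then beta (wet i b) else cst 0)" if b: "b \<in> wcomp n y" for b
  proof -
    have e: "crystal_e n M L i (beta b) = cst (ke i (g b))" unfolding beta_def by (rule crystal_e_cos[OF i g_L[OF b]])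
    have r: "rd (ke i (g b)) w = (if wphi i w > 0 then of_bool (wft i w = b) else 0)" for w
      using red_KE[OF g_props(1)[OF b], of w] g_props(2)[OF b] by (simp add: iota_kashiwara_e[OF i])
    have kL: "ke i (g b) \<in> L" by (rule L_stable(1)[OF i g_L[OF b]])
    show ?thesis
    proof (cases "weps i b > 0")
      case True
      have "rd (ke i (g b)) w = of_bool (w = wet i b)" for w
      proof (cases "wphi i w > 0 \<and> wft i w = b")
        case T: True
        then have "w = wet i b" by auto
        then show ?thesis using T by (simp add: r)
      next
        case F: False
        then have "w \<noteq> wet i b" using True by auto
        then show ?thesis using F by (auto simp: r)
      qed
      then have "beta (wet i b) = cst (ke i (g b))" by (intro beta_eqI comp_e b i True kL)
      then show ?thesis using e True by simp
    next
      case False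
      have "rd (ke i (g b)) w = 0" for w using False by (auto simp: r)
      then have "cst (ke i (g b)) = cst 0" using cos_eq_iff[OF kL L_0] by (simp add: rd_0)
      then show ?thesis using e False by simp
    qed
  qed
  have zero: "crystal_e n M L i (cst 0) = cst 0"
  proof -
    have "ke i 0 = 0" by (rule iota_inj) (simp add: iota_kashiwara_e[OF i] iota_0 KE_0)
    then show ?thesis using crystal_e_cos[OF i L_0] by simp
  qed
  have pow: "(crystal_e n M L i ^^ k) (beta b) = (if k \<le> weps i b then beta ((wet i ^^ k) b) else cst 0) \<and>
     (k \<le> weps i b \<longrightarrow> (wet i ^^ k) b \<in> wcomp n y)" for k
  proof (induction k)
    case (Suc k)
    show ?case
    proof (cases "Suc k \<le> weps i b")
      case True
      have m: "(wet i ^^ k) b \<in> wcomp n y" "weps i ((wet i ^^ k) b) > 0" using Suc True wet_pow[of k b] by auto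
      then show ?thesis using Suc True step[OF m(1)] comp_e[OF m(1) i m(2)] by simp
    next
      case False
      show ?thesis
      proof (cases "k \<le> weps i b")
        case True
        then have "weps i ((wet i ^^ k) b) = 0" "(wet i ^^ k) b \<in> wcomp n y" using wet_pow[of k b] False Suc by auto
        then show ?thesis using Suc True False step by simp
      next
        case F: False
        then show ?thesis using Suc False zero by simp
      qed
    qed
  qed (use b in simp)
  have nz: "beta a \<noteq> cst 0" if "a \<in> wcomp n y" for a
    using rho_beta[OF that, of a] rho_cos[OF L_0, of a] rd_0 by auto
  have "(crystal_e n M L i ^^ k) (beta b) \<noteq> cst 0 \<longleftrightarrow> k \<le> weps i b" for k
    using pow[of k] nz by auto
  then show ?thesis unfolding crystal_eps_def by (simp add: Greatest_equality)
qed

end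

text \<open>The highest weight vector is rescaled twice: by c, to generate the intersection of its
  line with L, then by the rational e, to bring its class into B. The second factor is a unit of
  \<open>regular_at_0\<close>, so the first property is kept.\<close>

theorem crystal_base_words:
  assumes irr: "irreducible_of_highest_weight n M a" and cb: "crystal_base n M L B"
    and y: "y \<in> words n N" "yam n y" "\<forall>i\<in>{1..<n}. wtw i y = int (a i)"
  obtains \<beta> where "bij_betw \<beta> (wcomp n y) B"
    "\<And>b. b \<in> wcomp n y \<Longrightarrow> \<beta> b \<in> crystal_of_weight n M L B (\<lambda>_. 0) \<longleftrightarrow> (\<forall>i. 1 \<le> i \<longrightarrow> i < n \<longrightarrow> wtw i b = 0)"
    "\<And>b i. 1 \<le> i \<Longrightarrow> i < n \<Longrightarrow> b \<in> wcomp n y \<Longrightarrow> crystal_eps n M L i (\<beta> b) = weps i b"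
    "\<And>b. b \<in> wcomp n y \<Longrightarrow> yam n b \<Longrightarrow> b = y"
proof -
  obtain h where h: "hwvec n N y h" using hwvec_exists[OF y(1,2)] by blast
  obtain v where v: "v \<noteq> 0" "v \<in> weight_space n M (\<lambda>i. int (a i))" "\<forall>i\<in>{1..<n}. opE M i v = 0"
    using irr unfolding irreducible_of_highest_weight_def by blast
  have loc: "irrep n N M a y v' h" if "v' \<noteq> 0" "v' \<in> weight_space n M (\<lambda>i. int (a i))" "\<forall>i\<in>{1..<n}. opE M i v' = 0" for v'
    by unfold_locales (use irr that y h in auto)
  interpret I1: irrep n N M a y v h by (rule loc[OF v])
  have loc': "irrep n N M a y (smult M c v) h" if "c \<noteq> 0" for c
  proof (rule loc)
    show "smult M c v \<noteq> 0" using that v(1) by simp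
    show "smult M c v \<in> weight_space n M (\<lambda>i. int (a i))" by (rule I1.weight_space_linear(2)[OF v(2)])
    show "\<forall>i\<in>{1..<n}. opE M i (smult M c v) = 0" using v(3) by (simp add: I1.ops_linear)
  qed
  have "crystal_lattice n M L" using cb by (simp add: crystal_base_def)
  then obtain c where c: "c \<noteq> 0" "smult M c v \<in> L" "\<forall>d. smult M d (smult M c v) \<in> L \<longrightarrow> d \<in> regular_at_0"
    using I1.primitive_multiple by blast
  interpret I2: crystal_irrep n N M a y "smult M c v" h L B
    by (intro crystal_irrep.intro loc' c(1) crystal_irrep_axioms.intro cb) (use c in auto)
  obtain e where e: "e \<noteq> 0" "lattice_coset M L (smult M (qconst e) (smult M c v)) \<in> B" using I2.highest_in_B by blast
  have qe: "qconst e \<noteq> 0" using e(1) by (metis ev0_0 ev0_qconst)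
  define v' where "v' = smult M (qconst e * c) v"
  have v': "v' = smult M (qconst e) (smult M c v)" by (simp add: v'_def)
  have i3: "irrep n N M a y v' h" unfolding v'_def using qe c(1) by (intro loc') simp
  have "crystal_irrep n N M a y v' h L B"
  proof (intro crystal_irrep.intro i3 crystal_irrep_axioms.intro cb)
    show "v' \<in> L" unfolding v' by (rule I2.L_closed(2)[OF c(2)]) simp
    show "d \<in> regular_at_0" if "smult M d v' \<in> L" for d
    proof -
      have "smult M (d * qconst e) (smult M c v) \<in> L" using that by (simp add: v' mult.assoc)
      then have "d * qconst e \<in> regular_at_0" using c(3) by blast
      moreover have "inverse (qconst e) \<in> regular_at_0" using regular_inverse(1)[of "qconst e"] e(1) by simp
      ultimately have "d * qconst e * inverse (qconst e) \<in> regular_at_0" by (rule regular_mult)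
      then show ?thesis using qe by (simp add: mult.assoc)
    qed
  qed
  then interpret I3: crystal_irrep_B n N M a y v' h L B
    by (intro crystal_irrep_B.intro crystal_irrep_B_axioms.intro) (use e v' in auto)
  show ?thesis
    by (rule that[OF I3.beta_bij I3.beta_weight I3.beta_eps I3.comp_yam])
qed

section \<open>Reflections\<close>

definition srprod :: "nat list \<Rightarrow> nat \<Rightarrow> nat" where
  "srprod js = foldr (\<circ>) (map simple_reflection js) id"

lemma srprod_simps [simp]: "srprod [] = id" "srprod (j # js) = transpose j (Suc j) \<circ> srprod js"
  by (simp_all add: srprod_def simple_reflection_def)

lemma srprod_append: "srprod (js @ ks) = srprod js \<circ> srprod ks"
  by (induction js) (auto simp: comp_assoc)

lemma srprod_sign: "sign (srprod js) = (-1) ^ length js"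
proof (induction js)
  case (Cons j js)
  have "permutation (srprod js)"
    by (induction js) (auto intro: permutation_compose permutation_swap_id permutation_id simp del: comp_apply)
  then show ?case using Cons by (simp add: sign_compose permutation_swap_id sign_swap_id del: comp_apply)
qed simp

lemma transpose_srprod:
  assumes "1 \<le> a"
  shows "a < b \<Longrightarrow> b \<le> n \<Longrightarrow> \<exists>js. set js \<subseteq> {1..<n} \<and> transpose a b = srprod js"
proof (induction b)
  case (Suc b)
  show ?case
  proof (cases "a = b")
    case True
    then show ?thesis using Suc assms by (intro exI[of _ "[b]"]) auto
  next
    case False
    then obtain js where js: "set js \<subseteq> {1..<n}" "transpose a b = srprod js" using Suc by auto
    have "transpose a (Suc b) = transpose b (Suc b) \<circ> transpose a b \<circ> transpose b (Suc b)"
      using False Suc by (auto simp: fun_eq_iff transpose_def)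
    then have "transpose a (Suc b) = srprod (b # js @ [b])" using js by (simp add: srprod_append comp_assoc)
    then show ?thesis using js Suc assms by (intro exI[of _ "b # js @ [b]"]) auto
  qed
qed simp

lemma permutes_srprod:
  assumes "w permutes {1..n}"
  shows "\<exists>js. set js \<subseteq> {1..<n} \<and> w = srprod js"
  using assms finite_atLeastAtMost
proof (induction rule: permutes_induct)
  case id
  show ?case by (intro exI[of _ "[]"]) simp
next
  case (swap a b p)
  obtain ks where ks: "set ks \<subseteq> {1..<n}" "p = srprod ks" using swap by blast
  have "\<exists>js. set js \<subseteq> {1..<n} \<and> transpose a b = srprod js"
  proof (cases "a < b")
    case True
    then show ?thesis using transpose_srprod[of a b n] swap by simp
  next
    case False
    then have "b < a" using swap by simp
    then show ?thesis using transpose_srprod[of b a n] swap by (simp add: transpose_commute)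
  qed
  then obtain js where "set js \<subseteq> {1..<n}" "transpose a b = srprod js" by blast
  then show ?case using ks by (intro exI[of _ "js @ ks"]) (simp add: srprod_append)
qed

text \<open>The minimum in \<open>weyl_length\<close> is attained because
  \<open>permutes_srprod\<close> provides some expression in simple reflections; the sign is the
  parity of any such expression.\<close>

lemma weyl_length_sign:
  assumes "w permutes {1..n}"
  shows "(-1) ^ weyl_length n w = (of_int (sign w) :: 'a::ring_1)"
proof -
  let ?P = "\<lambda>l. \<exists>js. length js = l \<and> set js \<subseteq> {1..<n} \<and> w = foldr (\<circ>) (map simple_reflection js) id"
  have "\<exists>l. ?P l" using permutes_srprod[OF assms] unfolding srprod_def by blast
  then have "?P (weyl_length n w)" unfolding weyl_length_def by (rule LeastI_ex)
  then obtain js where "length js = weyl_length n w" "w = srprod js" unfolding srprod_def by blast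
  then show ?thesis using srprod_sign[of js] by simp
qed

lemma antisymmetric_sign:
  assumes A: "\<And>\<nu> i. 1 \<le> i \<Longrightarrow> i < n \<Longrightarrow> A (\<nu> \<circ> transpose i (Suc i)) = - (A \<nu> :: 'r::ring_1)"
    and w: "w permutes {1..n}"
  shows "A (\<nu> \<circ> w) = of_int (sign w) * A \<nu>"
proof -
  have "set js \<subseteq> {1..<n} \<Longrightarrow> A (\<nu> \<circ> srprod js) = (-1) ^ length js * A \<nu>" for js \<nu>
  proof (induction js arbitrary: \<nu>)
    case (Cons j js)
    have "set js \<subseteq> {1..<n}" "1 \<le> j" "j < n" using Cons.prems by auto
    then have "A ((\<nu> \<circ> transpose j (Suc j)) \<circ> srprod js) = (-1) ^ length js * - A \<nu>"
      using Cons.IH[of "\<nu> \<circ> transpose j (Suc j)"] A[of j \<nu>] by (simp only:)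
    then show ?case by (simp add: comp_assoc del: comp_apply)
  qed simp
  moreover obtain js where "set js \<subseteq> {1..<n}" "w = srprod js" using permutes_srprod[OF w] by blast
  ultimately show ?thesis using srprod_sign[of js] by simp
qed

section \<open>Cancellation in the crystal of words\<close>

text \<open>Multiplicities of letters form a weight of gl_n; subtracting their mean N / n projects
  it to the sum-zero hyperplane, where \<open>fundamental_weight\<close> lives.\<close>

definition wtr :: "nat \<Rightarrow> nat \<Rightarrow> nat list \<Rightarrow> weight" where
  "wtr n N b = (\<lambda>k. if k \<in> {1..n} then of_nat (count_list b k) - of_nat N / of_nat n else 0)"

lemma wtr_wtw: "1 \<le> i \<Longrightarrow> i < n \<Longrightarrow> wtr n N b i - wtr n N b (Suc i) = of_int (wtw i b)"
  by (simp add: wtr_def wtw_def)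

text \<open>
  The index \<open>i\<close> for which \<open>\<epsilon>\<^sub>i \<le> \<mu>\<^sub>i\<close> fails on the shortest possible suffix. It is unchanged along the part of the
  \<open>i\<close>-string on which \<open>\<epsilon>\<^sub>i > \<mu>\<^sub>i\<close>, which makes the reflection in \<open>cancellation\<close> an involution.
\<close>

primrec bad :: "(nat \<Rightarrow> nat) \<Rightarrow> nat list \<Rightarrow> nat option" where
  "bad \<mu> [] = None"
| "bad \<mu> (a # w) = (case bad \<mu> w of Some i \<Rightarrow> Some i
     | None \<Rightarrow> if 2 \<le> a \<and> weps (a - 1) (a # w) > \<mu> (a - 1) then Some (a - 1) else None)"

lemma bad_None: "set w \<subseteq> {1..n} \<Longrightarrow> bad \<mu> w = None \<longleftrightarrow> (\<forall>i. 1 \<le> i \<longrightarrow> i < n \<longrightarrow> weps i w \<le> \<mu> i)"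
proof (induction w)
  case (Cons a w)
  have mono: "weps i w \<le> weps i (a # w)" for i by simp
  have same: "weps i (a # w) = weps i w" if "a \<noteq> Suc i" for i using that by simp
  show ?case
  proof (cases "bad \<mu> w")
    case None
    then have w: "\<forall>i. 1 \<le> i \<longrightarrow> i < n \<longrightarrow> weps i w \<le> \<mu> i" using Cons by simp
    show ?thesis
    proof
      assume b: "bad \<mu> (a # w) = None"
      show "\<forall>i. 1 \<le> i \<longrightarrow> i < n \<longrightarrow> weps i (a # w) \<le> \<mu> i"
      proof (intro allI impI)
        fix i assume i: "1 \<le> i" "i < n"
        show "weps i (a # w) \<le> \<mu> i"
        proof (cases "a = Suc i")
          case True
          then show ?thesis using b None i by (auto simp del: weps.simps split: if_splits)
        next
          case False
          then show ?thesis using same[OF False] w i by metis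
        qed
      qed
    next
      assume r: "\<forall>i. 1 \<le> i \<longrightarrow> i < n \<longrightarrow> weps i (a # w) \<le> \<mu> i"
      have "\<not> (2 \<le> a \<and> weps (a - 1) (a # w) > \<mu> (a - 1))"
      proof
        assume h: "2 \<le> a \<and> weps (a - 1) (a # w) > \<mu> (a - 1)"
        moreover have "1 \<le> a - 1" "a - 1 < n" using h Cons.prems by auto
        ultimately show False using r by (meson not_le)
      qed
      then show "bad \<mu> (a # w) = None" using None by (simp del: weps.simps)
    qed
  next
    case (Some j)
    then have "\<not> (\<forall>i. 1 \<le> i \<longrightarrow> i < n \<longrightarrow> weps i w \<le> \<mu> i)" using Cons by auto
    then have "\<not> (\<forall>i. 1 \<le> i \<longrightarrow> i < n \<longrightarrow> weps i (a # w) \<le> \<mu> i)" using mono le_trans by metis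
    then show ?thesis using Some by simp
  qed
qed simp

lemma bad_Some:
  "set w \<subseteq> {1..n} \<Longrightarrow> bad \<mu> w = Some i \<Longrightarrow> 1 \<le> i \<and> i < n \<and> weps i w > \<mu> i"
proof (induction w)
  case (Cons a w)
  show ?case
  proof (cases "bad \<mu> w")
    case None
    then have "2 \<le> a \<and> weps (a - 1) (a # w) > \<mu> (a - 1) \<and> i = a - 1" using Cons.prems by (auto split: if_splits)
    then show ?thesis using Cons.prems by auto
  next
    case (Some j)
    then show ?thesis using Cons by auto
  qed
qed simp

text \<open>The first violating suffix is \<open>Suc i # w\<close> where w has no free i and exactly
  \<mu> i free letters i + 1, and the \<mu> i + 1 free letters i + 1 of the suffix stay free in the
  whole word. So every free i stands to its left, and so does the first free i + 1 if \<epsilon>_i >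
  \<mu> i + 1. Both operators therefore leave this suffix as it is.\<close>

lemma bad_wft: "set w \<subseteq> {1..n} \<Longrightarrow> bad \<mu> w = Some i \<Longrightarrow> wphi i w > 0 \<Longrightarrow> bad \<mu> (wft i w) = Some i"
  and bad_wet: "set w \<subseteq> {1..n} \<Longrightarrow> bad \<mu> w = Some i \<Longrightarrow> weps i w > Suc (\<mu> i) \<Longrightarrow> bad \<mu> (wet i w) = Some i"
proof (induction w)
  case (Cons a w)
  have None_case: "a = Suc i \<and> wphi i w = 0 \<and> weps i w = \<mu> i" if "bad \<mu> w = None" "bad \<mu> (a # w) = Some i" "set (a # w) \<subseteq> {1..n}"
  proof -
    have h: "2 \<le> a" "weps (a - 1) (a # w) > \<mu> (a - 1)" "i = a - 1" using that by (auto split: if_splits)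
    then have "1 \<le> i" "i < n" using that by auto
    then have "weps i w \<le> \<mu> i" using that bad_None[of w n \<mu>] by auto
    then show ?thesis using h by (auto split: if_splits)
  qed
  {
    case 1
    show ?case
    proof (cases "bad \<mu> w")
      case None
      then show ?thesis using None_case 1 by auto
    next
      case (Some j)
      then have j: "j = i" using 1 by simp
      consider "a = i" "wphi i w = 0" | "a = i" "wphi i w > 0" | "a = Suc i" "wphi i w > 0" | "a \<noteq> i" "a \<noteq> Suc i" "wphi i w > 0"
        using 1 by (auto split: if_splits)
      then show ?thesis using Cons.IH(1) Some j 1 by cases auto
    qed
  next
    case 2
    show ?case
    proof (cases "bad \<mu> w")
      case None
      then show ?thesis using None_case 2 by auto
    next
      case (Some j)
      then have j: "j = i" using 2 by simp
      consider "a = Suc i" "wphi i w = 0" | "a = Suc i \<Longrightarrow> wphi i w > 0" "weps i w > Suc (\<mu> i)"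
        using 2 by (auto split: if_splits)
      then show ?thesis using Cons.IH(2) Some j 2 by cases auto
    qed
  }
qed simp_all

text \<open>A move by k along the i-string, lowering for positive k and raising for negative k, so
  that the weight changes by -k times the simple root.\<close>

definition reflect :: "nat \<Rightarrow> int \<Rightarrow> nat list \<Rightarrow> nat list" where
  "reflect i k w = (if k \<ge> 0 then (wft i ^^ nat k) w else (wet i ^^ nat (- k)) w)"

lemma wft_pow_inv: "k \<le> wphi i w \<Longrightarrow> wphi i ((wft i ^^ k) w) = wphi i w - k \<and> weps i ((wft i ^^ k) w) = weps i w + k \<and> (wet i ^^ k) ((wft i ^^ k) w) = w"
proof (induction k)
  case (Suc k)
  let ?u = "(wft i ^^ k) w"
  have u: "wphi i ?u > 0" using Suc by simp
  have "(wet i ^^ Suc k) ((wft i ^^ Suc k) w) = (wet i ^^ k) (wet i (wft i ?u))"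
    by (metis comp_apply funpow.simps(2) funpow_Suc_right)
  also have "\<dots> = w" using Suc u by simp
  finally show ?case using Suc u by simp
qed simp

lemma wet_pow_inv: "k \<le> weps i w \<Longrightarrow> wphi i ((wet i ^^ k) w) = wphi i w + k \<and> weps i ((wet i ^^ k) w) = weps i w - k \<and> (wft i ^^ k) ((wet i ^^ k) w) = w"
proof (induction k)
  case (Suc k)
  let ?u = "(wet i ^^ k) w"
  have u: "weps i ?u > 0" using Suc by simp
  have "(wft i ^^ Suc k) ((wet i ^^ Suc k) w) = (wft i ^^ k) (wft i (wet i ?u))"
    by (metis comp_apply funpow.simps(2) funpow_Suc_right)
  also have "\<dots> = w" using Suc u by simp
  finally show ?case using Suc u by simp
qed simp

lemma count_wft_pow: "k \<le> wphi i w \<Longrightarrow>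
   int (count_list ((wft i ^^ k) w) j) = int (count_list w j) - (if j = i then int k else 0) + (if j = Suc i then int k else 0)"
proof (induction k)
  case (Suc k)
  then have "wphi i ((wft i ^^ k) w) > 0" using wft_pow_inv[of k i w] by simp
  from count_wf[OF this, of j] show ?case using Suc by auto
qed simp

lemma count_wet_pow: "k \<le> weps i w \<Longrightarrow>
   int (count_list ((wet i ^^ k) w) j) = int (count_list w j) + (if j = i then int k else 0) - (if j = Suc i then int k else 0)"
proof (induction k)
  case (Suc k)
  then have "weps i ((wet i ^^ k) w) > 0" using wet_pow_inv[of k i w] by simp
  from count_we[OF this, of j] show ?case using Suc by auto
qed simp

locale component =
  fixes n N :: nat and y :: "nat list"
  assumes y: "y \<in> words n N"
begin

lemma comp_set: "b \<in> wcomp n y \<Longrightarrow> set b \<subseteq> {1..n}"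
  using comp_words[OF y] by (auto simp: words_def)

lemma reflect_props:
  assumes b: "b \<in> wcomp n y" and i: "1 \<le> i" "i < n" and k: "- int (weps i b) \<le> k" "k \<le> int (wphi i b)"
  shows "reflect i k b \<in> wcomp n y" "reflect i (- k) (reflect i k b) = b"
    "wtw i (reflect i k b) = wtw i b - 2 * k"
    "wtr n N (reflect i k b) j = wtr n N b j - (if j = i then of_int k else 0) + (if j = Suc i then of_int k else 0)"
proof -
  have f: "(wft i ^^ m) b \<in> wcomp n y" if "m \<le> wphi i b" for m
    using that
  proof (induction m)
    case (Suc m)
    then show ?case using comp_f[OF _ i, of "(wft i ^^ m) b"] wft_pow_inv[of m i b] by simp
  qed (use b in simp)
  have e: "(wet i ^^ m) b \<in> wcomp n y" if "m \<le> weps i b" for m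
    using that
  proof (induction m)
    case (Suc m)
    then show ?case using comp_e[OF _ i, of "(wet i ^^ m) b"] wet_pow_inv[of m i b] by simp
  qed (use b in simp)
  show "reflect i k b \<in> wcomp n y" using f[of "nat k"] e[of "nat (-k)"] k by (auto simp: reflect_def)
  show "reflect i (- k) (reflect i k b) = b"
    using wft_pow_inv[of "nat k" i b] wet_pow_inv[of "nat (-k)" i b] k by (auto simp: reflect_def)
  have c: "int (count_list (reflect i k b) j) = int (count_list b j) - (if j = i then k else 0) + (if j = Suc i then k else 0)" for j
    using count_wft_pow[of "nat k" i b j] count_wet_pow[of "nat (-k)" i b j] k by (auto simp: reflect_def)
  show "wtw i (reflect i k b) = wtw i b - 2 * k" using c[of i] c[of "Suc i"] by (simp add: wtw_def)
  have "(of_nat (count_list (reflect i k b) j) :: rat) = of_int (int (count_list (reflect i k b) j))" by simp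
  also have "\<dots> = of_nat (count_list b j) - (if j = i then of_int k else 0) + (if j = Suc i then of_int k else 0)"
    unfolding c by auto
  finally show "wtr n N (reflect i k b) j = wtr n N b j - (if j = i then of_int k else 0) + (if j = Suc i then of_int k else 0)"
    using i by (auto simp: wtr_def)
qed

text \<open>Moving by \<langle>h_i, wt b\<rangle> steps reverses each i-string and realizes the
  simple reflection on weights.\<close>

lemma weight_symmetric_simple:
  assumes i: "1 \<le> i" "i < n"
  shows "(\<Sum>b\<in>wcomp n y. F (wtr n N b \<circ> transpose i (Suc i))) = (\<Sum>b\<in>wcomp n y. F (wtr n N b))"
proof (rule sum.reindex_bij_witness[where i = "\<lambda>b. reflect i (wtw i b) b" and j = "\<lambda>b. reflect i (wtw i b) b"])
  fix b assume b: "b \<in> wcomp n y"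
  have k: "- int (weps i b) \<le> wtw i b" "wtw i b \<le> int (wphi i b)" using wphi_weps[of i b] by auto
  note R = reflect_props[OF b i k]
  show "reflect i (wtw i b) b \<in> wcomp n y" by (rule R)
  then show "reflect i (wtw i b) b \<in> wcomp n y" .
  show "reflect i (wtw i (reflect i (wtw i b) b)) (reflect i (wtw i b) b) = b" using R(2,3) by simp
  then show "reflect i (wtw i (reflect i (wtw i b) b)) (reflect i (wtw i b) b) = b" .
  have "of_int (wtw i b) = wtr n N b i - wtr n N b (Suc i)" using wtr_wtw[OF i] by simp
  then have "wtr n N (reflect i (wtw i b) b) = wtr n N b \<circ> transpose i (Suc i)"
    using R(4) by (auto simp: fun_eq_iff transpose_def)
  then show "F (wtr n N (reflect i (wtw i b) b)) = F (wtr n N b \<circ> transpose i (Suc i))" by simp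
qed

lemma weight_symmetric:
  assumes w: "w permutes {1..n}"
  shows "(\<Sum>b\<in>wcomp n y. F (wtr n N b \<circ> w)) = (\<Sum>b\<in>wcomp n y. F (wtr n N b))"
proof -
  have "set js \<subseteq> {1..<n} \<Longrightarrow> (\<Sum>b\<in>wcomp n y. F (wtr n N b \<circ> srprod js)) = (\<Sum>b\<in>wcomp n y. F (wtr n N b))" for js F
  proof (induction js arbitrary: F)
    case (Cons j js)
    have "(\<Sum>b\<in>wcomp n y. F (wtr n N b \<circ> transpose j (Suc j) \<circ> srprod js)) = (\<Sum>b\<in>wcomp n y. F (wtr n N b \<circ> srprod js))"
      using weight_symmetric_simple[of j "\<lambda>\<nu>. F (\<nu> \<circ> srprod js)"] Cons.prems by simp
    also have "\<dots> = (\<Sum>b\<in>wcomp n y. F (wtr n N b))" by (rule Cons.IH) (use Cons.prems in simp)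
    finally show ?case by (simp only: srprod_simps comp_assoc)
  qed simp
  then show ?thesis using permutes_srprod[OF w] by blast
qed

lemma bad_reflect:
  assumes b: "b \<in> wcomp n y" and i: "bad \<mu> b = Some i" and k: "Suc (\<mu> i) - int (weps i b) \<le> k" "k \<le> int (wphi i b)"
  shows "bad \<mu> (reflect i k b) = Some i"
proof -
  have i': "1 \<le> i" "i < n" using bad_Some[OF comp_set[OF b] i] by auto
  have f: "bad \<mu> ((wft i ^^ m) b) = Some i" if "m \<le> wphi i b" for m
    using that
  proof (induction m)
    case (Suc m)
    have "set ((wft i ^^ m) b) \<subseteq> {1..n}"
      using reflect_props(1)[OF b i', of "int m"] Suc.prems comp_set by (auto simp: reflect_def)
    then show ?case using Suc bad_wft[of "(wft i ^^ m) b" n \<mu> i] wft_pow_inv[of m i b] by simp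
  qed (use i in simp)
  have e: "bad \<mu> ((wet i ^^ m) b) = Some i" if "m + Suc (\<mu> i) \<le> weps i b" for m
    using that
  proof (induction m)
    case (Suc m)
    have "set ((wet i ^^ m) b) \<subseteq> {1..n}"
    proof (cases m)
      case 0
      then show ?thesis using comp_set[OF b] by simp
    next
      case (Suc m')
      have "reflect i (- int m) b \<in> wcomp n y" by (rule reflect_props(1)[OF b i']) (use Suc.prems in auto)
      moreover have "reflect i (- int m) b = (wet i ^^ m) b" using Suc by (auto simp: reflect_def simp del: of_nat_Suc)
      ultimately show ?thesis using comp_set by metis
    qed
    then show ?case using Suc bad_wet[of "(wet i ^^ m) b" n \<mu> i] wet_pow_inv[of m i b] by simp
  qed (use i in simp)
  show ?thesis using f[of "nat k"] e[of "nat (- k)"] k by (auto simp: reflect_def)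
qed

lemma cancellation:
  fixes A :: "weight \<Rightarrow> 'r::{idom, ring_char_0}"
  assumes A: "\<And>\<nu> i. 1 \<le> i \<Longrightarrow> i < n \<Longrightarrow> A (\<nu> \<circ> transpose i (Suc i)) = - A \<nu>"
    and \<kappa>: "\<And>i. 1 \<le> i \<Longrightarrow> i < n \<Longrightarrow> \<kappa> i - \<kappa> (Suc i) = of_nat (\<mu> i) + 1"
  shows "(\<Sum>b\<in>wcomp n y. A (\<lambda>k. \<kappa> k + wtr n N b k)) =
    (\<Sum>b\<in>{b \<in> wcomp n y. \<forall>i. 1 \<le> i \<longrightarrow> i < n \<longrightarrow> weps i b \<le> \<mu> i}. A (\<lambda>k. \<kappa> k + wtr n N b k))"
proof -
  let ?f = "\<lambda>b. A (\<lambda>k. \<kappa> k + wtr n N b k)"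
  let ?Bad = "{b \<in> wcomp n y. bad \<mu> b \<noteq> None}"
  define flip where "flip b = (let i = the (bad \<mu> b) in reflect i (int (\<mu> i) + 1 + wtw i b) b)" for b
  have flip: "flip b \<in> ?Bad \<and> flip (flip b) = b \<and> ?f (flip b) = - ?f b" if "b \<in> ?Bad" for b
  proof -
    from that have "bad \<mu> b \<noteq> None" by simp
    then obtain i where i: "bad \<mu> b = Some i" by blast
    have b: "b \<in> wcomp n y" using that by simp
    have i': "1 \<le> i" "i < n" "weps i b > \<mu> i" using bad_Some[OF comp_set[OF b] i] by auto
    \<comment> \<open>This k is the difference of the coordinates i and i + 1 of \<kappa> + wt b, so
      moving by k performs the reflection on \<kappa> + wt b. The new \<epsilon>_i is \<phi>_i +
      \<mu> i + 1, again above \<mu> i: the part of the string beyond the bound is reversed.\<close>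
    define k where "k = int (\<mu> i) + 1 + wtw i b"
    have fl: "flip b = reflect i k b" by (simp add: flip_def i k_def)
    have k: "Suc (\<mu> i) - int (weps i b) \<le> k" "- int (weps i b) \<le> k" "k \<le> int (wphi i b)"
      using wphi_weps[of i b] i'(3) by (auto simp: k_def)
    note R = reflect_props[OF b i'(1,2) k(2,3)]
    have bd: "bad \<mu> (reflect i k b) = Some i" by (rule bad_reflect[OF b i k(1,3)])
    have "flip (flip b) = reflect i (int (\<mu> i) + 1 + (wtw i b - 2 * k)) (reflect i k b)"
      unfolding fl unfolding flip_def Let_def bd option.sel R(3) ..
    also have "int (\<mu> i) + 1 + (wtw i b - 2 * k) = - k" by (simp add: k_def)
    finally have "flip (flip b) = b" using R(2) by simp
    moreover have "(\<lambda>j. \<kappa> j + wtr n N (reflect i k b) j) = (\<lambda>j. \<kappa> j + wtr n N b j) \<circ> transpose i (Suc i)"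
    proof
      fix j
      have "of_int k = (\<kappa> i + wtr n N b i) - (\<kappa> (Suc i) + wtr n N b (Suc i))"
        using \<kappa>[OF i'(1,2)] wtr_wtw[OF i'(1,2), of N b] by (simp add: k_def algebra_simps)
      then show "\<kappa> j + wtr n N (reflect i k b) j = ((\<lambda>j. \<kappa> j + wtr n N b j) \<circ> transpose i (Suc i)) j"
        unfolding R(4) by (auto simp: transpose_def)
    qed
    ultimately show ?thesis using R(1) bd A[OF i'(1,2)] fl by simp
  qed
  have "(\<Sum>b\<in>?Bad. ?f b) = (\<Sum>b\<in>?Bad. - ?f b)"
    by (rule sum.reindex_bij_witness[where i = flip and j = flip]) (use flip in auto)
  then have "2 * (\<Sum>b\<in>?Bad. ?f b) = 0" by (simp add: sum_negf)
  then have z: "(\<Sum>b\<in>?Bad. ?f b) = 0" by simp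
  have "(\<Sum>b\<in>wcomp n y. ?f b) = (\<Sum>b\<in>wcomp n y - ?Bad. ?f b) + (\<Sum>b\<in>?Bad. ?f b)"
    using finite_comp[OF y] by (intro sum.subset_diff) auto
  also have "wcomp n y - ?Bad = {b \<in> wcomp n y. \<forall>i. 1 \<le> i \<longrightarrow> i < n \<longrightarrow> weps i b \<le> \<mu> i}"
  proof (rule set_eqI)
    fix b
    show "b \<in> wcomp n y - ?Bad \<longleftrightarrow> b \<in> {b \<in> wcomp n y. \<forall>i. 1 \<le> i \<longrightarrow> i < n \<longrightarrow> weps i b \<le> \<mu> i}"
    proof (cases "b \<in> wcomp n y")
      case True
      from bad_None[OF comp_set[OF True], of \<mu>] True show ?thesis by (simp only: Diff_iff mem_Collect_eq simp_thms)
    next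
      case False
      then show ?thesis by (simp only: Diff_iff mem_Collect_eq simp_thms)
    qed
  qed
  finally show ?thesis using z by simp
qed

end

section \<open>Symmetrization identities\<close>

lemma lagrange_interpolation:
  fixes p :: "'a::field poly"
  assumes S: "finite S" "inj_on x S" "degree p < card S"
  shows "(\<Sum>k\<in>S. poly p (x k) * (\<Prod>j\<in>S - {k}. (z - x j) / (x k - x j))) = poly p z"
proof -
  define r where "r = (\<Sum>k\<in>S. Polynomial.smult (poly p (x k) / (\<Prod>j\<in>S - {k}. x k - x j)) (\<Prod>j\<in>S - {k}. [:- x j, 1:]))"
  have ev: "poly r u = (\<Sum>k\<in>S. poly p (x k) * (\<Prod>j\<in>S - {k}. (u - x j) / (x k - x j)))" for u
    unfolding r_def by (simp add: poly_sum poly_prod prod_dividef)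
  have deg: "degree (\<Prod>j\<in>S - {k}. [:- x j, 1:]) \<le> card S - 1" if "k \<in> S" for k
  proof -
    have "degree (\<Prod>j\<in>S - {k}. [:- x j, 1:]) \<le> (\<Sum>j\<in>S - {k}. degree [:- x j, 1:])"
      using degree_prod_sum_le[of "S - {k}" "\<lambda>j. [:- x j, 1:]"] S(1) by (simp add: comp_def)
    also have "\<dots> = card S - 1" using S that by simp
    finally show ?thesis .
  qed
  have "degree r \<le> card S - 1"
    unfolding r_def by (intro degree_sum_le S(1) order.trans[OF degree_smult_le] deg)
  moreover have "card S > 0" using S(3) by simp
  ultimately have dr: "degree r < card S" by linarith
  have "r = p"
  proof (rule poly_eqI_degree[where A = "x ` S"])
    have c: "card (x ` S) = card S" using card_image[OF S(2)] .
    show "degree r < card (x ` S)" "degree p < card (x ` S)" using dr S(3) c by auto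
    fix u assume "u \<in> x ` S"
    then obtain l where l: "l \<in> S" "u = x l" by blast
    have "(\<Prod>j\<in>S - {k}. (x l - x j) / (x k - x j)) = of_bool (k = l)" if "k \<in> S" for k
    proof (cases "k = l")
      case True
      have "(x l - x j) / (x k - x j) = 1" if "j \<in> S - {k}" for j
        using True that l S(2) by (auto simp: inj_on_def)
      then show ?thesis using True by simp
    next
      case False
      then show ?thesis using l(1) S(1) by (auto intro!: prod_zero)
    qed
    then have "poly r u = (\<Sum>k\<in>S. poly p (x k) * of_bool (k = l))" unfolding ev l(2) by (intro sum.cong) auto
    then show "poly r u = poly p u" using l S(1) by (simp add: of_bool_def if_distrib sum.delta cong: if_cong)
  qed
  then show ?thesis using ev[of z] by simp
qed

lemma prod_linear_coeff:
  fixes u :: "'b \<Rightarrow> 'a::comm_ring_1"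
  assumes "finite S"
  shows "degree (\<Prod>c\<in>S. [:u c, s:]) \<le> card S \<and> coeff (\<Prod>c\<in>S. [:u c, s:]) (card S) = s ^ card S"
  using assms
proof (induction S rule: finite_induct)
  case (insert a S)
  let ?q = "\<Prod>c\<in>S. [:u c, s:]"
  have "coeff ?q (Suc (card S)) = 0" using insert by (intro coeff_eq_0) auto
  moreover have "degree ([:u a, s:] * ?q) \<le> Suc (card S)"
    using degree_mult_le[of "[:u a, s:]" ?q] insert by (auto split: if_splits)
  ultimately show ?case using insert by simp
qed simp

lemma macdonald_step:
  fixes x :: "'b \<Rightarrow> 'a::field"
  assumes S: "finite S" "inj_on x S" "S \<noteq> {}" and nz: "\<And>c. c \<in> S \<Longrightarrow> x c \<noteq> 0" and t: "t \<noteq> 1"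
  shows "(\<Sum>b\<in>S. \<Prod>c\<in>S - {b}. (x c - t * x b) / (x c - x b)) = (\<Sum>k<card S. t ^ k)"
proof -
  let ?m = "card S"
  have m: "?m > 0" using S by (simp add: card_gt_0_iff)
  \<comment> \<open>The top coefficients cancel, so the degree is below \<open>?m\<close> and p is
    determined by its values at the x b. There the second product vanishes and the factor c = b of
    the first is (t - 1) x b. The claim is the interpolation formula evaluated at 0.\<close>
  define p where "p = (\<Prod>c\<in>S. [:- x c, t:]) - Polynomial.smult (t ^ ?m) (\<Prod>c\<in>S. [:- x c, 1:])"
  have "degree p \<le> ?m" "coeff p ?m = 0"
    unfolding p_def using prod_linear_coeff[OF S(1), of "\<lambda>c. - x c" t] prod_linear_coeff[OF S(1), of "\<lambda>c. - x c" 1]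
    by (auto intro!: degree_diff_le order.trans[OF degree_smult_le])
  then have dp: "degree p < ?m" using m by (metis leading_coeff_0_iff degree_0 le_neq_implies_less)
  have ev: "poly p u = (\<Prod>c\<in>S. t * u - x c) - t ^ ?m * (\<Prod>c\<in>S. u - x c)" for u
    by (simp add: p_def poly_prod mult.commute)
  let ?N = "\<Prod>c\<in>S. - x c"
  have N: "?N \<noteq> 0" using nz S by simp
  have pb: "poly p (x b) = (t - 1) * x b * (\<Prod>c\<in>S - {b}. t * x b - x c)" if "b \<in> S" for b
  proof -
    have "(\<Prod>c\<in>S. x b - x c) = 0" using that S by (intro prod_zero) auto
    then show ?thesis unfolding ev using prod.remove[OF S(1) that, of "\<lambda>c. t * x b - x c"] by (simp add: algebra_simps)
  qed
  have summand: "poly p (x b) * (\<Prod>j\<in>S - {b}. (0 - x j) / (x b - x j)) = (1 - t) * ?N * (\<Prod>c\<in>S - {b}. (x c - t * x b) / (x c - x b))"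
    if b: "b \<in> S" for b
  proof -
    have "(\<Prod>c\<in>S - {b}. (x c - t * x b) / (x c - x b)) = (\<Prod>c\<in>S - {b}. (t * x b - x c) / (x b - x c))"
    proof (rule prod.cong[OF refl])
      fix c
      have "(t * x b - x c) / (x b - x c) = (- (x c - t * x b)) / (- (x c - x b))" by simp
      then show "(x c - t * x b) / (x c - x b) = (t * x b - x c) / (x b - x c)" by (simp only: minus_divide_divide)
    qed
    moreover have "?N = - x b * (\<Prod>c\<in>S - {b}. 0 - x c)" using prod.remove[OF S(1) b, of "\<lambda>c. - x c"] by simp
    ultimately show ?thesis unfolding pb[OF b] prod_dividef by (simp add: algebra_simps)
  qed
  have "(1 - t) * ?N * (\<Sum>b\<in>S. \<Prod>c\<in>S - {b}. (x c - t * x b) / (x c - x b)) = poly p 0"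
    unfolding sum_distrib_left using lagrange_interpolation[OF S(1,2) dp, of 0] summand by simp
  also have "\<dots> = ?N * (1 - t ^ ?m)" unfolding ev by (simp add: algebra_simps)
  also have "\<dots> = ?N * ((1 - t) * (\<Sum>k<?m. t ^ k))" by (simp add: one_diff_power_eq)
  finally show ?thesis using N t by simp
qed

definition pairs :: "nat \<Rightarrow> (nat \<times> nat) set" where
  "pairs n = {(i, j). 1 \<le> i \<and> i < j \<and> j \<le> n}"

lemma finite_pairs [simp]: "finite (pairs n)"
  by (rule finite_subset[of _ "{1..n} \<times> {1..n}"]) (auto simp: pairs_def)

lemma pairs_Suc: "pairs (Suc n) = pairs n \<union> (\<lambda>i. (i, Suc n)) ` {1..n}" "pairs n \<inter> (\<lambda>i. (i, Suc n)) ` {1..n} = {}"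
  by (auto simp: pairs_def)

lemma prod_pairs_Suc: "(\<Prod>(i, j)\<in>pairs (Suc n). f i j) = (\<Prod>(i, j)\<in>pairs n. f i j) * (\<Prod>i\<in>{1..n}. f i (Suc n) :: 'a::comm_monoid_mult)"
  unfolding pairs_Suc(1) by (subst prod.union_disjoint[OF _ _ pairs_Suc(2)]) (auto simp: prod.reindex inj_on_def)

lemma pairs_0: "pairs 0 = {}"
  by (auto simp: pairs_def)

lemma card_pairs: "card (pairs n) = n * (n - 1) div 2"
proof (induction n)
  case (Suc n)
  have "card (pairs (Suc n)) = card (pairs n) + n"
    unfolding pairs_Suc(1) by (subst card_Un_disjoint[OF _ _ pairs_Suc(2)]) (auto simp: card_image inj_on_def)
  moreover have "Suc n * (Suc n - 1) = n * (n - 1) + 2 * n" by (cases n) (auto simp: algebra_simps)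
  ultimately show ?case using Suc by simp
qed (simp add: pairs_0)

lemma prod_offdiag:
  "(\<Prod>(a, b)\<in>{(a, b). a \<in> {1..n} \<and> b \<in> {1..n} \<and> a \<noteq> b}. f a b) = (\<Prod>(i, j)\<in>pairs n. f i j * f j i :: 'a::comm_monoid_mult)"
proof -
  have "{(a, b). a \<in> {1..n} \<and> b \<in> {1..n} \<and> a \<noteq> b} = pairs n \<union> prod.swap ` pairs n"
    by (auto simp: pairs_def image_iff)
  moreover have "pairs n \<inter> prod.swap ` pairs n = {}" by (auto simp: pairs_def)
  ultimately have "(\<Prod>(a, b)\<in>{(a, b). a \<in> {1..n} \<and> b \<in> {1..n} \<and> a \<noteq> b}. f a b) =
     (\<Prod>(i, j)\<in>pairs n. f i j) * (\<Prod>(i, j)\<in>prod.swap ` pairs n. f i j)"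
    by (simp add: prod.union_disjoint)
  also have "(\<Prod>(i, j)\<in>prod.swap ` pairs n. f i j) = (\<Prod>(i, j)\<in>pairs n. f j i)"
    by (subst prod.reindex) (auto simp: case_prod_beta)
  also have "(\<Prod>(i, j)\<in>pairs n. f i j) * (\<Prod>(i, j)\<in>pairs n. f j i) = (\<Prod>(i, j)\<in>pairs n. f i j * f j i)"
    by (simp add: prod.distrib[symmetric] case_prod_beta)
  finally show ?thesis .
qed

lemma prod_offdiag_permute:
  assumes w: "w permutes S"
  shows "(\<Prod>(a, b)\<in>{(a, b). a \<in> S \<and> b \<in> S \<and> a \<noteq> b}. f (w a) (w b)) = (\<Prod>(a, b)\<in>{(a, b). a \<in> S \<and> b \<in> S \<and> a \<noteq> b}. f a b :: 'a::comm_monoid_mult)"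
  by (rule prod.reindex_bij_witness[where i = "\<lambda>(a, b). (inv w a, inv w b)" and j = "\<lambda>(a, b). (w a, w b)"])
    (auto simp: permutes_inverses[OF w] permutes_in_image[OF w] permutes_in_image[OF permutes_inv[OF w]]
      inj_eq[OF permutes_inj[OF w]] inj_eq[OF permutes_inj[OF permutes_inv[OF w]]])

lemma prod_pairs_symmetric:
  assumes w: "w permutes {1..n}"
  shows "(\<Prod>(i, j)\<in>pairs n. f (w i) (w j) * f (w j) (w i)) = (\<Prod>(i, j)\<in>pairs n. f i j * f j i :: 'a::comm_monoid_mult)"
  using prod_offdiag_permute[OF w, of f] prod_offdiag[of f n] prod_offdiag[of "\<lambda>a b. f (w a) (w b)" n] by simp

text \<open>A simple transposition negates the factor at (k, k + 1) and permutes the remaining pairs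
  among themselves.\<close>

lemma vandermonde_sign:
  assumes "w permutes {1..n}"
  shows "(\<Prod>(i, j)\<in>pairs n. f (w i) - f (w j)) = of_int (sign w) * (\<Prod>(i, j)\<in>pairs n. f i - f j :: 'a::comm_ring_1)"
proof -
  let ?A = "\<lambda>f. \<Prod>(i, j)\<in>pairs n. f i - f j :: 'a"
  have "?A (f \<circ> transpose k (Suc k)) = - ?A f" if k: "1 \<le> k" "k < n" for f k
  proof -
    let ?s = "transpose k (Suc k)" and ?P = "pairs n - {(k, Suc k)}"
    have kp: "(k, Suc k) \<in> pairs n" using k by (simp add: pairs_def)
    have "(\<Prod>(i, j)\<in>?P. f (?s i) - f (?s j)) = (\<Prod>(i, j)\<in>?P. f i - f j)"
    proof (rule prod.reindex_bij_witness[where i = "\<lambda>(a, b). (?s a, ?s b)" and j = "\<lambda>(a, b). (?s a, ?s b)"])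
      have "(case p of (a, b) \<Rightarrow> (?s a, ?s b)) \<in> ?P" if p: "p \<in> ?P" for p
        using k p by (auto simp: pairs_def transpose_def split: if_splits)
      then show "\<And>p. p \<in> ?P \<Longrightarrow> (case p of (a, b) \<Rightarrow> (?s a, ?s b)) \<in> ?P"
        "\<And>p. p \<in> ?P \<Longrightarrow> (case p of (a, b) \<Rightarrow> (?s a, ?s b)) \<in> ?P" by blast+
    qed auto
    then show ?thesis by (simp add: prod.remove[OF finite_pairs kp] case_prod_beta) (simp add: algebra_simps)
  qed
  from antisymmetric_sign[of n ?A, OF this assms, of f] show ?thesis by (simp add: case_prod_beta)
qed

lemma permutes_insert_sum:
  "(\<Sum>w | w permutes {1..Suc n}. F w) = (\<Sum>b\<in>{1..Suc n}. \<Sum>q | q permutes {1..n}. F (transpose (Suc n) b \<circ> q) :: 'a::comm_monoid_add)"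
proof -
  have "{1..Suc n} = insert (Suc n) {1..n}" by auto
  then show ?thesis using sum_over_permutations_insert[of "{1..n}" "Suc n" F] by simp
qed

lemma transpose_image_prod:
  assumes "b \<in> {1..Suc n}"
  shows "(\<Prod>i\<in>{1..n}. f (transpose (Suc n) b i)) = (\<Prod>c\<in>{1..Suc n} - {b}. f c :: 'a::comm_monoid_mult)"
proof (rule prod.reindex_bij_witness[where i = "transpose (Suc n) b" and j = "transpose (Suc n) b"])
  show "transpose (Suc n) b c \<in> {1..n}" if "c \<in> {1..Suc n} - {b}" for c
    using that assms by (auto simp: transpose_def)
  show "transpose (Suc n) b i \<in> {1..Suc n} - {b}" if "i \<in> {1..n}" for i
    using that assms by (auto simp: transpose_def)
qed auto

text \<open>Induction on n, sorting permutations by the value b at the last index: the pairs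
  containing this index contribute the product over c \<noteq> b, the other pairs give the identity
  for the remaining variables, and \<open>macdonald_step\<close> sums over b.\<close>

lemma macdonald_identity:
  fixes x :: "nat \<Rightarrow> 'a::field"
  assumes "inj_on x {1..n}" and "\<And>c. c \<in> {1..n} \<Longrightarrow> x c \<noteq> 0" and t: "t \<noteq> 1"
  shows "(\<Sum>w | w permutes {1..n}. \<Prod>(i, j)\<in>pairs n. (x (w i) - t * x (w j)) / (x (w i) - x (w j))) = (\<Prod>k\<in>{1..n}. \<Sum>j<k. t ^ j)"
  using assms(1,2)
proof (induction n arbitrary: x)
  case 0
  then show ?case by (simp add: pairs_0)
next
  case (Suc n)
  let ?f = "\<lambda>u v. (u - t * v) / (u - v)"
  let ?a = "Suc n"
  have "(\<Sum>q | q permutes {1..n}. \<Prod>(i, j)\<in>pairs ?a. ?f (x ((transpose ?a b \<circ> q) i)) (x ((transpose ?a b \<circ> q) j)))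
     = (\<Prod>k\<in>{1..n}. \<Sum>j<k. t ^ j) * (\<Prod>c\<in>{1..?a} - {b}. ?f (x c) (x b))" if b: "b \<in> {1..?a}" for b
  proof -
    let ?y = "x \<circ> transpose ?a b"
    have "(\<Prod>(i, j)\<in>pairs ?a. ?f (x ((transpose ?a b \<circ> q) i)) (x ((transpose ?a b \<circ> q) j)))
      = (\<Prod>(i, j)\<in>pairs n. ?f (?y (q i)) (?y (q j))) * (\<Prod>c\<in>{1..?a} - {b}. ?f (x c) (x b))" if q: "q permutes {1..n}" for q
    proof -
      have "q ?a = ?a" using permutes_not_in[OF q, of ?a] by simp
      then have "(\<Prod>i\<in>{1..n}. ?f (x ((transpose ?a b \<circ> q) i)) (x ((transpose ?a b \<circ> q) ?a))) = (\<Prod>i\<in>{1..n}. ?f (x (transpose ?a b (q i))) (x b))" by simp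
      also have "\<dots> = (\<Prod>i\<in>{1..n}. ?f (x (transpose ?a b i)) (x b))"
        using prod.permute[OF q, of "\<lambda>i. ?f (x (transpose ?a b i)) (x b)"] by (simp add: comp_def)
      also have "\<dots> = (\<Prod>c\<in>{1..?a} - {b}. ?f (x c) (x b))" by (rule transpose_image_prod[OF b])
      finally show ?thesis unfolding prod_pairs_Suc by simp
    qed
    then have "(\<Sum>q | q permutes {1..n}. \<Prod>(i, j)\<in>pairs ?a. ?f (x ((transpose ?a b \<circ> q) i)) (x ((transpose ?a b \<circ> q) j)))
      = (\<Sum>q | q permutes {1..n}. (\<Prod>(i, j)\<in>pairs n. ?f (?y (q i)) (?y (q j)))) * (\<Prod>c\<in>{1..?a} - {b}. ?f (x c) (x b))"
      by (simp add: sum_distrib_right)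
    also have "(\<Sum>q | q permutes {1..n}. (\<Prod>(i, j)\<in>pairs n. ?f (?y (q i)) (?y (q j)))) = (\<Prod>k\<in>{1..n}. \<Sum>j<k. t ^ j)"
    proof (rule Suc.IH)
      have im: "transpose ?a b ` {1..n} \<subseteq> {1..?a}" using b by (auto simp: transpose_def)
      show "inj_on ?y {1..n}"
        by (intro comp_inj_on inj_on_subset[OF inj_transpose subset_UNIV] inj_on_subset[OF Suc.prems(1) im])
      show "?y c \<noteq> 0" if "c \<in> {1..n}" for c
        unfolding comp_apply by (rule Suc.prems(2)) (use im that in blast)
    qed
    finally show ?thesis .
  qed
  then have "(\<Sum>w | w permutes {1..?a}. \<Prod>(i, j)\<in>pairs ?a. ?f (x (w i)) (x (w j))) =
     (\<Prod>k\<in>{1..n}. \<Sum>j<k. t ^ j) * (\<Sum>b\<in>{1..?a}. \<Prod>c\<in>{1..?a} - {b}. ?f (x c) (x b))"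
    unfolding permutes_insert_sum sum_distrib_left by (intro sum.cong refl)
  also have "(\<Sum>b\<in>{1..?a}. \<Prod>c\<in>{1..?a} - {b}. ?f (x c) (x b)) = (\<Sum>k<card {1..?a}. t ^ k)"
    by (rule macdonald_step) (use Suc.prems t in auto)
  finally show ?case by simp
qed

section \<open>Cauchy's determinant\<close>

lemma cauchy_step:
  fixes x y :: "nat \<Rightarrow> 'a::field"
  assumes y: "inj_on y {1..Suc n}" and xa: "xa \<noteq> 0" and t: "t \<noteq> 0"
  shows "(\<Sum>b\<in>{1..Suc n}. (\<Prod>i\<in>{1..n}. 1 - t * x i * y b) * (\<Prod>c\<in>{1..Suc n} - {b}. (1 - t * xa * y c) / (y b - y c)))
    = t ^ n * (\<Prod>i\<in>{1..n}. xa - x i)"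
proof -
  \<comment> \<open>\<open>?p\<close> is interpolated through the y b and evaluated at
    \<open>?z\<close>, where its factors become 1 - x i / xa; multiplication by (t xa)^n clears the
    denominators containing t and xa on both sides.\<close>
  let ?p = "\<Prod>i\<in>{1..n}. [:1, - t * x i:]" and ?z = "1 / (t * xa)"
  have "degree ?p \<le> (\<Sum>i\<in>{1..n}. degree [:1, - t * x i:])"
    using degree_prod_sum_le[of "{1..n}" "\<lambda>i. [:1, - t * x i:]"] by (simp add: comp_def)
  also have "\<dots> \<le> (\<Sum>i\<in>{1..n}. 1)" by (rule sum_mono) simp
  finally have d: "degree ?p < card {1..Suc n}" by simp
  have ev: "poly ?p u = (\<Prod>i\<in>{1..n}. 1 - t * x i * u)" for u by (simp add: poly_prod algebra_simps)
  have "(t * xa) ^ n * poly ?p ?z = (\<Prod>i\<in>{1..n}. (t * xa) * (1 - t * x i * ?z))"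
    unfolding ev prod.distrib by (simp add: power_mult_distrib)
  also have "\<dots> = (\<Prod>i\<in>{1..n}. t * (xa - x i))" using xa t by (intro prod.cong) (auto simp: field_simps)
  finally have L: "(t * xa) ^ n * poly ?p ?z = t ^ n * (\<Prod>i\<in>{1..n}. xa - x i)"
    unfolding prod.distrib by (simp add: power_mult_distrib)
  have R: "(t * xa) ^ n * (\<Prod>c\<in>{1..Suc n} - {b}. (?z - y c) / (y b - y c)) = (\<Prod>c\<in>{1..Suc n} - {b}. (1 - t * xa * y c) / (y b - y c))" if "b \<in> {1..Suc n}" for b
  proof -
    have "card ({1..Suc n} - {b}) = n" using that by simp
    then have "(t * xa) ^ n * (\<Prod>c\<in>{1..Suc n} - {b}. (?z - y c) / (y b - y c)) = (\<Prod>c\<in>{1..Suc n} - {b}. (t * xa) * ((?z - y c) / (y b - y c)))"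
      unfolding prod.distrib prod_constant power_mult_distrib by (simp only:)
    also have "\<dots> = (\<Prod>c\<in>{1..Suc n} - {b}. (1 - t * xa * y c) / (y b - y c))"
      using xa t by (intro prod.cong) (auto simp: right_diff_distrib)
    finally show ?thesis .
  qed
  have "(t * xa) ^ n * poly ?p ?z = (\<Sum>b\<in>{1..Suc n}. poly ?p (y b) * ((t * xa) ^ n * (\<Prod>c\<in>{1..Suc n} - {b}. (?z - y c) / (y b - y c))))"
    unfolding lagrange_interpolation[OF _ y d, of ?z, symmetric, OF finite_atLeastAtMost] sum_distrib_left by (simp add: mult_ac)
  also have "\<dots> = (\<Sum>b\<in>{1..Suc n}. (\<Prod>i\<in>{1..n}. 1 - t * x i * y b) * (\<Prod>c\<in>{1..Suc n} - {b}. (1 - t * xa * y c) / (y b - y c)))"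
    by (rule sum.cong[OF refl]) (simp only: R ev)
  finally show ?thesis unfolding L ..
qed

text \<open>Laplace expansion along the last row: the minor belonging to b is a Cauchy determinant
  in the y c with c \<noteq> b, and once the common factor is taken out \<open>cauchy_step\<close>
  evaluates the sum over b.\<close>

lemma cauchy_determinant:
  fixes x y :: "nat \<Rightarrow> 'a::field"
  assumes "inj_on y {1..n}" and "\<And>i. i \<in> {1..n} \<Longrightarrow> x i \<noteq> 0" and t: "t \<noteq> 0"
    and "\<And>i j. i \<in> {1..n} \<Longrightarrow> j \<in> {1..n} \<Longrightarrow> t * x i * y j \<noteq> 1"
  shows "(\<Sum>w | w permutes {1..n}. of_int (sign w) * (\<Prod>i\<in>{1..n}. 1 / (1 - t * x i * y (w i)))) =
    t ^ card (pairs n) * (\<Prod>(i, j)\<in>pairs n. x i - x j) * (\<Prod>(i, j)\<in>pairs n. y i - y j) /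
      (\<Prod>i\<in>{1..n}. \<Prod>j\<in>{1..n}. 1 - t * x i * y j)"
  using assms(1,2,4)
proof (induction n arbitrary: y)
  case 0
  then show ?case by (simp add: pairs_0)
next
  case (Suc n)
  let ?a = "Suc n"
  define Dx where "Dx = (\<Prod>(i, j)\<in>pairs n. x i - x j)"
  define Dy where "Dy = (\<Prod>(i, j)\<in>pairs ?a. y i - y j)"
  define Q where "Q = (\<Prod>i\<in>{1..?a}. \<Prod>j\<in>{1..?a}. 1 - t * x i * y j)"
  have nz: "1 - t * x i * y j \<noteq> 0" if "i \<in> {1..?a}" "j \<in> {1..?a}" for i j using Suc.prems(3)[OF that] by simp
  have Q: "Q \<noteq> 0" unfolding Q_def using nz by simp
  have dy: "y b - y c \<noteq> 0" if "b \<in> {1..?a}" "c \<in> {1..?a} - {b}" for b c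
    using Suc.prems(1) that by (auto simp: inj_on_def)
  have summand: "(\<Sum>q | q permutes {1..n}. of_int (sign (transpose ?a b \<circ> q)) * (\<Prod>i\<in>{1..?a}. 1 / (1 - t * x i * y ((transpose ?a b \<circ> q) i))))
     = t ^ card (pairs n) * Dx * Dy / Q * ((-1) ^ n * ((\<Prod>i\<in>{1..n}. 1 - t * x i * y b) * (\<Prod>c\<in>{1..?a} - {b}. (1 - t * x ?a * y c) / (y b - y c))))"
    if b: "b \<in> {1..?a}" for b
  proof -
    let ?y = "y \<circ> transpose ?a b"
    let ?\<epsilon> = "of_int (sign (transpose ?a b)) :: 'a"
    have im: "transpose ?a b ` {1..n} \<subseteq> {1..?a}" using b by (auto simp: transpose_def)
    have tp: "transpose ?a b permutes {1..?a}" using b by (intro permutes_swap_id) auto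
    have "(\<Sum>q | q permutes {1..n}. of_int (sign (transpose ?a b \<circ> q)) * (\<Prod>i\<in>{1..?a}. 1 / (1 - t * x i * y ((transpose ?a b \<circ> q) i))))
      = (\<Sum>q | q permutes {1..n}. ?\<epsilon> / (1 - t * x ?a * y b) * (of_int (sign q) * (\<Prod>i\<in>{1..n}. 1 / (1 - t * x i * ?y (q i)))))"
    proof (rule sum.cong[OF refl])
      fix q assume "q \<in> {q. q permutes {1..n}}"
      then have q: "q permutes {1..n}" by simp
      have qa: "q ?a = ?a" using permutes_not_in[OF q, of ?a] by simp
      have "permutation q" using q permutation_permutes by blast
      then have s: "sign (transpose ?a b \<circ> q) = sign (transpose ?a b) * sign q" by (intro sign_compose permutation_swap_id)
      show "of_int (sign (transpose ?a b \<circ> q)) * (\<Prod>i\<in>{1..?a}. 1 / (1 - t * x i * y ((transpose ?a b \<circ> q) i)))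
        = ?\<epsilon> / (1 - t * x ?a * y b) * (of_int (sign q) * (\<Prod>i\<in>{1..n}. 1 / (1 - t * x i * ?y (q i))))"
        unfolding s by (simp add: qa mult_ac)
    qed
    also have "\<dots> = ?\<epsilon> / (1 - t * x ?a * y b) * (\<Sum>q | q permutes {1..n}. of_int (sign q) * (\<Prod>i\<in>{1..n}. 1 / (1 - t * x i * ?y (q i))))"
      by (simp only: sum_distrib_left)
    also have "(\<Sum>q | q permutes {1..n}. of_int (sign q) * (\<Prod>i\<in>{1..n}. 1 / (1 - t * x i * ?y (q i)))) =
       t ^ card (pairs n) * Dx * (\<Prod>(i, j)\<in>pairs n. ?y i - ?y j) / (\<Prod>i\<in>{1..n}. \<Prod>j\<in>{1..n}. 1 - t * x i * ?y j)"
      unfolding Dx_def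
    proof (rule Suc.IH)
      show "inj_on ?y {1..n}"
        by (intro comp_inj_on inj_on_subset[OF inj_transpose subset_UNIV] inj_on_subset[OF Suc.prems(1) im])
      show "t * x i * ?y j \<noteq> 1" if "i \<in> {1..n}" "j \<in> {1..n}" for i j
      proof -
        have "transpose ?a b j \<in> {1..?a}" using im that(2) by blast
        then show ?thesis using Suc.prems(3)[of i "transpose ?a b j"] that(1) by (simp only: comp_apply) auto
      qed
    qed (use Suc.prems in auto)
    also have "(\<Prod>i\<in>{1..n}. \<Prod>j\<in>{1..n}. 1 - t * x i * ?y j) = (\<Prod>i\<in>{1..n}. \<Prod>c\<in>{1..?a} - {b}. 1 - t * x i * y c)"
      using transpose_image_prod[OF b, of "\<lambda>c. 1 - t * x i * y c" for i] by simp
    \<comment> \<open>The Vandermonde product of the y c with c \<noteq> b is obtained from the full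
      one, permuted by the transposition, by removing the pairs with the last index.\<close>
    also have "(\<Prod>(i, j)\<in>pairs n. ?y i - ?y j) = ?\<epsilon> * Dy / (\<Prod>c\<in>{1..?a} - {b}. y c - y b)"
    proof -
      have "(\<Prod>(i, j)\<in>pairs ?a. ?y i - ?y j) = ?\<epsilon> * Dy" using vandermonde_sign[OF tp, of y] by (simp add: Dy_def)
      moreover have "(\<Prod>(i, j)\<in>pairs ?a. ?y i - ?y j) = (\<Prod>(i, j)\<in>pairs n. ?y i - ?y j) * (\<Prod>i\<in>{1..n}. ?y i - ?y ?a)"
        by (rule prod_pairs_Suc)
      moreover have "(\<Prod>i\<in>{1..n}. ?y i - ?y ?a) = (\<Prod>c\<in>{1..?a} - {b}. y c - y b)"
        using transpose_image_prod[OF b, of "\<lambda>c. y c - y b"] by simp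
      moreover have "(\<Prod>c\<in>{1..?a} - {b}. y c - y b) \<noteq> 0"
      proof -
        have "y c - y b \<noteq> 0" if "c \<in> {1..?a} - {b}" for c using dy[OF b that] by (metis right_minus_eq)
        then show ?thesis by (subst prod_zero_iff) blast+
      qed
      ultimately show ?thesis by (simp add: nonzero_eq_divide_eq)
    qed
    finally have 1: "(\<Sum>q | q permutes {1..n}. of_int (sign (transpose ?a b \<circ> q)) * (\<Prod>i\<in>{1..?a}. 1 / (1 - t * x i * y ((transpose ?a b \<circ> q) i))))
      = ?\<epsilon> / (1 - t * x ?a * y b) * (t ^ card (pairs n) * Dx * (?\<epsilon> * Dy / (\<Prod>c\<in>{1..?a} - {b}. y c - y b)) / (\<Prod>i\<in>{1..n}. \<Prod>c\<in>{1..?a} - {b}. 1 - t * x i * y c))" .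
    have eps: "?\<epsilon> * ?\<epsilon> = 1" by (simp flip: of_int_mult)
    define U where "U = (\<Prod>c\<in>{1..?a} - {b}. y b - y c)"
    define A where "A = (\<Prod>i\<in>{1..n}. \<Prod>c\<in>{1..?a} - {b}. 1 - t * x i * y c)"
    define B' where "B' = (\<Prod>i\<in>{1..n}. 1 - t * x i * y b)"
    define C' where "C' = (\<Prod>c\<in>{1..?a} - {b}. 1 - t * x ?a * y c)"
    define d where "d = 1 - t * x ?a * y b"
    have U0: "U \<noteq> 0" unfolding U_def using dy[OF b] by (simp del: atLeastAtMost_iff)
    have cardb: "card ({1..?a} - {b}) = n" using b by simp
    have "(\<Prod>c\<in>{1..?a} - {b}. y c - y b) = (\<Prod>c\<in>{1..?a} - {b}. (-1) * (y b - y c))" by (intro prod.cong) auto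
    also have "\<dots> = (-1) ^ n * U" unfolding U_def prod.distrib using cardb by simp
    finally have U': "(\<Prod>c\<in>{1..?a} - {b}. y c - y b) = (-1) ^ n * U" .
    have row: "(\<Prod>j\<in>{1..?a}. 1 - t * x i * y j) = (1 - t * x i * y b) * (\<Prod>c\<in>{1..?a} - {b}. 1 - t * x i * y c)" for i
      by (rule prod.remove) (use b in auto)
    have "Q = (\<Prod>i\<in>{1..n}. \<Prod>j\<in>{1..?a}. 1 - t * x i * y j) * (\<Prod>j\<in>{1..?a}. 1 - t * x ?a * y j)"
      unfolding Q_def by simp
    then have Q': "Q = A * B' * (d * C')"
      unfolding row prod.distrib A_def[symmetric] B'_def[symmetric] C'_def[symmetric] d_def[symmetric] by (simp only: mult_ac)
    have nz': "A \<noteq> 0" "B' \<noteq> 0" "d \<noteq> 0" "C' \<noteq> 0" using Q unfolding Q' by auto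
    have "(\<Prod>c\<in>{1..?a} - {b}. (1 - t * x ?a * y c) / (y b - y c)) = C' / U" unfolding prod_dividef C'_def U_def ..
    then show ?thesis
      unfolding 1 U' unfolding Q' A_def[symmetric] B'_def[symmetric] d_def[symmetric]
      using nz' U0 eps by (simp add: field_simps power_mult_distrib flip: power_mult_distrib)
  qed
  have "(\<Sum>w | w permutes {1..?a}. of_int (sign w) * (\<Prod>i\<in>{1..?a}. 1 / (1 - t * x i * y (w i)))) =
    (\<Sum>b\<in>{1..?a}. t ^ card (pairs n) * Dx * Dy / Q * ((-1) ^ n * ((\<Prod>i\<in>{1..n}. 1 - t * x i * y b) * (\<Prod>c\<in>{1..?a} - {b}. (1 - t * x ?a * y c) / (y b - y c)))))"
    unfolding permutes_insert_sum by (rule sum.cong[OF refl]) (rule summand)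
  also have "\<dots> = t ^ card (pairs n) * Dx * Dy / Q * ((-1) ^ n * (\<Sum>b\<in>{1..?a}. (\<Prod>i\<in>{1..n}. 1 - t * x i * y b) * (\<Prod>c\<in>{1..?a} - {b}. (1 - t * x ?a * y c) / (y b - y c))))"
    by (simp only: sum_distrib_left)
  also have "(\<Sum>b\<in>{1..?a}. (\<Prod>i\<in>{1..n}. 1 - t * x i * y b) * (\<Prod>c\<in>{1..?a} - {b}. (1 - t * x ?a * y c) / (y b - y c))) = t ^ n * (\<Prod>i\<in>{1..n}. x ?a - x i)"
    by (rule cauchy_step) (use Suc.prems t in auto)
  also have "(-1) ^ n * (t ^ n * (\<Prod>i\<in>{1..n}. x ?a - x i)) = t ^ n * (\<Prod>i\<in>{1..n}. x i - x ?a)"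
  proof -
    have "(\<Prod>i\<in>{1..n}. x i - x ?a) = (\<Prod>i\<in>{1..n}. (-1) * (x ?a - x i))" by (intro prod.cong) auto
    also have "\<dots> = (-1) ^ n * (\<Prod>i\<in>{1..n}. x ?a - x i)" unfolding prod.distrib by simp
    finally show ?thesis by simp
  qed
  also have "t ^ card (pairs n) * Dx * Dy / Q * (t ^ n * (\<Prod>i\<in>{1..n}. x i - x ?a)) =
     t ^ card (pairs ?a) * (\<Prod>(i, j)\<in>pairs ?a. x i - x j) * Dy / Q"
  proof -
    have "card (pairs ?a) = card (pairs n) + n"
      unfolding pairs_Suc(1) by (subst card_Un_disjoint[OF _ _ pairs_Suc(2)]) (auto simp: card_image inj_on_def)
    then show ?thesis unfolding prod_pairs_Suc Dx_def by (simp add: power_add mult_ac)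
  qed
  finally show ?case unfolding Dy_def Q_def .
qed

text \<open>
  With \<open>f i j = (1 - x\<^sub>i / x\<^sub>j) / (1 - t x\<^sub>i / x\<^sub>j)\<close>, both sides are multiples of the symmetric function
  \<open>\<Prod>i<j. f i j f j i\<close>: the left one by Macdonald's identity, the right one by Cauchy's determinant at \<open>y = 1 / x\<close>.
\<close>

lemma symmetrization_identity:
  fixes x :: "nat \<Rightarrow> 'a::field"
  assumes x: "inj_on x {1..n}" "\<And>i. i \<in> {1..n} \<Longrightarrow> x i \<noteq> 0" and t: "t \<noteq> 0"
    and xt: "\<And>i j. i \<in> {1..n} \<Longrightarrow> j \<in> {1..n} \<Longrightarrow> t * x i \<noteq> x j"
  shows "t ^ card (pairs n) * (\<Sum>w | w permutes {1..n}. \<Prod>(i, j)\<in>pairs n. (1 - x (w i) / x (w j)) / (1 - t * (x (w i) / x (w j)))) =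
    (\<Prod>k\<in>{1..n}. 1 - t ^ k) * (\<Sum>w | w permutes {1..n}. of_int (sign w) * (\<Prod>i\<in>{1..n}. 1 / (1 - t * (x i / x (w i)))))"
proof (cases "n = 0")
  case True
  then show ?thesis by (simp add: pairs_0)
next
  case False
  have t1: "t \<noteq> 1" using xt[of 1 1] False by auto
  have P: "i \<in> {1..n}" "j \<in> {1..n}" "i \<noteq> j" if "(i, j) \<in> pairs n" for i j using that by (auto simp: pairs_def)
  have xd: "x i \<noteq> x j" if "i \<in> {1..n}" "j \<in> {1..n}" "i \<noteq> j" for i j
    using inj_onD[OF x(1)] that by blast
  have xy: "t * (x i / x j) \<noteq> 1" if "i \<in> {1..n}" "j \<in> {1..n}" for i j using xt[OF that] x(2)[OF that(2)] by simp
  let ?f = "\<lambda>i j. (1 - x i / x j) / (1 - t * (x i / x j))"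
  let ?F = "\<Prod>(i, j)\<in>pairs n. ?f i j * ?f j i"
  let ?S = "\<Sum>w | w permutes {1..n}. \<Prod>(i, j)\<in>pairs n. (x (w i) - t * x (w j)) / (x (w i) - x (w j))"
  have "(\<Prod>(i, j)\<in>pairs n. ?f (w i) (w j)) = ?F * (\<Prod>(i, j)\<in>pairs n. (x (w i) - t * x (w j)) / (x (w i) - x (w j)))"
    if w: "w permutes {1..n}" for w
  proof -
    have "?f (w i) (w j) = ?f (w i) (w j) * ?f (w j) (w i) * ((x (w i) - t * x (w j)) / (x (w i) - x (w j)))"
      if "(i, j) \<in> pairs n" for i j
    proof -
      have m: "w i \<in> {1..n}" "w j \<in> {1..n}" using P[OF that] permutes_in_image[OF w] by blast+
      have ne: "w i \<noteq> w j" using P[OF that] permutes_inj[OF w] by (auto dest: injD)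
      have "?f (w j) (w i) = (x (w i) - x (w j)) / (x (w i) - t * x (w j))"
        using x(2)[OF m(1)] xt[OF m(2,1)] by (simp add: divide_simps)
      then have "?f (w j) (w i) * ((x (w i) - t * x (w j)) / (x (w i) - x (w j))) = 1"
        using xt[OF m(2,1)] xd[OF m ne] by simp
      then show ?thesis by (simp only: mult.assoc mult_1_right)
    qed
    then have "(\<Prod>(i, j)\<in>pairs n. ?f (w i) (w j)) = (\<Prod>(i, j)\<in>pairs n. ?f (w i) (w j) * ?f (w j) (w i) * ((x (w i) - t * x (w j)) / (x (w i) - x (w j))))"
      by (intro prod.cong) auto
    also have "\<dots> = (\<Prod>(i, j)\<in>pairs n. ?f (w i) (w j) * ?f (w j) (w i)) * (\<Prod>(i, j)\<in>pairs n. (x (w i) - t * x (w j)) / (x (w i) - x (w j)))"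
      unfolding prod.distrib[symmetric] case_prod_beta ..
    finally show ?thesis unfolding prod_pairs_symmetric[OF w, of ?f] .
  qed
  then have "(\<Sum>w | w permutes {1..n}. \<Prod>(i, j)\<in>pairs n. ?f (w i) (w j)) = ?F * ?S"
    unfolding sum_distrib_left by (intro sum.cong) auto
  also have "?S = (\<Prod>k\<in>{1..n}. \<Sum>j<k. t ^ j)" by (rule macdonald_identity[OF x t1])
  finally have lhs: "(\<Sum>w | w permutes {1..n}. \<Prod>(i, j)\<in>pairs n. ?f (w i) (w j)) = ?F * (\<Prod>k\<in>{1..n}. \<Sum>j<k. t ^ j)" .
  let ?C = "\<Sum>w | w permutes {1..n}. of_int (sign w) * (\<Prod>i\<in>{1..n}. 1 / (1 - t * (x i / x (w i))))"
  have yi: "inj_on (\<lambda>i. 1 / x i) {1..n}"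
  proof (rule inj_onI)
    fix i j assume "i \<in> {1..n}" "j \<in> {1..n}" "1 / x i = 1 / x j"
    then show "i = j" using inj_onD[OF x(1), of i j] by simp
  qed
  have "(\<Sum>w | w permutes {1..n}. of_int (sign w) * (\<Prod>i\<in>{1..n}. 1 / (1 - t * x i * (1 / x (w i))))) =
    t ^ card (pairs n) * (\<Prod>(i, j)\<in>pairs n. x i - x j) * (\<Prod>(i, j)\<in>pairs n. 1 / x i - 1 / x j) /
      (\<Prod>i\<in>{1..n}. \<Prod>j\<in>{1..n}. 1 - t * x i * (1 / x j))"
    by (rule cauchy_determinant[OF yi _ t]) (use x(2) xy in auto)
  then have C: "?C = t ^ card (pairs n) * ((\<Prod>(i, j)\<in>pairs n. x i - x j) * (\<Prod>(i, j)\<in>pairs n. 1 / x i - 1 / x j)) /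
      (\<Prod>i\<in>{1..n}. \<Prod>j\<in>{1..n}. 1 - t * (x i / x j))" by (simp add: mult.assoc)
  have num: "(\<Prod>(i, j)\<in>pairs n. x i - x j) * (\<Prod>(i, j)\<in>pairs n. 1 / x i - 1 / x j) = (\<Prod>(i, j)\<in>pairs n. (1 - x i / x j) * (1 - x j / x i))"
    unfolding case_prod_beta prod.distrib[symmetric]
  proof (rule prod.cong[OF refl])
    fix p assume "p \<in> pairs n"
    then have "x (fst p) \<noteq> 0" "x (snd p) \<noteq> 0" using P[of "fst p" "snd p"] x(2) by auto
    then show "(x (fst p) - x (snd p)) * (1 / x (fst p) - 1 / x (snd p)) = (1 - x (fst p) / x (snd p)) * (1 - x (snd p) / x (fst p))"
      by (simp add: field_simps)
  qed
  have den: "(\<Prod>i\<in>{1..n}. \<Prod>j\<in>{1..n}. 1 - t * (x i / x j)) = (1 - t) ^ n * (\<Prod>(i, j)\<in>pairs n. (1 - t * (x i / x j)) * (1 - t * (x j / x i)))"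
  proof -
    have "(\<Prod>i\<in>{1..n}. \<Prod>j\<in>{1..n}. 1 - t * (x i / x j)) = (\<Prod>(i, j)\<in>{1..n} \<times> {1..n}. 1 - t * (x i / x j))"
      by (simp add: prod.cartesian_product)
    also have "{1..n} \<times> {1..n} = (\<lambda>i. (i, i)) ` {1..n} \<union> {(a, b). a \<in> {1..n} \<and> b \<in> {1..n} \<and> a \<noteq> b}" by auto
    also have "(\<Prod>(i, j)\<in>\<dots>. 1 - t * (x i / x j)) = (\<Prod>(i, j)\<in>(\<lambda>i. (i, i)) ` {1..n}. 1 - t * (x i / x j)) *
       (\<Prod>(i, j)\<in>{(a, b). a \<in> {1..n} \<and> b \<in> {1..n} \<and> a \<noteq> b}. 1 - t * (x i / x j))"
      by (rule prod.union_disjoint) (auto intro: finite_subset[of _ "{1..n} \<times> {1..n}"])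
    also have "(\<Prod>(i, j)\<in>(\<lambda>i. (i, i)) ` {1..n}. 1 - t * (x i / x j)) = (\<Prod>i\<in>{1..n}. 1 - t)"
      by (subst prod.reindex) (use x(2) in \<open>auto simp: inj_on_def intro!: prod.cong\<close>)
    finally show ?thesis unfolding prod_offdiag by simp
  qed
  have "?C * (1 - t) ^ n = t ^ card (pairs n) * ?F"
    unfolding C num den using t1 by (simp add: prod_dividef case_prod_beta)
  then have C': "t ^ card (pairs n) * ?F = ?C * (1 - t) ^ n" ..
  have "t ^ card (pairs n) * (?F * (\<Prod>k\<in>{1..n}. \<Sum>j<k. t ^ j)) = t ^ card (pairs n) * ?F * (\<Prod>k\<in>{1..n}. \<Sum>j<k. t ^ j)"
    by (simp only: mult.assoc)
  also have "\<dots> = (1 - t) ^ n * (\<Prod>k\<in>{1..n}. \<Sum>j<k. t ^ j) * ?C" unfolding C' by (simp only: mult_ac)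
  also have "(1 - t) ^ n * (\<Prod>k\<in>{1..n}. \<Sum>j<k. t ^ j) = (\<Prod>k\<in>{1..n}. 1 - t ^ k)"
    by (simp add: one_diff_power_eq prod.distrib)
  finally show ?thesis unfolding lhs .
qed

text \<open>Macdonald's identity for the variables 1 / x at t = 0, where its right side is 1;
  multiplying by the Vandermonde product clears the denominators and brings in the signs.\<close>

lemma weyl_denominator:
  fixes x :: "nat \<Rightarrow> 'a::field"
  assumes x: "inj_on x {1..n}" "\<And>i. i \<in> {1..n} \<Longrightarrow> x i \<noteq> 0"
  shows "(\<Prod>(i, j)\<in>pairs n. 1 - x i / x j) = (\<Sum>w | w permutes {1..n}. of_int (sign w) * (\<Prod>(i, j)\<in>pairs n. x i / x (w i)))"
proof -
  let ?y = "\<lambda>i. 1 / x i"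
  let ?D = "\<Prod>(i, j)\<in>pairs n. ?y i - ?y j"
  have P: "i \<in> {1..n}" "j \<in> {1..n}" "i \<noteq> j" if "(i, j) \<in> pairs n" for i j using that by (auto simp: pairs_def)
  have yd: "?y i \<noteq> ?y j" if "i \<in> {1..n}" "j \<in> {1..n}" "i \<noteq> j" for i j
    using inj_onD[OF x(1)] x(2)[OF that(1)] x(2)[OF that(2)] that by (simp add: frac_eq_eq) blast
  have D: "?D \<noteq> 0"
  proof -
    have "?y i - ?y j \<noteq> 0" if "(i, j) \<in> pairs n" for i j using yd[OF P[OF that]] by simp
    then show ?thesis by (auto simp: prod_zero_iff)
  qed
  have yi: "inj_on (\<lambda>i. 1 / x i) {1..n}"
  proof (rule inj_onI)
    fix i j assume "i \<in> {1..n}" "j \<in> {1..n}" "1 / x i = 1 / x j"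
    then show "i = j" using inj_onD[OF x(1), of i j] by simp
  qed
  have "(\<Sum>w | w permutes {1..n}. \<Prod>(i, j)\<in>pairs n. (?y (w i) - 0 * ?y (w j)) / (?y (w i) - ?y (w j))) = (\<Prod>k\<in>{1..n}. \<Sum>j<k. 0 ^ j)"
    by (rule macdonald_identity[OF yi]) (use x(2) in auto)
  also have "\<dots> = 1" by (intro prod.neutral) (auto simp: power_0_left sum.delta)
  finally have "?D = ?D * (\<Sum>w | w permutes {1..n}. \<Prod>(i, j)\<in>pairs n. ?y (w i) / (?y (w i) - ?y (w j)))" by simp
  also have "\<dots> = (\<Sum>w | w permutes {1..n}. of_int (sign w) * (\<Prod>(i, j)\<in>pairs n. ?y (w i)))"
    unfolding sum_distrib_left
  proof (rule sum.cong[OF refl])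
    fix w assume "w \<in> {w. w permutes {1..n}}"
    then have w: "w permutes {1..n}" by simp
    have s: "of_int (sign w) * of_int (sign w) = (1 :: 'a)" by (simp add: sign_def)
    have "?D * (\<Prod>(i, j)\<in>pairs n. ?y (w i) / (?y (w i) - ?y (w j))) = ?D * ((\<Prod>(i, j)\<in>pairs n. ?y (w i)) / (of_int (sign w) * ?D))"
      unfolding vandermonde_sign[OF w, symmetric] by (simp only: prod_dividef case_prod_unfold)
    also have "\<dots> = of_int (sign w) * (\<Prod>(i, j)\<in>pairs n. ?y (w i))"
      using D by (cases "sign w = 1") (auto simp: sign_def)
    finally show "?D * (\<Prod>(i, j)\<in>pairs n. ?y (w i) / (?y (w i) - ?y (w j))) = of_int (sign w) * (\<Prod>(i, j)\<in>pairs n. ?y (w i))" .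
  qed
  finally have E: "?D = (\<Sum>w | w permutes {1..n}. of_int (sign w) * (\<Prod>(i, j)\<in>pairs n. ?y (w i)))" .
  have "(\<Prod>(i, j)\<in>pairs n. 1 - x i / x j) = (\<Prod>(i, j)\<in>pairs n. x i * (?y i - ?y j))"
    unfolding case_prod_beta
  proof (rule prod.cong[OF refl])
    fix p assume "p \<in> pairs n"
    then have "x (fst p) \<noteq> 0" "x (snd p) \<noteq> 0" using P[of "fst p" "snd p"] x(2) by auto
    then show "1 - x (fst p) / x (snd p) = x (fst p) * (1 / x (fst p) - 1 / x (snd p))" by (simp add: right_diff_distrib)
  qed
  also have "\<dots> = (\<Prod>(i, j)\<in>pairs n. x i) * ?D" by (simp add: prod.distrib case_prod_beta)
  also have "\<dots> = (\<Sum>w | w permutes {1..n}. of_int (sign w) * (\<Prod>(i, j)\<in>pairs n. x i / x (w i)))"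
    unfolding E sum_distrib_left by (intro sum.cong) (auto simp: prod_dividef case_prod_beta)
  finally show ?thesis .
qed

section \<open>Transfer of the identities from fields to integral domains\<close>

lemma to_fract_prod: "to_fract (prod f A) = (\<Prod>x\<in>A. to_fract (f x))"
  by (induction A rule: infinite_finite_induct) auto

lemma to_fract_power: "to_fract (x ^ k) = to_fract x ^ k"
  by (induction k) auto

lemma to_fract_of_int: "to_fract (of_int k) = of_int k"
proof (cases k rule: int_cases2)
  have "to_fract (of_nat m :: 'a) = of_nat m" for m by (induction m) auto
  note m = this
  { case (nonneg m) then show ?thesis by (simp add: m) }
  { case (nonpos m) then show ?thesis by (simp add: m) }
qed

lemma inj_on_to_fract_comp: "inj_on x S \<Longrightarrow> inj_on (\<lambda>i. to_fract (x i)) S"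
  by (rule inj_onI) (auto dest: inj_onD)

text \<open>\<open>z i j\<close> stands for x i / x j and \<open>P i j\<close> for 1 / (1 - t
  \<open>z i j\<close>). Both exist among power series over formal exponentials, which do not form a
  field. The identity is checked in the fraction field, into which a domain embeds.\<close>

lemma symmetrization_identity_idom:
  fixes x :: "nat \<Rightarrow> 'a::idom"
  assumes x: "inj_on x {1..n}" "\<And>i. i \<in> {1..n} \<Longrightarrow> x i \<noteq> 0" and t: "t \<noteq> 0"
    and xt: "\<And>i j. i \<in> {1..n} \<Longrightarrow> j \<in> {1..n} \<Longrightarrow> t * x i \<noteq> x j"
    and z: "\<And>i j. z i j * x j = x i" and P: "\<And>i j. (1 - t * z i j) * P i j = 1"
  shows "t ^ card (pairs n) * (\<Sum>w | w permutes {1..n}. \<Prod>(i, j)\<in>pairs n. (1 - z (w i) (w j)) * P (w i) (w j)) =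
    (\<Prod>k\<in>{1..n}. 1 - t ^ k) * (\<Sum>w | w permutes {1..n}. of_int (sign w) * (\<Prod>i\<in>{1..n}. P i (w i)))"
proof -
  let ?\<phi> = "to_fract :: 'a \<Rightarrow> 'a fract"
  have z': "?\<phi> (x i) / ?\<phi> (x j) = ?\<phi> (z i j)" if "j \<in> {1..n}" for i j
    using x(2)[OF that] z[of i j] by (metis nonzero_eq_divide_eq to_fract_eq_0_iff to_fract_mult)
  have P': "1 / (1 - ?\<phi> t * ?\<phi> (z i j)) = ?\<phi> (P i j)" for i j
  proof -
    have "(1 - ?\<phi> t * ?\<phi> (z i j)) * ?\<phi> (P i j) = 1"
      using arg_cong[OF P[of i j], of to_fract] by simp
    then show ?thesis by (metis mult_zero_left nonzero_divide_eq_eq mult.commute zero_neq_one)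
  qed
  have m: "w i \<in> {1..n}" if "w permutes {1..n}" "i \<in> {1..n}" for w i using permutes_in_image[OF that(1)] that(2) by blast
  have "?\<phi> t ^ card (pairs n) * (\<Sum>w | w permutes {1..n}. \<Prod>(i, j)\<in>pairs n. (1 - ?\<phi> (x (w i)) / ?\<phi> (x (w j))) / (1 - ?\<phi> t * (?\<phi> (x (w i)) / ?\<phi> (x (w j))))) =
    (\<Prod>k\<in>{1..n}. 1 - ?\<phi> t ^ k) * (\<Sum>w | w permutes {1..n}. of_int (sign w) * (\<Prod>i\<in>{1..n}. 1 / (1 - ?\<phi> t * (?\<phi> (x i) / ?\<phi> (x (w i))))))"
  proof (rule symmetrization_identity[of "?\<phi> \<circ> x" n "?\<phi> t", unfolded comp_apply])
    show "inj_on (\<lambda>i. ?\<phi> (x i)) {1..n}" by (rule inj_on_to_fract_comp[OF x(1)])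
    show "?\<phi> t * ?\<phi> (x i) \<noteq> ?\<phi> (x j)" if "i \<in> {1..n}" "j \<in> {1..n}" for i j
      using xt[OF that] by (simp flip: to_fract_mult)
  qed (use x t in auto)
  moreover have "(\<Prod>(i, j)\<in>pairs n. (1 - ?\<phi> (x (w i)) / ?\<phi> (x (w j))) / (1 - ?\<phi> t * (?\<phi> (x (w i)) / ?\<phi> (x (w j)))))
    = ?\<phi> (\<Prod>(i, j)\<in>pairs n. (1 - z (w i) (w j)) * P (w i) (w j))" if w: "w permutes {1..n}" for w
    unfolding to_fract_prod
  proof (rule prod.cong[OF refl])
    fix p assume "p \<in> pairs n"
    then obtain i j where p: "p = (i, j)" "j \<in> {1..n}" by (auto simp: pairs_def)
    have "(1 - ?\<phi> (x (w i)) / ?\<phi> (x (w j))) / (1 - ?\<phi> t * (?\<phi> (x (w i)) / ?\<phi> (x (w j)))) = (1 - ?\<phi> (z (w i) (w j))) * (1 / (1 - ?\<phi> t * ?\<phi> (z (w i) (w j))))"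
      unfolding z'[OF m[OF w p(2)]] by simp
    also have "\<dots> = ?\<phi> ((1 - z (w i) (w j)) * P (w i) (w j))" unfolding P' by simp
    finally show "(case p of (i, j) \<Rightarrow> (1 - ?\<phi> (x (w i)) / ?\<phi> (x (w j))) / (1 - ?\<phi> t * (?\<phi> (x (w i)) / ?\<phi> (x (w j))))) =
      ?\<phi> (case p of (i, j) \<Rightarrow> (1 - z (w i) (w j)) * P (w i) (w j))" unfolding p by simp
  qed
  moreover have "(\<Prod>i\<in>{1..n}. 1 / (1 - ?\<phi> t * (?\<phi> (x i) / ?\<phi> (x (w i))))) = ?\<phi> (\<Prod>i\<in>{1..n}. P i (w i))" if w: "w permutes {1..n}" for w
    unfolding to_fract_prod by (intro prod.cong refl) (simp only: z'[OF m[OF w]] P')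
  ultimately have "?\<phi> (t ^ card (pairs n) * (\<Sum>w | w permutes {1..n}. \<Prod>(i, j)\<in>pairs n. (1 - z (w i) (w j)) * P (w i) (w j))) =
    ?\<phi> ((\<Prod>k\<in>{1..n}. 1 - t ^ k) * (\<Sum>w | w permutes {1..n}. of_int (sign w) * (\<Prod>i\<in>{1..n}. P i (w i))))"
    by (simp add: to_fract_power to_fract_prod[of "\<lambda>k. 1 - t ^ k"] to_fract_of_int cong: sum.cong_simp)
  then show ?thesis by (simp only: to_fract_eq_iff)
qed

lemma weyl_denominator_idom:
  fixes x :: "nat \<Rightarrow> 'a::idom"
  assumes x: "inj_on x {1..n}" "\<And>i. i \<in> {1..n} \<Longrightarrow> x i \<noteq> 0" and z: "\<And>i j. z i j * x j = x i"
  shows "(\<Prod>(i, j)\<in>pairs n. 1 - z i j) = (\<Sum>w | w permutes {1..n}. of_int (sign w) * (\<Prod>(i, j)\<in>pairs n. z i (w i)))"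
proof -
  let ?\<phi> = "to_fract :: 'a \<Rightarrow> 'a fract"
  have z': "?\<phi> (x i) / ?\<phi> (x j) = ?\<phi> (z i j)" if "j \<in> {1..n}" for i j
    using x(2)[OF that] z[of i j] by (metis nonzero_eq_divide_eq to_fract_eq_0_iff to_fract_mult)
  have P: "i \<in> {1..n}" "j \<in> {1..n}" if "(i, j) \<in> pairs n" for i j using that by (auto simp: pairs_def)
  have m: "w i \<in> {1..n}" if "w permutes {1..n}" "i \<in> {1..n}" for w i using permutes_in_image[OF that(1)] that(2) by blast
  have "(\<Prod>(i, j)\<in>pairs n. 1 - ?\<phi> (x i) / ?\<phi> (x j)) = (\<Sum>w | w permutes {1..n}. of_int (sign w) * (\<Prod>(i, j)\<in>pairs n. ?\<phi> (x i) / ?\<phi> (x (w i))))"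
    by (rule weyl_denominator[of "?\<phi> \<circ> x", unfolded comp_apply, OF inj_on_to_fract_comp[OF x(1)]]) (use x(2) in auto)
  moreover have "(\<Prod>(i, j)\<in>pairs n. 1 - ?\<phi> (x i) / ?\<phi> (x j)) = ?\<phi> (\<Prod>(i, j)\<in>pairs n. 1 - z i j)"
    unfolding to_fract_prod by (intro prod.cong refl) (auto simp: z'[OF P(2)])
  moreover have "(\<Prod>(i, j)\<in>pairs n. ?\<phi> (x i) / ?\<phi> (x (w i))) = ?\<phi> (\<Prod>(i, j)\<in>pairs n. z i (w i))" if w: "w permutes {1..n}" for w
    unfolding to_fract_prod by (intro prod.cong refl) (auto simp: z'[OF m[OF w P(1)]])
  ultimately have "?\<phi> (\<Prod>(i, j)\<in>pairs n. 1 - z i j) = ?\<phi> (\<Sum>w | w permutes {1..n}. of_int (sign w) * (\<Prod>(i, j)\<in>pairs n. z i (w i)))"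
    by (simp add: to_fract_of_int cong: sum.cong_simp)
  then show ?thesis by (simp only: to_fract_eq_iff)
qed

section \<open>Coefficients of products and strictly decreasing sequences\<close>

definition compositions :: "'a set \<Rightarrow> nat \<Rightarrow> ('a \<Rightarrow> nat) set" where
  "compositions S k = {\<kappa> \<in> S \<rightarrow>\<^sub>E UNIV. (\<Sum>s\<in>S. \<kappa> s) = k}"

lemma finite_compositions [simp]: "finite S \<Longrightarrow> finite (compositions S k)"
proof (rule finite_subset[of _ "S \<rightarrow>\<^sub>E {..k}"])
  assume S: "finite S"
  show "compositions S k \<subseteq> S \<rightarrow>\<^sub>E {..k}"
  proof
    fix \<kappa> assume \<kappa>: "\<kappa> \<in> compositions S k"
    then have "\<kappa> s \<le> k" if "s \<in> S" for s
      using member_le_sum[of s S \<kappa>, OF that _ S] by (simp add: compositions_def)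
    then show "\<kappa> \<in> S \<rightarrow>\<^sub>E {..k}" using \<kappa> by (auto simp: compositions_def PiE_iff)
  qed
qed (auto intro: finite_PiE)

lemma prod_fps_nth:
  fixes f :: "'b \<Rightarrow> 'a::comm_ring_1 fps"
  assumes S: "finite S"
  shows "fps_nth (\<Prod>s\<in>S. f s) k = (\<Sum>\<kappa>\<in>compositions S k. \<Prod>s\<in>S. fps_nth (f s) (\<kappa> s))"
  unfolding fps_prod_nth'[OF S]
proof (rule sum.reindex_bij_witness[where j = "\<lambda>X. restrict (count X) S" and i = "\<lambda>\<kappa>. \<Sum>s\<in>S. replicate_mset (\<kappa> s) s"])
  have cnt: "count (\<Sum>s\<in>S. replicate_mset (\<kappa> s) s) a = (if a \<in> S then \<kappa> a else 0)" for \<kappa> a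
    using S by (simp add: count_sum if_distrib sum.delta' cong: if_cong)
  fix X assume X: "X \<in> multisets_of_size S k"
  then have X': "set_mset X \<subseteq> S" "size X = k" by (auto simp: multisets_of_size_def)
  show "(\<Sum>s\<in>S. replicate_mset (restrict (count X) S s) s) = X"
    by (rule multiset_eqI) (use X'(1) in \<open>auto simp: cnt count_eq_zero_iff\<close>)
  have "(\<Sum>s\<in>S. count X s) = size X"
    unfolding size_multiset_overloaded_eq by (rule sum.mono_neutral_right) (use S X'(1) in \<open>auto simp: count_eq_zero_iff\<close>)
  then show "restrict (count X) S \<in> compositions S k" using X'(2) by (auto simp: compositions_def)
  show "(\<Prod>s\<in>S. fps_nth (f s) (restrict (count X) S s)) = (\<Prod>s\<in>S. fps_nth (f s) (count X s))" by simp
next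
  have cnt: "count (\<Sum>s\<in>S. replicate_mset (\<kappa> s) s) a = (if a \<in> S then \<kappa> a else 0)" for \<kappa> a
    using S by (simp add: count_sum if_distrib sum.delta' cong: if_cong)
  fix \<kappa> assume \<kappa>: "\<kappa> \<in> compositions S k"
  then show "restrict (count (\<Sum>s\<in>S. replicate_mset (\<kappa> s) s)) S = \<kappa>"
    by (auto simp: cnt compositions_def fun_eq_iff PiE_iff extensional_def restrict_def)
  show "(\<Sum>s\<in>S. replicate_mset (\<kappa> s) s) \<in> multisets_of_size S k"
    using \<kappa> S by (auto simp: multisets_of_size_def compositions_def size_multiset_sum set_mset_sum split: if_splits)
qed

lemma sum_of_bool: "finite S \<Longrightarrow> (\<Sum>x\<in>S. of_bool (P x)) = (of_nat (card {x \<in> S. P x}) :: 'a::semiring_1)"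
  unfolding of_bool_def by (subst sum.inter_filter[symmetric]) simp_all

lemma strictly_decreasing_le:
  fixes f :: "nat \<Rightarrow> 'a::linordered_idom"
  assumes "\<And>i. 1 \<le> i \<Longrightarrow> i < n \<Longrightarrow> f (Suc i) < f i" "1 \<le> i" "i < j" "j \<le> n"
  shows "f j < f i"
  using assms(3,4)
proof (induction j)
  case (Suc j)
  show ?case
  proof (cases "i = j")
    case True
    then show ?thesis using assms(1)[of i] assms(2) Suc.prems by simp
  next
    case False
    then have "f j < f i" using Suc by simp
    moreover have "f (Suc j) < f j" using assms(1)[of j] assms(2) Suc.prems False by simp
    ultimately show ?thesis by simp
  qed
qed simp

text \<open>As f and f \<circ> w both decrease, w is increasing; then i \<le> w i for all i by
  induction, which leaves only the identity.\<close>

lemma strictly_decreasing_permute: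
  fixes f :: "nat \<Rightarrow> 'a::linordered_idom"
  assumes f: "\<And>i. 1 \<le> i \<Longrightarrow> i < n \<Longrightarrow> f (Suc i) < f i" and w: "w permutes {1..n}"
    and fw: "\<And>i. 1 \<le> i \<Longrightarrow> i < n \<Longrightarrow> f (w (Suc i)) < f (w i)"
  shows "w = id"
proof (rule permutes_natset_ge[OF w], rule ballI)
  fix i assume "i \<in> {1..n}"
  then show "i \<le> w i"
  proof (induction i)
    case (Suc i)
    have "w (Suc i) \<in> {1..n}" using permutes_in_image[OF w] Suc.prems by blast
    moreover have "i < w (Suc i)" if i: "i \<ge> 1"
    proof -
      have i': "i \<in> {1..n}" "i < n" using i Suc.prems by auto
      have wi: "w i \<in> {1..n}" using permutes_in_image[OF w] i'(1) by blast
      have "\<not> w (Suc i) < w i"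
        using strictly_decreasing_le[of n f "w (Suc i)" "w i", OF f] fw[OF i i'(2)] wi \<open>w (Suc i) \<in> {1..n}\<close> by force
      moreover have "w (Suc i) \<noteq> w i" using fw[OF i i'(2)] by auto
      ultimately show ?thesis using Suc.IH[OF i'(1)] by simp
    qed
    ultimately show ?case by (cases "i = 0") auto
  qed simp
qed

text \<open>An arrangement minimizing \<Sum> i f (w i) is taken: swapping an ascent at positions i
  and i + 1 would make the sum smaller.\<close>

lemma decreasing_arrangement:
  fixes f :: "nat \<Rightarrow> 'a::linordered_idom"
  assumes f: "inj_on f {1..n}"
  shows "\<exists>w. w permutes {1..n} \<and> (\<forall>i. 1 \<le> i \<longrightarrow> i < n \<longrightarrow> f (w (Suc i)) < f (w i))"
proof -
  let ?h = "\<lambda>w. \<Sum>i\<in>{1..n}. of_nat i * f (w i)"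
  have fin: "finite {w. w permutes {1..n}}" by (simp add: finite_permutations)
  moreover have "{w. w permutes {1..n}} \<noteq> {}" using permutes_id by blast
  ultimately obtain w where w: "w permutes {1..n}" "\<And>v. v permutes {1..n} \<Longrightarrow> ?h w \<le> ?h v"
    using ex_min_if_finite[of "?h ` {w. w permutes {1..n}}"] by (auto simp: not_less)
  have "f (w (Suc i)) < f (w i)" if i: "1 \<le> i" "i < n" for i
  proof (rule ccontr)
    assume "\<not> ?thesis"
    moreover have "f (w (Suc i)) \<noteq> f (w i)"
    proof
      assume e: "f (w (Suc i)) = f (w i)"
      have "w i \<in> {1..n}" "w (Suc i) \<in> {1..n}" using i permutes_in_image[OF w(1)] by auto
      then have "w (Suc i) = w i" using inj_onD[OF f e] by blast
      then show False using permutes_inj[OF w(1)] by (metis injD n_not_Suc_n)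
    qed
    ultimately have lt: "f (w i) < f (w (Suc i))" by simp
    let ?v = "w \<circ> transpose i (Suc i)"
    have "?v permutes {1..n}" using i by (intro permutes_compose[OF permutes_swap_id w(1)]) auto
    then have "?h w \<le> ?h ?v" by (rule w(2))
    moreover have "{1..n} = insert i (insert (Suc i) ({1..n} - {i, Suc i}))" using i by auto
    then have s: "(\<Sum>j\<in>{1..n}. g j) = g i + (g (Suc i) + (\<Sum>j\<in>{1..n} - {i, Suc i}. g j))" for g :: "nat \<Rightarrow> 'a"
      by (metis (no_types, lifting) finite_atLeastAtMost finite_Diff finite_insert insert_iff Diff_iff n_not_Suc_n sum.insert)
    have "(\<Sum>j\<in>{1..n} - {i, Suc i}. of_nat j * f (?v j)) = (\<Sum>j\<in>{1..n} - {i, Suc i}. of_nat j * f (w j))"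
      by (intro sum.cong) (auto simp: transpose_def)
    ultimately show False using lt unfolding s by (simp add: algebra_simps)
  qed
  then show ?thesis using w(1) by blast
qed

text \<open>The geometric series of t^i, seen as the generating function of the multiples of
  i.\<close>

lemma geometric_dvd: "0 < i \<Longrightarrow> (1 - fps_X ^ i) * Abs_fps (\<lambda>m. of_bool (i dvd m)) = (1 :: 'a::comm_ring_1 fps)"
proof (rule fps_ext)
  fix m assume i: "0 < i"
  show "fps_nth ((1 - fps_X ^ i) * Abs_fps (\<lambda>m. of_bool (i dvd m))) m = fps_nth (1 :: 'a fps) m"
    using i by (auto simp: left_diff_distrib fps_X_power_mult_nth dest: dvd_imp_le dvd_diffD)
qed

lemma sum_tails: "(\<Sum>i\<in>{1..n}. \<Sum>j\<in>{i..n}. g j) = (\<Sum>j\<in>{1..n}. j * (g j :: nat))"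
proof -
  have "(\<Sum>i\<in>{1..n}. \<Sum>j\<in>{i..n}. g j) = (\<Sum>i\<in>{1..n}. \<Sum>j\<in>{j. j \<in> {1..n} \<and> i \<le> j}. g j)"
    by (intro sum.cong) auto
  also have "\<dots> = (\<Sum>j\<in>{1..n}. \<Sum>i\<in>{i. i \<in> {1..n} \<and> i \<le> j}. g j)" by (rule sum.swap_restrict) auto
  also have "\<dots> = (\<Sum>j\<in>{1..n}. j * g j)"
  proof (rule sum.cong[OF refl])
    fix j assume "j \<in> {1..n}"
    then have "{i. i \<in> {1..n} \<and> i \<le> j} = {1..j}" by auto
    then show "(\<Sum>i\<in>{i. i \<in> {1..n} \<and> i \<le> j}. g j) = j * g j" by simp
  qed
  finally show ?thesis .
qed

text \<open>The bijection is \<open>e\<^sub>i = i (\<kappa>\<^sub>i - \<kappa>\<^sub>i\<^sub>+\<^sub>1 - c\<^sub>i)\<close>, with \<open>\<kappa>\<^sub>n\<^sub>+\<^sub>1 = 0\<close>.\<close>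

lemma count_decreasing:
  fixes c :: "nat \<Rightarrow> nat" and n k :: nat
  defines "nx \<equiv> \<lambda>\<kappa> i. if i < n then \<kappa> (Suc i) else (0 :: nat)"
  shows "(of_nat (card {\<kappa> \<in> compositions {1..n} k. \<forall>i\<in>{1..n}. nx \<kappa> i + c i \<le> \<kappa> i}) :: rat) =
    fps_nth (fps_X ^ (\<Sum>i\<in>{1..n}. i * c i) * (\<Prod>i\<in>{1..n}. Abs_fps (\<lambda>m. of_bool (i dvd m)))) k" (is "_ = ?R")
proof -
  let ?C = "\<Sum>i\<in>{1..n}. i * c i"
  let ?D = "{\<kappa> \<in> compositions {1..n} k. \<forall>i\<in>{1..n}. nx \<kappa> i + c i \<le> \<kappa> i}"
  let ?E = "{e \<in> {1..n} \<rightarrow>\<^sub>E UNIV. (\<Sum>i\<in>{1..n}. e i) + ?C = k \<and> (\<forall>i\<in>{1..n}. i dvd e i)}"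
  let ?j = "\<lambda>\<kappa>. \<lambda>i\<in>{1..n}. i * (\<kappa> i - nx \<kappa> i - c i)"
  let ?i = "\<lambda>e. \<lambda>i\<in>{1..n}. \<Sum>j\<in>{i..n}. e j div j + c j"
  have tele: "\<kappa> i = (\<Sum>j\<in>{i..n}. \<kappa> j - nx \<kappa> j)" if "\<And>i. i \<in> {1..n} \<Longrightarrow> nx \<kappa> i \<le> \<kappa> i" "i \<in> {1..n}" for \<kappa> i
  proof -
    have "1 \<le> i" "i \<le> n" using that(2) by auto
    from this(2,1) show ?thesis
    proof (induction i rule: inc_induct)
      case base
      then show ?case by (simp add: nx_def)
    next
      case (step i)
      have "(\<Sum>j\<in>{i..n}. \<kappa> j - nx \<kappa> j) = (\<kappa> i - nx \<kappa> i) + (\<Sum>j\<in>{Suc i..n}. \<kappa> j - nx \<kappa> j)"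
        by (rule sum.atLeast_Suc_atMost) (use step in simp)
      also have "\<dots> = \<kappa> i - nx \<kappa> i + \<kappa> (Suc i)" using step by simp
      also have "\<dots> = \<kappa> i" using that(1)[of i] step by (simp add: nx_def)
      finally show ?case ..
    qed
  qed
  have "card ?D = card ?E"
  proof (rule bij_betw_same_card[of ?j], rule bij_betw_byWitness[where f' = ?i])
    show "\<forall>\<kappa>\<in>?D. ?i (?j \<kappa>) = \<kappa>"
    proof
      fix \<kappa> assume \<kappa>: "\<kappa> \<in> ?D"
      have "(\<Sum>j\<in>{i..n}. ?j \<kappa> j div j + c j) = \<kappa> i" if i: "i \<in> {1..n}" for i
      proof -
        have "(\<Sum>j\<in>{i..n}. ?j \<kappa> j div j + c j) = (\<Sum>j\<in>{i..n}. \<kappa> j - nx \<kappa> j)"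
        proof (rule sum.cong[OF refl])
          fix j assume "j \<in> {i..n}"
          then have j: "j \<in> {1..n}" "j > 0" using i by auto
          then have "nx \<kappa> j + c j \<le> \<kappa> j" using \<kappa> by blast
          then show "?j \<kappa> j div j + c j = \<kappa> j - nx \<kappa> j" using j by simp
        qed
        also have "\<dots> = \<kappa> i" by (rule tele[symmetric, OF _ i]) (use \<kappa> add_leD1 in blast)
        finally show ?thesis .
      qed
      moreover have "\<kappa> \<in> extensional {1..n}" using \<kappa> by (auto simp: compositions_def PiE_def)
      ultimately show "?i (?j \<kappa>) = \<kappa>" by (auto simp: fun_eq_iff extensional_def restrict_def)
    qed
    show "\<forall>e\<in>?E. ?j (?i e) = e"
    proof
      fix e assume e: "e \<in> ?E"
      have "i * (?i e i - nx (?i e) i - c i) = e i" if i: "i \<in> {1..n}" for i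
      proof -
        have "?i e i = (e i div i + c i) + (\<Sum>j\<in>{Suc i..n}. e j div j + c j)"
          using i sum.atLeast_Suc_atMost[of i n "\<lambda>j. e j div j + c j"] by simp
        moreover have "nx (?i e) i = (\<Sum>j\<in>{Suc i..n}. e j div j + c j)" using i by (simp add: nx_def)
        moreover have "i * (e i div i) = e i" using e i by simp
        ultimately show ?thesis by simp
      qed
      moreover have "e \<in> extensional {1..n}" using e by (auto simp: PiE_def)
      ultimately show "?j (?i e) = e" by (auto simp: fun_eq_iff extensional_def restrict_def)
    qed
    show "?j ` ?D \<subseteq> ?E"
    proof
      fix e assume "e \<in> ?j ` ?D"
      then obtain \<kappa> where \<kappa>: "\<kappa> \<in> ?D" "e = ?j \<kappa>" by blast
      have "(\<Sum>i\<in>{1..n}. e i) + ?C = (\<Sum>i\<in>{1..n}. i * (\<kappa> i - nx \<kappa> i))"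
        unfolding sum.distrib[symmetric]
      proof (rule sum.cong[OF refl])
        fix i assume i: "i \<in> {1..n}"
        then have "nx \<kappa> i + c i \<le> \<kappa> i" using \<kappa> by blast
        then have m: "(\<kappa> i - nx \<kappa> i - c i) + c i = \<kappa> i - nx \<kappa> i" by simp
        have "e i = i * (\<kappa> i - nx \<kappa> i - c i)" using i unfolding \<kappa>(2) by simp
        then have "e i + i * c i = i * ((\<kappa> i - nx \<kappa> i - c i) + c i)" by (simp only: distrib_left)
        then show "e i + i * c i = i * (\<kappa> i - nx \<kappa> i)" unfolding m .
      qed
      also have "\<dots> = (\<Sum>i\<in>{1..n}. \<Sum>j\<in>{i..n}. \<kappa> j - nx \<kappa> j)" by (rule sum_tails[symmetric])
      also have "\<dots> = (\<Sum>i\<in>{1..n}. \<kappa> i)" by (intro sum.cong refl tele[symmetric]) (use \<kappa> add_leD1 in blast)+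
      also have "\<dots> = k" using \<kappa> by (simp add: compositions_def)
      finally show "e \<in> ?E" using \<kappa>(2) by auto
    qed
    show "?i ` ?E \<subseteq> ?D"
    proof
      fix \<kappa> assume "\<kappa> \<in> ?i ` ?E"
      then obtain e where e: "e \<in> ?E" "\<kappa> = ?i e" by blast
      have "(\<Sum>i\<in>{1..n}. \<kappa> i) = (\<Sum>i\<in>{1..n}. i * (e i div i + c i))" unfolding e(2) using sum_tails[of "\<lambda>j. e j div j + c j" n] by simp
      also have "\<dots> = (\<Sum>i\<in>{1..n}. e i) + ?C"
        unfolding sum.distrib[symmetric] by (intro sum.cong refl) (use e in \<open>simp add: distrib_left\<close>)
      finally have "\<kappa> \<in> compositions {1..n} k" using e by (auto simp: compositions_def)
      moreover have "nx \<kappa> i + c i \<le> \<kappa> i" if i: "i \<in> {1..n}" for i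
        unfolding e(2) using i sum.atLeast_Suc_atMost[of i n "\<lambda>j. e j div j + c j"] by (simp add: nx_def)
      ultimately show "\<kappa> \<in> ?D" by blast
    qed
  qed
  moreover have "?R = of_nat (card ?E)"
  proof (cases "k < ?C")
    case True
    then have "?E = {}" by auto
    then show ?thesis using True by (simp only: fps_X_power_mult_nth if_True card.empty of_nat_0)
  next
    case False
    have "?R = (\<Sum>\<kappa>\<in>compositions {1..n} (k - ?C). \<Prod>i\<in>{1..n}. of_bool (i dvd \<kappa> i))"
      using False by (simp add: fps_X_power_mult_nth prod_fps_nth)
    also have "\<dots> = (\<Sum>\<kappa>\<in>compositions {1..n} (k - ?C). of_bool (\<forall>i\<in>{1..n}. i dvd \<kappa> i))"
      by (rule sum.cong[OF refl]) (auto simp: of_bool_def intro: prod_zero)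
    also have "\<dots> = of_nat (card {\<kappa> \<in> compositions {1..n} (k - ?C). \<forall>i\<in>{1..n}. i dvd \<kappa> i})"
      by (rule sum_of_bool) simp
    also have "{\<kappa> \<in> compositions {1..n} (k - ?C). \<forall>i\<in>{1..n}. i dvd \<kappa> i} = ?E"
      using False by (auto simp: compositions_def)
    finally show ?thesis .
  qed
  ultimately show ?thesis by simp
qed

section \<open>Formal exponentials and the character\<close>

text \<open>The formal exponential e^\<nu>, with the coordinates in {1..n} as exponents. Rational
  exponents admit the denominators n of the weights, and since finitely supported functions are
  linearly ordered as an additive group, the algebra is an integral domain.\<close>

definition fexp :: "nat \<Rightarrow> weight \<Rightarrow> (nat \<Rightarrow>\<^sub>0 rat) \<Rightarrow>\<^sub>0 rat" where
  "fexp n \<nu> = Poly_Mapping.single (\<Sum>k\<in>{1..n}. Poly_Mapping.single k (\<nu> k)) 1"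

lemma lookup_sum_single:
  "Poly_Mapping.lookup (\<Sum>k\<in>{1..n::nat}. Poly_Mapping.single k (\<nu> k)) j = (if j \<in> {1..n} then \<nu> j else (0 :: rat))"
  unfolding lookup_sum lookup_single when_def by (subst sum.delta) simp_all

lemma sum_single_eq_iff:
  "(\<Sum>k\<in>{1..n::nat}. Poly_Mapping.single k (\<nu> k)) = (\<Sum>k\<in>{1..n}. Poly_Mapping.single k (\<nu>' k :: rat)) \<longleftrightarrow> (\<forall>k\<in>{1..n}. \<nu> k = \<nu>' k)"
  unfolding poly_mapping_eq_iff fun_eq_iff lookup_sum_single by auto

lemma fexp_0: "fexp n (\<lambda>_. 0) = 1"
  by (simp add: fexp_def)

lemma fexp_add: "fexp n (\<lambda>k. \<nu> k + \<nu>' k) = fexp n \<nu> * fexp n \<nu>'"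
  by (simp add: fexp_def mult_single single_add sum.distrib)

lemma fexp_sum: "(\<Prod>s\<in>S. fexp n (f s)) = fexp n (\<lambda>k. \<Sum>s\<in>S. f s k)"
  by (induction S rule: infinite_finite_induct) (simp_all add: fexp_0 fexp_add)

lemma fexp_power: "fexp n \<nu> ^ m = fexp n (\<lambda>k. of_nat m * \<nu> k)"
  by (induction m) (simp_all add: fexp_0 distrib_right fexp_add)

lemma fexp_nonzero: "fexp n \<nu> \<noteq> 0"
  by (metis fexp_def lookup_single_eq lookup_zero one_neq_zero)

lemma fexp_eq_iff: "fexp n \<nu> = fexp n \<nu>' \<longleftrightarrow> (\<forall>k\<in>{1..n}. \<nu> k = \<nu>' k)"
proof -
  have "a = b" if "Poly_Mapping.single a (1::rat) = Poly_Mapping.single b 1" for a b :: "nat \<Rightarrow>\<^sub>0 rat"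
    using that by (metis lookup_single_eq lookup_single_not_eq one_neq_zero)
  then have "Poly_Mapping.single a (1::rat) = Poly_Mapping.single b 1 \<longleftrightarrow> a = b" for a b :: "nat \<Rightarrow>\<^sub>0 rat" by blast
  then show ?thesis unfolding fexp_def by (simp only: sum_single_eq_iff)
qed

lemma sl_root_fexp: "fexp n (sl_root i j) * fexp n (\<lambda>k. of_bool (k = j)) = fexp n (\<lambda>k. of_bool (k = i))"
  unfolding fexp_add[symmetric] by (simp add: sl_root_def)

lemma sl_root_permute: "w permutes S \<Longrightarrow> sl_root (w i) (w j) k = sl_root i j (inv w k)"
  by (auto simp: sl_root_def permutes_inv_eq of_bool_def)

lemma fexp_generators:
  "inj_on (\<lambda>i. fexp n (\<lambda>k. of_bool (k = i))) {1..n}"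
proof (rule inj_onI, unfold fexp_eq_iff)
  fix i j assume "i \<in> {1..n}" "\<forall>k\<in>{1..n}. of_bool (k = i) = (of_bool (k = j) :: rat)"
  then have "of_bool (i = i) = (of_bool (i = j) :: rat)" by blast
  then show "i = j" by (simp split: if_splits)
qed

lemma fps_const_prod: "(\<Prod>s\<in>S. fps_const (f s)) = fps_const (\<Prod>s\<in>S. f s :: 'a::comm_ring_1)"
  by (induction S rule: infinite_finite_induct) simp_all

lemma sum_of_bool_swap:
  "finite S \<Longrightarrow> (\<Sum>x\<in>{x \<in> S. P x}. of_bool (Q x)) = (\<Sum>x\<in>{x \<in> S. Q x}. of_bool (P x) :: 'a::semiring_1)"
proof -
  assume "finite S"
  then have "finite {x \<in> S. P x}" "finite {x \<in> S. Q x}" by simp_all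
  moreover have "{x \<in> {x \<in> S. P x}. Q x} = {x \<in> {x \<in> S. Q x}. P x}" by blast
  ultimately show ?thesis using sum_of_bool[of "{x \<in> S. P x}" Q] sum_of_bool[of "{x \<in> S. Q x}" P] by metis
qed

definition geom :: "'a::comm_ring_1 \<Rightarrow> 'a fps" where
  "geom z = Abs_fps (\<lambda>k. z ^ k)"

lemma geom_nth: "fps_nth (geom z) k = z ^ k"
  by (simp add: geom_def)

lemma geom_inverse: "(1 - fps_X * fps_const z) * geom z = 1"
proof (rule fps_ext)
  fix m
  show "fps_nth ((1 - fps_X * fps_const z) * geom z) m = fps_nth 1 m"
    by (cases m) (simp_all add: left_diff_distrib mult.assoc geom_nth)
qed

section \<open>Pairing with the character\<close>

context component
begin

text \<open>The constant term of p times \<Sum> e^(-wt b): a linear functional that reads off a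
  multiplicity from each exponential.\<close>

definition chpair :: "((nat \<Rightarrow>\<^sub>0 rat) \<Rightarrow>\<^sub>0 rat) \<Rightarrow> rat" where
  "chpair p = (\<Sum>b\<in>wcomp n y. Poly_Mapping.lookup p (\<Sum>k\<in>{1..n}. Poly_Mapping.single k (wtr n N b k)))"

lemma chpair_linear:
  "chpair 0 = 0" "chpair (p + q) = chpair p + chpair q" "chpair (- p) = - chpair p" "chpair (p - q) = chpair p - chpair q"
  by (simp_all add: chpair_def lookup_add lookup_minus sum.distrib sum_negf sum_subtractf)

lemma chpair_sum: "chpair (\<Sum>s\<in>S. f s) = (\<Sum>s\<in>S. chpair (f s))"
  by (induction S rule: infinite_finite_induct) (simp_all add: chpair_linear)

lemma chpair_sign: "chpair (of_int (sign w) * p) = of_int (sign w) * chpair p"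
  by (cases "sign w = 1") (auto simp: sign_def chpair_linear)

lemma chpair_fexp: "chpair (fexp n \<nu>) = (\<Sum>b\<in>wcomp n y. of_bool (\<forall>k\<in>{1..n}. wtr n N b k = \<nu> k))"
  unfolding chpair_def fexp_def
proof (rule sum.cong[OF refl])
  fix b
  have "(\<forall>k\<in>{1..n}. \<nu> k = wtr n N b k) = (\<forall>k\<in>{1..n}. wtr n N b k = \<nu> k)" by auto
  then show "Poly_Mapping.lookup (Poly_Mapping.single (\<Sum>k\<in>{1..n}. Poly_Mapping.single k (\<nu> k)) 1) (\<Sum>k\<in>{1..n}. Poly_Mapping.single k (wtr n N b k)) =
    (of_bool (\<forall>k\<in>{1..n}. wtr n N b k = \<nu> k) :: rat)"
    unfolding lookup_single sum_single_eq_iff when_def of_bool_def by simp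
qed

lemma chpair_fexp_permute:
  assumes w: "w permutes {1..n}"
  shows "chpair (fexp n (\<lambda>k. \<nu> (inv w k))) = chpair (fexp n \<nu>)"
proof -
  have "(\<forall>k\<in>{1..n}. f k = \<nu> (inv w k)) \<longleftrightarrow> (\<forall>k\<in>{1..n}. (f \<circ> w) k = \<nu> k)" for f :: weight
  proof
    assume l: "\<forall>k\<in>{1..n}. f k = \<nu> (inv w k)"
    show "\<forall>k\<in>{1..n}. (f \<circ> w) k = \<nu> k"
    proof
      fix k assume "k \<in> {1..n}"
      then have "w k \<in> {1..n}" using permutes_in_image[OF w] by blast
      then show "(f \<circ> w) k = \<nu> k" using l permutes_inverses(2)[OF w, of k] by (metis comp_apply)
    qed
  next
    assume r: "\<forall>k\<in>{1..n}. (f \<circ> w) k = \<nu> k"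
    show "\<forall>k\<in>{1..n}. f k = \<nu> (inv w k)"
    proof
      fix k assume "k \<in> {1..n}"
      then have "inv w k \<in> {1..n}" using permutes_in_image[OF permutes_inv[OF w]] by blast
      then show "f k = \<nu> (inv w k)" using r permutes_inverses(1)[OF w, of k] by (metis comp_apply)
    qed
  qed
  then show ?thesis unfolding chpair_fexp
    using weight_symmetric[OF w, of "\<lambda>f. of_bool (\<forall>k\<in>{1..n}. f k = \<nu> k)"] by simp
qed

definition chpair_fps :: "((nat \<Rightarrow>\<^sub>0 rat) \<Rightarrow>\<^sub>0 rat) fps \<Rightarrow> rat fps" where
  "chpair_fps F = Abs_fps (\<lambda>k. chpair (fps_nth F k))"

lemma chpair_fps_nth: "fps_nth (chpair_fps F) k = chpair (fps_nth F k)"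
  by (simp add: chpair_fps_def)

lemma chpair_fps_X_power: "chpair_fps (fps_X ^ m * F) = fps_X ^ m * chpair_fps F"
  by (rule fps_ext) (simp add: chpair_fps_nth fps_X_power_mult_nth chpair_linear)

lemma chpair_fps_prod: "finite S \<Longrightarrow> chpair_fps ((\<Prod>k\<in>S. 1 - fps_X ^ k) * F) = (\<Prod>k\<in>S. 1 - fps_X ^ k) * chpair_fps F"
proof (induction S rule: finite_induct)
  case (insert k S)
  have "chpair_fps ((1 - fps_X ^ k) * G) = (1 - fps_X ^ k) * chpair_fps G" for G
  proof -
    have "chpair_fps ((1 - fps_X ^ k) * G) = chpair_fps G - chpair_fps (fps_X ^ k * G)"
      by (rule fps_ext) (simp add: chpair_fps_nth left_diff_distrib chpair_linear)
    then show ?thesis by (simp add: chpair_fps_X_power left_diff_distrib)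
  qed
  then show ?case using insert by (simp add: mult.assoc)
qed simp

text \<open>The exponent of a term of \<Prod>(1 - e^\<alpha>) / (1 - t e^\<alpha>): the first sum is
  \<rho> - u \<rho>, from Weyl's denominator formula, and m records the exponents in the geometric
  series.\<close>

definition kwt :: "(nat \<Rightarrow> nat) \<Rightarrow> (nat \<times> nat \<Rightarrow> nat) \<Rightarrow> weight" where
  "kwt u m = (\<lambda>k. (\<Sum>(i, j)\<in>pairs n. sl_root i (u i) k) + (\<Sum>p\<in>pairs n. of_nat (m p) * sl_root (fst p) (snd p) k))"

text \<open>The result does not depend on w: all exponents are permuted by w, and
  \<open>chpair\<close> is invariant under permutations. So all terms of the symmetrization
  contribute the same.\<close>

lemma chpair_roots:
  assumes w: "w permutes {1..n}"
  shows "chpair (fps_nth (\<Prod>(i, j)\<in>pairs n. (1 - fps_const (fexp n (sl_root (w i) (w j)))) * geom (fexp n (sl_root (w i) (w j)))) k) =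
    (\<Sum>u | u permutes {1..n}. of_int (sign u) * (\<Sum>m\<in>compositions (pairs n) k. chpair (fexp n (kwt u m))))"
proof -
  let ?z = "\<lambda>i j. fexp n (sl_root (w i) (w j))"
  let ?x = "(\<lambda>i. fexp n (\<lambda>k. of_bool (k = i))) \<circ> w"
  have "w ` {1..n} = {1..n}" using permutes_image[OF w] .
  then have inj: "inj_on ?x {1..n}"
    using fexp_generators[of n] by (intro comp_inj_on permutes_inj_on[OF w]) simp
  have d: "(\<Prod>(i, j)\<in>pairs n. 1 - ?z i j) = (\<Sum>u | u permutes {1..n}. of_int (sign u) * (\<Prod>(i, j)\<in>pairs n. ?z i (u i)))"
    by (rule weyl_denominator_idom[OF inj]) (simp_all add: fexp_nonzero sl_root_fexp)
  have c: "fps_const (1 - p) = 1 - fps_const p" for p :: "(nat \<Rightarrow>\<^sub>0 rat) \<Rightarrow>\<^sub>0 rat" by (metis fps_const_1_eq_1 fps_const_sub)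
  have "(\<Prod>(i, j)\<in>pairs n. (1 - fps_const (?z i j)) * geom (?z i j)) =
    (\<Prod>p\<in>pairs n. fps_const (1 - ?z (fst p) (snd p))) * (\<Prod>p\<in>pairs n. geom (?z (fst p) (snd p)))"
    unfolding prod.distrib[symmetric] case_prod_unfold c ..
  also have "(\<Prod>p\<in>pairs n. fps_const (1 - ?z (fst p) (snd p))) = fps_const (\<Prod>(i, j)\<in>pairs n. 1 - ?z i j)"
    unfolding fps_const_prod case_prod_unfold ..
  finally have "fps_nth (\<Prod>(i, j)\<in>pairs n. (1 - fps_const (?z i j)) * geom (?z i j)) k =
    (\<Prod>(i, j)\<in>pairs n. 1 - ?z i j) * (\<Sum>m\<in>compositions (pairs n) k. \<Prod>p\<in>pairs n. ?z (fst p) (snd p) ^ m p)"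
    by (simp add: prod_fps_nth geom_nth)
  also have "\<dots> = (\<Sum>u | u permutes {1..n}. of_int (sign u) * (\<Sum>m\<in>compositions (pairs n) k. fexp n (\<lambda>k. kwt u m (inv w k))))"
    unfolding d sum_distrib_right
  proof (rule sum.cong[OF refl])
    fix u
    have "(\<Prod>(i, j)\<in>pairs n. ?z i (u i)) * (\<Prod>p\<in>pairs n. ?z (fst p) (snd p) ^ m p) = fexp n (\<lambda>k. kwt u m (inv w k))" for m
      unfolding fexp_power fexp_sum case_prod_unfold fexp_add[symmetric] kwt_def sl_root_permute[OF w] ..
    then show "of_int (sign u) * (\<Prod>(i, j)\<in>pairs n. ?z i (u i)) * (\<Sum>m\<in>compositions (pairs n) k. \<Prod>p\<in>pairs n. ?z (fst p) (snd p) ^ m p) =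
      of_int (sign u) * (\<Sum>m\<in>compositions (pairs n) k. fexp n (\<lambda>k. kwt u m (inv w k)))"
      by (simp add: mult.assoc sum_distrib_left)
  qed
  finally show ?thesis
    by (simp add: chpair_sum chpair_sign chpair_fexp_permute[OF w])
qed

section \<open>The Cauchy side: antisymmetrized exponents\<close>

definition emb :: "(nat \<Rightarrow> nat) \<Rightarrow> weight" where
  "emb \<kappa> = (\<lambda>k. if k \<in> {1..n} then of_nat (\<kappa> k) else 0)"

text \<open>The contribution of one exponent vector \<kappa> of the geometric series to the Cauchy
  side, a signed sum of multiplicities of the weights \<kappa> \<circ> w - \<kappa> in the
  component.\<close>

definition skew :: "weight \<Rightarrow> rat" where
  "skew \<kappa> = (\<Sum>w | w permutes {1..n}. of_int (sign w) * chpair (fexp n (\<lambda>k. \<kappa> (w k) - \<kappa> k)))"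

lemma emb_permute: "w permutes {1..n} \<Longrightarrow> emb (\<kappa> \<circ> w) k = emb \<kappa> (w k)"
  using permutes_in_image[of w "{1..n}" k] by (simp add: emb_def)

text \<open>Exponents \<kappa> i of the factors 1 / (1 - t x_i / x_(w i)) give the weight \<kappa> -
  \<kappa> \<circ> w^-1, which a permutation carries to \<kappa> \<circ> w - \<kappa> without
  changing the pairing.\<close>

lemma chpair_cauchy:
  "chpair (fps_nth (\<Sum>w | w permutes {1..n}. of_int (sign w) * (\<Prod>i\<in>{1..n}. geom (fexp n (sl_root i (w i))))) k) =
    (\<Sum>\<kappa>\<in>compositions {1..n} k. skew (emb \<kappa>))"
proof -
  have e: "fexp n (\<lambda>k. \<Sum>i\<in>{1..n}. of_nat (\<kappa> i) * sl_root i (w i) k) = fexp n (\<lambda>k. emb \<kappa> (w (inv w k)) - emb \<kappa> (inv w k))"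
    if w: "w permutes {1..n}" for w \<kappa>
    unfolding fexp_eq_iff
  proof
    fix k assume k: "k \<in> {1..n}"
    then have k': "inv w k \<in> {1..n}" using permutes_in_image[OF permutes_inv[OF w]] by blast
    have "(\<Sum>i\<in>{1..n}. of_nat (\<kappa> i) * sl_root i (w i) k) = (\<Sum>i\<in>{1..n}. (if k = i then of_nat (\<kappa> i) else 0) - (if inv w k = i then of_nat (\<kappa> i) else 0) :: rat)"
      by (intro sum.cong refl) (auto simp: sl_root_def of_bool_def permutes_inv_eq[OF w])
    also have "\<dots> = of_nat (\<kappa> k) - of_nat (\<kappa> (inv w k))" unfolding sum_subtractf using k k' by simp
    finally show "(\<Sum>i\<in>{1..n}. of_nat (\<kappa> i) * sl_root i (w i) k) = emb \<kappa> (w (inv w k)) - emb \<kappa> (inv w k)"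
      using k k' by (simp add: emb_def permutes_inverses[OF w])
  qed
  have "chpair (fps_nth (\<Prod>i\<in>{1..n}. geom (fexp n (sl_root i (w i)))) k) =
      (\<Sum>\<kappa>\<in>compositions {1..n} k. chpair (fexp n (\<lambda>k. emb \<kappa> (w k) - emb \<kappa> k)))" if w: "w permutes {1..n}" for w
  proof -
    have "fps_nth (\<Prod>i\<in>{1..n}. geom (fexp n (sl_root i (w i)))) k = (\<Sum>\<kappa>\<in>compositions {1..n} k. fexp n (\<lambda>k. emb \<kappa> (w (inv w k)) - emb \<kappa> (inv w k)))"
      by (simp only: prod_fps_nth finite_atLeastAtMost geom_nth fexp_power fexp_sum e[OF w])
    then show ?thesis
      using chpair_fexp_permute[OF w, of "\<lambda>k. emb \<kappa> (w k) - emb \<kappa> k" for \<kappa>] by (simp only: chpair_sum)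
  qed
  moreover have "fps_nth (of_int (sign w) * F) k = of_int (sign w) * fps_nth F k" for w :: "nat \<Rightarrow> nat" and F :: "((nat \<Rightarrow>\<^sub>0 rat) \<Rightarrow>\<^sub>0 rat) fps"
    by (cases "sign w = 1") (auto simp: sign_def)
  ultimately have "chpair (fps_nth (\<Sum>w | w permutes {1..n}. of_int (sign w) * (\<Prod>i\<in>{1..n}. geom (fexp n (sl_root i (w i))))) k) =
    (\<Sum>w | w permutes {1..n}. \<Sum>\<kappa>\<in>compositions {1..n} k. of_int (sign w) * chpair (fexp n (\<lambda>k. emb \<kappa> (w k) - emb \<kappa> k)))"
    by (simp add: fps_sum_nth chpair_sum chpair_sign sum_distrib_left)
  also have "\<dots> = (\<Sum>\<kappa>\<in>compositions {1..n} k. skew (emb \<kappa>))" unfolding skew_def by (rule sum.swap)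
  finally show ?thesis .
qed

lemma permutation_if: "w permutes {1..n} \<Longrightarrow> permutation w"
  using permutation_permutes by blast

text \<open>Conjugating the summation variable by \<sigma> keeps its sign, and \<open>chpair\<close>
  absorbs the remaining permutation of coordinates.\<close>

lemma skew_permute:
  assumes \<sigma>: "\<sigma> permutes {1..n}"
  shows "skew (\<lambda>k. \<kappa> (\<sigma> k)) = skew \<kappa>"
proof -
  note inv = permutes_inverses[OF \<sigma>]
  have "skew (\<lambda>k. \<kappa> (\<sigma> k)) = (\<Sum>w | w permutes {1..n}. of_int (sign w) * chpair (fexp n (\<lambda>k. \<kappa> (\<sigma> (w (inv \<sigma> k))) - \<kappa> k)))"
    unfolding skew_def
  proof (rule sum.cong[OF refl])
    fix w
    have "(\<lambda>k. \<kappa> (\<sigma> (w k)) - \<kappa> (\<sigma> k)) = (\<lambda>k. \<kappa> (\<sigma> (w (inv \<sigma> (inv (inv \<sigma>) k)))) - \<kappa> (inv (inv \<sigma>) k))"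
      using inv_inv_eq[OF permutes_bij[OF \<sigma>]] by (simp add: inv)
    then show "of_int (sign w) * chpair (fexp n (\<lambda>k. \<kappa> (\<sigma> (w k)) - \<kappa> (\<sigma> k))) = of_int (sign w) * chpair (fexp n (\<lambda>k. \<kappa> (\<sigma> (w (inv \<sigma> k))) - \<kappa> k))"
      using chpair_fexp_permute[OF permutes_inv[OF \<sigma>], of "\<lambda>k. \<kappa> (\<sigma> (w (inv \<sigma> k))) - \<kappa> k"] by simp
  qed
  also have "\<dots> = skew \<kappa>" unfolding skew_def
  proof (rule sum.reindex_bij_witness[where i = "\<lambda>v. inv \<sigma> \<circ> v \<circ> \<sigma>" and j = "\<lambda>w. \<sigma> \<circ> w \<circ> inv \<sigma>"])
    fix w assume "w \<in> {w. w permutes {1..n}}"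
    then have w: "w permutes {1..n}" by simp
    show "\<sigma> \<circ> w \<circ> inv \<sigma> \<in> {w. w permutes {1..n}}" "inv \<sigma> \<circ> w \<circ> \<sigma> \<in> {w. w permutes {1..n}}"
      using w \<sigma> by (auto intro!: permutes_compose permutes_inv simp del: comp_apply)
    show "inv \<sigma> \<circ> (\<sigma> \<circ> w \<circ> inv \<sigma>) \<circ> \<sigma> = w" "\<sigma> \<circ> (inv \<sigma> \<circ> w \<circ> \<sigma>) \<circ> inv \<sigma> = w" by (auto simp: fun_eq_iff inv)
    have "sign (\<sigma> \<circ> w \<circ> inv \<sigma>) = sign \<sigma> * sign w * sign \<sigma>"
      by (simp add: sign_compose permutation_if[OF \<sigma>] permutation_if[OF w] permutation_if[OF permutes_inv[OF \<sigma>]]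
          permutation_compose sign_inverse del: comp_apply)
    also have "\<dots> = sign w" by (simp add: sign_def)
    finally show "of_int (sign (\<sigma> \<circ> w \<circ> inv \<sigma>)) * chpair (fexp n (\<lambda>k. \<kappa> ((\<sigma> \<circ> w \<circ> inv \<sigma>) k) - \<kappa> k)) =
      of_int (sign w) * chpair (fexp n (\<lambda>k. \<kappa> (\<sigma> (w (inv \<sigma> k))) - \<kappa> k))" by simp
  qed
  finally show ?thesis .
qed

text \<open>Composing w with the transposition of a and b changes the sign of a term but not its
  weight.\<close>

lemma skew_degenerate:
  assumes ab: "a \<in> {1..n}" "b \<in> {1..n}" "a \<noteq> b" and \<kappa>: "\<kappa> a = \<kappa> b"
  shows "skew \<kappa> = 0"
proof -
  let ?\<tau> = "transpose a b"
  have t: "?\<tau> permutes {1..n}" by (rule permutes_swap_id[OF ab(1,2)])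
  have "\<kappa> (?\<tau> k) = \<kappa> k" for k using \<kappa> by (simp add: transpose_def)
  moreover have "sign (?\<tau> \<circ> w) = - sign w" if "w permutes {1..n}" for w
    using ab(3) by (simp add: sign_compose permutation_swap_id permutation_if[OF that] sign_swap_id del: comp_apply)
  moreover have "skew \<kappa> = (\<Sum>w | w permutes {1..n}. of_int (sign (?\<tau> \<circ> w)) * chpair (fexp n (\<lambda>k. \<kappa> ((?\<tau> \<circ> w) k) - \<kappa> k)))"
    unfolding skew_def
  proof (rule sum.reindex_bij_witness[where i = "\<lambda>w. ?\<tau> \<circ> w" and j = "\<lambda>w. ?\<tau> \<circ> w"])
    fix w assume "w \<in> {w. w permutes {1..n}}"
    then show "?\<tau> \<circ> w \<in> {w. w permutes {1..n}}" using permutes_compose[OF _ t] by blast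
    then show "?\<tau> \<circ> w \<in> {w. w permutes {1..n}}" .
    show ii: "?\<tau> \<circ> (?\<tau> \<circ> w) = w" by (simp add: fun_eq_iff)
    then show "?\<tau> \<circ> (?\<tau> \<circ> w) = w" .
    show "of_int (sign (?\<tau> \<circ> (?\<tau> \<circ> w))) * chpair (fexp n (\<lambda>k. \<kappa> ((?\<tau> \<circ> (?\<tau> \<circ> w)) k) - \<kappa> k)) = of_int (sign w) * chpair (fexp n (\<lambda>k. \<kappa> (w k) - \<kappa> k))"
      unfolding ii ..
  qed
  ultimately have "skew \<kappa> = - skew \<kappa>" by (simp add: skew_def sum_negf)
  then show ?thesis by simp
qed

text \<open>For the words left by the cancellation, \<kappa> + wt b is strictly decreasing like
  \<kappa>. It can then be a rearrangement of \<kappa> only by being equal to \<kappa>, that is, if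
  b has weight zero.\<close>

lemma skew_decreasing:
  assumes \<kappa>: "\<And>i. 1 \<le> i \<Longrightarrow> i < n \<Longrightarrow> \<kappa> i - \<kappa> (Suc i) = of_nat (\<mu> i) + 1"
  shows "skew \<kappa> = (\<Sum>b\<in>{b \<in> wcomp n y. \<forall>i. 1 \<le> i \<longrightarrow> i < n \<longrightarrow> weps i b \<le> \<mu> i}. of_bool (\<forall>k\<in>{1..n}. wtr n N b k = 0))"
proof -
  \<comment> \<open>The signed indicator of the rearrangements of \<kappa>, an antisymmetric
    function; its sum over the \<kappa> + wt b is \<open>skew \<kappa>\<close>.\<close>
  define A :: "weight \<Rightarrow> rat" where "A \<nu> = (\<Sum>w | w permutes {1..n}. of_int (sign w) * of_bool (\<forall>k\<in>{1..n}. \<nu> k = \<kappa> (w k)))" for \<nu>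
  have "skew \<kappa> = (\<Sum>w | w permutes {1..n}. \<Sum>b\<in>wcomp n y. of_int (sign w) * of_bool (\<forall>k\<in>{1..n}. \<kappa> k + wtr n N b k = \<kappa> (w k)))"
    unfolding skew_def chpair_fexp sum_distrib_left by (intro sum.cong refl) (auto simp: of_bool_def algebra_simps)
  also have "\<dots> = (\<Sum>b\<in>wcomp n y. A (\<lambda>k. \<kappa> k + wtr n N b k))" unfolding A_def by (rule sum.swap)
  also have "\<dots> = (\<Sum>b\<in>{b \<in> wcomp n y. \<forall>i. 1 \<le> i \<longrightarrow> i < n \<longrightarrow> weps i b \<le> \<mu> i}. A (\<lambda>k. \<kappa> k + wtr n N b k))"
  proof (rule cancellation[where A = A and \<kappa> = \<kappa> and \<mu> = \<mu>, OF _ \<kappa>])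
    fix \<nu> :: weight and i assume i: "1 \<le> i" "i < n"
    let ?s = "transpose i (Suc i)"
    have s: "?s permutes {1..n}" using i by (intro permutes_swap_id) auto
    have "sign (w \<circ> ?s) = - sign w" if "w permutes {1..n}" for w
      by (simp add: sign_compose permutation_swap_id permutation_if[OF that] sign_swap_id del: comp_apply)
    moreover have "(\<forall>k\<in>{1..n}. (\<nu> \<circ> ?s) k = \<kappa> ((w \<circ> ?s) k)) = (\<forall>k\<in>{1..n}. \<nu> k = \<kappa> (w k))" for w
    proof -
      have "(\<forall>k\<in>{1..n}. \<nu> k = \<kappa> (w k)) = (\<forall>k\<in>?s ` {1..n}. \<nu> k = \<kappa> (w k))" unfolding permutes_image[OF s] ..
      then show ?thesis by simp
    qed
    ultimately show "A (\<nu> \<circ> ?s) = - A \<nu>"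
      unfolding A_def by (subst sum_permutations_compose_right[OF s]) (simp add: sum_negf del: comp_apply)
  qed
  also have "\<dots> = (\<Sum>b\<in>{b \<in> wcomp n y. \<forall>i. 1 \<le> i \<longrightarrow> i < n \<longrightarrow> weps i b \<le> \<mu> i}. of_bool (\<forall>k\<in>{1..n}. wtr n N b k = 0))"
  proof (rule sum.cong[OF refl])
    fix b assume b: "b \<in> {b \<in> wcomp n y. \<forall>i. 1 \<le> i \<longrightarrow> i < n \<longrightarrow> weps i b \<le> \<mu> i}"
    have dec: "\<kappa> (Suc i) < \<kappa> i" if "1 \<le> i" "i < n" for i using \<kappa>[OF that] by (simp add: algebra_simps)
    have dec': "\<kappa> (Suc i) + wtr n N b (Suc i) < \<kappa> i + wtr n N b i" if i: "1 \<le> i" "i < n" for i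
    proof -
      have "weps i b \<le> \<mu> i" using b i by blast
      then have "- int (\<mu> i) \<le> wtw i b" using wphi_weps[of i b] by linarith
      then have "- (of_nat (\<mu> i) :: rat) \<le> of_int (wtw i b)" by (metis of_int_le_iff of_int_minus of_int_of_nat_eq)
      then show ?thesis using \<kappa>[OF i] wtr_wtw[OF i, of N b] by linarith
    qed
    have "(\<forall>k\<in>{1..n}. \<kappa> k + wtr n N b k = \<kappa> (w k)) \<longleftrightarrow> w = id \<and> (\<forall>k\<in>{1..n}. wtr n N b k = 0)" if w: "w permutes {1..n}" for w
    proof
      assume l: "\<forall>k\<in>{1..n}. \<kappa> k + wtr n N b k = \<kappa> (w k)"
      have "w = id"
      proof (rule strictly_decreasing_permute[where f = \<kappa>, OF dec w])
        fix i assume i: "1 \<le> i" "i < n"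
        then have "\<kappa> i + wtr n N b i = \<kappa> (w i)" "\<kappa> (Suc i) + wtr n N b (Suc i) = \<kappa> (w (Suc i))" using l by auto
        then show "\<kappa> (w (Suc i)) < \<kappa> (w i)" using dec'[OF i] by simp
      qed
      then show "w = id \<and> (\<forall>k\<in>{1..n}. wtr n N b k = 0)" using l by auto
    qed auto
    then have "A (\<lambda>k. \<kappa> k + wtr n N b k) = (\<Sum>w | w permutes {1..n}. if w = id then of_bool (\<forall>k\<in>{1..n}. wtr n N b k = 0) else 0)"
      unfolding A_def by (intro sum.cong refl) (auto simp: of_bool_def sign_id)
    also have "\<dots> = of_bool (\<forall>k\<in>{1..n}. wtr n N b k = 0)"
      using permutes_id by (subst sum.delta) (auto simp: finite_permutations)
    finally show "A (\<lambda>k. \<kappa> k + wtr n N b k) = of_bool (\<forall>k\<in>{1..n}. wtr n N b k = 0)" .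
  qed
  finally show ?thesis .
qed

definition dec :: "(nat \<Rightarrow> nat) \<Rightarrow> bool" where
  "dec \<kappa> \<longleftrightarrow> (\<forall>i. 1 \<le> i \<longrightarrow> i < n \<longrightarrow> \<kappa> (Suc i) < \<kappa> i)"

text \<open>A composition with repeated entries contributes zero. One with distinct entries has
  exactly one decreasing rearrangement, and \<open>skew\<close> takes the same value on all n!
  arrangements.\<close>

lemma sum_skew_decreasing:
  "(\<Sum>\<kappa>\<in>compositions {1..n} k. skew (emb \<kappa>)) = fact n * (\<Sum>\<kappa>\<in>{\<kappa> \<in> compositions {1..n} k. dec \<kappa>}. skew (emb \<kappa>))"
proof -
  let ?C = "compositions {1..n} k"
  have perm: "\<kappa> \<circ> \<sigma> \<in> ?C" if "\<kappa> \<in> ?C" "\<sigma> permutes {1..n}" for \<kappa> \<sigma>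
  proof -
    have "(\<Sum>i\<in>{1..n}. \<kappa> (\<sigma> i)) = (\<Sum>i\<in>{1..n}. \<kappa> i)" using sum.permute[OF that(2), of \<kappa>] by (simp add: comp_def)
    moreover have "\<kappa> \<circ> \<sigma> \<in> {1..n} \<rightarrow>\<^sub>E UNIV"
      using that permutes_not_in[OF that(2)] by (auto simp: compositions_def PiE_iff extensional_def)
    ultimately show ?thesis using that(1) by (simp add: compositions_def)
  qed
  have skew_emb: "skew (emb (\<kappa> \<circ> \<sigma>)) = skew (emb \<kappa>)" if "\<sigma> permutes {1..n}" for \<kappa> \<sigma>
    using skew_permute[OF that, of "emb \<kappa>"] emb_permute[OF that, of \<kappa>] by presburger
  have "skew (emb \<kappa>) = (\<Sum>\<sigma> | \<sigma> permutes {1..n}. if dec (\<kappa> \<circ> \<sigma>) then skew (emb \<kappa>) else 0)" if \<kappa>: "\<kappa> \<in> ?C" for \<kappa>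
  proof (cases "inj_on \<kappa> {1..n}")
    case True
    then have "inj_on (int \<circ> \<kappa>) {1..n}" by (intro comp_inj_on) auto
    then obtain \<sigma> where \<sigma>: "\<sigma> permutes {1..n}" "\<And>i. 1 \<le> i \<Longrightarrow> i < n \<Longrightarrow> int (\<kappa> (\<sigma> (Suc i))) < int (\<kappa> (\<sigma> i))"
      using decreasing_arrangement[of "int \<circ> \<kappa>" n] by auto
    have "dec (\<kappa> \<circ> \<tau>) \<longleftrightarrow> \<tau> = \<sigma>" if \<tau>: "\<tau> permutes {1..n}" for \<tau>
    proof
      assume d: "dec (\<kappa> \<circ> \<tau>)"
      have "inv \<sigma> \<circ> \<tau> = id"
      proof (rule strictly_decreasing_permute[of n "\<lambda>i. int (\<kappa> (\<sigma> i))", OF \<sigma>(2)])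
        show "inv \<sigma> \<circ> \<tau> permutes {1..n}" by (intro permutes_compose \<tau> permutes_inv \<sigma>(1))
      qed (use d in \<open>auto simp: dec_def permutes_inverses[OF \<sigma>(1)]\<close>)
      then have "\<sigma> \<circ> (inv \<sigma> \<circ> \<tau>) = \<sigma>" by simp
      then show "\<tau> = \<sigma>" by (simp add: fun_eq_iff permutes_inverses[OF \<sigma>(1)])
    qed (use \<sigma> in \<open>auto simp: dec_def\<close>)
    then have "(\<Sum>\<tau> | \<tau> permutes {1..n}. if dec (\<kappa> \<circ> \<tau>) then skew (emb \<kappa>) else 0) = (\<Sum>\<tau> | \<tau> permutes {1..n}. if \<tau> = \<sigma> then skew (emb \<kappa>) else 0)"
      by (intro sum.cong refl) auto
    also have "\<dots> = skew (emb \<kappa>)" using \<sigma>(1) by (subst sum.delta) (auto simp: finite_permutations)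
    finally show ?thesis by simp
  next
    case False
    then obtain a b where "a \<in> {1..n}" "b \<in> {1..n}" "a \<noteq> b" "\<kappa> a = \<kappa> b" unfolding inj_on_def by blast
    then have "skew (emb \<kappa>) = 0" by (intro skew_degenerate[of a b]) (auto simp: emb_def)
    then show ?thesis by (simp cong: if_cong)
  qed
  then have "(\<Sum>\<kappa>\<in>?C. skew (emb \<kappa>)) = (\<Sum>\<kappa>\<in>?C. \<Sum>\<sigma> | \<sigma> permutes {1..n}. if dec (\<kappa> \<circ> \<sigma>) then skew (emb \<kappa>) else 0)"
    by (rule sum.cong[OF refl])
  also have "\<dots> = (\<Sum>\<sigma> | \<sigma> permutes {1..n}. \<Sum>\<kappa>\<in>?C. if dec (\<kappa> \<circ> \<sigma>) then skew (emb \<kappa>) else 0)" by (rule sum.swap)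
  also have "\<dots> = (\<Sum>\<sigma> | \<sigma> permutes {1..n}. \<Sum>\<kappa>\<in>?C. if dec \<kappa> then skew (emb \<kappa>) else 0)"
  proof (rule sum.cong[OF refl])
    fix \<sigma> assume "\<sigma> \<in> {\<sigma>. \<sigma> permutes {1..n}}"
    then have \<sigma>: "\<sigma> permutes {1..n}" by simp
    show "(\<Sum>\<kappa>\<in>?C. if dec (\<kappa> \<circ> \<sigma>) then skew (emb \<kappa>) else 0) = (\<Sum>\<kappa>\<in>?C. if dec \<kappa> then skew (emb \<kappa>) else 0)"
      by (rule sum.reindex_bij_witness[where i = "\<lambda>\<kappa>. \<kappa> \<circ> inv \<sigma>" and j = "\<lambda>\<kappa>. \<kappa> \<circ> \<sigma>"])
        (auto intro: perm \<sigma> permutes_inv simp: skew_emb[OF \<sigma>] comp_assoc permutes_inv_o[OF \<sigma>] simp del: comp_apply One_nat_def)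
  qed
  also have "\<dots> = fact n * (\<Sum>\<kappa>\<in>?C. if dec \<kappa> then skew (emb \<kappa>) else 0)"
    using card_permutations[of "{1..n}" n] by simp
  also have "(\<Sum>\<kappa>\<in>?C. if dec \<kappa> then skew (emb \<kappa>) else 0) = (\<Sum>\<kappa>\<in>{\<kappa> \<in> ?C. dec \<kappa>}. skew (emb \<kappa>))"
    by (rule sum.inter_filter[symmetric]) simp
  finally show ?thesis .
qed

definition zero_weight :: "nat list set" where
  "zero_weight = {b \<in> wcomp n y. \<forall>k\<in>{1..n}. wtr n N b k = 0}"

definition eps_sum :: "nat list \<Rightarrow> nat" where
  "eps_sum b = (\<Sum>i=1..n-1. i * weps i b)"

lemma sum_skew_eps:
  "(\<Sum>\<kappa>\<in>{\<kappa> \<in> compositions {1..n} k. dec \<kappa>}. skew (emb \<kappa>)) =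
    fps_nth (fps_X ^ card (pairs n) * (\<Sum>b\<in>zero_weight. fps_X ^ eps_sum b) * (\<Prod>i\<in>{1..n}. Abs_fps (\<lambda>m. of_bool (i dvd m)))) k"
proof -
  let ?D = "{\<kappa> \<in> compositions {1..n} k. dec \<kappa>}"
  have fin: "finite zero_weight" "finite ?D" using finite_comp[OF y] by (simp_all add: zero_weight_def)
  \<comment> \<open>The conditions \<epsilon>_i(b) < \<kappa>_i - \<kappa>_(i+1) in the form of
    \<open>count_decreasing\<close>: \<open>Suc\<close> expresses strictness, and the 0 at i = n
    imposes nothing on \<kappa>_n. Weighted by i, the ones from \<open>Suc\<close> add up to n (n -
    1) / 2, which is \<open>card (pairs n)\<close>.\<close>
  let ?c = "\<lambda>b i. if i < n then Suc (weps i b) else 0"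
  let ?nx = "\<lambda>\<kappa> i. if i < n then \<kappa> (Suc i) else (0 :: nat)"
  have C: "(\<Sum>i\<in>{1..n}. i * ?c b i) = card (pairs n) + eps_sum b" for b
  proof -
    have "(\<Sum>i\<in>{1..n}. i * ?c b i) = (\<Sum>i\<in>{1..n-1}. i * Suc (weps i b))"
      by (rule sum.mono_neutral_cong_right) auto
    also have "\<dots> = (\<Sum>i\<in>{1..n-1}. i) + eps_sum b" by (simp add: eps_sum_def sum.distrib)
    also have "(\<Sum>i\<in>{1..n-1}. i) = card (pairs n)"
      unfolding card_pairs using gauss_sum_from_Suc_0[of "n - 1", where ?'a = nat] by (cases n) (simp_all add: mult.commute)
    finally show ?thesis .
  qed
  have "skew (emb \<kappa>) = (\<Sum>b\<in>zero_weight. of_bool (\<forall>i\<in>{1..n}. ?nx \<kappa> i + ?c b i \<le> \<kappa> i))" if \<kappa>: "\<kappa> \<in> ?D" for \<kappa>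
  proof -
    let ?\<mu> = "\<lambda>i. \<kappa> i - \<kappa> (Suc i) - 1"
    have d: "\<kappa> (Suc i) < \<kappa> i" if "1 \<le> i" "i < n" for i using \<kappa> that by (simp add: dec_def)
    have "skew (emb \<kappa>) = (\<Sum>b\<in>{b \<in> wcomp n y. \<forall>i. 1 \<le> i \<longrightarrow> i < n \<longrightarrow> weps i b \<le> ?\<mu> i}. of_bool (\<forall>k\<in>{1..n}. wtr n N b k = 0))"
    proof (rule skew_decreasing)
      fix i assume i: "1 \<le> i" "i < n"
      define m where "m = ?\<mu> i"
      have "\<kappa> i = \<kappa> (Suc i) + m + 1" using d[OF i] by (simp add: m_def)
      then show "emb \<kappa> i - emb \<kappa> (Suc i) = of_nat (?\<mu> i) + 1" unfolding m_def[symmetric] using i by (simp add: emb_def)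
    qed
    also have "\<dots> = (\<Sum>b\<in>zero_weight. of_bool (\<forall>i. 1 \<le> i \<longrightarrow> i < n \<longrightarrow> weps i b \<le> ?\<mu> i))"
      unfolding zero_weight_def by (rule sum_of_bool_swap[OF finite_comp[OF y]])
    also have "\<dots> = (\<Sum>b\<in>zero_weight. of_bool (\<forall>i\<in>{1..n}. ?nx \<kappa> i + ?c b i \<le> \<kappa> i))"
    proof (rule sum.cong[OF refl])
      fix b
      have e: "weps i b \<le> ?\<mu> i \<longleftrightarrow> ?nx \<kappa> i + ?c b i \<le> \<kappa> i" if "1 \<le> i" "i < n" for i using d[OF that] that by auto
      have "(\<forall>i. 1 \<le> i \<longrightarrow> i < n \<longrightarrow> weps i b \<le> ?\<mu> i) \<longleftrightarrow> (\<forall>i\<in>{1..n}. ?nx \<kappa> i + ?c b i \<le> \<kappa> i)"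
      proof
        assume l: "\<forall>i. 1 \<le> i \<longrightarrow> i < n \<longrightarrow> weps i b \<le> ?\<mu> i"
        show "\<forall>i\<in>{1..n}. ?nx \<kappa> i + ?c b i \<le> \<kappa> i"
        proof
          fix i assume "i \<in> {1..n}"
          then show "?nx \<kappa> i + ?c b i \<le> \<kappa> i" using l e[of i] by (cases "i < n") auto
        qed
      next
        assume r: "\<forall>i\<in>{1..n}. ?nx \<kappa> i + ?c b i \<le> \<kappa> i"
        show "\<forall>i. 1 \<le> i \<longrightarrow> i < n \<longrightarrow> weps i b \<le> ?\<mu> i"
        proof (intro allI impI)
          fix i assume i: "1 \<le> i" "i < n"
          then have "i \<in> {1..n}" by simp
          then show "weps i b \<le> ?\<mu> i" using r e[OF i] by blast
        qed
      qed
      then show "of_bool (\<forall>i. 1 \<le> i \<longrightarrow> i < n \<longrightarrow> weps i b \<le> ?\<mu> i) = (of_bool (\<forall>i\<in>{1..n}. ?nx \<kappa> i + ?c b i \<le> \<kappa> i) :: rat)" by simp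
    qed
    finally show ?thesis .
  qed
  then have "(\<Sum>\<kappa>\<in>?D. skew (emb \<kappa>)) = (\<Sum>\<kappa>\<in>?D. \<Sum>b\<in>zero_weight. of_bool (\<forall>i\<in>{1..n}. ?nx \<kappa> i + ?c b i \<le> \<kappa> i))"
    by (rule sum.cong[OF refl])
  also have "\<dots> = (\<Sum>b\<in>zero_weight. \<Sum>\<kappa>\<in>?D. of_bool (\<forall>i\<in>{1..n}. ?nx \<kappa> i + ?c b i \<le> \<kappa> i))" by (rule sum.swap)
  also have "\<dots> = (\<Sum>b\<in>zero_weight. of_nat (card {\<kappa> \<in> compositions {1..n} k. \<forall>i\<in>{1..n}. ?nx \<kappa> i + ?c b i \<le> \<kappa> i}))"
  proof (rule sum.cong[OF refl])
    fix b
    have eq: "{\<kappa> \<in> ?D. \<forall>i\<in>{1..n}. ?nx \<kappa> i + ?c b i \<le> \<kappa> i} = {\<kappa> \<in> compositions {1..n} k. \<forall>i\<in>{1..n}. ?nx \<kappa> i + ?c b i \<le> \<kappa> i}"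
      by (force simp: dec_def)
    show "(\<Sum>\<kappa>\<in>?D. of_bool (\<forall>i\<in>{1..n}. ?nx \<kappa> i + ?c b i \<le> \<kappa> i)) =
      (of_nat (card {\<kappa> \<in> compositions {1..n} k. \<forall>i\<in>{1..n}. ?nx \<kappa> i + ?c b i \<le> \<kappa> i}) :: rat)"
      unfolding eq[symmetric] by (rule sum_of_bool[OF fin(2)])
  qed
  also have "\<dots> = (\<Sum>b\<in>zero_weight. fps_nth (fps_X ^ (card (pairs n) + eps_sum b) * (\<Prod>i\<in>{1..n}. Abs_fps (\<lambda>m. of_bool (i dvd m)))) k)"
    unfolding count_decreasing C ..
  also have "\<dots> = fps_nth (fps_X ^ card (pairs n) * (\<Sum>b\<in>zero_weight. fps_X ^ eps_sum b) * (\<Prod>i\<in>{1..n}. Abs_fps (\<lambda>m. of_bool (i dvd m)))) k"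
    by (simp add: sum_distrib_left sum_distrib_right power_add fps_sum_nth)
  finally show ?thesis .
qed

text \<open>The symmetrization identity, with t the power series variable, is paired with the
  character. Invariance makes the left side n! times the series \<open>D\<close> of the alternating
  sums, up to the power of t; the right side is n! times that power times \<open>E\<close> times
  \<open>Q\<close>, and \<open>Q\<close> inverts the product of the 1 - t^k. The common factors are
  cancelled in the domain of power series.\<close>

theorem eps_generating_function:
  "(\<Sum>u | u permutes {1..n}. of_int (sign u) * (\<Sum>m\<in>compositions (pairs n) k. chpair (fexp n (kwt u m)))) =
    of_nat (card {b \<in> zero_weight. eps_sum b = k})"
proof -
  define S1 where "S1 = (\<Sum>w | w permutes {1..n}. \<Prod>(i, j)\<in>pairs n. (1 - fps_const (fexp n (sl_root (w i) (w j)))) * geom (fexp n (sl_root (w i) (w j))))"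
  define S2 where "S2 = (\<Sum>w | w permutes {1..n}. of_int (sign w) * (\<Prod>i\<in>{1..n}. geom (fexp n (sl_root i (w i)))))"
  define D where "D = Abs_fps (\<lambda>k. \<Sum>u | u permutes {1..n}. of_int (sign u) * (\<Sum>m\<in>compositions (pairs n) k. chpair (fexp n (kwt u m))))"
  define Q :: "rat fps" where "Q = (\<Prod>i\<in>{1..n}. Abs_fps (\<lambda>m. of_bool (i dvd m)))"
  define E :: "rat fps" where "E = (\<Sum>b\<in>zero_weight. fps_X ^ eps_sum b)"
  have "fps_X ^ card (pairs n) * S1 = (\<Prod>k\<in>{1..n}. 1 - fps_X ^ k) * S2"
    unfolding S1_def S2_def
  proof (rule symmetrization_identity_idom[where x = "\<lambda>i. fps_const (fexp n (\<lambda>k. of_bool (k = i)))" and z = "\<lambda>i j. fps_const (fexp n (sl_root i j))"])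
    show "inj_on (\<lambda>i. fps_const (fexp n (\<lambda>k. of_bool (k = i)))) {1..n}"
    proof (rule inj_onI)
      fix i j assume ij: "i \<in> {1..n}" "j \<in> {1..n}" "fps_const (fexp n (\<lambda>k. of_bool (k = i))) = fps_const (fexp n (\<lambda>k. of_bool (k = j)))"
      then show "i = j" using inj_onD[OF fexp_generators[of n], of i j] by simp
    qed
    show "fps_X * fps_const (fexp n (\<lambda>k. of_bool (k = i))) \<noteq> fps_const (fexp n (\<lambda>k. of_bool (k = j)))" for i j
    proof
      assume "fps_X * fps_const (fexp n (\<lambda>k. of_bool (k = i))) = fps_const (fexp n (\<lambda>k. of_bool (k = j)))"
      from arg_cong[OF this, of "\<lambda>F. fps_nth F 0"] show False using fexp_nonzero by simp
    qed
  qed (auto simp: fexp_nonzero sl_root_fexp geom_inverse)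
  then have id: "fps_X ^ card (pairs n) * chpair_fps S1 = (\<Prod>k\<in>{1..n}. 1 - fps_X ^ k) * chpair_fps S2"
    by (metis chpair_fps_X_power chpair_fps_prod finite_atLeastAtMost)
  have S1: "chpair_fps S1 = fact n * D"
  proof (rule fps_ext)
    fix k
    have "fps_nth (chpair_fps S1) k = fact n * fps_nth D k"
      unfolding chpair_fps_nth S1_def fps_sum_nth chpair_sum
      using chpair_roots[of _ k] card_permutations[of "{1..n}" n] by (simp add: D_def)
    then show "fps_nth (chpair_fps S1) k = fps_nth (fact n * D) k" by (metis fps_mult_of_nat_nth(1) of_nat_fact)
  qed
  have S2: "chpair_fps S2 = fact n * (fps_X ^ card (pairs n) * E * Q)"
  proof (rule fps_ext)
    fix k
    have "fps_nth (chpair_fps S2) k = fact n * fps_nth (fps_X ^ card (pairs n) * E * Q) k"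
      unfolding chpair_fps_nth S2_def chpair_cauchy sum_skew_decreasing sum_skew_eps E_def Q_def ..
    then show "fps_nth (chpair_fps S2) k = fps_nth (fact n * (fps_X ^ card (pairs n) * E * Q)) k" by (metis fps_mult_of_nat_nth(1) of_nat_fact)
  qed
  have Q: "(\<Prod>k\<in>{1..n}. 1 - fps_X ^ k) * Q = 1"
    unfolding Q_def prod.distrib[symmetric] by (intro prod.neutral) (auto simp: geometric_dvd)
  have "fact n * fps_X ^ card (pairs n) * D = fps_X ^ card (pairs n) * (fact n * D)" by (simp only: mult_ac)
  also have "\<dots> = fact n * fps_X ^ card (pairs n) * E * ((\<Prod>k\<in>{1..n}. 1 - fps_X ^ k) * Q)"
    unfolding id[unfolded S1 S2] by (simp only: mult_ac)
  finally have "fact n * fps_X ^ card (pairs n) * D = fact n * fps_X ^ card (pairs n) * E" unfolding Q by (simp only: mult_1_right)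
  then have "D = E" by simp
  then have "fps_nth D k = fps_nth E k" by simp
  also have "fps_nth E k = (\<Sum>b\<in>zero_weight. of_bool (eps_sum b = k))"
    unfolding E_def fps_sum_nth by (intro sum.cong refl) (simp add: fps_X_power_nth of_bool_def)
  also have "\<dots> = of_nat (card {b \<in> zero_weight. eps_sum b = k})"
    by (rule sum_of_bool) (use finite_comp[OF y] in \<open>simp add: zero_weight_def\<close>)
  finally show ?thesis by (simp add: D_def)
qed

end

section \<open>Generalized exponents\<close>

lemma sum_pairs_sl_root:
  assumes "k \<in> {1..n}" "w permutes {1..n}"
  shows "(\<Sum>(i, j)\<in>pairs n. of_bool (k = w i)) = (of_nat n - of_nat (inv w k) :: rat)"
    "(\<Sum>(i, j)\<in>pairs n. of_bool (k = j)) = (of_nat k - 1 :: rat)"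
proof -
  have fst: "pairs n = (SIGMA i:{1..n}. {i<..n})" by (auto simp: pairs_def)
  have k: "inv w k \<in> {1..n}" using permutes_in_image[OF permutes_inv[OF assms(2)]] assms(1) by blast
  have "(\<Sum>(i, j)\<in>pairs n. of_bool (k = w i)) = (\<Sum>i\<in>{1..n}. \<Sum>j\<in>{i<..n}. of_bool (k = w i) :: rat)"
    unfolding fst by (rule sum.Sigma[symmetric]) auto
  also have "\<dots> = (\<Sum>i\<in>{1..n}. if i = inv w k then of_nat (n - i) else 0)"
    by (intro sum.cong refl) (auto simp: of_bool_def permutes_inv_eq[OF assms(2)] permutes_inverses[OF assms(2)])
  also have "\<dots> = of_nat n - of_nat (inv w k)" using k by (subst sum.delta) (auto simp: of_nat_diff)
  finally show "(\<Sum>(i, j)\<in>pairs n. of_bool (k = w i)) = (of_nat n - of_nat (inv w k) :: rat)" .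
  have "(\<Sum>(i, j)\<in>pairs n. of_bool (k = j)) = (\<Sum>p\<in>(SIGMA j:{1..n}. {1..<j}). of_bool (k = fst p) :: rat)"
    by (rule sum.reindex_bij_witness[where i = prod.swap and j = prod.swap]) (auto simp: pairs_def)
  also have "\<dots> = (\<Sum>j\<in>{1..n}. \<Sum>i\<in>{1..<j}. of_bool (k = j))"
    by (simp only: sum.Sigma[OF finite_atLeastAtMost ballI[OF finite_atLeastLessThan]] case_prod_unfold)
  also have "\<dots> = (\<Sum>j\<in>{1..n}. if j = k then of_nat (j - 1) else 0)"
    by (intro sum.cong refl) (auto simp: of_bool_def)
  also have "\<dots> = of_nat k - 1" using assms(1) by (subst sum.delta) (auto simp: of_nat_diff)
  finally show "(\<Sum>(i, j)\<in>pairs n. of_bool (k = j)) = (of_nat k - 1 :: rat)" .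
qed

lemma positive_roots_pairs: "positive_roots n = (\<lambda>p. sl_root (fst p) (snd p)) ` pairs n"
  by (force simp: positive_roots_def pairs_def)

lemma inj_on_sl_root: "inj_on (\<lambda>p. sl_root (fst p) (snd p)) (pairs n)"
proof (rule inj_onI)
  fix p q assume pq: "p \<in> pairs n" "q \<in> pairs n" "sl_root (fst p) (snd p) = sl_root (fst q) (snd q)"
  obtain i j i' j' where e: "p = (i, j)" "q = (i', j')" by (cases p, cases q) auto
  then have "i < j" "i' < j'" using pq by (auto simp: pairs_def)
  moreover have "sl_root i j i = sl_root i' j' i" "sl_root i j j = sl_root i' j' j" using pq(3) e by simp_all
  ultimately show "p = q" unfolding e by (auto simp: sl_root_def of_bool_def split: if_splits)
qed

lemma bij_betw_pairs: "bij_betw (\<lambda>p. sl_root (fst p) (snd p)) (pairs n) (positive_roots n)"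
  unfolding positive_roots_pairs by (rule inj_on_imp_bij_betw[OF inj_on_sl_root])

lemma sum_positive_roots: "(\<Sum>\<alpha>\<in>positive_roots n. F \<alpha>) = (\<Sum>p\<in>pairs n. F (sl_root (fst p) (snd p)) :: 'a::comm_monoid_add)"
  by (rule sum.reindex_bij_betw[OF bij_betw_pairs, symmetric])

lemma half_sum_eq: "half_sum n k = (if k \<in> {1..n} then (of_nat n + 1) / 2 - of_nat k else 0)"
proof (cases "k \<in> {1..n}")
  case True
  have "(\<Sum>p\<in>pairs n. sl_root (fst p) (snd p) k) = (\<Sum>(i, j)\<in>pairs n. of_bool (k = id i)) - (\<Sum>(i, j)\<in>pairs n. of_bool (k = j))"
    unfolding sum_subtractf[symmetric] by (simp add: sl_root_def case_prod_unfold)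
  also have "\<dots> = (of_nat n - of_nat k) - (of_nat k - 1)"
    unfolding sum_pairs_sl_root[OF True permutes_id] by simp
  finally show ?thesis using True unfolding half_sum_def sum_positive_roots by (simp add: field_simps)
next
  case False
  have "sl_root (fst p) (snd p) k = 0" if "p \<in> pairs n" for p
    using that False by (auto simp: pairs_def sl_root_def)
  then show ?thesis unfolding half_sum_def sum_positive_roots using False by (simp only: sum.neutral_const cong: sum.cong) simp
qed

definition root_sum :: "nat \<Rightarrow> (nat \<times> nat \<Rightarrow> nat) \<Rightarrow> weight" where
  "root_sum n m = (\<lambda>k. \<Sum>p\<in>pairs n. of_nat (m p) * sl_root (fst p) (snd p) k)"

lemma root_sum_outside: "k \<notin> {1..n} \<Longrightarrow> root_sum n m k = 0"
  unfolding root_sum_def by (rule sum.neutral) (auto simp: pairs_def sl_root_def)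

text \<open>Pairing with \<open>(n - k)\<^sub>k\<close> bounds the multiplicities, as every positive root has pairing at least one.\<close>

lemma finite_root_choices: "finite {m \<in> pairs n \<rightarrow>\<^sub>E UNIV. root_sum n m = \<beta>}"
proof -
  let ?\<phi> = "\<lambda>\<nu>. \<Sum>k\<in>{1..n}. of_nat (n - k) * \<nu> k :: rat"
  obtain K where K: "?\<phi> \<beta> \<le> of_nat K" using real_arch_simple by blast
  have \<phi>: "?\<phi> (sl_root (fst p) (snd p)) \<ge> 1" if pn: "p \<in> pairs n" for p
  proof -
    obtain i j where p: "p = (i, j)" "1 \<le> i" "i < j" "j \<le> n" using pn by (auto simp: pairs_def)
    have "?\<phi> (sl_root i j) = (\<Sum>k\<in>{1..n}. (if k = i then of_nat (n - k) else 0) - (if k = j then of_nat (n - k) else 0))"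
      by (intro sum.cong refl) (auto simp: sl_root_def)
    also have "\<dots> = of_nat (n - i) - of_nat (n - j)" unfolding sum_subtractf using p by simp
    also have "\<dots> \<ge> 1"
    proof -
      have "of_nat (n - j) + (1 :: rat) = of_nat (n - j + 1)" by simp
      also have "\<dots> \<le> of_nat (n - i)" unfolding of_nat_le_iff using p by simp
      finally show ?thesis by simp
    qed
    finally show ?thesis using p by simp
  qed
  have "m p \<le> K" if m: "root_sum n m = \<beta>" and p: "p \<in> pairs n" for m p
  proof -
    have "of_nat (m p) \<le> of_nat (m p) * ?\<phi> (sl_root (fst p) (snd p))"
      using mult_left_mono[OF \<phi>[OF p], of "of_nat (m p)"] by simp
    also have "\<dots> \<le> (\<Sum>p\<in>pairs n. of_nat (m p) * ?\<phi> (sl_root (fst p) (snd p)))"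
    proof (rule member_le_sum[OF p])
      show "0 \<le> of_nat (m q) * ?\<phi> (sl_root (fst q) (snd q))" if "q \<in> pairs n - {p}" for q
        using \<phi>[of q] that by (intro mult_nonneg_nonneg) auto
    qed simp
    also have "\<dots> = ?\<phi> (root_sum n m)"
      unfolding root_sum_def sum_distrib_left by (subst sum.swap) (intro sum.cong refl, simp add: mult_ac)
    finally have "rat_of_nat (m p) \<le> of_nat K" using K m by simp
    then show ?thesis by simp
  qed
  then have "{m \<in> pairs n \<rightarrow>\<^sub>E UNIV. root_sum n m = \<beta>} \<subseteq> pairs n \<rightarrow>\<^sub>E {..K}"
    by (intro subsetI) (simp add: PiE_iff)
  then show ?thesis by (rule finite_subset) (intro finite_PiE, auto)
qed

lemma coeff_t_kostant: "coeff (t_kostant n \<beta>) k = int (card {m \<in> compositions (pairs n) k. root_sum n m = \<beta>})"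
proof -
  let ?r = "\<lambda>p. sl_root (fst p) (snd p)"
  let ?C = "{m \<in> pairs n \<rightarrow>\<^sub>E UNIV. root_sum n m = \<beta>}"
  let ?j = "\<lambda>m. \<lambda>p\<in>pairs n. m (?r p)" and ?i = "\<lambda>m. \<lambda>\<alpha>\<in>positive_roots n. m (inv_into (pairs n) ?r \<alpha>)"
  have r: "?r p \<in> positive_roots n" "inv_into (pairs n) ?r (?r p) = p" if "p \<in> pairs n" for p
    using that inv_into_f_f[OF inj_on_sl_root that] by (simp_all add: positive_roots_pairs)
  have r': "inv_into (pairs n) ?r \<alpha> \<in> pairs n" "?r (inv_into (pairs n) ?r \<alpha>) = \<alpha>" if "\<alpha> \<in> positive_roots n" for \<alpha>
    using that inv_into_into[of \<alpha> ?r "pairs n"] f_inv_into_f[of \<alpha> ?r "pairs n"] by (simp_all add: positive_roots_pairs)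
  have "t_kostant n \<beta> = (\<Sum>m\<in>?C. monom 1 (\<Sum>p\<in>pairs n. m p))"
    unfolding t_kostant_def
  proof (rule sum.reindex_bij_witness[where i = ?i and j = ?j])
    fix m assume m: "m \<in> kostant_choices n \<beta>"
    then have ext: "m \<in> extensional (positive_roots n)" by (simp add: kostant_choices_def PiE_def)
    show "?i (?j m) = m"
    proof
      fix \<alpha> show "?i (?j m) \<alpha> = m \<alpha>" using r'[of \<alpha>] ext by (cases "\<alpha> \<in> positive_roots n") (auto simp: extensional_def)
    qed
    have "root_sum n (?j m) = (\<lambda>k. \<Sum>\<alpha>\<in>positive_roots n. of_nat (m \<alpha>) * \<alpha> k)"
      unfolding root_sum_def sum_positive_roots by (intro HOL.ext sum.cong) auto
    then show "?j m \<in> ?C" using m by (auto simp: kostant_choices_def)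
    show "monom 1 (\<Sum>p\<in>pairs n. ?j m p) = (monom 1 (\<Sum>\<alpha>\<in>positive_roots n. m \<alpha>) :: int poly)"
      unfolding sum_positive_roots by simp
  next
    fix m assume m: "m \<in> ?C"
    then have ext: "m \<in> extensional (pairs n)" by (simp add: PiE_def)
    show "?j (?i m) = m"
    proof
      fix p show "?j (?i m) p = m p" using r[of p] ext by (cases "p \<in> pairs n") (auto simp: extensional_def simp del: split_paired_All)
    qed
    have "(\<lambda>k. \<Sum>\<alpha>\<in>positive_roots n. of_nat (?i m \<alpha>) * \<alpha> k) = root_sum n m"
      unfolding root_sum_def sum_positive_roots by (intro HOL.ext sum.cong refl) (use r in auto)
    then show "?i m \<in> kostant_choices n \<beta>" using m by (auto simp: kostant_choices_def)
  qed
  then have "coeff (t_kostant n \<beta>) k = (\<Sum>m\<in>?C. of_bool ((\<Sum>p\<in>pairs n. m p) = k))"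
    by (simp add: coeff_sum of_bool_def)
  also have "\<dots> = int (card {m \<in> ?C. (\<Sum>p\<in>pairs n. m p) = k})" by (rule sum_of_bool[OF finite_root_choices])
  also have "{m \<in> ?C. (\<Sum>p\<in>pairs n. m p) = k} = {m \<in> compositions (pairs n) k. root_sum n m = \<beta>}"
    by (auto simp: compositions_def)
  finally show ?thesis .
qed

text \<open>The coefficient of t^k in the alternating sum of the P_t(w \<nu> - \<rho>). Regarded as
  a function of \<nu> it is antisymmetric, which makes it a candidate for
  \<open>cancellation\<close>; the generalized exponent is its value at \<nu> = \<lambda> +
  \<rho>.\<close>

definition kostant_alt :: "nat \<Rightarrow> nat \<Rightarrow> weight \<Rightarrow> rat" where
  "kostant_alt n k \<nu> = (\<Sum>w | w permutes {1..n}. of_int (sign w) *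
     (\<Sum>m\<in>compositions (pairs n) k. of_bool (root_sum n m = (\<lambda>j. \<nu> (inv w j) - half_sum n j))))"

lemma coeff_generalized_exponent:
  "of_int (coeff (generalized_exponent n \<mu>) k) = kostant_alt n k (\<lambda>j. half_sum n j + \<mu> j)"
proof -
  have c: "coeff ((-1) ^ weyl_length n w * p) k = sign w * coeff p k" if "w permutes {1..n}" for w and p :: "int poly"
    unfolding weyl_length_sign[OF that] by (cases "sign w = 1") (auto simp: sign_def)
  have "coeff (generalized_exponent n \<mu>) k = (\<Sum>w | w permutes {1..n}. sign w *
      coeff (t_kostant n (\<lambda>j. weyl_act w (\<lambda>j. \<mu> j + half_sum n j) j - half_sum n j)) k)"
    unfolding generalized_exponent_def weyl_group_def coeff_sum by (intro sum.cong refl) (simp add: c)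
  also have "\<dots> = (\<Sum>w | w permutes {1..n}. sign w *
      int (card {m \<in> compositions (pairs n) k. root_sum n m = (\<lambda>j. half_sum n (inv w j) + \<mu> (inv w j) - half_sum n j)}))"
    unfolding coeff_t_kostant weyl_act_def by (simp only: add.commute)
  finally show ?thesis unfolding kostant_alt_def sum_of_bool[OF finite_compositions[OF finite_pairs]] by simp
qed

lemma kostant_alt_antisymmetric:
  assumes i: "1 \<le> i" "i < n"
  shows "kostant_alt n k (\<nu> \<circ> transpose i (Suc i)) = - kostant_alt n k \<nu>"
proof -
  let ?s = "transpose i (Suc i)"
  have s: "?s permutes {1..n}" using i by (intro permutes_swap_id) auto
  have "sign (w \<circ> ?s) = - sign w" if "w permutes {1..n}" for w
  proof -
    have "permutation w" using that permutation_permutes by blast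
    then show ?thesis by (simp add: sign_compose permutation_swap_id sign_swap_id del: comp_apply)
  qed
  moreover have "?s (inv (w \<circ> ?s) j) = inv w j" if "w permutes {1..n}" for w j
    using o_inv_distrib[OF permutes_bij[OF that] permutes_bij[OF s]] by (simp add: inv_unique_comp[OF transpose_comp_involutory transpose_comp_involutory])
  ultimately show ?thesis
    unfolding kostant_alt_def by (subst sum_permutations_compose_right[OF s]) (simp add: sum_negf)
qed

context component
begin

text \<open>\<open>kwt u m\<close> is \<rho> - u \<rho> plus the root sum of m. It equals u (wt b)
  exactly if m expresses u (\<rho> + wt b) - \<rho> as a sum of roots; replacing wt b by u (wt b)
  only permutes the weights of the component.\<close>

lemma kostant_alt_sum:
  "(\<Sum>u | u permutes {1..n}. of_int (sign u) * (\<Sum>m\<in>compositions (pairs n) k. chpair (fexp n (kwt u m)))) =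
    (\<Sum>b\<in>wcomp n y. kostant_alt n k (\<lambda>j. half_sum n j + wtr n N b j))"
proof -
  have "chpair (fexp n (kwt u m)) = (\<Sum>b\<in>wcomp n y. of_bool (root_sum n m = (\<lambda>j. half_sum n (inv u j) + wtr n N b (inv u j) - half_sum n j)))"
    if u: "u permutes {1..n}" for u m
  proof -
    have "kwt u m j = half_sum n j - half_sum n (inv u j) + root_sum n m j" if j: "j \<in> {1..n}" for j
    proof -
      have "inv u j \<in> {1..n}" using permutes_in_image[OF permutes_inv[OF u]] j by blast
      moreover have "(\<Sum>(i, l)\<in>pairs n. sl_root i (u i) j) = (\<Sum>(i, l)\<in>pairs n. of_bool (j = id i)) - (\<Sum>(i, l)\<in>pairs n. of_bool (j = u i))"
        unfolding sum_subtractf[symmetric] by (simp add: sl_root_def case_prod_unfold)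
      ultimately show ?thesis
        unfolding kwt_def root_sum_def sum_pairs_sl_root(1)[OF j permutes_id] sum_pairs_sl_root(1)[OF j u] half_sum_eq
        using j by simp
    qed
    then have "(\<forall>j\<in>{1..n}. wtr n N b (inv u j) = kwt u m j) \<longleftrightarrow> root_sum n m = (\<lambda>j. half_sum n (inv u j) + wtr n N b (inv u j) - half_sum n j)" for b
    proof -
      have o: "root_sum n m j = half_sum n (inv u j) + wtr n N b (inv u j) - half_sum n j" if j: "j \<notin> {1..n}" for j
      proof -
        have "inv u j = j" using permutes_not_in[OF permutes_inv[OF u] j] .
        then show ?thesis using j by (auto simp: half_sum_eq wtr_def root_sum_outside)
      qed
      have "root_sum n m = (\<lambda>j. half_sum n (inv u j) + wtr n N b (inv u j) - half_sum n j) \<longleftrightarrow>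
        (\<forall>j\<in>{1..n}. root_sum n m j = half_sum n (inv u j) + wtr n N b (inv u j) - half_sum n j)"
        unfolding fun_eq_iff using o by blast
      also have "\<dots> \<longleftrightarrow> (\<forall>j\<in>{1..n}. wtr n N b (inv u j) = kwt u m j)"
        by (intro ball_cong refl) (simp only: \<open>\<And>j. j \<in> {1..n} \<Longrightarrow> kwt u m j = half_sum n j - half_sum n (inv u j) + root_sum n m j\<close>, auto)
      finally show ?thesis by blast
    qed
    then show ?thesis
      unfolding chpair_fexp
      using weight_symmetric[OF permutes_inv[OF u], of "\<lambda>f. of_bool (\<forall>j\<in>{1..n}. f j = kwt u m j) :: rat"] by simp
  qed
  then have "(\<Sum>u | u permutes {1..n}. of_int (sign u) * (\<Sum>m\<in>compositions (pairs n) k. chpair (fexp n (kwt u m)))) =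
    (\<Sum>u | u permutes {1..n}. \<Sum>b\<in>wcomp n y. of_int (sign u) *
      (\<Sum>m\<in>compositions (pairs n) k. of_bool (root_sum n m = (\<lambda>j. half_sum n (inv u j) + wtr n N b (inv u j) - half_sum n j))))"
    by (intro sum.cong refl) (simp add: sum_distrib_left sum.swap[of _ "wcomp n y"])
  also have "\<dots> = (\<Sum>b\<in>wcomp n y. kostant_alt n k (\<lambda>j. half_sum n j + wtr n N b j))"
    unfolding kostant_alt_def by (rule sum.swap)
  finally show ?thesis .
qed

lemma coeff_generalized_exponent_zero_weight:
  assumes yam: "yam n y" and uniq: "\<And>b. b \<in> wcomp n y \<Longrightarrow> yam n b \<Longrightarrow> b = y"
  shows "coeff (generalized_exponent n (wtr n N y)) k = int (card {b \<in> zero_weight. eps_sum b = k})"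
proof -
  have "{b \<in> wcomp n y. \<forall>i. 1 \<le> i \<longrightarrow> i < n \<longrightarrow> weps i b \<le> 0} = {y}"
    using uniq yam comp_base by (auto simp: yam_def)
  moreover have "(\<Sum>b\<in>wcomp n y. kostant_alt n k (\<lambda>j. half_sum n j + wtr n N b j)) =
    (\<Sum>b\<in>{b \<in> wcomp n y. \<forall>i. 1 \<le> i \<longrightarrow> i < n \<longrightarrow> weps i b \<le> 0}. kostant_alt n k (\<lambda>j. half_sum n j + wtr n N b j))"
  proof (rule cancellation[where \<mu> = "\<lambda>_. 0"])
    show "half_sum n i - half_sum n (Suc i) = of_nat 0 + 1" if "1 \<le> i" "i < n" for i
      using that by (simp add: half_sum_eq)
  qed (rule kostant_alt_antisymmetric)
  ultimately have "kostant_alt n k (\<lambda>j. half_sum n j + wtr n N y j) = of_nat (card {b \<in> zero_weight. eps_sum b = k})"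
    using kostant_alt_sum[of k] eps_generating_function[of k] by simp
  then have "(of_int (coeff (generalized_exponent n (wtr n N y)) k) :: rat) = of_int (int (card {b \<in> zero_weight. eps_sum b = k}))"
    by (simp only: coeff_generalized_exponent of_int_of_nat_eq)
  then show ?thesis by (simp only: of_int_eq_iff)
qed

end

section \<open>Partitions, weights and Yamanouchi words\<close>

lemma weight_eqI:
  fixes f g :: weight
  assumes out: "\<And>k. k \<notin> {1..n} \<Longrightarrow> f k = g k" and sum: "(\<Sum>k\<in>{1..n}. f k) = (\<Sum>k\<in>{1..n}. g k)"
    and diff: "\<And>i. 1 \<le> i \<Longrightarrow> i < n \<Longrightarrow> f i - f (Suc i) = g i - g (Suc i)"
  shows "f = g"
proof (cases "n = 0")
  case False
  have d: "f k - g k = f 1 - g 1" if "1 \<le> k" "k \<le> n" for k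
    using that
  proof (induction k rule: nat_induct_at_least)
    case (Suc k)
    then show ?case using diff[of k] by simp
  qed simp
  have "(\<Sum>k\<in>{1..n}. f k - g k) = (\<Sum>k\<in>{1..n}. f 1 - g 1)" by (intro sum.cong refl d) auto
  then have "of_nat n * (f 1 - g 1) = 0" using sum by (simp add: sum_subtractf)
  then have "f 1 = g 1" using False by simp
  then have "f k = g k" for k using d[of k] out[of k] by (cases "k \<in> {1..n}") auto
  then show ?thesis by blast
qed (use out in auto)

lemma sum_wtr:
  assumes "b \<in> words n N" "n > 0"
  shows "(\<Sum>k\<in>{1..n}. wtr n N b k) = 0"
proof -
  have "(\<Sum>k\<in>{1..n}. count_list b k) = N"
    using assms sum_count_set[of b "{1..n}"] by (simp add: words_def)
  then have "(\<Sum>k\<in>{1..n}. rat_of_nat (count_list b k)) = of_nat N" by (metis of_nat_sum)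
  then show ?thesis using assms(2) by (simp add: wtr_def sum_subtractf)
qed

lemma zero_weight_iff:
  assumes "b \<in> words n N" "n > 0"
  shows "(\<forall>k\<in>{1..n}. wtr n N b k = 0) \<longleftrightarrow> (\<forall>i. 1 \<le> i \<longrightarrow> i < n \<longrightarrow> wtw i b = 0)"
proof
  assume l: "\<forall>k\<in>{1..n}. wtr n N b k = 0"
  show "\<forall>i. 1 \<le> i \<longrightarrow> i < n \<longrightarrow> wtw i b = 0"
  proof (intro allI impI)
    fix i assume i: "1 \<le> i" "i < n"
    then have "wtr n N b i = 0" "wtr n N b (Suc i) = 0" using l by auto
    then show "wtw i b = 0" using wtr_wtw[OF i, of N b] by simp
  qed
next
  assume r: "\<forall>i. 1 \<le> i \<longrightarrow> i < n \<longrightarrow> wtw i b = 0"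
  have "wtr n N b = (\<lambda>_. 0)"
  proof (rule weight_eqI[of n])
    show "wtr n N b i - wtr n N b (Suc i) = 0 - 0" if "1 \<le> i" "i < n" for i
      using wtr_wtw[OF that, of N b] r that by simp
    show "wtr n N b k = 0" if "k \<notin> {1..n}" for k unfolding wtr_def using that by (simp only: if_False)
    show "(\<Sum>k\<in>{1..n}. wtr n N b k) = (\<Sum>k\<in>{1..n}. 0)" unfolding sum_wtr[OF assms] by simp
  qed
  then show "\<forall>k\<in>{1..n}. wtr n N b k = 0" by simp
qed

lemma partition_weight_wtr:
  assumes y: "y \<in> words n N" "\<forall>i\<in>{1..<n}. wtw i y = int (columns_of_height lam i)" and n: "n > 0"
  shows "partition_weight n lam = wtr n N y"
proof (rule weight_eqI[of n])
  let ?a = "\<lambda>i. rat_of_nat (columns_of_height lam i)"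
  show "partition_weight n lam k = wtr n N y k" if "k \<notin> {1..n}" for k
    using that by (auto simp: partition_weight_def fundamental_weight_def wtr_def)
  have "(\<Sum>k\<in>{1..n}. fundamental_weight n i k) = 0" if i: "i \<in> {1..n-1}" for i
  proof -
    have "(\<Sum>k\<in>{1..n}. of_bool (k \<le> i)) = rat_of_nat (card {k \<in> {1..n}. k \<le> i})" by (rule sum_of_bool) simp
    also have "{k \<in> {1..n}. k \<le> i} = {1..i}" using i by auto
    finally show ?thesis using n by (simp add: fundamental_weight_def sum_subtractf)
  qed
  then have "(\<Sum>k\<in>{1..n}. partition_weight n lam k) = 0"
    unfolding partition_weight_def by (subst sum.swap) (simp add: sum_distrib_left[symmetric])
  then show "(\<Sum>k\<in>{1..n}. partition_weight n lam k) = (\<Sum>k\<in>{1..n}. wtr n N y k)" using sum_wtr[OF y(1) n] by simp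
  fix k assume k: "1 \<le> k" "k < n"
  have "partition_weight n lam k - partition_weight n lam (Suc k) = (\<Sum>i\<in>{1..n-1}. if i = k then ?a i else 0)"
    unfolding partition_weight_def sum_subtractf[symmetric]
    by (intro sum.cong refl) (use k in \<open>auto simp: fundamental_weight_def algebra_simps\<close>)
  also have "\<dots> = ?a k" using k by (subst sum.delta) auto
  also have "\<dots> = of_int (wtw k y)" using y(2) k by simp
  finally show "partition_weight n lam k - partition_weight n lam (Suc k) = wtr n N y k - wtr n N y (Suc k)"
    unfolding wtr_wtw[OF k] .
qed

text \<open>Puts the column i, i - 1, ..., 1 in front of w. A letter k + 1 of the column is
  cancelled by the k that follows it, so a Yamanouchi word stays Yamanouchi, and its weight grows by
  the i-th fundamental weight.\<close>

primrec column_word :: "nat \<Rightarrow> nat list \<Rightarrow> nat list" where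
  "column_word 0 w = w"
| "column_word (Suc i) w = Suc i # column_word i w"

lemma count_column_word: "count_list (column_word i w) k = count_list w k + of_bool (1 \<le> k \<and> k \<le> i)"
proof (induction i)
  case (Suc i)
  then show ?case by (cases "k = Suc i") (simp_all add: le_Suc_eq)
qed simp

lemma set_column_word: "set (column_word i w) = {1..i} \<union> set w"
proof (induction i)
  case (Suc i)
  have "{1..Suc i} = insert (Suc i) {1..i}" by auto
  then show ?case using Suc by simp
qed simp

lemma column_word_eps:
  assumes "\<And>k. 1 \<le> k \<Longrightarrow> weps k w = 0" "1 \<le> k"
  shows "weps k (column_word i w) = 0"
proof (induction i)
  case (Suc i)
  have "wphi k (column_word i w) > 0" if "i = k"
    using assms(2) that by (cases i) auto
  then show ?case using Suc by auto
qed (use assms in simp)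

lemma yam_word_exists:
  assumes "\<And>i. i \<in> set hs \<Longrightarrow> i < n"
  shows "\<exists>w. set w \<subseteq> {1..n} \<and> (\<forall>k\<ge>1. weps k w = 0) \<and> (\<forall>k\<ge>1. wtw k w = int (count_list hs k))"
  using assms
proof (induction hs)
  case Nil
  show ?case by (intro exI[of _ "[]"]) (simp add: wtw_def)
next
  case (Cons i hs)
  then obtain w where w: "set w \<subseteq> {1..n}" "\<forall>k\<ge>1. weps k w = 0" "\<forall>k\<ge>1. wtw k w = int (count_list hs k)" by auto
  have "wtw k (column_word i w) = int (count_list (i # hs) k)" if "k \<ge> 1" for k
    using w(3) that by (auto simp: wtw_def count_column_word of_bool_def)
  moreover have "set (column_word i w) \<subseteq> {1..n}" using Cons.prems[of i] w(1) by (auto simp: set_column_word)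
  ultimately show ?case using column_word_eps[of w] w(2) by blast
qed

theorem theorem3p1:
  fixes n :: nat and lam :: "nat list"
    and M :: "'v::ab_group_add uq_rep" and L :: "'v set" and B :: "'v set set"
  assumes "n \<ge> 2"
    and "is_partition lam" and "length lam \<le> n - 1"
    and "irreducible_of_highest_weight n M (columns_of_height lam)"
    and "crystal_base n M L B"
  shows "generalized_exponent n (partition_weight n lam) =
    (\<Sum>b\<in>crystal_of_weight n M L B (\<lambda>_. 0). monom 1 (\<Sum>i=1..n-1. i * crystal_eps n M L i b))"
proof -
  \<comment> \<open>\<open>hs\<close> lists the column heights of the diagram with multiplicity. The
    range {1..<n} keeps out height 0, which all sufficiently large column indices have.\<close>
  obtain hs where hs: "mset hs = (\<Sum>i\<in>{1..<n}. replicate_mset (columns_of_height lam i) i)"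
    using ex_mset by blast
  have cnt: "count_list hs k = (if k \<in> {1..<n} then columns_of_height lam k else 0)" for k
    unfolding count_mset[symmetric] hs by (simp add: count_sum if_distrib sum.delta' cong: if_cong)
  have "i < n" if "i \<in> set hs" for i
    using that cnt[of i] by (metis atLeastLessThan_iff count_list_0_iff)
  then obtain y where y: "set y \<subseteq> {1..n}" "\<forall>k\<ge>1. weps k y = 0" "\<forall>k\<ge>1. wtw k y = int (count_list hs k)"
    using yam_word_exists[of hs n] by blast
  define N where "N = length y"
  have yw: "y \<in> words n N" "yam n y" "\<forall>i\<in>{1..<n}. wtw i y = int (columns_of_height lam i)"
    using y cnt by (auto simp: words_def N_def yam_def)
  interpret component n N y by unfold_locales (rule yw)
  obtain \<beta> where \<beta>: "bij_betw \<beta> (wcomp n y) B"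
    "\<And>b. b \<in> wcomp n y \<Longrightarrow> \<beta> b \<in> crystal_of_weight n M L B (\<lambda>_. 0) \<longleftrightarrow> (\<forall>i. 1 \<le> i \<longrightarrow> i < n \<longrightarrow> wtw i b = 0)"
    "\<And>b i. 1 \<le> i \<Longrightarrow> i < n \<Longrightarrow> b \<in> wcomp n y \<Longrightarrow> crystal_eps n M L i (\<beta> b) = weps i b"
    "\<And>b. b \<in> wcomp n y \<Longrightarrow> yam n b \<Longrightarrow> b = y"
    by (rule crystal_base_words[OF assms(4,5) yw]) (rule that)
  have n: "n > 0" using assms(1) by simp
  have zw: "zero_weight = {b \<in> wcomp n y. \<beta> b \<in> crystal_of_weight n M L B (\<lambda>_. 0)}"
    unfolding zero_weight_def using zero_weight_iff[OF comp_words[OF yw(1)] n] \<beta>(2) by blast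
  have "crystal_of_weight n M L B (\<lambda>_. 0) \<subseteq> B" by (auto simp: crystal_of_weight_def)
  then have "bij_betw \<beta> zero_weight (crystal_of_weight n M L B (\<lambda>_. 0))"
    using \<beta>(1) unfolding zw bij_betw_def by (auto simp: inj_on_def)
  then have "(\<Sum>b\<in>crystal_of_weight n M L B (\<lambda>_. 0). monom 1 (\<Sum>i=1..n-1. i * crystal_eps n M L i b)) =
    (\<Sum>b\<in>zero_weight. monom (1 :: int) (\<Sum>i=1..n-1. i * crystal_eps n M L i (\<beta> b)))"
    by (rule sum.reindex_bij_betw[symmetric])
  also have "\<dots> = (\<Sum>b\<in>zero_weight. monom 1 (eps_sum b))"
  proof (rule sum.cong[OF refl])
    fix b assume "b \<in> zero_weight"
    then have "(\<Sum>i=1..n-1. i * crystal_eps n M L i (\<beta> b)) = eps_sum b"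
      unfolding eps_sum_def by (intro sum.cong refl) (use \<beta>(3) in \<open>auto simp: zero_weight_def\<close>)
    then show "monom (1 :: int) (\<Sum>i=1..n-1. i * crystal_eps n M L i (\<beta> b)) = monom 1 (eps_sum b)" by simp
  qed
  also have "\<dots> = generalized_exponent n (partition_weight n lam)"
  proof (rule poly_eqI)
    fix k
    have "coeff (\<Sum>b\<in>zero_weight. monom (1 :: int) (eps_sum b)) k = (\<Sum>b\<in>zero_weight. of_bool (eps_sum b = k))"
      by (simp add: coeff_sum of_bool_def)
    also have "\<dots> = int (card {b \<in> zero_weight. eps_sum b = k})"
      by (rule sum_of_bool) (use finite_comp[OF yw(1)] in \<open>simp add: zero_weight_def\<close>)
    also have "\<dots> = coeff (generalized_exponent n (partition_weight n lam)) k"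
      unfolding partition_weight_wtr[OF yw(1,3) n] by (rule coeff_generalized_exponent_zero_weight[OF yw(2) \<beta>(4), symmetric])
    finally show "coeff (\<Sum>b\<in>zero_weight. monom (1 :: int) (eps_sum b)) k = coeff (generalized_exponent n (partition_weight n lam)) k" .
  qed
  finally show ?thesis ..
qed

end
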